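(* Let $\mathbf{k}$ be a field, $S=\mathbf{k}[x_1,\dots,x_n]$ and $R=\mathbf{k}[x_1,\dots,x_{n+1}]$, both standard graded. For every $2$-linear homogeneous ideal $I$ of $S$ there is a threshold graph $T$ on the vertex set $[n+1]$, unique up to graph isomorphism, such that $\beta(S/I)=\beta(\mathbf{k}[T])$, i.e. $\beta_{i,j}^S(S/I)=\beta_{i,j}^R(\mathbf{k}[T])$ for all $i,j$.
   Context: For a finitely generated graded module $M$ over a standard graded polynomial ring $A$ over $\mathbf{k}$, $\beta_{i,j}(M)=\beta^A_{i,j}(M)=\dim_{\mathbf{k}}\operatorname{Tor}_i^A(M,\mathbf{k})_j$ are the graded Betti numbers (the ranks of $A(-j)$ in the $i$-th module of a minimal graded free resolution), and the Betti diagram $\beta(M)$ is the array of all of them. A homogeneous ideal $I$ is $2$-linear if $\beta_{i,j}(I)=0$ whenever $j-i\neq 1$. For a graph $G$ on vertex set $[n+1]$, $I^c(G)\subseteq R$ is the ideal generated by the monomials $x_ix_j$ with $i\neq j$ and $ij$ not an edge of $G$, and $\mathbf{k}[G]=R/I^c(G)$. For a graph $G$, $G_\ast$ denotes $G$ with one new isolated vertex added and $G^\ast$ denotes $G$ with one new vertex adjacent to all vertices of $G$ added. A graph is threshold if it can be obtained from a single vertex by a finite sequence of the operations $G\mapsto G_\ast$ and $G\mapsto G^\ast$.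
   Formalization: 2-linear is taken as β_{i,j}(I)=0 whenever j−i≠2 (generated by quadrics with linear resolution), not j−i≠1; read literally for the module I, the latter describes ideals of linear forms, and the claim fails for n=1, I=(x_1), as β_{1,1}(S/I)=1. *)

theory Defs
  imports "HOL-Algebra.QuotRing" "HOL-Algebra.Module" "HOL-Library.Poly_Mapping"
begin

section \<open>Standard graded polynomial rings\<close>

text \<open>Monomials are finitely supported exponent functions; the multiplication of
  \<^typ>\<open>'a \<Rightarrow>\<^sub>0 'b\<close> is the convolution product, i.e. multiplication of polynomials.\<close>

type_synonym 'k mpoly = "(nat \<Rightarrow>\<^sub>0 nat) \<Rightarrow>\<^sub>0 'k"

definition var :: "nat \<Rightarrow> 'k::field mpoly" where
  "var i = Poly_Mapping.single (Poly_Mapping.single i 1) 1"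

definition polys :: "nat \<Rightarrow> 'k::field mpoly set" where
  "polys n = {p. \<forall>m \<in> Poly_Mapping.keys p. Poly_Mapping.keys m \<subseteq> {1..n}}"

definition poly_ring :: "nat \<Rightarrow> ('k::field mpoly) ring" where
  "poly_ring n = \<lparr>carrier = polys n, mult = (*), one = 1, zero = 0, add = (+)\<rparr>"

definition mon_degree :: "(nat \<Rightarrow>\<^sub>0 nat) \<Rightarrow> nat" where
  "mon_degree m = (\<Sum>i \<in> Poly_Mapping.keys m. Poly_Mapping.lookup m i)"

definition homogeneous_part :: "nat \<Rightarrow> int \<Rightarrow> 'k::field mpoly set" where
  "homogeneous_part n d = {p \<in> polys n. \<forall>m \<in> Poly_Mapping.keys p. int (mon_degree m) = d}"

definition irrelevant_ideal :: "nat \<Rightarrow> 'k::field mpoly set" where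
  "irrelevant_ideal n = {p \<in> polys n. Poly_Mapping.lookup p 0 = 0}"

definition homogeneous_ideal :: "nat \<Rightarrow> 'k::field mpoly set \<Rightarrow> bool" where
  "homogeneous_ideal n I \<longleftrightarrow>
     (\<exists>H \<subseteq> (\<Union>d. homogeneous_part n d). I = genideal (poly_ring n) H)"

section \<open>Graded modules\<close>

record ('a, 'b) graded_module = "('a, 'b) module" +
  component :: "int \<Rightarrow> 'b set"

text \<open>The fields \<^const>\<open>mult\<close> and \<^const>\<open>one\<close>, which the library's module record inherits
  from rings, play no role for modules.\<close>

definition ideal_module :: "nat \<Rightarrow> 'k::field mpoly set \<Rightarrow> ('k mpoly, 'k mpoly) graded_module" where
  "ideal_module n I =
     \<lparr>carrier = I, mult = (*), one = 1, zero = 0, add = (+), smult = (*),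
      component = (\<lambda>d. I \<inter> homogeneous_part n d)\<rparr>"

definition quotient_module ::
    "nat \<Rightarrow> 'k::field mpoly set \<Rightarrow> ('k mpoly, 'k mpoly set) graded_module" where
  "quotient_module n I =
     (let S = poly_ring n; Q = S Quot I in
      \<lparr>carrier = carrier Q, mult = mult Q, one = one Q, zero = zero Q, add = add Q,
       smult = (\<lambda>p X. (I +>\<^bsub>S\<^esub> p) \<otimes>\<^bsub>Q\<^esub> X),
       component = (\<lambda>d. (\<lambda>p. I +>\<^bsub>S\<^esub> p) ` homogeneous_part n d)\<rparr>)"

text \<open>For \<open>ds = [d\<^sub>0, \<dots>, d\<^sub>r]\<close> this is the graded free module
  \<open>A(-d\<^sub>0) \<oplus> \<dots> \<oplus> A(-d\<^sub>r)\<close> over the polynomial ring \<open>A\<close> in \<open>n\<close> variables; its elements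
  are functions vanishing outside \<open>{0..r}\<close>.\<close>

definition free_graded_module ::
    "nat \<Rightarrow> int list \<Rightarrow> ('k::field mpoly, nat \<Rightarrow> 'k mpoly) graded_module" where
  "free_graded_module n ds =
     (let C = {v. (\<forall>e < length ds. v e \<in> polys n) \<and> (\<forall>e \<ge> length ds. v e = 0)} in
      \<lparr>carrier = C, mult = undefined, one = undefined, zero = (\<lambda>e. 0),
       add = (\<lambda>v w e. v e + w e), smult = (\<lambda>p v e. p * v e),
       component = (\<lambda>d. {v \<in> C. \<forall>e < length ds. v e \<in> homogeneous_part n (d - ds ! e)})\<rparr>)"

definition graded_hom ::
    "nat \<Rightarrow> ('k::field mpoly, 'b) graded_module \<Rightarrow> ('k mpoly, 'c) graded_module \<Rightarrow> ('b \<Rightarrow> 'c) set" where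
  "graded_hom n M N =
     {f \<in> carrier M \<rightarrow> carrier N.
        (\<forall>x \<in> carrier M. \<forall>y \<in> carrier M. f (x \<oplus>\<^bsub>M\<^esub> y) = f x \<oplus>\<^bsub>N\<^esub> f y) \<and>
        (\<forall>p \<in> carrier (poly_ring n). \<forall>x \<in> carrier M. f (p \<odot>\<^bsub>M\<^esub> x) = p \<odot>\<^bsub>N\<^esub> f x) \<and>
        (\<forall>d. f ` component M d \<subseteq> component N d)}"

lemma polys_closed:
  "p \<in> polys n \<Longrightarrow> q \<in> polys n \<Longrightarrow> p + q \<in> polys n"
  "p \<in> polys n \<Longrightarrow> - p \<in> polys n"
  "0 \<in> polys n" "1 \<in> polys n"
  "p \<in> polys n \<Longrightarrow> q \<in> polys n \<Longrightarrow> p * q \<in> polys n"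
proof -
  show "p \<in> polys n \<Longrightarrow> q \<in> polys n \<Longrightarrow> p + q \<in> polys n"
    unfolding polys_def using Poly_Mapping.keys_add[of p q] by blast
  show "p \<in> polys n \<Longrightarrow> - p \<in> polys n"  unfolding polys_def by simp
  show "0 \<in> polys n" "1 \<in> polys n" unfolding polys_def by (auto simp flip: single_one)
  assume a: "p \<in> polys n" "q \<in> polys n"
  show "p * q \<in> polys n" unfolding polys_def
  proof safe
    fix m i assume "m \<in> Poly_Mapping.keys (p * q)" "i \<in> Poly_Mapping.keys m"
    then obtain a b where "m = a + b" "a \<in> Poly_Mapping.keys p" "b \<in> Poly_Mapping.keys q"
      using keys_mult[of p q] by blast
    then show "i \<in> {1..n}" using a \<open>i \<in> Poly_Mapping.keys m\<close> Poly_Mapping.keys_add[of a b] unfolding polys_def by blast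
  qed
qed

lemma cring_poly_ring: "cring (poly_ring n :: ('k::field mpoly) ring)"
proof (rule cringI)
  show "abelian_group (poly_ring n :: ('k mpoly) ring)"
    by (rule abelian_groupI)
       (auto simp: poly_ring_def polys_closed algebra_simps intro!: bexI[of _ "- _"])
  show "comm_monoid (poly_ring n :: ('k mpoly) ring)"
    by (rule comm_monoidI) (auto simp: poly_ring_def polys_closed algebra_simps)
qed (auto simp: poly_ring_def polys_closed algebra_simps)

lemma module_free_graded_module: "module (poly_ring n) (free_graded_module n ds :: ('k::field mpoly, _) graded_module)"
proof (rule moduleI[OF cring_poly_ring])
  show "abelian_group (free_graded_module n ds :: ('k::field mpoly, _) graded_module)"
    apply (rule abelian_groupI)
     apply (auto simp: free_graded_module_def poly_ring_def polys_closed algebra_simps)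
    subgoal for x by (rule exI[of _ "\<lambda>e. - x e"]) (auto simp: polys_closed)
    done
qed (auto simp: free_graded_module_def poly_ring_def polys_closed algebra_simps)

lemma module_ideal_module: assumes "ideal I (poly_ring n)"
  shows "module (poly_ring n) (ideal_module n I :: ('k::field mpoly, _) graded_module)"
proof -
  interpret ideal I "poly_ring n" by fact
  have s: "x \<in> polys n" if "x \<in> I" for x using Icarr[OF that] by (simp add: poly_ring_def)
  have a: "x + y \<in> I" if "x \<in> I" "y \<in> I" for x y
    using additive_subgroup.a_closed[OF additive_subgroup_axioms that] by (simp add: poly_ring_def)
  have z: "0 \<in> I"
    using additive_subgroup.zero_closed[OF additive_subgroup_axioms] by (simp add: poly_ring_def)
  have m: "p * x \<in> I" if "p \<in> polys n" "x \<in> I" for p x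
    using I_l_closed[of x p] that by (simp add: poly_ring_def)
  have u: "- x \<in> I" if "x \<in> I" for x
    using m[OF polys_closed(2)[OF polys_closed(4)] that] by simp
  have g: "abelian_group (ideal_module n I)"
  proof (rule abelian_groupI)
    fix x assume "x \<in> carrier (ideal_module n I)"
    then show "\<exists>y \<in> carrier (ideal_module n I). y \<oplus>\<^bsub>ideal_module n I\<^esub> x = \<zero>\<^bsub>ideal_module n I\<^esub>"
      using u by (intro bexI[of _ "- x"]) (simp_all add: ideal_module_def)
  qed (simp_all add: ideal_module_def a z add_ac)
  show ?thesis
    by (rule moduleI[OF cring_poly_ring g])
       (simp_all add: ideal_module_def poly_ring_def m distrib_left distrib_right mult.assoc)
qed

lemma module_quotient_module: assumes "ideal I (poly_ring n)"
  shows "module (poly_ring n) (quotient_module n I :: ('k::field mpoly, _) graded_module)"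
proof -
  interpret ideal I "poly_ring n" by fact
  interpret Q: cring "poly_ring n Quot I" by (rule quotient_is_cring) (rule cring_poly_ring)
  interpret H: ring_hom_cring "poly_ring n" "poly_ring n Quot I" "(+>\<^bsub>poly_ring n\<^esub>) I"
    by (rule rcos_ring_hom_cring) (rule cring_poly_ring)
  have g: "abelian_group (quotient_module n I)"
  proof (rule abelian_groupI)
    fix x assume x: "x \<in> carrier (quotient_module n I)"
    then show "\<exists>y \<in> carrier (quotient_module n I).
        y \<oplus>\<^bsub>quotient_module n I\<^esub> x = \<zero>\<^bsub>quotient_module n I\<^esub>"
      using Q.l_neg Q.a_inv_closed by (auto simp: quotient_module_def Let_def)
  next
    fix x y
    assume "x \<in> carrier (quotient_module n I)" "y \<in> carrier (quotient_module n I)"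
    then show "x \<oplus>\<^bsub>quotient_module n I\<^esub> y = y \<oplus>\<^bsub>quotient_module n I\<^esub> x"
      using Q.a_comm by (simp add: quotient_module_def Let_def)
  qed (simp_all add: quotient_module_def Let_def Q.a_assoc)
  show ?thesis
    by (rule moduleI[OF cring_poly_ring g])
       (simp_all add: quotient_module_def Let_def Q.l_distr Q.r_distr Q.m_assoc)
qed

section \<open>Minimal graded free resolutions and graded Betti numbers\<close>

text \<open>The complex \<open>\<dots> \<rightarrow> F\<^sub>2 \<rightarrow> F\<^sub>1 \<rightarrow> F\<^sub>0 \<rightarrow> M \<rightarrow> 0\<close> with \<open>F\<^sub>i = free_graded_module n (ds i)\<close>,
  differentials \<open>\<phi> i : F\<^sub>i\<^sub>+\<^sub>1 \<rightarrow> F\<^sub>i\<close> and augmentation \<open>\<epsilon>\<close> is exact, and the image of each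
  differential lies in \<open>\<mm> F\<^sub>i\<close>, where \<open>\<mm>\<close> is the irrelevant ideal.\<close>

definition minimal_graded_free_resolution ::
    "nat \<Rightarrow> ('k::field mpoly, 'b) graded_module \<Rightarrow> (nat \<Rightarrow> int list) \<Rightarrow>
     (nat \<Rightarrow> (nat \<Rightarrow> 'k mpoly) \<Rightarrow> (nat \<Rightarrow> 'k mpoly)) \<Rightarrow> ((nat \<Rightarrow> 'k mpoly) \<Rightarrow> 'b) \<Rightarrow> bool" where
  "minimal_graded_free_resolution n M ds \<phi> \<epsilon> \<longleftrightarrow>
     (let F = (\<lambda>i. free_graded_module n (ds i)) in
      \<epsilon> \<in> graded_hom n (F 0) M \<and>
      (\<forall>i. \<phi> i \<in> graded_hom n (F (Suc i)) (F i)) \<and>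
      \<epsilon> ` carrier (F 0) = carrier M \<and>
      \<phi> 0 ` carrier (F 1) = {v \<in> carrier (F 0). \<epsilon> v = \<zero>\<^bsub>M\<^esub>} \<and>
      (\<forall>i. \<phi> (Suc i) ` carrier (F (Suc (Suc i))) =
             {v \<in> carrier (F (Suc i)). \<phi> i v = \<zero>\<^bsub>F i\<^esub>}) \<and>
      (\<forall>i. \<forall>v \<in> carrier (F (Suc i)). \<forall>e < length (ds i). \<phi> i v e \<in> irrelevant_ideal n))"

text \<open>The multiplicity of \<open>A(-j)\<close> in the \<open>i\<close>-th module of a minimal graded free resolution.
  For finitely generated graded modules such a resolution exists and all of them have the same
  multiplicities, so the description is proper.\<close>

definition betti ::
    "nat \<Rightarrow> ('k::field mpoly, 'b) graded_module \<Rightarrow> nat \<Rightarrow> int \<Rightarrow> nat" where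
  "betti n M i j =
     (THE b. \<exists>ds \<phi> \<epsilon>. minimal_graded_free_resolution n M ds \<phi> \<epsilon> \<and> b = count_list (ds i) j)"

text \<open>The Betti numbers here are those of the module \<open>I\<close> itself, so \<open>i = 0\<close> counts minimal
  generators and 2-linearity says that \<open>I\<close> is generated by quadrics and has a linear resolution.
  In terms of \<open>S/I\<close> this reads \<open>j - i = 1\<close>, because
  \<open>\<beta>\<^sub>i\<^sub>+\<^sub>1\<^sub>,\<^sub>j(S/I) = \<beta>\<^sub>i\<^sub>,\<^sub>j(I)\<close> for \<open>I \<noteq> S\<close>.\<close>

definition two_linear :: "nat \<Rightarrow> 'k::field mpoly set \<Rightarrow> bool" where
  "two_linear n I \<longleftrightarrow> (\<forall>i j. j - int i \<noteq> 2 \<longrightarrow> betti n (ideal_module n I) i j = 0)"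

section \<open>Simple graphs and threshold graphs\<close>

record 'v sgraph =
  verts :: "'v set"
  edges :: "'v set set"

definition simple_graph :: "'v sgraph \<Rightarrow> bool" where
  "simple_graph G \<longleftrightarrow> finite (verts G) \<and> edges G \<subseteq> {e. e \<subseteq> verts G \<and> card e = 2}"

definition add_isolated :: "'v \<Rightarrow> 'v sgraph \<Rightarrow> 'v sgraph" where
  "add_isolated v G = \<lparr>verts = insert v (verts G), edges = edges G\<rparr>"

definition add_dominating :: "'v \<Rightarrow> 'v sgraph \<Rightarrow> 'v sgraph" where
  "add_dominating v G =
     \<lparr>verts = insert v (verts G), edges = edges G \<union> {{u, v} | u. u \<in> verts G}\<rparr>"

inductive threshold :: "'v sgraph \<Rightarrow> bool" where
  single: "threshold \<lparr>verts = {v}, edges = {}\<rparr>"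
| isolated: "threshold G \<Longrightarrow> v \<notin> verts G \<Longrightarrow> threshold (add_isolated v G)"
| dominating: "threshold G \<Longrightarrow> v \<notin> verts G \<Longrightarrow> threshold (add_dominating v G)"

lemma threshold_simple_graph: "threshold G \<Longrightarrow> simple_graph G"
  by (induction rule: threshold.induct)
     (auto simp: simple_graph_def add_isolated_def add_dominating_def card_2_iff)

definition graph_iso :: "'v sgraph \<Rightarrow> 'w sgraph \<Rightarrow> bool" where
  "graph_iso G H \<longleftrightarrow>
     (\<exists>f. bij_betw f (verts G) (verts H) \<and> (\<lambda>e. f ` e) ` edges G = edges H)"

definition nonedge_ideal :: "nat \<Rightarrow> nat sgraph \<Rightarrow> 'k::field mpoly set" where
  "nonedge_ideal N G =
     genideal (poly_ring N)
       {var i * var j | i j. i \<in> {1..N} \<and> j \<in> {1..N} \<and> i \<noteq> j \<and> {i, j} \<notin> edges G}"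

text \<open>\<open>\<k>[G]\<close> for a graph \<open>G\<close> on the vertex set \<open>{1..N}\<close>\<close>

definition graph_module :: "nat \<Rightarrow> nat sgraph \<Rightarrow> ('k::field mpoly, 'k mpoly set) graded_module" where
  "graph_module N G = quotient_module N (nonedge_ideal N G)"

end

(* A homogeneous ideal I generated by quadrics has a linear resolution iff S/I is 1-regular, and
   then its Betti table and its Hilbert series determine each other. Regularity is measured by the
   Koszul homology of S/I.

   Suppose that S/I is 1-regular and k is infinite. If S/I has a linear socle element f, then
   S/(I + f) is 1-regular, and the Hilbert series drops by t. Otherwise the socle vanishes (by
   regularity it lives in degree at most 1), a general linear form f is a nonzerodivisor, and the
   Hilbert series of S/I is that of S/(I + f) divided by 1 - t. Up to the factor 1/(1 - t) these are
   the changes caused by adding an isolated, respectively a dominating, vertex to a graph. Hence S/I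
   has the Hilbert series of a threshold graph, with the free variable of its first vertex divided
   out. A finite field k is replaced by k(u), which changes neither the regularity nor the
   Hilbert series.

   Conversely, the Hilbert series determines the sequence of operations: multiplied by the power of
   1 - t that makes it a polynomial, it has maximal possible degree iff the last vertex was isolated. *)

theory Submission
  imports Defs "HOL-Library.Function_Algebras" "HOL-Computational_Algebra.Formal_Power_Series"
    "HOL-Computational_Algebra.Fraction_Field" "HOL-Computational_Algebra.Polynomial"
begin

section \<open>Polynomials, degrees and graded ideals\<close>

text \<open>\<open>betti\<close> is a definite description over all minimal resolutions, so it
  carries no information until such resolutions are shown to exist and to have unique
  multiplicities; existence is where Noetherianity enters. Adjoining a linear form leaves the class
  of ideals generated by quadrics, whereas 1-regularity survives in both cases. The induction
  therefore concerns 1-regular ideals of a fixed polynomial ring, and it runs over the dimension of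
  the linear part of \<open>S/J\<close>, which either case lowers by one. A 2-linear ideal contains
  no nonzero linear form, so this dimension starts at \<open>n\<close>: there are \<open>n\<close>
  operations on a first vertex, hence \<open>n + 1\<close> vertices. Koszul homology occurs only
  through its vanishing, expressed with representatives in the polynomial ring; long exact sequences
  reduce to the few fragments that relate \<open>J\<close>, \<open>J : f\<close> and
  \<open>J + f\<close>. Associated primes and prime avoidance do not occur. Noetherian induction
  reduces the choice of a nonzerodivisor to the fact that a proper subspace contains only finitely
  many forms of the moment curve.\<close>

abbreviation lk :: "('a \<Rightarrow>\<^sub>0 'b::zero) \<Rightarrow> 'a \<Rightarrow> 'b" where "lk \<equiv> Poly_Mapping.lookup"
abbreviation kys :: "('a \<Rightarrow>\<^sub>0 'b::zero) \<Rightarrow> 'a set" where "kys \<equiv> Poly_Mapping.keys"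
definition xm :: "nat \<Rightarrow> nat \<Rightarrow>\<^sub>0 nat" where "xm i = Poly_Mapping.single i 1"
abbreviation S :: "nat \<Rightarrow> int \<Rightarrow> 'k::field mpoly set" where "S \<equiv> homogeneous_part"

definition cst :: "'k::field \<Rightarrow> 'k mpoly" where "cst c = Poly_Mapping.single 0 c"

lemma poly_sum_monomials: "(p::'a \<Rightarrow>\<^sub>0 'b::comm_monoid_add) = (\<Sum>m\<in>kys p. Poly_Mapping.single m (lk p m))"
proof (rule poly_mapping_eqI)
  fix k
  have "lk (\<Sum>m\<in>kys p. Poly_Mapping.single m (lk p m)) k = (\<Sum>m\<in>kys p. if k = m then lk p m else 0)"
    unfolding lookup_sum by (rule sum.cong) (auto simp: lookup_single when_def)
  also have "\<dots> = lk p k" by (simp add: sum.delta in_keys_iff)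
  finally show "lk p k = lk (\<Sum>m\<in>kys p. Poly_Mapping.single m (lk p m)) k" by simp
qed

lemma lookup_single_mult_sum:
  "lk (Poly_Mapping.single a c * p) k = (\<Sum>m\<in>kys p. (c * lk p m when a + m = k))"
  for p :: "('a::comm_monoid_add) \<Rightarrow>\<^sub>0 ('b::comm_semiring_1)"
  by (subst (1) poly_sum_monomials[of p]) (simp add: sum_distrib_left mult_single lookup_sum lookup_single)

lemma lookup_single_mult [simp]:
  "lk (Poly_Mapping.single a c * p) (a + m) = c * lk p m"
  for p :: "('a::cancel_comm_monoid_add) \<Rightarrow>\<^sub>0 ('b::comm_semiring_1)"
proof -
  have "lk (Poly_Mapping.single a c * p) (a + m) = (\<Sum>k\<in>kys p. if k = m then c * lk p k else 0)"
    unfolding lookup_single_mult_sum by (rule sum.cong) (auto simp: when_def)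
  thus ?thesis by (simp add: in_keys_iff)
qed

lemma lookup_single_mult_0:
  "(\<And>b. k \<noteq> a + b) \<Longrightarrow> lk (Poly_Mapping.single a c * p) k = 0"
  for p :: "('a::cancel_comm_monoid_add) \<Rightarrow>\<^sub>0 ('b::comm_semiring_1)"
proof -
  assume "\<And>b. k \<noteq> a + b"
  hence "a + m \<noteq> k" for m by metis
  thus ?thesis unfolding lookup_single_mult_sum by simp
qed

lemma lookup_cst_mult [simp]: "lk (cst c * p) m = c * lk p m"
  using lookup_single_mult[of 0 c p m] by (simp add: cst_def)

lemma cst_simps [simp]: "cst 0 = 0" "cst 1 = 1" "cst (a + b) = cst a + cst b" "cst (a * b) = cst a * cst b"
    "cst (- a) = - cst a" "cst (a - b) = cst a - cst b"
  by (simp_all add: cst_def single_add mult_single single_uminus single_diff)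

lemma lookup_cst: "lk (cst c) m = (if m = 0 then c else 0)"
  by (simp add: cst_def lookup_single when_def)

lemma cst_in_polys [simp]: "cst c \<in> polys n"
  by (auto simp: cst_def polys_def)

lemma var_xm: "var i = Poly_Mapping.single (xm i) 1" by (simp add: var_def xm_def)

lemma lookup_xm: "lk (xm i) j = (if i = j then 1 else 0)" by (simp add: xm_def lookup_single when_def)

lemma keys_xm [simp]: "kys (xm i) = {i}" by (simp add: xm_def)

lemma mono_add_decomp: "k \<in> kys m \<Longrightarrow> m = xm k + (m - xm k)" for m :: "nat \<Rightarrow>\<^sub>0 nat"
  by (rule poly_mapping_eqI)
     (auto simp: lookup_add lookup_minus lookup_xm in_keys_iff)

lemma keys_nat_add: "kys (a + b) = kys a \<union> kys b" for a b :: "nat \<Rightarrow>\<^sub>0 nat"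
  by (auto simp: in_keys_iff lookup_add)

lemma lookup_var_mult [simp]: "lk (var i * p) (xm i + m) = lk p m"
  by (simp add: var_xm)

lemma lookup_var_mult_0: "i \<notin> kys m \<Longrightarrow> lk (var i * p) m = 0"
  unfolding var_xm by (rule lookup_single_mult_0) (auto simp: keys_nat_add)

lemma lookup_var_mult_if: "lk (var i * p) m = (if i \<in> kys m then lk p (m - xm i) else 0)"
  by (metis lookup_var_mult lookup_var_mult_0 mono_add_decomp)

lemma keys_var_mult: "kys (var i * p) = (+) (xm i) ` kys p"
proof (intro equalityI subsetI)
  fix m assume "m \<in> kys (var i * p)"
  hence "i \<in> kys m" "lk p (m - xm i) \<noteq> 0" by (auto simp: in_keys_iff lookup_var_mult_if split: if_splits)
  thus "m \<in> (+) (xm i) ` kys p" using mono_add_decomp[of i m] by (auto simp: in_keys_iff)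
qed (auto simp: in_keys_iff)

lemma polysD: "p \<in> polys n \<Longrightarrow> m \<in> kys p \<Longrightarrow> kys m \<subseteq> {1..n}"
  by (auto simp: polys_def)

lemma polys_iff: "p \<in> polys n \<longleftrightarrow> (\<forall>m. lk p m \<noteq> 0 \<longrightarrow> kys m \<subseteq> {1..n})"
  by (auto simp: polys_def in_keys_iff)

lemma var_in_polys [simp]: "i \<in> {1..n} \<Longrightarrow> var i \<in> polys n"
  by (auto simp: polys_def var_def)

lemma polys_diff: "p \<in> polys n \<Longrightarrow> q \<in> polys n \<Longrightarrow> p - q \<in> polys n"
  using polys_closed(1)[of p n "-q"] polys_closed(2)[of q n] by simp

lemma polys_sum: "(\<And>a. a \<in> A \<Longrightarrow> f a \<in> polys n) \<Longrightarrow> sum f A \<in> polys n"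
  by (induction A rule: infinite_finite_induct) (auto simp: polys_closed)

lemma mon_degree_superset: "finite A \<Longrightarrow> kys m \<subseteq> A \<Longrightarrow> mon_degree m = (\<Sum>i\<in>A. lk m i)"
  unfolding mon_degree_def by (rule sum.mono_neutral_left) (auto simp: in_keys_iff)

lemma mon_degree_add [simp]: "mon_degree (a + b) = mon_degree a + mon_degree b"
  using mon_degree_superset[of "kys a \<union> kys b" a] mon_degree_superset[of "kys a \<union> kys b" b]
  by (simp add: mon_degree_superset[of "kys a \<union> kys b" "a + b"] keys_nat_add lookup_add sum.distrib)

lemma mon_degree_simps [simp]: "mon_degree 0 = 0" "mon_degree (Poly_Mapping.single i k) = k" "mon_degree (xm i) = 1"
  by (auto simp: mon_degree_def lookup_xm)

lemma mon_degree_eq_0 [simp]: "mon_degree m = 0 \<longleftrightarrow> m = 0"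
proof
  assume "mon_degree m = 0"
  hence "\<forall>i\<in>kys m. lk m i = 0" by (simp add: mon_degree_def)
  thus "m = 0" by (auto simp: in_keys_iff intro: poly_mapping_eqI)
qed simp

subsection \<open>Homogeneous components\<close>

definition keep :: "('a \<Rightarrow> bool) \<Rightarrow> ('a \<Rightarrow>\<^sub>0 'b::zero) \<Rightarrow> 'a \<Rightarrow>\<^sub>0 'b" where
  "keep P p = Abs_poly_mapping (\<lambda>m. if P m then lk p m else 0)"

lemma lookup_keep [simp]: "lk (keep P p) m = (if P m then lk p m else 0)"
proof -
  have "finite {m. (if P m then lk p m else 0) \<noteq> 0}"
    by (rule finite_subset[OF _ finite_keys[of p]]) (auto simp: in_keys_iff)
  thus ?thesis by (simp add: keep_def)
qed

definition hc :: "int \<Rightarrow> 'k::field mpoly \<Rightarrow> 'k mpoly" where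
  "hc d p = keep (\<lambda>m. int (mon_degree m) = d) p"

lemma keep_add: "keep P (p + q) = keep P p + keep P q" for p q :: "'a \<Rightarrow>\<^sub>0 'b::monoid_add"
  by (rule poly_mapping_eqI) (simp add: lookup_add)

lemma keep_polys: "p \<in> polys n \<Longrightarrow> keep P p \<in> polys n"
  by (auto simp: polys_iff)

lemma hc_add [simp]: "hc d (p + q) = hc d p + hc d q"
  by (simp add: hc_def keep_add)

lemma lookup_hc: "lk (hc d p) m = (if int (mon_degree m) = d then lk p m else 0)"
  by (simp add: hc_def)

lemma hc_0 [simp]: "hc d 0 = 0"
  by (rule poly_mapping_eqI) (simp add: lookup_hc)

lemma hc_uminus [simp]: "hc d (- p) = - hc d p"
  by (rule poly_mapping_eqI) (simp add: lookup_hc)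

lemma hc_diff [simp]: "hc d (p - q) = hc d p - hc d q"
  by (rule poly_mapping_eqI) (simp add: lookup_hc lookup_minus)

lemma hc_sum [simp]: "hc d (sum f A) = (\<Sum>a\<in>A. hc d (f a))"
  by (induction A rule: infinite_finite_induct) auto

lemma hc_cst_mult [simp]: "hc d (cst c * p) = cst c * hc d p"
  by (rule poly_mapping_eqI) (simp add: lookup_hc)

lemma S_iff: "p \<in> S n d \<longleftrightarrow> p \<in> polys n \<and> (\<forall>m. lk p m \<noteq> 0 \<longrightarrow> int (mon_degree m) = d)"
  by (auto simp: homogeneous_part_def in_keys_iff)

lemma S_polys: "p \<in> S n d \<Longrightarrow> p \<in> polys n"
  by (simp add: S_iff)

lemma hc_S [simp]: "p \<in> polys n \<Longrightarrow> hc d p \<in> S n d"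
  by (auto simp: S_iff lookup_hc hc_def keep_polys split: if_splits)

lemma hc_id: "p \<in> S n d \<Longrightarrow> hc d p = p"
  by (rule poly_mapping_eqI) (auto simp: lookup_hc S_iff)

lemma hc_other: "p \<in> S n d \<Longrightarrow> e \<noteq> d \<Longrightarrow> hc e p = 0"
  by (rule poly_mapping_eqI) (auto simp: lookup_hc S_iff)

lemma S_eq_hc: "S n d = {p \<in> polys n. hc d p = p}"
proof safe
  fix p :: "'a mpoly" assume "p \<in> polys n" "hc d p = p"
  thus "p \<in> S n d" using hc_S[of p n d] by simp
qed (simp_all add: hc_id S_polys)

definition degs :: "'k::field mpoly \<Rightarrow> int set" where
  "degs p = (\<lambda>m. int (mon_degree m)) ` kys p"

lemma finite_degs [simp]: "finite (degs p)" by (simp add: degs_def)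

lemma hc_decomp_superset: "finite A \<Longrightarrow> degs p \<subseteq> A \<Longrightarrow> p = (\<Sum>d\<in>A. hc d p)"
  by (rule poly_mapping_eqI)
     (auto simp: lookup_sum lookup_hc sum.delta degs_def in_keys_iff image_subset_iff)

lemma hc_decomp: "p = (\<Sum>d\<in>degs p. hc d p)"
  by (rule hc_decomp_superset) auto

lemma S_zero [simp]: "0 \<in> S n d"
  by (simp add: S_iff polys_closed)

lemma S_add: "p \<in> S n d \<Longrightarrow> q \<in> S n d \<Longrightarrow> p + q \<in> S n d"
  by (simp add: S_eq_hc polys_closed)

lemma S_uminus: "p \<in> S n d \<Longrightarrow> - p \<in> S n d"
  by (simp add: S_eq_hc polys_closed)

lemma S_diff: "p \<in> S n d \<Longrightarrow> q \<in> S n d \<Longrightarrow> p - q \<in> S n d"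
  by (simp add: S_eq_hc polys_diff)

lemma S_sum: "(\<And>a. a \<in> A \<Longrightarrow> f a \<in> S n d) \<Longrightarrow> sum f A \<in> S n d"
  by (induction A rule: infinite_finite_induct) (auto simp: S_add)

lemma S_cst_mult: "p \<in> S n d \<Longrightarrow> cst c * p \<in> S n d"
  by (simp add: S_eq_hc polys_closed)

lemma S_mult: "p \<in> S n a \<Longrightarrow> q \<in> S n b \<Longrightarrow> p * q \<in> S n (a + b)"
  unfolding homogeneous_part_def
  by (auto simp: polys_closed dest!: subsetD[OF keys_mult])

lemma var_S [simp]: "i \<in> {1..n} \<Longrightarrow> var i \<in> S n 1"
  using var_in_polys[of i n] by (auto simp: homogeneous_part_def var_xm)

lemma S_neg: "d < 0 \<Longrightarrow> S n d = {0}"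
  by (auto simp: S_iff polys_closed intro!: poly_mapping_eqI)

lemma cst_S [simp]: "cst c \<in> S n 0"
  by (auto simp: S_iff lookup_cst)

lemma S_0_cst: "p \<in> S n 0 \<Longrightarrow> p = cst (lk p 0)"
  by (rule poly_mapping_eqI) (auto simp: S_iff lookup_cst)

lemma S_0: "S n 0 = range cst"
  using S_0_cst cst_S by blast

text \<open>A homogeneous factor shifts all degrees equally, so after expanding \<open>q\<close>
  only its component of degree \<open>d - e\<close> can contribute. That ideals and maps are
  compatible with components always comes down to this.\<close>

lemma hc_mult: assumes "p \<in> S n e" "q \<in> polys n" shows "hc d (p * q) = p * hc (d - e) q"
proof -
  have "hc d (p * hc c q) = (if c = d - e then p * hc c q else 0)" for c
    using S_mult[OF assms(1) hc_S[OF assms(2), of c]] by (auto simp: hc_id hc_other)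
  hence "hc d (p * (\<Sum>c\<in>insert (d-e) (degs q). hc c q)) = p * hc (d - e) q"
    by (simp add: sum_distrib_left sum.delta del: sum.insert)
  thus ?thesis using hc_decomp_superset[of "insert (d-e) (degs q)" q]
      by (metis finite_degs finite_insert subset_insertI)
qed

lemma hc_hc: "p \<in> polys n \<Longrightarrow> hc d (hc e p) = (if d = e then hc d p else 0)"
  by (rule poly_mapping_eqI) (auto simp: lookup_hc)

lemma hc_0_cst: "hc 0 p = cst (lk p 0)"
  by (rule poly_mapping_eqI) (auto simp: lookup_hc lookup_cst)

subsection \<open>Division by variables\<close>

text \<open>Division by \<open>x_k\<close> with the remainder discarded: monomials not divisible by
  \<open>x_k\<close> leave no trace.\<close>

definition divvar :: "nat \<Rightarrow> 'k::field mpoly \<Rightarrow> 'k mpoly" where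
  "divvar k p = Abs_poly_mapping (\<lambda>m. lk p (xm k + m))"

lemma lookup_divvar [simp]: "lk (divvar k p) m = lk p (xm k + m)"
proof -
  have "finite {m. lk p (xm k + m) \<noteq> 0}"
    using finite_vimageI[OF finite_keys[of p], of "(+) (xm k)"]
    by (simp add: vimage_def in_keys_iff)
  thus ?thesis by (simp add: divvar_def)
qed

lemma var_divvar: "var k * divvar k p = keep (\<lambda>m. k \<in> kys m) p"
  by (rule poly_mapping_eqI) (metis lookup_keep lookup_var_mult_if lookup_divvar mono_add_decomp)

lemma divvar_S: assumes "p \<in> S n d" shows "divvar k p \<in> S n (d - 1)"
  unfolding S_iff polys_iff
proof (safe, goal_cases)
  case (1 m i)
  hence "kys (xm k + m) \<subseteq> {1..n}" using assms by (auto simp: S_iff polys_iff)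
  thus ?case using 1 by (auto simp: keys_nat_add)
next
  case (2 m)
  hence "int (mon_degree (xm k + m)) = d" using assms by (auto simp: S_iff simp del: mon_degree_add)
  thus ?case by simp
qed

text \<open>Monomials divisible by \<open>a\<close> are split off through \<open>divvar\<close>, the
  others are left to the induction. The variables range over a subset \<open>A\<close> because
  acyclicity of the Koszul complex needs membership in the ideal of the first \<open>m\<close>
  variables.\<close>

lemma decomp_vars:
  assumes "finite A" "p \<in> S n d" "\<forall>m\<in>kys p. kys m \<inter> A \<noteq> {}"
  shows "\<exists>w. (\<forall>k. w k \<in> S n (d - 1)) \<and> (\<forall>k. k \<notin> A \<longrightarrow> w k = 0) \<and> p = (\<Sum>k\<in>A. var k * w k)"
  using assms
proof (induction A arbitrary: p rule: finite_induct)
  case empty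
  hence "p = 0" by (auto simp flip: keys_eq_empty)
  thus ?case by (auto intro!: exI[of _ "\<lambda>_. 0"])
next
  case (insert a A)
  let ?q = "keep (\<lambda>m. a \<notin> kys m) p"
  have q1: "?q \<in> S n d" using insert.prems by (auto simp: S_iff keep_polys)
  have q2: "\<forall>m\<in>kys ?q. kys m \<inter> A \<noteq> {}"
  proof
    fix m assume "m \<in> kys ?q"
    hence "m \<in> kys p" "a \<notin> kys m" by (auto simp: in_keys_iff split: if_splits)
    thus "kys m \<inter> A \<noteq> {}" using insert.prems(2) by blast
  qed
  from insert.IH[OF q1 q2] obtain w where
    "(\<forall>k. w k \<in> S n (d - 1)) \<and> (\<forall>k. k \<notin> A \<longrightarrow> w k = 0) \<and> ?q = (\<Sum>k\<in>A. var k * w k)"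
    by (rule exE)
  hence w: "\<forall>k. w k \<in> S n (d - 1)" "\<forall>k. k \<notin> A \<longrightarrow> w k = 0" "?q = (\<Sum>k\<in>A. var k * w k)"
    by simp_all
  have "p = var a * divvar a p + ?q" unfolding var_divvar
    by (rule poly_mapping_eqI) (simp add: lookup_add)
  also have "?q = (\<Sum>k\<in>A. var k * (w(a := divvar a p)) k)"
    unfolding w(3) using insert.hyps by (intro sum.cong) auto
  finally have "p = (\<Sum>k\<in>insert a A. var k * (w(a := divvar a p)) k)"
    using insert.hyps by simp
  moreover have "\<forall>k. (w(a := divvar a p)) k \<in> S n (d - 1)" using w divvar_S[OF insert.prems(1)] by simp
  moreover have "\<forall>k. k \<notin> insert a A \<longrightarrow> (w(a := divvar a p)) k = 0" using w(2) by simp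
  ultimately show ?case by blast
qed

lemma decomp_all_vars:
  assumes "p \<in> S n d" "d \<noteq> 0"
  shows "\<exists>w. (\<forall>k. w k \<in> S n (d - 1)) \<and> p = (\<Sum>k\<in>{1..n}. var k * w k)"
proof -
  have "kys m \<inter> {1..n} \<noteq> {}" if "m \<in> kys p" for m
  proof -
    have "kys m \<subseteq> {1..n}" "int (mon_degree m) = d" using that assms by (auto simp: homogeneous_part_def polys_def)
    moreover have "kys m \<noteq> {}" using calculation(2) assms(2) by (metis keys_eq_empty mon_degree_simps(1) of_nat_0)
    ultimately show ?thesis by blast
  qed
  thus ?thesis using decomp_vars[of "{1..n}" p n d] assms by blast
qed

section \<open>Koszul homology of graded modules\<close>

text \<open>The sign that \<open>e_j\<close> acquires on its way past the smaller elements of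
  \<open>A\<close>. It acts on values in any abelian group, so no scalar \<open>-1\<close> is
  required of them.\<close>

definition sg :: "nat \<Rightarrow> nat set \<Rightarrow> 'v::ab_group_add \<Rightarrow> 'v" where
  "sg j A x = (if even (card {a\<in>A. a < j}) then x else - x)"

lemma sg_simps [simp]: "sg j A 0 = 0" "sg j A (x + y) = sg j A x + sg j A y"
    "sg j A (x - y) = sg j A x - sg j A y"
  by (simp_all add: sg_def)

text \<open>The values \<open>u A\<close> are the coefficients of the exterior monomials \<open>e\<^sub>A\<close>, and \<open>e\<^sub>A\<close> has degree \<open>card A\<close>;
  so \<open>j\<close> is the total degree.\<close>

definition chain :: "nat \<Rightarrow> nat \<Rightarrow> int \<Rightarrow> (int \<Rightarrow> 'v::ab_group_add set) \<Rightarrow> (nat set \<Rightarrow> 'v) \<Rightarrow> bool" where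
  "chain n i j M u \<longleftrightarrow>
     (\<forall>A. if A \<subseteq> {1..n} \<and> card A = i then u A \<in> M (j - int i) else u A = 0)"

lemma chain_val: "chain n i j M u \<Longrightarrow> A \<subseteq> {1..n} \<Longrightarrow> card A = i \<Longrightarrow> u A \<in> M (j - int i)"
  by (auto simp: chain_def)

lemma chain_0: "chain n i j M u \<Longrightarrow> \<not> (A \<subseteq> {1..n} \<and> card A = i) \<Longrightarrow> u A = 0"
  by (simp add: chain_def del: atLeastAtMost_iff)

lemma chainI: "(\<And>A. A \<subseteq> {1..n} \<Longrightarrow> card A = i \<Longrightarrow> u A \<in> M (j - int i)) \<Longrightarrow>
    (\<And>A. \<not> (A \<subseteq> {1..n} \<and> card A = i) \<Longrightarrow> u A = 0) \<Longrightarrow> chain n i j M u"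
  by (auto simp: chain_def)

lemma chain_sub: "chain n i j M u \<Longrightarrow> (\<And>A. A \<subseteq> {1..n} \<Longrightarrow> card A = i \<Longrightarrow> u A \<in> P (j - int i)) \<Longrightarrow> chain n i j P u"
  by (rule chainI) (simp_all add: chain_0)

lemma chain_mono: "chain n i j M u \<Longrightarrow> (\<And>d. M d \<subseteq> P d) \<Longrightarrow> chain n i j P u"
  by (rule chain_sub) (blast dest: chain_val)+

text \<open>Commuting additive operators stand for the variables of a module over the polynomial
  ring. One theory then serves polynomials (\<open>kp\<close>) and vectors of polynomials
  (\<open>kv\<close>).\<close>

locale koszul =
  fixes act :: "nat \<Rightarrow> 'v::ab_group_add \<Rightarrow> 'v"
  assumes act_add: "act i (x + y) = act i x + act i y"
    and act_comm: "act i (act j x) = act j (act i x)"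
begin

lemma act_0 [simp]: "act i 0 = 0"
  using act_add[of i 0 0] by simp

lemma act_uminus [simp]: "act i (- x) = - act i x"
  using act_add[of i x "- x"] by (metis act_0 add.right_inverse minus_unique)

lemma act_diff: "act i (x - y) = act i x - act i y"
  using act_add[of i x "- y"] by simp

lemma act_sum: "act i (sum f A) = (\<Sum>a\<in>A. act i (f a))"
  by (induction A rule: infinite_finite_induct) (auto simp: act_add)

lemma act_sg [simp]: "act i (sg j A x) = sg j A (act i x)"
  by (simp add: sg_def)

text \<open>The coefficient of \<open>e_A\<close> in the boundary of the sum of all
  \<open>u B e_B\<close>: the contributions come from the sets
  \<open>B = insert j A\<close>.\<close>

definition koszul_diff :: "nat \<Rightarrow> (nat set \<Rightarrow> 'v) \<Rightarrow> nat set \<Rightarrow> 'v" where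
  "koszul_diff n u A = (\<Sum>j\<in>{1..n} - A. sg j A (act j (u (insert j A))))"

definition gm :: "nat \<Rightarrow> (int \<Rightarrow> 'v set) \<Rightarrow> bool" where
  "gm n M \<longleftrightarrow> (\<forall>d. 0 \<in> M d \<and> (\<forall>x\<in>M d. \<forall>y\<in>M d. x - y \<in> M d) \<and> (\<forall>i\<in>{1..n}. \<forall>x\<in>M d. act i x \<in> M (d + 1)))"

lemma gm_0: "gm n M \<Longrightarrow> 0 \<in> M d" by (simp add: gm_def)
lemma gm_diff: "gm n M \<Longrightarrow> x \<in> M d \<Longrightarrow> y \<in> M d \<Longrightarrow> x - y \<in> M d" by (simp add: gm_def)
lemma gm_act: "gm n M \<Longrightarrow> i \<in> {1..n} \<Longrightarrow> x \<in> M d \<Longrightarrow> act i x \<in> M (d + 1)" by (simp add: gm_def)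
lemma gm_uminus: "gm n M \<Longrightarrow> x \<in> M d \<Longrightarrow> - x \<in> M d" using gm_diff[of n M 0 d x] by (simp add: gm_0)
lemma gm_add: "gm n M \<Longrightarrow> x \<in> M d \<Longrightarrow> y \<in> M d \<Longrightarrow> x + y \<in> M d"
  using gm_diff[of n M x d "- y"] by (simp add: gm_uminus)
lemma gm_sum: "gm n M \<Longrightarrow> (\<And>a. a \<in> A \<Longrightarrow> f a \<in> M d) \<Longrightarrow> sum f A \<in> M d"
  by (induction A rule: infinite_finite_induct) (auto simp: gm_add gm_0)
lemma gm_sg: "gm n M \<Longrightarrow> x \<in> M d \<Longrightarrow> sg j A x \<in> M d"
  by (simp add: sg_def gm_uminus)

lemma gm_zero: "gm n (\<lambda>_. {0})" by (simp add: gm_def)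

lemma koszul_diff_diff: "koszul_diff n (u - v) A = koszul_diff n u A - koszul_diff n v A"
  by (simp add: koszul_diff_def act_diff sum_subtractf)

lemma koszul_diff_add: "koszul_diff n (u + v) A = koszul_diff n u A + koszul_diff n v A"
  by (simp add: koszul_diff_def act_add sum.distrib)

lemma koszul_diff_chain:
  assumes "gm n M" "chain n (Suc i) j M u"
  shows "chain n i j M (koszul_diff n u)"
proof (rule chainI)
  fix A assume A: "A \<subseteq> {1..n}" "card A = i"
  show "koszul_diff n u A \<in> M (j - int i)" unfolding koszul_diff_def
  proof (rule gm_sum[OF assms(1)], rule gm_sg[OF assms(1)])
    fix k assume k: "k \<in> {1..n} - A"
    have "finite A" using A(1) by (rule finite_subset) simp
    hence "u (insert k A) \<in> M (j - int (Suc i))" using k A by (intro chain_val[OF assms(2)]) auto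
    thus "act k (u (insert k A)) \<in> M (j - int i)" using gm_act[OF assms(1), of k "u (insert k A)" "j - int (Suc i)"] k
        by simp
  qed
next
  fix A assume A: "\<not> (A \<subseteq> {1..n} \<and> card A = i)"
  have "u (insert k A) = 0" if k: "k \<in> {1..n} - A" for k
  proof (rule chain_0[OF assms(2)], safe)
    assume *: "insert k A \<subseteq> {1..n}" "card (insert k A) = Suc i"
    have "finite A" by (rule finite_subset[of _ "{1..n}"]) (use *(1) in auto)
    hence "card A = i" using *(2) k by simp
    thus False using *(1) A by simp
  qed
  thus "koszul_diff n u A = 0" by (simp add: koszul_diff_def)
qed

lemma koszul_diff_chain_0: assumes "chain n 0 j M u" shows "koszul_diff n u A = 0"
proof -
  have "u (insert k A) = 0" if k: "k \<in> {1..n} - A" for k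
  proof (rule chain_0[OF assms], safe)
    assume *: "insert k A \<subseteq> {1..n}" "card (insert k A) = 0"
    have "finite (insert k A)" by (rule finite_subset[OF *(1)]) simp
    thus False using *(2) by (simp del: card_insert_disjoint)
  qed
  thus "koszul_diff n u A = 0" by (simp add: koszul_diff_def)
qed

text \<open>The terms of \<open>(j,k)\<close> and \<open>(k,j)\<close> cancel: the operators
  commute, and of the two signs only that of the larger index depends on which of them is inserted
  first.\<close>

lemma koszul_diff_koszul_diff_finite: assumes "finite A" shows "koszul_diff n (koszul_diff n u) A = 0"
proof -
  define B where "B = {1..n} - A"
  define T where "T = (\<lambda>j k. sg j A (sg k (insert j A) (act j (act k (u (insert k (insert j A)))))))"
  have fin: "finite B" by (simp add: B_def)
  have "koszul_diff n (koszul_diff n u) A = (\<Sum>j\<in>B. \<Sum>k\<in>B - {j}. T j k)"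
    unfolding koszul_diff_def B_def T_def
  proof (rule sum.cong)
    fix k assume "k \<in> {1..n} - A"
    have *: "{1..n} - insert k A = {1..n} - A - {k}" by auto
    show "sg k A (act k (\<Sum>l\<in>{1..n} - insert k A. sg l (insert k A) (act l (u (insert l (insert k A)))))) =
       (\<Sum>l\<in>{1..n} - A - {k}. sg k A (sg l (insert k A) (act k (act l (u (insert l (insert k A)))))))"
      unfolding * act_sum act_sg by (simp add: sg_def sum_negf)
  qed simp
  also have "\<dots> = (\<Sum>(j,k)\<in>Sigma B (\<lambda>j. B - {j}). T j k)"
    by (rule sum.Sigma) (auto simp: fin)
  also have "Sigma B (\<lambda>j. B - {j}) = {(j,k)\<in>B\<times>B. j < k} \<union> {(j,k)\<in>B\<times>B. k < j}" by auto
  also have "(\<Sum>(j,k)\<in>\<dots>. T j k) = (\<Sum>(j,k)\<in>{(j,k)\<in>B\<times>B. j < k}. T j k) + (\<Sum>(j,k)\<in>{(j,k)\<in>B\<times>B. k < j}. T j k)"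
    by (rule sum.union_disjoint) (auto intro: finite_subset[OF _ finite_cartesian_product[OF fin fin]])
  also have "(\<Sum>(j,k)\<in>{(j,k)\<in>B\<times>B. k < j}. T j k) = (\<Sum>(j,k)\<in>{(j,k)\<in>B\<times>B. j < k}. - T j k)"
  proof (rule sum.reindex_bij_witness[of _ prod.swap prod.swap])
    fix a assume "a \<in> {(j,k)\<in>B\<times>B. k < j}"
    then obtain j k where a: "a = (j,k)" "j \<notin> A" "k \<notin> A" "k < j" by (auto simp: B_def)
    have *: "{a \<in> insert k A. a < j} = insert k {a\<in>A. a < j}" "{a \<in> insert j A. a < k} = {a\<in>A. a < k}" using a by auto
    have c: "even (card {a \<in> insert k A. a < j}) = odd (card {a\<in>A. a < j})"
      unfolding * using a assms by simp
    have "T j k = - T k j" unfolding T_def sg_def c *(2) act_comm[of j k] insert_commute[of j k]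
      by simp
    thus "(case prod.swap a of (j, k) \<Rightarrow> - T j k) = (case a of (j, k) \<Rightarrow> T j k)" using a by simp
  qed auto
  finally show ?thesis by (simp add: sum_negf case_prod_unfold)
qed

lemma koszul_diff_koszul_diff: assumes "chain n i j M u" shows "koszul_diff n (koszul_diff n u) A = 0"
proof (cases "finite A")
  case False
  have "u (insert k (insert l A)) = 0" for k l
    using False finite_subset[of "insert k (insert l A)" "{1..n}"] by (intro chain_0[OF assms]) auto
  thus ?thesis by (simp add: koszul_diff_def)
qed (rule koszul_diff_koszul_diff_finite)

text \<open>The vanishing of \<open>H\<^sub>i(M/N)\<^sub>j\<close>, in terms of representatives in \<open>M\<close>.\<close>

definition koszul_exact :: "nat \<Rightarrow> nat \<Rightarrow> int \<Rightarrow> (int \<Rightarrow> 'v set) \<Rightarrow> (int \<Rightarrow> 'v set) \<Rightarrow> bool" where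
  "koszul_exact n i j M N \<longleftrightarrow> (\<forall>u. chain n i j M u \<and> (\<forall>A. koszul_diff n u A \<in> N (j - int i + 1)) \<longrightarrow>
      (\<exists>w. chain n (Suc i) j M w \<and> (\<forall>A. u A - koszul_diff n w A \<in> N (j - int i))))"

lemma koszul_exactE:
  assumes "koszul_exact n i j M N" "chain n i j M u" "\<And>A. koszul_diff n u A \<in> N (j - int i + 1)"
  obtains w where "chain n (Suc i) j M w" "\<And>A. u A - koszul_diff n w A \<in> N (j - int i)"
  using assms unfolding koszul_exact_def by blast

section \<open>Fragments of long exact sequences in Koszul homology\<close>

lemma chain_diff: "gm n M \<Longrightarrow> chain n i j M u \<Longrightarrow> chain n i j M v \<Longrightarrow> chain n i j M (u - v)"
  by (rule chainI) (simp_all add: chain_val chain_0 gm_diff)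

lemma chain_add: "gm n M \<Longrightarrow> chain n i j M u \<Longrightarrow> chain n i j M v \<Longrightarrow> chain n i j M (u + v)"
  by (rule chainI) (simp_all add: chain_val chain_0 gm_add)

lemma chain_in: "chain n i j M u \<Longrightarrow> gm n M \<Longrightarrow> u A \<in> M (j - int i)"
  by (cases "A \<subseteq> {1..n} \<and> card A = i") (simp_all add: chain_val chain_0 gm_0 del: atLeastAtMost_iff)

text \<open>Exactness of \<open>H_i(P/N) -> H_i(M/N) -> H_i(M/P)\<close> in the middle: modulo
  \<open>P\<close> the cycle is a boundary, and after subtracting this boundary a cycle in
  \<open>P\<close> remains.\<close>

lemma koszul_exact_ext:
  assumes gm: "gm n M" and sub: "\<And>d. N d \<subseteq> P d" "\<And>d. P d \<subseteq> M d"
    and z: "koszul_exact n i j P N" "koszul_exact n i j M P"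
  shows "koszul_exact n i j M N"
  unfolding koszul_exact_def
proof safe
  fix u assume u: "chain n i j M u" "\<forall>A. koszul_diff n u A \<in> N (j - int i + 1)"
  obtain w where w: "chain n (Suc i) j M w" "\<And>A. u A - koszul_diff n w A \<in> P (j - int i)"
    using koszul_exactE[OF z(2) u(1)] u(2) sub(1) by blast
  have c: "chain n i j P (u - koszul_diff n w)"
    using w by (intro chain_sub[OF chain_diff[OF gm u(1) koszul_diff_chain[OF gm w(1)]]]) auto
  have "koszul_diff n (u - koszul_diff n w) A \<in> N (j - int i + 1)" for A
    using u(2) koszul_diff_koszul_diff[OF w(1)] by (simp add: koszul_diff_diff)
  then obtain w' where w': "chain n (Suc i) j P w'" "\<And>A. (u - koszul_diff n w) A - koszul_diff n w' A \<in> N (j - int i)"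
    using koszul_exactE[OF z(1) c] by blast
  have "chain n (Suc i) j M (w + w')" by (intro chain_add[OF gm] w chain_mono[OF w'(1)] sub)
  moreover have "u A - koszul_diff n (w + w') A \<in> N (j - int i)" for A
    using w'(2)[of A] by (simp add: koszul_diff_add algebra_simps)
  ultimately show "\<exists>w. chain n (Suc i) j M w \<and> (\<forall>A. u A - koszul_diff n w A \<in> N (j - int i))" by blast
qed

text \<open>Exactness of \<open>H_(i+1)(M/N) -> H_(i+1)(M/P) -> H_i(P/N)\<close> in the middle. The
  connecting map takes a cycle modulo \<open>P\<close> to its boundary, which lies in
  \<open>P\<close>; correcting \<open>u\<close> by a chain \<open>w\<close> of \<open>P\<close>
  makes it a cycle modulo \<open>N\<close>.\<close>

lemma koszul_exact_coker:
  assumes gm: "gm n M" "gm n P" "gm n N" and sub: "\<And>d. N d \<subseteq> P d" "\<And>d. P d \<subseteq> M d"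
    and z: "koszul_exact n i j P N" "koszul_exact n (Suc i) j M N"
  shows "koszul_exact n (Suc i) j M P"
  unfolding koszul_exact_def
proof safe
  fix u assume u: "chain n (Suc i) j M u" "\<forall>A. koszul_diff n u A \<in> P (j - int (Suc i) + 1)"
  have c: "chain n i j P (koszul_diff n u)"
    using u(2) by (intro chain_sub[OF koszul_diff_chain[OF gm(1) u(1)]]) auto
  obtain w where w: "chain n (Suc i) j P w" "\<And>A. koszul_diff n u A - koszul_diff n w A \<in> N (j - int i)"
    using koszul_exactE[OF z(1) c] koszul_diff_koszul_diff[OF u(1)] gm_0[OF gm(3)] by metis
  have wM: "chain n (Suc i) j M w" by (rule chain_mono[OF w(1) sub(2)])
  have "koszul_diff n (u - w) A \<in> N (j - int (Suc i) + 1)" for A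
    using w(2)[of A] by (simp add: koszul_diff_diff algebra_simps)
  then obtain w' where w': "chain n (Suc (Suc i)) j M w'" "\<And>A. (u - w) A - koszul_diff n w' A \<in> N (j - int (Suc i))"
    using koszul_exactE[OF z(2) chain_diff[OF gm(1) u(1) wM]] by blast
  have "w A \<in> P (j - int (Suc i))" for A
    by (rule chain_in[OF w(1) gm(2)])
  hence "u A - koszul_diff n w' A \<in> P (j - int (Suc i))" for A
    using gm_add[OF gm(2) subsetD[OF sub(1) w'(2)[of A]], of "w A"] by simp
  thus "\<exists>w. chain n (Suc (Suc i)) j M w \<and> (\<forall>A. u A - koszul_diff n w A \<in> P (j - int (Suc i)))"
    using w'(1) by blast
qed

text \<open>At the right end there is no connecting map: every 0-chain is a cycle, so vanishing
  passes from \<open>M/N\<close> to its quotient \<open>M/P\<close>.\<close>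

lemma koszul_exact_coker_0:
  assumes "gm n N" "\<And>d. N d \<subseteq> P d" "koszul_exact n 0 j M N"
  shows "koszul_exact n 0 j M P"
  unfolding koszul_exact_def
proof safe
  fix u assume u: "chain n 0 j M u"
  obtain w where "chain n (Suc 0) j M w" "\<And>A. u A - koszul_diff n w A \<in> N (j - int 0)"
    using koszul_exactE[OF assms(3) u] koszul_diff_chain_0[OF u] gm_0[OF assms(1)] by metis
  thus "\<exists>w. chain n (Suc 0) j M w \<and> (\<forall>A. u A - koszul_diff n w A \<in> P (j - int 0))" using assms(2) by blast
qed

text \<open>Exactness of \<open>H_(i+1)(M/P) -> H_i(P/N) -> H_i(M/N)\<close> in the middle: a chain
  \<open>w\<close> of \<open>M\<close> that bounds \<open>u\<close> is a cycle modulo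
  \<open>P\<close>, so subtracting a boundary moves it into \<open>P\<close>.\<close>

lemma koszul_exact_sub:
  assumes gm: "gm n M" "gm n P" "gm n N" and sub: "\<And>d. N d \<subseteq> P d" "\<And>d. P d \<subseteq> M d"
    and z: "koszul_exact n i j M N" "koszul_exact n (Suc i) j M P"
  shows "koszul_exact n i j P N"
  unfolding koszul_exact_def
proof safe
  fix u assume u: "chain n i j P u" "\<forall>A. koszul_diff n u A \<in> N (j - int i + 1)"
  have uM: "chain n i j M u" by (rule chain_mono[OF u(1) sub(2)])
  obtain w where w: "chain n (Suc i) j M w" "\<And>A. u A - koszul_diff n w A \<in> N (j - int i)"
    using koszul_exactE[OF z(1) uM] u(2) by blast
  have uP: "u A \<in> P (j - int i)" for A by (rule chain_in[OF u(1) gm(2)])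
  have "koszul_diff n w A \<in> P (j - int (Suc i) + 1)" for A
    using gm_diff[OF gm(2) uP[of A] subsetD[OF sub(1) w(2)[of A]]] by simp
  then obtain w' where w': "chain n (Suc (Suc i)) j M w'" "\<And>A. w A - koszul_diff n w' A \<in> P (j - int (Suc i))"
    using koszul_exactE[OF z(2) w(1)] by blast
  have "chain n (Suc i) j P (w - koszul_diff n w')"
    using w'(2) by (intro chain_sub[OF chain_diff[OF gm(1) w(1) koszul_diff_chain[OF gm(1) w'(1)]]]) auto
  moreover have "u A - koszul_diff n (w - koszul_diff n w') A \<in> N (j - int i)" for A
    using w(2)[of A] koszul_diff_koszul_diff[OF w'(1)] by (simp add: koszul_diff_diff)
  ultimately show "\<exists>w. chain n (Suc i) j P w \<and> (\<forall>A. u A - koszul_diff n w A \<in> N (j - int i))" by blast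
qed

end

text \<open>Short exact sequences whose ends live in different groups: a module \<open>M\<close>,
  its image under \<open>h\<close>, and the kernel \<open>K\<close> defined below. They serve for
  the passage from a free module to its syzygies.\<close>

locale koszul_hom = a: koszul act1 + b: koszul act2
  for act1 :: "nat \<Rightarrow> 'v::ab_group_add \<Rightarrow> 'v" and act2 :: "nat \<Rightarrow> 'w::ab_group_add \<Rightarrow> 'w" +
  fixes n :: nat and M :: "int \<Rightarrow> 'v set" and h :: "'v \<Rightarrow> 'w"
  assumes gm: "a.gm n M"
    and h_diff: "x \<in> M d \<Longrightarrow> y \<in> M d \<Longrightarrow> h (x - y) = h x - h y"
    and h_act: "i \<in> {1..n} \<Longrightarrow> x \<in> M d \<Longrightarrow> h (act1 i x) = act2 i (h x)"
begin

lemma h_0: "h 0 = 0"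
  using h_diff[of 0 0 0] a.gm_0[OF gm] by simp

lemma h_uminus: "x \<in> M d \<Longrightarrow> h (- x) = - h x"
  using h_diff[of 0 d x] a.gm_0[OF gm] by (simp add: h_0)

lemma h_add: "x \<in> M d \<Longrightarrow> y \<in> M d \<Longrightarrow> h (x + y) = h x + h y"
  using h_diff[of x d "- y"] a.gm_uminus[OF gm, of y d] by (simp add: h_uminus)

lemma h_sum: "(\<And>a. a \<in> A \<Longrightarrow> f a \<in> M d) \<Longrightarrow> h (sum f A) = (\<Sum>a\<in>A. h (f a))"
  by (induction A rule: infinite_finite_induct) (auto simp: h_0 h_add[of _ d] a.gm_sum[OF gm])

lemma h_koszul_diff: assumes "chain n i j M u" shows "h (a.koszul_diff n u A) = b.koszul_diff n (h \<circ> u) A"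
proof -
  have v: "u B \<in> M (j - int i)" for B
    by (rule a.chain_in[OF assms gm])
  have v': "act1 k (u B) \<in> M (j - int i + 1)" if "k \<in> {1..n} - A" for k B
    using a.gm_act[OF gm _ v] that by simp
  have "h (a.koszul_diff n u A) = (\<Sum>j\<in>{1..n} - A. h (sg j A (act1 j (u (insert j A)))))"
    unfolding a.koszul_diff_def by (rule h_sum) (rule a.gm_sg[OF gm v'])
  also have "\<dots> = b.koszul_diff n (h \<circ> u) A" unfolding b.koszul_diff_def
  proof (rule sum.cong)
    fix k assume k: "k \<in> {1..n} - A"
    have "h (act1 k (u (insert k A))) = act2 k (h (u (insert k A)))" using h_act[OF _ v] k by simp
    thus "h (sg k A (act1 k (u (insert k A)))) = sg k A (act2 k ((h \<circ> u) (insert k A)))"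
      using h_uminus[OF v'[OF k]] by (auto simp: sg_def)
  qed simp
  finally show ?thesis .
qed

lemma chain_image: "chain n i j M u \<Longrightarrow> chain n i j (\<lambda>d. h ` M d) (h \<circ> u)"
  by (rule chainI) (simp_all add: chain_val chain_0 h_0)

lemma chain_lift:
  assumes "chain n i j (\<lambda>d. h ` M d) u"
  obtains v where "chain n i j M v" "h \<circ> v = u"
proof -
  have "\<exists>x. (if A \<subseteq> {1..n} \<and> card A = i then x \<in> M (j - int i) else x = 0) \<and> h x = u A" for A
    using chain_val[OF assms, of A] chain_0[OF assms, of A] h_0 by (cases "A \<subseteq> {1..n} \<and> card A = i") auto
  then obtain v where "\<forall>A. (if A \<subseteq> {1..n} \<and> card A = i then v A \<in> M (j - int i) else v A = 0) \<and> h (v A) = u A"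
    by metis
  thus ?thesis by (intro that[of v]) (auto simp: chain_def)
qed

definition K :: "int \<Rightarrow> 'v set" where "K d = {x \<in> M d. h x = 0}"

lemma gm_K: "a.gm n K"
  unfolding a.gm_def
proof safe
  fix d i x assume "i \<in> {1..n}" "x \<in> K d"
  thus "act1 i x \<in> K (d + 1)" using h_act[of i x d] a.gm_act[OF gm, of i x d] by (simp add: K_def)
qed (auto simp: K_def h_0 h_diff a.gm_0[OF gm] a.gm_diff[OF gm])

text \<open>\<open>H_(i+1)\<close> of the image lies between \<open>H_(i+1)(M)\<close> and
  \<open>H_i(K)\<close>. A lift of a cycle has its boundary in \<open>K\<close>; since this is also
  the boundary of a chain of \<open>K\<close>, the lift can be corrected to a cycle of
  \<open>M\<close>.\<close>

lemma koszul_exact_image: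
  assumes "a.koszul_exact n (Suc i) j M (\<lambda>_. {0})" "a.koszul_exact n i j K (\<lambda>_. {0})"
  shows "b.koszul_exact n (Suc i) j (\<lambda>d. h ` M d) (\<lambda>_. {0})"
  unfolding b.koszul_exact_def
proof safe
  fix u assume u: "chain n (Suc i) j (\<lambda>d. h ` M d) u" "\<forall>A. b.koszul_diff n u A \<in> {0}"
  obtain v where v: "chain n (Suc i) j M v" "h \<circ> v = u" using chain_lift[OF u(1)] by blast
  have c0: "chain n i j M (a.koszul_diff n v)" by (rule a.koszul_diff_chain[OF gm v(1)])
  have c: "chain n i j K (a.koszul_diff n v)"
    using u(2) h_koszul_diff[OF v(1)] v(2) by (intro chain_sub[OF c0]) (simp add: K_def chain_val[OF c0])
  obtain w where w: "chain n (Suc i) j K w" "\<And>A. a.koszul_diff n v A - a.koszul_diff n w A \<in> {0}"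
    using a.koszul_exactE[OF assms(2) c] a.koszul_diff_koszul_diff[OF v(1)] by auto
  have wM: "chain n (Suc i) j M w" by (rule chain_mono[OF w(1)]) (auto simp: K_def)
  obtain w' where w': "chain n (Suc (Suc i)) j M w'" "\<And>A. (v - w) A - a.koszul_diff n w' A \<in> {0}"
    using a.koszul_exactE[OF assms(1) a.chain_diff[OF gm v(1) wM]] w(2) by (auto simp: a.koszul_diff_diff)
  have "u A = b.koszul_diff n (h \<circ> w') A" for A
  proof -
    have vv: "v A \<in> M (j - int (Suc i))" "w A \<in> K (j - int (Suc i))"
      by (rule a.chain_in[OF v(1) gm], rule a.chain_in[OF w(1) gm_K])
    have "u A = h (v A)" using v(2) by auto
    also have "\<dots> = h (v A - w A)" using vv by (subst h_diff[of _ "j - int (Suc i)"]) (auto simp: K_def)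
    also have "v A - w A = a.koszul_diff n w' A" using w'(2)[of A] by simp
    finally show ?thesis using h_koszul_diff[OF w'(1)] by simp
  qed
  thus "\<exists>w. chain n (Suc (Suc i)) j (\<lambda>d. h ` M d) w \<and> (\<forall>A. u A - b.koszul_diff n w A \<in> {0})"
    using chain_image[OF w'(1)] by (intro exI[of _ "h \<circ> w'"]) auto
qed

lemma koszul_exact_image_0:
  assumes "a.koszul_exact n 0 j M (\<lambda>_. {0})"
  shows "b.koszul_exact n 0 j (\<lambda>d. h ` M d) (\<lambda>_. {0})"
  unfolding b.koszul_exact_def
proof safe
  fix u assume u: "chain n 0 j (\<lambda>d. h ` M d) u"
  obtain v where v: "chain n 0 j M v" "h \<circ> v = u" using chain_lift[OF u] by blast
  obtain w where w: "chain n (Suc 0) j M w" "\<And>A. v A - a.koszul_diff n w A \<in> {0}"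
    using a.koszul_exactE[OF assms v(1)] a.koszul_diff_chain_0[OF v(1)] by auto
  have "u A = b.koszul_diff n (h \<circ> w) A" for A
    using w(2)[of A] h_koszul_diff[OF w(1), of A] v(2) by auto
  thus "\<exists>w. chain n (Suc 0) j (\<lambda>d. h ` M d) w \<and> (\<forall>A. u A - b.koszul_diff n w A \<in> {0})"
    using chain_image[OF w(1)] by (intro exI[of _ "h \<circ> w"]) auto
qed

text \<open>\<open>H_i(K)\<close> lies between \<open>H_(i+1)\<close> of the image and
  \<open>H_i(M)\<close>. A chain \<open>w\<close> bounding the cycle in \<open>M\<close> is mapped
  to a cycle; as this is a boundary, \<open>w\<close> can be moved into \<open>K\<close>.\<close>

lemma koszul_exact_kernel:
  assumes "a.koszul_exact n i j M (\<lambda>_. {0})" "b.koszul_exact n (Suc i) j (\<lambda>d. h ` M d) (\<lambda>_. {0})"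
  shows "a.koszul_exact n i j K (\<lambda>_. {0})"
  unfolding a.koszul_exact_def
proof safe
  fix u assume u: "chain n i j K u" "\<forall>A. a.koszul_diff n u A \<in> {0}"
  have uM: "chain n i j M u" by (rule chain_mono[OF u(1)]) (auto simp: K_def)
  obtain w where w: "chain n (Suc i) j M w" "\<And>A. u A - a.koszul_diff n w A \<in> {0}"
    using a.koszul_exactE[OF assms(1) uM] u(2) by blast
  have "h (u A) = 0" for A using a.chain_in[OF u(1) gm_K, of A] by (simp add: K_def)
  hence "b.koszul_diff n (h \<circ> w) A \<in> {0}" for A using w(2)[of A] h_koszul_diff[OF w(1), of A]
      by (metis eq_iff_diff_eq_0 singletonD singletonI)
  then obtain z where z: "chain n (Suc (Suc i)) j (\<lambda>d. h ` M d) z" "\<And>A. (h \<circ> w) A - b.koszul_diff n z A \<in> {0}"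
    using b.koszul_exactE[OF assms(2) chain_image[OF w(1)]] by blast
  obtain v where v: "chain n (Suc (Suc i)) j M v" "h \<circ> v = z" using chain_lift[OF z(1)] by blast
  have c: "chain n (Suc i) j M (w - a.koszul_diff n v)"
      by (intro a.chain_diff[OF gm w(1)] a.koszul_diff_chain[OF gm v(1)])
  have "chain n (Suc i) j K (w - a.koszul_diff n v)"
  proof (rule chain_sub[OF c])
    fix A :: "nat set" assume A: "A \<subseteq> {1..n}" "card A = Suc i"
    have "h (w A - a.koszul_diff n v A) = h (w A) - h (a.koszul_diff n v A)"
      using chain_val[OF w(1) A] chain_val[OF a.koszul_diff_chain[OF gm v(1)] A] by (rule h_diff)
    also have "\<dots> = 0" using z(2)[of A] h_koszul_diff[OF v(1)] v(2) by simp
    finally show "(w - a.koszul_diff n v) A \<in> K (j - int (Suc i))" using chain_val[OF c A] by (simp add: K_def)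
  qed
  moreover have "u A - a.koszul_diff n (w - a.koszul_diff n v) A \<in> {0}" for A
    using w(2)[of A] a.koszul_diff_koszul_diff[OF v(1)] by (simp add: a.koszul_diff_diff)
  ultimately show "\<exists>w. chain n (Suc i) j K w \<and> (\<forall>A. u A - a.koszul_diff n w A \<in> {0})" by blast
qed

end

subsection \<open>Acyclicity for polynomial rings\<close>

text \<open>With \<open>s\<close> the last index, a chain splits as \<open>u0 + e_s u1\<close>;
  \<open>prj0\<close> and \<open>prj1\<close> extract the two parts as chains on the remaining
  indices.\<close>

definition prj0 :: "nat \<Rightarrow> (nat set \<Rightarrow> 'v) \<Rightarrow> nat set \<Rightarrow> 'v::ab_group_add" where
  "prj0 s u A = (if s \<in> A then 0 else u A)"

definition prj1 :: "nat \<Rightarrow> (nat set \<Rightarrow> 'v) \<Rightarrow> nat set \<Rightarrow> 'v::ab_group_add" where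
  "prj1 s u A = (if s \<in> A then 0 else u (insert s A))"

lemma chain_prj0:
  assumes "chain (Suc m) i j M u" shows "chain m i j M (prj0 (Suc m) u)"
proof (rule chainI)
  fix A assume A: "A \<subseteq> {1..m}" "card A = i"
  hence "A \<subseteq> {1..Suc m}" "Suc m \<notin> A" by auto
  thus "prj0 (Suc m) u A \<in> M (j - int i)" using chain_val[OF assms] A by (simp add: prj0_def)
next
  fix A assume "\<not> (A \<subseteq> {1..m} \<and> card A = i)"
  hence "\<not> (A \<subseteq> {1..Suc m} \<and> card A = i)" if "Suc m \<notin> A" using that by (auto simp: atLeastAtMostSuc_conv)
  thus "prj0 (Suc m) u A = 0" using chain_0[OF assms] by (simp add: prj0_def)
qed

lemma chain_prj1:
  assumes "chain (Suc m) (Suc i) j M u" shows "chain m i (j - 1) M (prj1 (Suc m) u)"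
proof (rule chainI)
  fix A assume A: "A \<subseteq> {1..m}" "card A = i"
  have "finite A" using A(1) by (rule finite_subset) simp
  moreover have "insert (Suc m) A \<subseteq> {1..Suc m}" "Suc m \<notin> A" using A by auto
  ultimately show "prj1 (Suc m) u A \<in> M (j - 1 - int i)"
    using chain_val[OF assms, of "insert (Suc m) A"] A by (simp add: prj1_def algebra_simps)
next
  fix A assume A: "\<not> (A \<subseteq> {1..m} \<and> card A = i)"
  have "u (insert (Suc m) A) = 0" if s: "Suc m \<notin> A"
  proof (rule chain_0[OF assms], safe)
    assume *: "insert (Suc m) A \<subseteq> {1..Suc m}" "card (insert (Suc m) A) = Suc i"
    have "finite A" by (rule finite_subset[of _ "{1..Suc m}"]) (use *(1) in auto)
    hence "card A = i" using *(2) s by simp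
    moreover have "A \<subseteq> {1..m}" using *(1) s by (auto simp: atLeastAtMostSuc_conv)
    ultimately show False using A by simp
  qed
  thus "prj1 (Suc m) u A = 0" by (simp add: prj1_def)
qed

context koszul
begin

text \<open>This lemma and the next exhibit the complex in \<open>m + 1\<close> variables as the
  mapping cone of multiplication by the last variable on the complex in \<open>m\<close> variables.
  Signs at the smaller indices do not change, because \<open>Suc m\<close> exceeds them all.\<close>

lemma koszul_diff_Suc_notin:
  assumes "Suc m \<notin> A"
  shows "koszul_diff (Suc m) u A = koszul_diff m (prj0 (Suc m) u) A + sg (Suc m) A (act (Suc m) (prj1 (Suc m) u A))"
proof -
  have "{1..Suc m} - A = insert (Suc m) ({1..m} - A)" using assms by auto
  moreover have "(\<Sum>k\<in>{1..m} - A. sg k A (act k (u (insert k A)))) = koszul_diff m (prj0 (Suc m) u) A"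
    unfolding koszul_diff_def using assms by (intro sum.cong) (auto simp: prj0_def)
  ultimately show ?thesis using assms by (simp add: koszul_diff_def[of "Suc m"] prj1_def add.commute)
qed

lemma koszul_diff_Suc_insert:
  assumes "Suc m \<notin> A"
  shows "koszul_diff (Suc m) u (insert (Suc m) A) = koszul_diff m (prj1 (Suc m) u) A"
  unfolding koszul_diff_def
proof (rule sum.cong)
  show "{1..Suc m} - insert (Suc m) A = {1..m} - A" by auto
  fix k assume k: "k \<in> {1..m} - A"
  hence "{a \<in> insert (Suc m) A. a < k} = {a\<in>A. a < k}" by auto
  thus "sg k (insert (Suc m) A) (act k (u (insert k (insert (Suc m) A)))) =
      sg k A (act k (prj1 (Suc m) u (insert k A)))"
    using k assms by (auto simp: sg_def prj1_def insert_commute)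
qed

lemma koszul_diff_prj1_in: "Suc m \<in> A \<Longrightarrow> koszul_diff m (prj1 (Suc m) u) A = 0"
  by (simp add: koszul_diff_def prj1_def)

text \<open>On subsets of \<open>{1..m}\<close> the sign is the parity of the cardinality, and
  inserting an index reverses it; hence the twisted multiplication anticommutes with the
  boundary.\<close>

lemma koszul_diff_twist:
  assumes A: "A \<subseteq> {1..m}"
  shows "koszul_diff m (\<lambda>A. sg (Suc m) A (act (Suc m) (w A))) A = - sg (Suc m) A (act (Suc m) (koszul_diff m w A))"
  unfolding koszul_diff_def act_sum
proof -
  have fin: "finite A" using A by (rule finite_subset) simp
  have "sg k A (act k (sg (Suc m) (insert k A) (act (Suc m) (w (insert k A))))) =
     - sg (Suc m) A (act (Suc m) (sg k A (act k (w (insert k A)))))" if k: "k \<in> {1..m} - A" for k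
  proof -
    have "{a \<in> insert k A. a < Suc m} = insert k {a\<in>A. a < Suc m}" using k by auto
    hence "even (card {a \<in> insert k A. a < Suc m}) = odd (card {a\<in>A. a < Suc m})" using k fin by simp
    thus ?thesis by (simp add: sg_def act_comm)
  qed
  hence "(\<Sum>k\<in>{1..m} - A. sg k A (act k (sg (Suc m) (insert k A) (act (Suc m) (w (insert k A)))))) =
    (\<Sum>k\<in>{1..m} - A. - sg (Suc m) A (act (Suc m) (sg k A (act k (w (insert k A))))))"
    by (intro sum.cong) auto
  also have "\<dots> = - sg (Suc m) A (\<Sum>k\<in>{1..m} - A. act (Suc m) (sg k A (act k (w (insert k A)))))"
    by (simp add: sg_def sum_negf)
  finally show "(\<Sum>k\<in>{1..m} - A. sg k A (act k (sg (Suc m) (insert k A) (act (Suc m) (w (insert k A)))))) =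
    - sg (Suc m) A (\<Sum>k\<in>{1..m} - A. act (Suc m) (sg k A (act k (w (insert k A)))))" .
qed

end

interpretation kp: koszul "\<lambda>i (p :: 'k::field mpoly). var i * p"
  by unfold_locales (simp_all add: algebra_simps)

lemma gm_S: "m \<le> n \<Longrightarrow> kp.gm m (S n)"
  unfolding kp.gm_def
proof safe
  fix d i and x :: "'a mpoly" assume "m \<le> n" "i \<in> {1..m}" "x \<in> S n d"
  thus "var i * x \<in> S n (d + 1)" using S_mult[of "var i" n 1 x d] by (simp add: add.commute)
qed (auto simp: S_diff)

text \<open>Here acyclicity draws on the ring itself: the next variable is a nonzerodivisor modulo
  the first \<open>m\<close>. If \<open>x_(m+1) p\<close> lies in the ideal of these variables, each
  monomial of \<open>p\<close> is divisible by one of them.\<close>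

lemma acyclic_aux_base:
  fixes u :: "nat set \<Rightarrow> 'k::field mpoly"
  assumes "Suc m \<le> n" "chain (Suc m) (Suc 0) j (S n) u" "\<And>A. kp.koszul_diff (Suc m) u A = 0"
  shows "\<exists>w. chain m (Suc 0) (j - 1) (S n) w \<and> (\<forall>A. prj1 (Suc m) u A = kp.koszul_diff m w A)"
proof -
  let ?s = "Suc m"
  define p where "p = prj1 ?s u {}"
  have c1: "chain m 0 (j - 1) (S n) (prj1 ?s u)" by (rule chain_prj1[OF assms(2)])
  have p: "p \<in> S n (j - 1)" using chain_val[OF c1, of "{}"] by (simp add: p_def)
  have "kp.koszul_diff m (prj0 ?s u) {} + var ?s * p = 0"
    using assms(3)[of "{}"] kp.koszul_diff_Suc_notin[of m "{}" u] by (simp add: sg_def p_def)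
  hence "var ?s * p = - kp.koszul_diff m (prj0 ?s u) {}"
    by (rule minus_unique[symmetric])
  hence eq: "var ?s * p = - (\<Sum>k\<in>{1..m}. var k * prj0 ?s u {k})"
    by (simp add: kp.koszul_diff_def sg_def)
  have meet: "\<forall>a\<in>kys p. kys a \<inter> {1..m} \<noteq> {}"
  proof
    fix a assume "a \<in> kys p"
    hence "xm ?s + a \<in> kys (var ?s * p)" unfolding keys_var_mult by (rule imageI)
    hence "xm ?s + a \<in> kys (\<Sum>k\<in>{1..m}. var k * prj0 ?s u {k})"
      unfolding eq keys_minus .
    hence "xm ?s + a \<in> (\<Union>k\<in>{1..m}. kys (var k * prj0 ?s u {k}))"
      by (rule subsetD[OF keys_sum])
    then obtain k b where "k \<in> {1..m}" "xm ?s + a = xm k + b" by (auto simp: keys_var_mult)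
    hence "k \<in> kys (xm ?s + a)" "k \<in> {1..m}" by (simp_all add: keys_nat_add)
    thus "kys a \<inter> {1..m} \<noteq> {}" by (auto simp: keys_nat_add)
  qed
  obtain v where v: "\<forall>k. v k \<in> S n (j - 1 - 1)" "p = (\<Sum>k\<in>{1..m}. var k * v k)"
    using decomp_vars[OF _ p meet] by auto
  define w where "w = (\<lambda>A. if A \<subseteq> {1..m} \<and> card A = Suc 0 then v (the_elem A) else 0)"
  have cw: "chain m (Suc 0) (j - 1) (S n) w"
    by (rule chainI) (use v(1) in \<open>auto simp: w_def\<close>)
  have "prj1 ?s u A = kp.koszul_diff m w A" for A
  proof (cases "A = {}")
    case True
    have "kp.koszul_diff m w {} = (\<Sum>k\<in>{1..m}. var k * v k)"
      unfolding kp.koszul_diff_def by (rule sum.cong) (auto simp: sg_def w_def)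
    thus ?thesis using True v(2) by (simp add: p_def)
  next
    case False
    hence *: "\<not> (A \<subseteq> {1..m} \<and> card A = 0)" by (metis card_0_eq finite_atLeastAtMost finite_subset)
    have "kp.koszul_diff m w A = 0" by (rule chain_0[OF kp.koszul_diff_chain[OF gm_S cw]]) (use assms(1) * in auto)
    thus ?thesis using chain_0[OF c1 *] by simp
  qed
  thus ?thesis using cw by blast
qed

text \<open>Induction on the number \<open>m\<close> of Koszul variables, inside a fixed polynomial
  ring in \<open>n\<close> variables. The part \<open>u1\<close> bounds a chain \<open>w2\<close>;
  then \<open>u0\<close> minus the twist of \<open>w2\<close> by the last variable is a cycle in
  \<open>m\<close> variables and bounds a chain \<open>w1\<close>.\<close>

lemma acyclic:
  fixes u :: "nat set \<Rightarrow> 'k::field mpoly"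
  assumes "m \<le> n" "chain m (Suc i) j (S n) u" "\<And>A. kp.koszul_diff m u A = 0"
  shows "\<exists>w. chain m (Suc (Suc i)) j (S n) w \<and> (\<forall>A. u A = kp.koszul_diff m w A)"
  using assms
proof (induction m arbitrary: i j u)
  case 0
  have "u A = 0" for A
  proof (rule chain_0[OF 0(2)], safe)
    assume "A \<subseteq> {1..0}" "card A = Suc i" thus False by simp
  qed
  moreover have "chain 0 (Suc (Suc i)) j (S n) (\<lambda>A. 0::'k mpoly)" by (rule chainI) auto
  ultimately show ?case by (intro exI[of _ "\<lambda>A. 0"]) (auto simp: kp.koszul_diff_def)
next
  case (Suc m)
  let ?s = "Suc m"
  note gmm = gm_S[of m n]
  have mn: "m \<le> n" using Suc.prems by simp
  have c0: "chain m (Suc i) j (S n) (prj0 ?s u)" by (rule chain_prj0[OF Suc.prems(2)])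
  have c1: "chain m i (j - 1) (S n) (prj1 ?s u)" by (rule chain_prj1[OF Suc.prems(2)])
  have k1: "kp.koszul_diff m (prj1 ?s u) A = 0" for A
    using kp.koszul_diff_prj1_in kp.koszul_diff_Suc_insert Suc.prems(3) by (metis (full_types))
  \<comment> \<open>For \<open>i = 0\<close> the part \<open>u1\<close> is a 0-chain, out of reach
    of the induction hypothesis.\<close>
  have "\<exists>w. chain m (Suc i) (j - 1) (S n) w \<and> (\<forall>A. prj1 ?s u A = kp.koszul_diff m w A)"
  proof (cases i)
    case 0
    thus ?thesis using acyclic_aux_base[of m n j u] Suc.prems by simp
  next
    case (Suc i')
    thus ?thesis using Suc.IH[OF mn, of i' "j - 1" "prj1 ?s u"] c1 k1 by simp
  qed
  then obtain w2 where w2: "chain m (Suc i) (j - 1) (S n) w2" "\<And>A. prj1 ?s u A = kp.koszul_diff m w2 A" by blast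
  define t where "t = (\<lambda>A. sg ?s A (var ?s * w2 A))"
  have ct: "chain m (Suc i) j (S n) t"
  proof (rule chainI)
    fix A assume A: "A \<subseteq> {1..m}" "card A = Suc i"
    have "var ?s * w2 A \<in> S n (1 + (j - 1 - int (Suc i)))"
      by (rule S_mult) (use chain_val[OF w2(1) A] Suc.prems(1) in auto)
    moreover have "1 + (j - 1 - int (Suc i)) = j - int (Suc i)" by simp
    ultimately have "var ?s * w2 A \<in> S n (j - int (Suc i))" by metis
    thus "t A \<in> S n (j - int (Suc i))" unfolding t_def sg_def using S_uminus by auto
  qed (simp add: t_def chain_0[OF w2(1)])
  have cv: "chain m (Suc i) j (S n) (prj0 ?s u - t)" by (rule kp.chain_diff[OF gmm[OF mn] c0 ct])
  have "kp.koszul_diff m (prj0 ?s u - t) A = 0" for A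
  proof (cases "A \<subseteq> {1..m} \<and> card A = i")
    case True
    hence s: "?s \<notin> A" by auto
    have "kp.koszul_diff m (prj0 ?s u) A = - sg ?s A (var ?s * prj1 ?s u A)"
      using kp.koszul_diff_Suc_notin[OF s, of u] Suc.prems(3) by (simp add: eq_neg_iff_add_eq_0)
    moreover have "kp.koszul_diff m t A = - sg ?s A (var ?s * prj1 ?s u A)"
      unfolding t_def w2(2) using True by (intro kp.koszul_diff_twist) simp
    ultimately show ?thesis by (simp add: kp.koszul_diff_diff)
  next
    case False
    thus ?thesis by (rule chain_0[OF kp.koszul_diff_chain[OF gmm[OF mn] cv]])
  qed
  then obtain w1 where w1: "chain m (Suc (Suc i)) j (S n) w1" "\<And>A. (prj0 ?s u - t) A = kp.koszul_diff m w1 A"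
    using Suc.IH[OF mn cv] by blast
  \<comment> \<open>The chain \<open>w1 + e_s w2\<close>, reassembled from its two parts.\<close>
  define W where "W = (\<lambda>A. if ?s \<in> A then w2 (A - {?s}) else w1 A)"
  have p0: "prj0 ?s W = w1"
  proof
    fix A show "prj0 ?s W A = w1 A"
    proof (cases "?s \<in> A")
      case True
      hence "\<not> A \<subseteq> {1..m}" by auto
      thus ?thesis using True chain_0[OF w1(1), of A] by (simp add: prj0_def)
    qed (simp add: prj0_def W_def)
  qed
  have p1: "prj1 ?s W = w2"
  proof
    fix A show "prj1 ?s W A = w2 A"
    proof (cases "?s \<in> A")
      case True
      hence "\<not> A \<subseteq> {1..m}" by auto
      thus ?thesis using True chain_0[OF w2(1), of A] by (simp add: prj1_def)
    qed (simp add: prj1_def W_def)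
  qed
  have "chain ?s (Suc (Suc i)) j (S n) W"
  proof (rule chainI)
    fix A assume A: "A \<subseteq> {1..?s}" "card A = Suc (Suc i)"
    show "W A \<in> S n (j - int (Suc (Suc i)))"
    proof (cases "?s \<in> A")
      case True
      hence "A - {?s} \<subseteq> {1..m}" "card (A - {?s}) = Suc i" using A by (auto simp: atLeastAtMostSuc_conv)
      hence "w2 (A - {?s}) \<in> S n (j - 1 - int (Suc i))" by (rule chain_val[OF w2(1)])
      thus ?thesis using True by (simp add: W_def algebra_simps)
    next
      case False
      hence "A \<subseteq> {1..m}" using A by (auto simp: atLeastAtMostSuc_conv)
      thus ?thesis using False A chain_val[OF w1(1)] by (simp add: W_def)
    qed
  next
    fix A assume A: "\<not> (A \<subseteq> {1..?s} \<and> card A = Suc (Suc i))"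
    show "W A = 0"
    proof (cases "?s \<in> A")
      case True
      have "\<not> (A - {?s} \<subseteq> {1..m} \<and> card (A - {?s}) = Suc i)"
      proof safe
        assume *: "A - {?s} \<subseteq> {1..m}" "card (A - {?s}) = Suc i"
        have "finite (A - {?s})" using *(1) by (rule finite_subset) simp
        hence "card A = Suc (Suc i)" using *(2) True by (metis card.remove finite_Diff2 finite.emptyI finite_insert)
        moreover have "A \<subseteq> {1..?s}" using *(1) by (auto simp: atLeastAtMostSuc_conv)
        ultimately show False using A by simp
      qed
      thus ?thesis using True chain_0[OF w2(1)] by (simp add: W_def)
    next
      case False
      hence "\<not> (A \<subseteq> {1..m} \<and> card A = Suc (Suc i))" using A by (auto simp: atLeastAtMostSuc_conv)
      thus ?thesis using False chain_0[OF w1(1)] by (simp add: W_def)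
    qed
  qed
  moreover have "u A = kp.koszul_diff ?s W A" for A
  proof (cases "?s \<in> A")
    case True
    then obtain B where B: "A = insert ?s B" "?s \<notin> B" by (metis mk_disjoint_insert)
    have "kp.koszul_diff ?s W A = kp.koszul_diff m w2 B" using kp.koszul_diff_Suc_insert[OF B(2), of W] B(1) p1 by simp
    also have "\<dots> = u A" using w2(2)[of B] B by (simp add: prj1_def)
    finally show ?thesis by simp
  next
    case False
    have "kp.koszul_diff ?s W A = kp.koszul_diff m w1 A + t A" using kp.koszul_diff_Suc_notin[OF False, of W] p0 p1
        by (simp add: t_def)
    also have "\<dots> = u A" using w1(2)[of A] False by (simp add: prj0_def algebra_simps)
    finally show ?thesis by simp
  qed
  ultimately show ?case by blast
qed

text \<open>The complex resolves the field, which sits in \<open>H_0\<close> in degree 0; the strict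
  inequality excludes this class.\<close>

theorem koszul_exact_S: assumes "j > int i" shows "kp.koszul_exact n i j (S n) (\<lambda>_. {0 :: 'k::field mpoly})"
proof (cases i)
  case 0
  show ?thesis unfolding kp.koszul_exact_def
  proof safe
    fix u :: "nat set \<Rightarrow> 'k mpoly" assume u: "chain n i j (S n) u"
    have "u {} \<in> S n j" using chain_val[OF u, of "{}"] 0 by simp
    then obtain v where v: "\<forall>k. v k \<in> S n (j - 1)" "u {} = (\<Sum>k\<in>{1..n}. var k * v k)"
      using decomp_all_vars[of "u {}" n j] assms 0 by auto
    define w where "w = (\<lambda>A. if A \<subseteq> {1..n} \<and> card A = Suc 0 then v (the_elem A) else 0)"
    have cw: "chain n (Suc i) j (S n) w"
      by (rule chainI) (use v(1) 0 in \<open>auto simp: w_def\<close>)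
    have "u A - kp.koszul_diff n w A \<in> {0}" for A
    proof (cases "A = {}")
      case True
      have "kp.koszul_diff n w {} = (\<Sum>k\<in>{1..n}. var k * v k)"
        unfolding kp.koszul_diff_def by (rule sum.cong) (auto simp: sg_def w_def)
      thus ?thesis using True v(2) by simp
    next
      case False
      hence *: "\<not> (A \<subseteq> {1..n} \<and> card A = i)" unfolding 0 by (metis card_0_eq finite_atLeastAtMost finite_subset)
      have "kp.koszul_diff n w A = 0" by (rule chain_0[OF kp.koszul_diff_chain[OF gm_S cw]]) (use * in auto)
      thus ?thesis using chain_0[OF u *] by simp
    qed
    thus "\<exists>w. chain n (Suc i) j (S n) w \<and> (\<forall>A. u A - kp.koszul_diff n w A \<in> {0})" using cw by blast
  qed
next
  case (Suc i')
  show ?thesis unfolding kp.koszul_exact_def using acyclic[of n n i' j] Suc by auto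
qed

subsection \<open>Regularity of graded ideals\<close>

text \<open>Homogeneity as closure under components, a form that can be checked directly for
  \<open>J : f\<close>, for \<open>J + f\<close> and for coordinates of submodules, where no
  homogeneous generators are at hand.\<close>

definition graded_ideal :: "nat \<Rightarrow> 'k::field mpoly set \<Rightarrow> bool" where
  "graded_ideal n J \<longleftrightarrow> J \<subseteq> polys n \<and> 0 \<in> J \<and> (\<forall>p\<in>J. \<forall>q\<in>J. p + q \<in> J) \<and>
     (\<forall>p\<in>polys n. \<forall>q\<in>J. p * q \<in> J) \<and> (\<forall>p\<in>J. \<forall>d. hc d p \<in> J)"

lemma graded_idealD:
  assumes "graded_ideal n J"
  shows "p \<in> J \<Longrightarrow> p \<in> polys n" "0 \<in> J" "p \<in> J \<Longrightarrow> q \<in> J \<Longrightarrow> p + q \<in> J"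
    "r \<in> polys n \<Longrightarrow> p \<in> J \<Longrightarrow> r * p \<in> J" "r \<in> polys n \<Longrightarrow> p \<in> J \<Longrightarrow> p * r \<in> J" "p \<in> J \<Longrightarrow> hc d p \<in> J"
  using assms by (auto simp: graded_ideal_def mult.commute)

lemma graded_ideal_uminus: "graded_ideal n J \<Longrightarrow> p \<in> J \<Longrightarrow> - p \<in> J"
  using graded_idealD(4)[of n J "- 1" p] by (simp add: polys_closed)

lemma graded_ideal_diff: "graded_ideal n J \<Longrightarrow> p \<in> J \<Longrightarrow> q \<in> J \<Longrightarrow> p - q \<in> J"
  using graded_idealD(3)[of n J p "- q"] by (simp add: graded_ideal_uminus)

lemma graded_ideal_sum: "graded_ideal n J \<Longrightarrow> (\<And>a. a \<in> A \<Longrightarrow> f a \<in> J) \<Longrightarrow> sum f A \<in> J"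
  by (induction A rule: infinite_finite_induct) (auto simp: graded_idealD)

lemma graded_ideal_hc_iff: "graded_ideal n J \<Longrightarrow> p \<in> J \<longleftrightarrow> (\<forall>d. hc d p \<in> J)"
  using graded_ideal_sum[of n J "degs p" "\<lambda>d. hc d p"] hc_decomp[of p] graded_idealD(6)[of n J p] by auto

lemma graded_ideal_polys: "graded_ideal n (polys n)"
  by (auto simp: graded_ideal_def polys_closed hc_def keep_polys)

definition graded_part :: "nat \<Rightarrow> 'k::field mpoly set \<Rightarrow> int \<Rightarrow> 'k mpoly set" where
  "graded_part n J d = J \<inter> S n d"

lemma graded_part_polys: "graded_part n (polys n) = S n"
  by (auto simp: graded_part_def fun_eq_iff S_polys)

lemma graded_part_zero: "graded_part n {0} = (\<lambda>_. {0})"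
  by (auto simp: graded_part_def fun_eq_iff)

lemma gm_graded_part: assumes "graded_ideal n J" shows "kp.gm n (graded_part n J)"
  unfolding kp.gm_def
proof safe
  fix d i x assume "i \<in> {1..n}" "x \<in> graded_part n J d"
  thus "var i * x \<in> graded_part n J (d + 1)"
    using S_mult[of "var i" n 1 x d] graded_idealD(4)[OF assms, of "var i" x] by (simp add: graded_part_def add.commute)
qed (auto simp: graded_part_def S_diff graded_idealD[OF assms] graded_ideal_diff[OF assms])

definition adjoin :: "nat \<Rightarrow> 'k::field mpoly set \<Rightarrow> 'k mpoly \<Rightarrow> 'k mpoly set" where
  "adjoin n J f = {a + b * f | a b. a \<in> J \<and> b \<in> polys n}"

definition colon :: "nat \<Rightarrow> 'k::field mpoly set \<Rightarrow> 'k mpoly \<Rightarrow> 'k mpoly set" where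
  "colon n J f = {p \<in> polys n. p * f \<in> J}"

lemma graded_ideal_colon: assumes J: "graded_ideal n J" and f: "f \<in> S n e" shows "graded_ideal n (colon n J f)"
  unfolding graded_ideal_def
proof (intro conjI ballI allI)
  fix p d assume p: "p \<in> colon n J f"
  have "hc (d + e) (f * p) = f * hc (d + e - e) p" by (rule hc_mult[OF f]) (use p in \<open>simp add: colon_def\<close>)
  hence "f * hc d p \<in> J" using p graded_idealD(6)[OF J, of "f * p" "d + e"] by (simp add: colon_def mult.commute)
  thus "hc d p \<in> colon n J f" using p by (simp add: colon_def mult.commute hc_def keep_polys)
qed (auto simp: colon_def polys_closed graded_idealD[OF J] algebra_simps)

lemma colon_sup: "graded_ideal n J \<Longrightarrow> f \<in> polys n \<Longrightarrow> J \<subseteq> colon n J f"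
  by (auto simp: colon_def graded_idealD)

lemma graded_ideal_adjoin: fixes J :: "'k::field mpoly set" assumes J: "graded_ideal n J" and f: "f \<in> S n e"
    shows "graded_ideal n (adjoin n J f)"
  unfolding graded_ideal_def
proof (intro conjI ballI allI)
  note fP = S_polys[OF f]
  show "adjoin n J f \<subseteq> polys n" using fP by (auto simp: adjoin_def polys_closed graded_idealD[OF J])
  show "0 \<in> adjoin n J f" using graded_idealD(2)[OF J] by (auto simp: adjoin_def polys_closed intro!: exI[of _ 0])
next
  fix p q assume "p \<in> adjoin n J f" "q \<in> adjoin n J f"
  then obtain a b c d where *: "p = a + b * f" "q = c + d * f" "a \<in> J" "c \<in> J" "b \<in> polys n" "d \<in> polys n"
    unfolding adjoin_def by blast
  have "p + q = (a + c) + (b + d) * f" by (simp add: * algebra_simps)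
  thus "p + q \<in> adjoin n J f" unfolding adjoin_def using * graded_idealD(3)[OF J] polys_closed(1) by blast
next
  fix p q :: "'k mpoly" assume "p \<in> polys n" "q \<in> adjoin n J f"
  then obtain c d where *: "q = c + d * f" "c \<in> J" "d \<in> polys n"
    unfolding adjoin_def by blast
  have "p * q = (p * c) + (p * d) * f" by (simp add: * algebra_simps)
  thus "p * q \<in> adjoin n J f" unfolding adjoin_def using * \<open>p \<in> polys n\<close> graded_idealD(4)[OF J] polys_closed(5) by blast
next
  fix p d assume "p \<in> adjoin n J f"
  then obtain a b where *: "p = a + b * f" "a \<in> J" "b \<in> polys n"
    unfolding adjoin_def by blast
  have "hc d p = hc d a + hc (d - e) b * f" using hc_mult[OF f *(3)] by (simp add: *(1) mult.commute)
  moreover have "hc (d - e) b \<in> polys n" using *(3) by (simp add: hc_def keep_polys)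
  ultimately show "hc d p \<in> adjoin n J f" unfolding adjoin_def using graded_idealD(6)[OF J *(2)] by blast
qed

lemma adjoin_sup: "J \<subseteq> adjoin n J f" "graded_ideal n J \<Longrightarrow> f \<in> adjoin n J f"
proof -
  have "a = a + 0 * f" "f = 0 + 1 * f" for a by simp_all
  thus "J \<subseteq> adjoin n J f" "graded_ideal n J \<Longrightarrow> f \<in> adjoin n J f"
    unfolding adjoin_def using polys_closed(3,4)[of n] graded_idealD(2)[of n J] by blast+
qed

lemma graded_part_adjoin_iff:
  assumes J: "graded_ideal n J" and f: "f \<in> S n e"
  shows "p \<in> graded_part n (adjoin n J f) d \<longleftrightarrow> (\<exists>a b. a \<in> graded_part n J d \<and> b \<in> S n (d - e) \<and> p = a + b * f)"
proof safe
  assume p: "p \<in> graded_part n (adjoin n J f) d"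
  then obtain a b where *: "p = a + b * f" "a \<in> J" "b \<in> polys n" unfolding graded_part_def adjoin_def by blast
  have "p = hc d p" using p hc_id[of p n d] by (simp add: graded_part_def)
  also have "\<dots> = hc d a + hc (d - e) b * f" using hc_mult[OF f *(3)] by (simp add: *(1) mult.commute)
  finally have "p = hc d a + hc (d - e) b * f" .
  moreover have "hc d a \<in> graded_part n J d" "hc (d - e) b \<in> S n (d - e)"
    using * graded_idealD(1,6)[OF J] by (simp_all add: graded_part_def)
  ultimately show "\<exists>a b. a \<in> graded_part n J d \<and> b \<in> S n (d - e) \<and> p = a + b * f" by blast
next
  fix a b :: "'a mpoly" assume "a \<in> graded_part n J d" "b \<in> S n (d - e)"
  moreover from this have "b * f \<in> S n d" using S_mult[of b n "d - e" f e] f by simp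
  ultimately show "a + b * f \<in> graded_part n (adjoin n J f) d"
    unfolding graded_part_def adjoin_def using S_add S_polys by blast
qed

lemma (in koszul) koszul_diff_in: "gm n M \<Longrightarrow> (\<And>A. u A \<in> M d) \<Longrightarrow> koszul_diff n u A \<in> M (d + 1)"
  unfolding koszul_diff_def by (rule gm_sum, assumption, rule gm_sg, assumption, rule gm_act) auto

lemma koszul_diff_mult_right: "kp.koszul_diff n (\<lambda>A. w A * f) A = kp.koszul_diff n w A * f"
  unfolding kp.koszul_diff_def sum_distrib_right by (rule sum.cong) (auto simp: sg_def mult.assoc)

text \<open>Multiplication by \<open>f\<close> identifies \<open>S/(J : f)\<close>, shifted by one, with \<open>(J + f)/J\<close>.\<close>

lemma koszul_exact_shift:
  fixes f :: "'k::field mpoly"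
  assumes J: "graded_ideal n J" and f: "f \<in> S n 1"
      and z: "kp.koszul_exact n i (j - 1) (S n) (graded_part n (colon n J f))"
  shows "kp.koszul_exact n i j (graded_part n (adjoin n J f)) (graded_part n J)"
  unfolding kp.koszul_exact_def
proof safe
  fix u assume u: "chain n i j (graded_part n (adjoin n J f)) u"
      "\<forall>A. kp.koszul_diff n u A \<in> graded_part n J (j - int i + 1)"
  have uS: "u A \<in> graded_part n (adjoin n J f) (j - int i)" for A
      by (rule kp.chain_in[OF u(1) gm_graded_part[OF graded_ideal_adjoin[OF J f]]])
  \<comment> \<open>The coefficient of \<open>f\<close> is not unique; taking it to be 0 outside the
    index sets makes \<open>b\<close> a chain.\<close>
  have "\<exists>a b. a \<in> graded_part n J (j - int i) \<and> b \<in> S n (j - int i - 1) \<and> u A = a + b * f \<and>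
      (\<not> (A \<subseteq> {1..n} \<and> card A = i) \<longrightarrow> b = 0)" for A
  proof (cases "A \<subseteq> {1..n} \<and> card A = i")
    case True
    thus ?thesis using uS[of A] unfolding graded_part_adjoin_iff[OF J f] by blast
  next
    case False
    hence "u A = 0" by (rule chain_0[OF u(1)])
    moreover have "0 \<in> graded_part n J (j - int i)" by (simp add: graded_part_def graded_idealD[OF J])
    ultimately show ?thesis by (intro exI[of _ 0]) auto
  qed
  then obtain a b where ab: "\<And>A. a A \<in> graded_part n J (j - int i)" "\<And>A. b A \<in> S n (j - int i - 1)" "\<And>A. u A =
      a A + b A * f"
      "\<And>A. \<not> (A \<subseteq> {1..n} \<and> card A = i) \<Longrightarrow> b A = 0" by metis
  have eq: "j - int i - 1 = j - 1 - int i" by simp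
  have cb: "chain n i (j - 1) (S n) b" by (rule chainI) (use ab(2,4) in \<open>auto simp: eq\<close>)
  have "u = a + (\<lambda>A. b A * f)" using ab(3) by (auto simp: fun_eq_iff)
  hence kdu: "kp.koszul_diff n u A = kp.koszul_diff n a A + kp.koszul_diff n b A * f" for A
    by (simp only: kp.koszul_diff_add koszul_diff_mult_right)
  have kda: "kp.koszul_diff n a A \<in> J" for A using kp.koszul_diff_in[OF gm_graded_part[OF J] ab(1)]
      by (simp add: graded_part_def)
  have kdb: "kp.koszul_diff n b A \<in> S n (j - 1 - int i + 1)" for A
    by (rule kp.koszul_diff_in[OF gm_S]) (use ab(2) in \<open>simp_all add: eq\<close>)
  have "kp.koszul_diff n b A \<in> graded_part n (colon n J f) (j - 1 - int i + 1)" for A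
  proof -
    have "kp.koszul_diff n u A - kp.koszul_diff n a A \<in> J" using u(2) kda
        by (intro graded_ideal_diff[OF J]) (auto simp: graded_part_def)
    hence "kp.koszul_diff n b A * f \<in> J" by (simp add: kdu)
    thus ?thesis using kdb[of A] S_polys by (auto simp: graded_part_def colon_def)
  qed
  then obtain w where w: "chain n (Suc i) (j - 1) (S n) w"
      "\<And>A. b A - kp.koszul_diff n w A \<in> graded_part n (colon n J f) (j - 1 - int i)"
    using kp.koszul_exactE[OF z cb] by blast
  define W where "W = (\<lambda>A. w A * f)"
  have cW: "chain n (Suc i) j (graded_part n (adjoin n J f)) W"
  proof (rule chainI)
    fix A assume A: "A \<subseteq> {1..n}" "card A = Suc i"
    have "w A \<in> S n (j - int (Suc i) - 1)" using chain_val[OF w(1) A] by (simp add: algebra_simps)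
    moreover have "0 \<in> graded_part n J (j - int (Suc i))" by (simp add: graded_part_def graded_idealD[OF J])
    ultimately show "W A \<in> graded_part n (adjoin n J f) (j - int (Suc i))"
      unfolding graded_part_adjoin_iff[OF J f] W_def by (intro exI[of _ 0] exI[of _ "w A"]) simp
  qed (simp add: W_def chain_0[OF w(1)])
  have "u A - kp.koszul_diff n W A \<in> graded_part n J (j - int i)" for A
  proof -
    have "u A - kp.koszul_diff n W A = a A + (b A - kp.koszul_diff n w A) * f"
      unfolding W_def koszul_diff_mult_right ab(3) by (simp add: left_diff_distrib)
    moreover have "a A + (b A - kp.koszul_diff n w A) * f \<in> J"
      using ab(1)[of A] w(2)[of A] by (intro graded_idealD(3)[OF J]) (auto simp: graded_part_def colon_def)
    moreover have "u A - kp.koszul_diff n W A \<in> graded_part n (adjoin n J f) (j - int i)"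
      using kp.chain_in[OF kp.koszul_diff_chain[OF gm_graded_part[OF graded_ideal_adjoin[OF J f]] cW]
          gm_graded_part[OF graded_ideal_adjoin[OF J f]]] uS
      by (intro kp.gm_diff[OF gm_graded_part[OF graded_ideal_adjoin[OF J f]]])
    ultimately show ?thesis by (simp add: graded_part_def)
  qed
  thus "\<exists>w. chain n (Suc i) j (graded_part n (adjoin n J f)) w \<and>
      (\<forall>A. u A - kp.koszul_diff n w A \<in> graded_part n J (j - int i))"
    using cW by blast
qed

text \<open>The Castelnuovo--Mumford regularity of \<open>S/J\<close> is at most \<open>r\<close>.\<close>

definition regularity_le :: "nat \<Rightarrow> int \<Rightarrow> 'k::field mpoly set \<Rightarrow> bool" where
  "regularity_le n r J \<longleftrightarrow> (\<forall>i j. j > int i + r \<longrightarrow> kp.koszul_exact n i j (S n) (graded_part n J))"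

lemma regularity_le_zero: "regularity_le n 0 {0}"
  unfolding regularity_le_def graded_part_zero using koszul_exact_S by auto

lemma graded_part_mono: "J \<subseteq> J' \<Longrightarrow> graded_part n J d \<subseteq> graded_part n J' d" by (auto simp: graded_part_def)
lemma graded_part_S: "graded_part n J d \<subseteq> S n d" by (auto simp: graded_part_def)

text \<open>From \<open>0 -> S/(J:f)(-1) -> S/J -> S/(J+f) -> 0\<close>: the connecting map lowers
  the homological degree by one, and this makes up for the twist by one.\<close>

lemma regularity_le_adjoin_colon:
  assumes J: "graded_ideal n J" and f: "f \<in> S n 1"
    and z: "\<And>i j. j > int i + r + 1 \<Longrightarrow> kp.koszul_exact n i (j - 1) (S n) (graded_part n (colon n J f))"
        and r: "regularity_le n r J"
  shows "regularity_le n r (adjoin n J f)"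
  unfolding regularity_le_def
proof (intro allI impI)
  fix i j assume j: "j > int i + r"
  have zJ: "kp.koszul_exact n i j (S n) (graded_part n J)" using r j by (simp add: regularity_le_def)
  show "kp.koszul_exact n i j (S n) (graded_part n (adjoin n J f))"
  proof (cases i)
    case 0
    show ?thesis unfolding 0 by (rule kp.koszul_exact_coker_0[OF gm_graded_part[OF J] graded_part_mono[OF
        adjoin_sup(1)]]) (use zJ 0 in simp)
  next
    case (Suc i')
    have "kp.koszul_exact n i' j (graded_part n (adjoin n J f)) (graded_part n J)" using j Suc
        by (intro koszul_exact_shift[OF J f] z) simp
    thus ?thesis unfolding Suc
      by (rule kp.koszul_exact_coker[OF gm_S gm_graded_part[OF graded_ideal_adjoin[OF J f]] gm_graded_part[OF J]
        graded_part_mono[OF adjoin_sup(1)] graded_part_S, rotated])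
        (use zJ Suc in simp_all)
  qed
qed

lemma regularity_le_nonzerodivisor:
  assumes "graded_ideal n J" "f \<in> S n 1" "colon n J f = J" "regularity_le n r J"
  shows "regularity_le n r (adjoin n J f)"
  using assms by (intro regularity_le_adjoin_colon) (auto simp: regularity_le_def)

text \<open>\<open>S/J\<close> is concentrated in degree 0, whereas the coefficients of the chains
  have the positive degree \<open>j - i\<close>.\<close>

lemma koszul_exact_irrelevant:
  fixes J :: "'k::field mpoly set"
  assumes "j > int i" "\<And>d. d > 0 \<Longrightarrow> S n d \<subseteq> J"
  shows "kp.koszul_exact n i j (S n) (graded_part n J)"
  unfolding kp.koszul_exact_def
proof safe
  fix u :: "nat set \<Rightarrow> 'k mpoly" assume u: "chain n i j (S n) u"
  have "u A - kp.koszul_diff n (\<lambda>_. 0) A \<in> graded_part n J (j - int i)" for A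
    using kp.chain_in[OF u gm_S] assms(2)[of "j - int i"] assms(1) by (auto simp: graded_part_def kp.koszul_diff_def)
  moreover have "chain n (Suc i) j (S n) (\<lambda>_. 0)" by (rule chainI) auto
  ultimately show "\<exists>w. chain n (Suc i) j (S n) w \<and> (\<forall>A. u A - kp.koszul_diff n w A \<in> graded_part n J (j - int i))"
      by blast
qed

lemma S_pos_in_ideal:
  assumes "graded_ideal n J" "\<forall>k\<in>{1..n}. var k \<in> J" "d > 0" shows "S n d \<subseteq> J"
proof
  fix p :: "'a mpoly" assume "p \<in> S n d"
  then obtain w where "\<forall>k. w k \<in> S n (d - 1)" "p = (\<Sum>k\<in>{1..n}. var k * w k)"
    using decomp_all_vars[of p n d] assms(3) by auto
  thus "p \<in> J" using assms
    by (auto intro!: graded_ideal_sum[OF assms(1)] graded_idealD(5)[OF assms(1)] intro: S_polys[of _ n "d - 1"])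
qed

text \<open>\<open>J : f\<close> contains every variable, so \<open>S/(J:f)\<close> is concentrated
  in degree 0, below the range in question because \<open>r\<close> is nonnegative.\<close>

lemma regularity_le_socle:
  assumes J: "graded_ideal n J" and f: "f \<in> S n 1" and m: "\<forall>k\<in>{1..n}. var k * f \<in> J"
      and r: "regularity_le n r J" "r \<ge> 0"
  shows "regularity_le n r (adjoin n J f)"
proof (rule regularity_le_adjoin_colon[OF J f _ r(1)])
  fix i j assume j: "j > int i + r + 1"
  have kc: "\<forall>k\<in>{1..n}. var k \<in> colon n J f" using m by (simp add: colon_def)
  have "S n d \<subseteq> colon n J f" if "d > 0" for d by (rule S_pos_in_ideal[OF graded_ideal_colon[OF J f] kc that])
  thus "kp.koszul_exact n i (j - 1) (S n) (graded_part n (colon n J f))" using j r(2)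
      by (intro koszul_exact_irrelevant) auto
qed

text \<open>In \<open>0 -> S/(J:f)(-1) -> S/J -> S/(J+f) -> 0\<close> both ends bound the middle.
  The twist costs the left end one unit, hence its bound 0. For an isolated vertex \<open>v\<close>
  this is applied with \<open>f = x_v\<close>.\<close>

lemma regularity_le_ext:
  assumes J: "graded_ideal n J" and f: "f \<in> S n 1"
      and r: "regularity_le n 0 (colon n J f)" "regularity_le n 1 (adjoin n J f)"
  shows "regularity_le n 1 J"
  unfolding regularity_le_def
proof (intro allI impI)
  fix i j assume j: "j > int i + 1"
  have "kp.koszul_exact n i j (graded_part n (adjoin n J f)) (graded_part n J)" using r(1) j
      by (intro koszul_exact_shift[OF J f]) (simp add: regularity_le_def)
  moreover have "kp.koszul_exact n i j (S n) (graded_part n (adjoin n J f))" using r(2) j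
      by (simp add: regularity_le_def)
  ultimately show "kp.koszul_exact n i j (S n) (graded_part n J)"
    by (rule kp.koszul_exact_ext[OF gm_S graded_part_mono[OF adjoin_sup(1)] graded_part_S, rotated]) simp
qed

text \<open>The socle is the top Koszul homology: a socle element of degree \<open>e\<close> times
  \<open>e_{1..n}\<close> is a cycle of total degree \<open>e + n\<close>. There are no chains above
  it, so it can only vanish by lying in \<open>J\<close>.\<close>

lemma regularity_le_no_socle:
  assumes J: "graded_ideal n J" and r: "regularity_le n 1 J" and f: "f \<in> S n e" "e \<ge> 2" "\<forall>k\<in>{1..n}. var k * f \<in> J"
  shows "f \<in> J"
proof -
  define u where "u = (\<lambda>A. if A = {1..n} then f else 0)"
  have c: "chain n n (e + int n) (S n) u"
  proof (rule chainI)
    fix A assume "A \<subseteq> {1..n}" "card A = n"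
    thus "u A \<in> S n (e + int n - int n)" using f(1) by (simp add: u_def)
  qed (auto simp: u_def)
  have "kp.koszul_diff n u A \<in> graded_part n J (e + int n - int n + 1)" for A
    unfolding kp.koszul_diff_def
  proof (rule kp.gm_sum[OF gm_graded_part[OF J]], rule kp.gm_sg[OF gm_graded_part[OF J]])
    fix k assume k: "k \<in> {1..n} - A"
    have "var k * f \<in> S n (1 + e)" using k f(1) by (intro S_mult) auto
    thus "var k * u (insert k A) \<in> graded_part n J (e + int n - int n + 1)"
      using k f(3) by (auto simp: u_def graded_part_def graded_idealD[OF J] add.commute)
  qed
  moreover have "kp.koszul_exact n n (e + int n) (S n) (graded_part n J)" using r f(2) by (simp add: regularity_le_def)
  ultimately obtain w where w: "chain n (Suc n) (e + int n) (S n) w"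
      "\<And>A. u A - kp.koszul_diff n w A \<in> graded_part n J (e + int n - int n)"
    using kp.koszul_exactE[OF _ c] by metis
  have "w A = 0" for A
  proof (rule chain_0[OF w(1)], safe)
    assume "A \<subseteq> {1..n}" "card A = Suc n"
    thus False using card_mono[of "{1..n}" A] by simp
  qed
  hence "kp.koszul_diff n w {1..n} = 0" by (simp add: kp.koszul_diff_def)
  thus ?thesis using w(2)[of "{1..n}"] by (simp add: u_def graded_part_def)
qed

section \<open>Dimensions and Hilbert series\<close>

context vector_space
begin

lemma fd_dim_eq:
  assumes "finite W" "U \<subseteq> span W" "V \<subseteq> U" "subspace V" "dim V = dim U"
  shows "V = U"
proof -
  obtain B where B: "B \<subseteq> V" "independent B" "V \<subseteq> span B" "card B = dim V" by (rule basis_exists)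
  have BU: "B \<subseteq> U" using B(1) assms(3) by blast
  obtain C where C: "B \<subseteq> C" "C \<subseteq> U" "independent C" "U \<subseteq> span C"
    using maximal_independent_subset_extend[OF BU B(2)] by blast
  have "finite C" using independent_span_bound[OF assms(1) C(3)] C(2) assms(2) by blast
  moreover have "card C = dim U" using C by (intro basis_card_eq_dim)
  ultimately have "B = C" using B(4) C(1) assms(5) by (simp add: card_subset_eq)
  moreover have "span B \<subseteq> V" using B(1) assms(4) by (rule span_minimal)
  ultimately show ?thesis using C(4) assms(3) by auto
qed

text \<open>The identity minus a projection onto \<open>U\<close>. An endomorphism with prescribed
  kernel stands in for the quotient map, so that dimensions modulo \<open>U\<close> become
  ranks.\<close>

lemma exists_projection_kernel:
  assumes "subspace U"
  shows "\<exists>g. (\<forall>x y. g (x + y) = g x + g y) \<and> (\<forall>c x. g (scale c x) = scale c (g x)) \<and> (\<forall>x. g x = 0 \<longleftrightarrow> x \<in> U)"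
proof -
  interpret p: vector_space_pair scale scale by unfold_locales
  obtain B where B: "B \<subseteq> U" "independent B" "U \<subseteq> span B" by (rule maximal_independent_subset)
  define c where "c = p.construct B (\<lambda>b. b)"
  have lin: "Vector_Spaces.linear scale scale c" unfolding c_def by (rule p.linear_construct[OF B(2)])
  interpret c: Vector_Spaces.linear scale scale c by (rule lin)
  have li: "Vector_Spaces.linear scale scale (\<lambda>x. x)"
    unfolding Vector_Spaces.linear_iff using vector_space_axioms by simp
  have cx: "c x = x" if "x \<in> U" for x
  proof -
    have "c b = b" if "b \<in> B" for b unfolding c_def using B(2) that by (rule p.construct_basis)
    thus ?thesis by (rule p.linear_eq_on_span[OF lin li _ subsetD[OF B(3) that]])
  qed
  have cU: "c x \<in> U" for x
  proof -
    have "c x \<in> span ((\<lambda>b. b) ` B)" unfolding c_def by (rule p.construct_in_span[OF B(2)])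
    hence "c x \<in> span B" by simp
    thus ?thesis by (rule subsetD[OF span_minimal[OF B(1) assms]])
  qed
  have "x - c x = 0 \<longleftrightarrow> x \<in> U" for x
    using cx[of x] cU[of x] by (metis eq_iff_diff_eq_0)
  moreover have "x + y - c (x + y) = (x - c x) + (y - c y)" for x y by (simp add: c.add)
  moreover have "scale a x - c (scale a x) = scale a (x - c x)" for a x
    by (simp add: c.scale scale_right_diff_distrib)
  ultimately show ?thesis by (intro exI[of _ "\<lambda>x. x - c x"] conjI allI)
qed

end

text \<open>\<open>f\<close> is linear on \<open>V\<close> only, so it is replaced by the linear map
  \<open>g\<close> with the same values on a basis of \<open>V\<close>. The finite set
  \<open>W\<close> supplies finite dimension.\<close>

lemma (in vector_space_pair) rank_nullity:
  assumes V: "vs1.subspace V" and W: "finite W" "V \<subseteq> vs1.span W"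
    and add: "\<And>x y. x \<in> V \<Longrightarrow> y \<in> V \<Longrightarrow> f (x + y) = f x + f y"
    and sc: "\<And>c x. x \<in> V \<Longrightarrow> f (s1 c x) = s2 c (f x)"
  shows "vs1.dim V = vs1.dim {x\<in>V. f x = 0} + vs2.dim (f ` V)"
proof -
  define K where "K = {x\<in>V. f x = 0}"
  obtain A where A: "A \<subseteq> K" "vs1.independent A" "K \<subseteq> vs1.span A" by (rule vs1.maximal_independent_subset)
  have AV: "A \<subseteq> V" using A by (auto simp: K_def)
  obtain B where B: "A \<subseteq> B" "B \<subseteq> V" "vs1.independent B" "V \<subseteq> vs1.span B"
    using vs1.maximal_independent_subset_extend[OF AV A(2)] by blast
  have fB: "finite B" using vs1.independent_span_bound[OF W(1) B(3)] B(2) W(2) by blast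
  have spB: "vs1.span B = V" using B(2,4) vs1.span_minimal[OF B(2) V] by auto
  define g where "g = construct B f"
  have lg: "Vector_Spaces.linear s1 s2 g" unfolding g_def by (rule linear_construct[OF B(3)])
  interpret g: Vector_Spaces.linear s1 s2 g by (rule lg)
  have f0: "f 0 = 0" using sc[of 0 0] vs1.subspace_0[OF V] by simp
  have gf: "g x = f x" if "x \<in> V" for x
  proof -
    have "x \<in> vs1.span B" using that spB by simp
    hence "x \<in> V \<and> g x = f x"
    proof (induction rule: vs1.span_induct_alt)
      case base thus ?case by (simp add: g.zero f0 vs1.subspace_0[OF V])
    next
      case (step c x y)
      have xy: "x \<in> V" "y \<in> V" "s1 c x \<in> V" using step B(2) vs1.subspace_scale[OF V] by auto
      have "g x = f x" unfolding g_def by (rule construct_basis[OF B(3) step(1)])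
      thus ?case using step xy vs1.subspace_add[OF V xy(3,2)] by (simp add: g.add g.scale add sc)
    qed
    thus ?thesis by simp
  qed
  let ?D = "B - A"
  interpret p: vector_space_pair s1 s1 by unfold_locales
  \<comment> \<open>The projection onto the span of \<open>A\<close> along the rest of the basis; it
    shows that the two spans meet in 0 only.\<close>
  define c where "c = p.construct B (\<lambda>b. if b \<in> A then b else 0)"
  have lincomb: "Vector_Spaces.linear s1 s1 c" unfolding c_def by (rule p.linear_construct[OF B(3)])
  interpret c: Vector_Spaces.linear s1 s1 c by (rule lincomb)
  have li: "Vector_Spaces.linear s1 s1 (\<lambda>x. x)" and lz: "Vector_Spaces.linear s1 s1 (\<lambda>x. 0)"
    unfolding Vector_Spaces.linear_iff using vs1.vector_space_axioms by simp_all
  have cA: "c x = x" if "x \<in> vs1.span A" for x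
    by (rule p.linear_eq_on_span[OF lincomb li _ that]) (use B in \<open>auto simp: c_def p.construct_basis\<close>)
  have cD: "c x = 0" if "x \<in> vs1.span ?D" for x
    by (rule p.linear_eq_on_span[OF lincomb lz _ that]) (use B in \<open>auto simp: c_def p.construct_basis\<close>)
  have inj: "inj_on g (vs1.span ?D)"
    unfolding g.inj_on_iff_eq_0[OF vs1.subspace_span]
  proof safe
    fix x assume x: "x \<in> vs1.span ?D" "g x = 0"
    have "x \<in> V" using x(1) vs1.span_mono[of ?D B] spB by auto
    hence "x \<in> K" using x(2) gf by (simp add: K_def)
    hence "c x = x" using A(3) cA by blast
    thus "x = 0" using cD[OF x(1)] by simp
  qed
  have iD: "vs1.independent ?D" by (rule vs1.independent_mono[OF B(3)]) auto
  have "vs2.dim (f ` V) = card (g ` ?D)"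
  proof (rule vs2.dim_unique)
    show "vs2.independent (g ` ?D)" by (rule linear_independent_injective_image[OF lg iD inj])
    show "g ` ?D \<subseteq> f ` V" using B(2) gf by auto
    show "f ` V \<subseteq> vs2.span (g ` ?D)"
    proof
      fix y assume "y \<in> f ` V"
      then obtain x where x: "x \<in> V" "y = g x" using gf by auto
      have "x \<in> vs1.span (A \<union> ?D)" using x(1) spB B(1) by (simp add: Un_absorb1)
      then obtain a d where ad: "x = a + d" "a \<in> vs1.span A" "d \<in> vs1.span ?D" unfolding vs1.span_Un by blast
      have "g a = 0"
        by (rule linear_eq_0_on_span[OF lg _ ad(2)]) (use A AV gf in \<open>auto simp: K_def\<close>)
      hence "y = g d" using x ad by (simp add: g.add)
      thus "y \<in> vs2.span (g ` ?D)" using ad(3) by (simp add: g.span_image)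
    qed
  qed simp
  also have "\<dots> = card ?D"
    by (rule card_image) (rule inj_on_subset[OF inj vs1.span_superset])
  finally have 1: "vs2.dim (f ` V) = card ?D" .
  have "vs1.dim K = card A" using A by (intro vs1.dim_unique[of A]) auto
  moreover have "vs1.dim V = card B" using B by (intro vs1.dim_unique[of B]) auto
  moreover have "card B = card A + card ?D" using B(1) fB
    by (metis card_Diff_subset card_mono finite_subset le_add_diff_inverse)
  ultimately show ?thesis using 1 by (simp add: K_def)
qed

definition pscale :: "'k::field \<Rightarrow> 'k mpoly \<Rightarrow> 'k mpoly" where "pscale c p = cst c * p"

interpretation mv: vector_space "pscale :: 'k::field \<Rightarrow> _"
  by unfold_locales (simp_all add: pscale_def algebra_simps)

interpretation mm: vector_space_pair "pscale :: 'k::field \<Rightarrow> _" "pscale :: 'k::field \<Rightarrow> _"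
  by unfold_locales

lemma finite_monomials: "finite {m. kys m \<subseteq> {1..n} \<and> int (mon_degree m) = d}"
proof (rule finite_imageD)
  show "inj_on lk {m. kys m \<subseteq> {1..n} \<and> int (mon_degree m) = d}" by (rule inj_onI) (rule poly_mapping_eqI, simp)
  have "lk ` {m. kys m \<subseteq> {1..n} \<and> int (mon_degree m) = d} \<subseteq>
    {f. \<forall>x. (x \<in> {1..n} \<longrightarrow> f x \<in> {0..nat d}) \<and> (x \<notin> {1..n} \<longrightarrow> f x = 0)}"
  proof safe
    fix m :: "nat \<Rightarrow>\<^sub>0 nat" and x assume m: "kys m \<subseteq> {1..n}" and x: "x \<in> {1..n}"
    have "lk m x \<le> (\<Sum>i\<in>{1..n}. lk m i)" using x by (intro member_le_sum) auto
    hence "lk m x \<le> mon_degree m" using mon_degree_superset[OF _ m] by simp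
    thus "lk m x \<in> {0..nat (int (mon_degree m))}" by simp
  next
    fix m :: "nat \<Rightarrow>\<^sub>0 nat" and x assume "kys m \<subseteq> {1..n}" "x \<notin> {1..n}" thus "lk m x = 0" by (auto simp: in_keys_iff)
  qed
  thus "finite (lk ` {m. kys m \<subseteq> {1..n} \<and> int (mon_degree m) = d})"
    by (rule finite_subset) (rule finite_set_of_finite_funs, auto)
qed

lemma S_finite_span: obtains W where "finite W" "S n d \<subseteq> mv.span W"
proof -
  let ?M = "{m. kys m \<subseteq> {1..n} \<and> int (mon_degree m) = d}"
  let ?W = "(\<lambda>m. Poly_Mapping.single m (1::'a)) ` ?M"
  have "S n d \<subseteq> mv.span ?W"
  proof
    fix p :: "'a mpoly" assume p: "p \<in> S n d"
    have "(\<Sum>m\<in>kys p. Poly_Mapping.single m (lk p m)) \<in> mv.span ?W"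
    proof (rule mv.span_sum)
      fix m assume m: "m \<in> kys p"
      hence "m \<in> ?M" using p by (auto simp: homogeneous_part_def polys_def)
      hence "pscale (lk p m) (Poly_Mapping.single m 1) \<in> mv.span ?W" by (intro mv.span_scale mv.span_base) auto
      thus "Poly_Mapping.single m (lk p m) \<in> mv.span ?W" by (simp add: pscale_def cst_def mult_single)
    qed
    thus "p \<in> mv.span ?W" by (simp flip: poly_sum_monomials)
  qed
  thus ?thesis using that finite_monomials by blast
qed

lemma subspace_S: "mv.subspace (S n d)"
  by (auto simp: mv.subspace_def S_add S_cst_mult pscale_def)

lemma subspace_graded_part: "graded_ideal n J \<Longrightarrow> mv.subspace (graded_part n J d)"
  by (auto simp: mv.subspace_def graded_part_def S_add S_cst_mult pscale_def graded_idealD)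

text \<open>The dimension of the quotient in degree \<open>d\<close>, as a difference inside the
  polynomial ring. The values are integers because the series get multiplied by powers of
  \<open>1 - t\<close>.\<close>

definition hilbert_fun :: "nat \<Rightarrow> 'k::field mpoly set \<Rightarrow> int \<Rightarrow> int" where
  "hilbert_fun n J d = int (mv.dim (S n d :: 'k mpoly set)) - int (mv.dim (graded_part n J d))"

lemma hilbert_fun_neg: "d < 0 \<Longrightarrow> hilbert_fun n J d = 0"
proof -
  assume "d < 0"
  hence "graded_part n J d \<subseteq> mv.span {}" "S n d \<subseteq> mv.span ({} :: 'a mpoly set)" using S_neg[of d n]
      by (auto simp: graded_part_def)
  hence "mv.dim (graded_part n J d) \<le> card ({}::'a mpoly set)"
      "mv.dim (S n d :: 'a mpoly set) \<le> card ({}::'a mpoly set)"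
    by (auto intro!: mv.dim_le_card simp del: card.empty)
  thus ?thesis by (simp add: hilbert_fun_def)
qed

text \<open>\<open>g\<close> has kernel \<open>J_d\<close>, and it has the same image on
  \<open>(J+f)_d\<close> as on the multiples of \<open>f\<close>. Rank-nullity reads this image once
  as \<open>(J+f)/J\<close> in degree \<open>d\<close> and once as \<open>S/(J:f)\<close> in degree
  \<open>d - 1\<close>.\<close>

lemma hilbert_fun_exact:
  fixes J :: "'k::field mpoly set"
  assumes J: "graded_ideal n J" and f: "f \<in> S n 1"
  shows "hilbert_fun n J d = hilbert_fun n (adjoin n J f) d + hilbert_fun n (colon n J f) (d - 1)"
proof -
  obtain g where g: "\<And>x y. g (x + y) = g x + g y" "\<And>c x. g (pscale c x) = pscale c (g x)"
     "\<And>x. g x = 0 \<longleftrightarrow> x \<in> graded_part n J d"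
    using mv.exists_projection_kernel[OF subspace_graded_part[OF J, of d]] by blast
  obtain W where W: "finite W" "S n d \<subseteq> mv.span (W :: 'k mpoly set)" by (rule S_finite_span)
  obtain W' where W': "finite W'" "S n (d - 1) \<subseteq> mv.span (W' :: 'k mpoly set)" by (rule S_finite_span)
  note J' = graded_ideal_adjoin[OF J f]
  have "mv.dim (graded_part n (adjoin n J f) d) = mv.dim {x \<in> graded_part n (adjoin n J f) d. g x =
      0} + mv.dim (g ` graded_part n (adjoin n J f) d)"
    by (rule mm.rank_nullity[OF subspace_graded_part[OF J'] W(1) subset_trans[OF graded_part_S W(2)]]) (use g in auto)
  also have "{x \<in> graded_part n (adjoin n J f) d. g x = 0} = graded_part n J d"
      using g(3) graded_part_mono[OF adjoin_sup(1)[of J n f]] by auto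
  also have "g ` graded_part n (adjoin n J f) d = (\<lambda>x. g (x * f)) ` S n (d - 1)"
  proof (intro equalityI subsetI)
    fix y assume "y \<in> g ` graded_part n (adjoin n J f) d"
    then obtain a b where "a \<in> graded_part n J d" "b \<in> S n (d - 1)" "y = g (a + b * f)"
      unfolding graded_part_adjoin_iff[OF J f] image_iff Bex_def by blast
    moreover from this have "g a = 0" using g(3) by blast
    ultimately show "y \<in> (\<lambda>x. g (x * f)) ` S n (d - 1)" by (simp add: g(1))
  next
    fix y assume "y \<in> (\<lambda>x. g (x * f)) ` S n (d - 1)"
    then obtain b where b: "b \<in> S n (d - 1)" "y = g (b * f)" by blast
    have "b * f \<in> graded_part n (adjoin n J f) d" unfolding graded_part_adjoin_iff[OF J f]
      using b graded_idealD(2)[OF J] by (intro exI[of _ 0] exI[of _ b]) (auto simp: graded_part_def)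
    thus "y \<in> g ` graded_part n (adjoin n J f) d" using b by blast
  qed
  finally have 1: "mv.dim (graded_part n (adjoin n J f) d) =
      mv.dim (graded_part n J d) + mv.dim ((\<lambda>x. g (x * f)) ` S n (d - 1))" .
  have "mv.dim (S n (d - 1) :: 'k mpoly set) = mv.dim {x \<in> S n (d - 1). g (x * f) =
      0} + mv.dim ((\<lambda>x. g (x * f)) ` S n (d - 1))"
  proof (rule mm.rank_nullity[OF subspace_S W'])
    fix c x show "g (pscale c x * f) = pscale c (g (x * f))"
      using g(2)[of c "x * f"] by (simp add: pscale_def mult.assoc)
  qed (simp add: distrib_right g(1))
  also have "{x \<in> S n (d - 1). g (x * f) = 0} = graded_part n (colon n J f) (d - 1)"
    using S_mult[OF _ f, of _ "d - 1"] S_polys by (auto simp: g(3) graded_part_def colon_def)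
  finally show ?thesis using 1 by (simp add: hilbert_fun_def)
qed

definition hilbert_series :: "nat \<Rightarrow> 'k::field mpoly set \<Rightarrow> int fps" where
  "hilbert_series n J = Abs_fps (\<lambda>d. hilbert_fun n J (int d))"

lemma hilbert_series_nth: "fps_nth (hilbert_series n J) d = hilbert_fun n J (int d)" by (simp add: hilbert_series_def)

lemma hilbert_series_exact:
  assumes "graded_ideal n J" "f \<in> S n 1"
  shows "hilbert_series n J = hilbert_series n (adjoin n J f) + fps_X * hilbert_series n (colon n J f)"
proof (rule fps_ext)
  fix d show "fps_nth (hilbert_series n J) d =
      fps_nth (hilbert_series n (adjoin n J f) + fps_X * hilbert_series n (colon n J f)) d"
    using hilbert_fun_exact[OF assms, of "int d"] hilbert_fun_neg[of "-1" n "colon n J f"]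
    by (cases d) (simp_all add: hilbert_series_nth)
qed

lemma hilbert_series_irrelevant:
  fixes J :: "'k::field mpoly set"
  assumes J: "graded_ideal n J" "\<forall>k\<in>{1..n}. var k \<in> J" "1 \<notin> J"
  shows "hilbert_series n J = 1"
proof (rule fps_ext)
  fix d :: nat
  show "fps_nth (hilbert_series n J) d = fps_nth 1 d"
  proof (cases "d = 0")
    case True
    have "graded_part n J 0 \<subseteq> {0}"
    proof
      fix p assume p: "p \<in> graded_part n J 0"
      then obtain c where c: "p = cst c" using S_0 by (auto simp: graded_part_def)
      have "c = 0"
      proof (rule ccontr)
        assume "c \<noteq> 0"
        hence "cst (inverse c) * p = 1" using c cst_simps(4)[of "inverse c" c] by simp
        moreover have "cst (inverse c) * p \<in> J" using p
            by (intro graded_idealD(4)[OF J(1)]) (auto simp: graded_part_def)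
        ultimately show False using J(3) by simp
      qed
      thus "p \<in> {0}" using c by simp
    qed
    hence "mv.dim (graded_part n J 0) \<le> card ({}::'k mpoly set)" by (intro mv.dim_le_card) auto
    moreover have "mv.dim (S n 0 :: 'k mpoly set) = 1"
    proof (rule mv.dim_unique[of "{1}"])
      show "S n 0 \<subseteq> mv.span {1 :: 'k mpoly}"
      proof
        fix p :: "'k mpoly" assume "p \<in> S n 0"
        then obtain c where "p = pscale c 1" using S_0 by (auto simp: pscale_def)
        thus "p \<in> mv.span {1}" by (simp add: mv.span_scale mv.span_base)
      qed
    qed (use cst_S[of 1 n] in auto)
    ultimately show ?thesis using True by (simp add: hilbert_series_nth hilbert_fun_def)
  next
    case False
    hence "S n (int d) \<subseteq> J" using S_pos_in_ideal[OF J(1,2)] by simp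
    hence "graded_part n J (int d) = S n (int d)" by (auto simp: graded_part_def)
    thus ?thesis using False by (simp add: hilbert_series_nth hilbert_fun_def)
  qed
qed

lemma hilbert_series_nonzerodivisor:
  assumes "graded_ideal n J" "f \<in> S n 1" "colon n J f = J"
  shows "hilbert_series n (adjoin n J f) = (1 - fps_X) * hilbert_series n J"
  using hilbert_series_exact[OF assms(1,2)] assms(3) by (simp add: algebra_simps)

section \<open>Noetherianity\<close>

lemma nat_incseq_subseq:
  fixes s :: "nat \<Rightarrow> nat"
  shows "\<exists>t::nat \<Rightarrow> nat. strict_mono t \<and> (\<forall>i j. i \<le> j \<longrightarrow> s (t i) \<le> s (t j))"
proof -
  from seq_monosub[of s] obtain t :: "nat \<Rightarrow> nat" where t: "strict_mono t \<and> monoseq (\<lambda>i. s (t i))" by (rule exE)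
  from t have "(\<forall>i j. i \<le> j \<longrightarrow> s (t i) \<le> s (t j)) \<or> (\<forall>i j. i \<le> j \<longrightarrow> s (t j) \<le> s (t i))"
    by (simp add: monoseq_def)
  thus ?thesis
  proof
    assume "\<forall>i j. i \<le> j \<longrightarrow> s (t i) \<le> s (t j)"
    thus ?thesis using t by (intro exI[of _ t] conjI) simp_all
  next
    \<comment> \<open>A decreasing sequence of natural numbers is constant from its minimum on, and
      so also increasing there.\<close>
    assume dec: "\<forall>i j. i \<le> j \<longrightarrow> s (t j) \<le> s (t i)"
    define N where "N = arg_min (\<lambda>i. s (t i)) (\<lambda>_. True)"
    have N: "s (t N) \<le> s (t i)" for i unfolding N_def by (rule arg_min_nat_le) simp
    have "s (t (i + N)) = s (t N)" for i
    proof (rule antisym)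
      show "s (t (i + N)) \<le> s (t N)" using dec by simp
    qed (rule N)
    moreover have "strict_mono (\<lambda>i. t (i + N))" using t by (simp add: strict_mono_def)
    ultimately show ?thesis by (intro exI[of _ "\<lambda>i. t (i + N)"] conjI) simp_all
  qed
qed

lemma dickson_subseq:
  fixes f :: "nat \<Rightarrow> nat \<Rightarrow>\<^sub>0 nat"
  assumes "finite A"
  shows "\<exists>t::nat \<Rightarrow> nat. strict_mono t \<and> (\<forall>k\<in>A. \<forall>i j. i \<le> j \<longrightarrow> lk (f (t i)) k \<le> lk (f (t j)) k)"
  using assms
proof induction
  case empty
  show ?case by (intro exI[of _ "\<lambda>i. i"]) (simp add: strict_mono_def)
next
  case (insert a A)
  from insert.IH obtain t :: "nat \<Rightarrow> nat" where
    t: "strict_mono t \<and> (\<forall>k\<in>A. \<forall>i j. i \<le> j \<longrightarrow> lk (f (t i)) k \<le> lk (f (t j)) k)" by (rule exE)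
  from nat_incseq_subseq[of "\<lambda>i. lk (f (t i)) a"] obtain r :: "nat \<Rightarrow> nat" where
    r: "strict_mono r \<and> (\<forall>i j. i \<le> j \<longrightarrow> lk (f (t (r i))) a \<le> lk (f (t (r j))) a)" by (rule exE)
  have "r i \<le> r j" if "i \<le> j" for i j using r that by (simp add: strict_mono_less_eq)
  hence "\<forall>k\<in>insert a A. \<forall>i j. i \<le> j \<longrightarrow> lk (f (t (r i))) k \<le> lk (f (t (r j))) k" using t r by simp
  moreover have "strict_mono (\<lambda>i. t (r i))" using t r by (simp add: strict_mono_def)
  ultimately show ?case by (intro exI[of _ "\<lambda>i. t (r i)"] conjI)
qed

lemma dickson:
  fixes f :: "nat \<Rightarrow> nat \<Rightarrow>\<^sub>0 nat"
  assumes "\<And>i. kys (f i) \<subseteq> {1..n}"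
  shows "\<exists>i j a. i < j \<and> kys a \<subseteq> {1..n} \<and> f j = a + f i"
proof -
  from dickson_subseq[of "{1..n}" f] obtain t :: "nat \<Rightarrow> nat" where
    t: "strict_mono t \<and> (\<forall>k\<in>{1..n}. \<forall>i j. i \<le> j \<longrightarrow> lk (f (t i)) k \<le> lk (f (t j)) k)"
    by (auto simp del: atLeastAtMost_iff)
  have le: "lk (f (t 0)) k \<le> lk (f (t 1)) k" for k
  proof (cases "k \<in> {1..n}")
    case True
    thus ?thesis using t by simp
  next
    case False
    hence "lk (f (t 0)) k = 0" using assms[of "t 0"] by (auto simp: in_keys_iff)
    thus ?thesis by simp
  qed
  have "f (t 1) = (f (t 1) - f (t 0)) + f (t 0)"
    by (rule poly_mapping_eqI) (use le in \<open>simp add: lookup_add lookup_minus\<close>)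
  moreover have "kys (f (t 1) - f (t 0)) \<subseteq> {1..n}"
    using assms[of "t 1"] by (auto simp: in_keys_iff lookup_minus)
  moreover have "t 0 < t 1" using t by (simp add: strict_mono_def)
  ultimately show ?thesis by blast
qed

text \<open>Leading monomials with respect to the linear order on exponent functions, which is
  compatible with addition. Only homogeneous elements count: each degree has finitely many
  monomials, and this replaces well-foundedness of the order.\<close>

definition LM :: "nat \<Rightarrow> 'k::field mpoly set \<Rightarrow> (nat \<Rightarrow>\<^sub>0 nat) set" where
  "LM n J = {Max (kys p) | p. p \<in> J \<and> p \<noteq> 0 \<and> (\<exists>d. p \<in> S n d)}"

lemma LM_mult:
  assumes J: "graded_ideal n J" and m: "m \<in> LM n J" and a: "kys a \<subseteq> {1..n}"
  shows "a + m \<in> LM n J"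
proof -
  obtain p d where p: "p \<in> J" "p \<noteq> 0" "p \<in> S n d" "m = Max (kys p)" using m by (auto simp: LM_def)
  let ?x = "Poly_Mapping.single a (1::'a)"
  have k: "kys (?x * p) = (+) a ` kys p"
  proof (intro equalityI subsetI)
    fix k assume k: "k \<in> kys (?x * p)"
    hence "\<exists>b. k = a + b" using lookup_single_mult_0[of k a 1 p] by (auto simp: in_keys_iff)
    thus "k \<in> (+) a ` kys p" using k by (auto simp: in_keys_iff)
  qed (auto simp: in_keys_iff)
  have xS: "?x \<in> S n (int (mon_degree a))" using a by (auto simp: S_iff polys_iff lookup_single when_def)
  have "a + m = Max (kys (?x * p))"
  proof (rule Max_eqI[symmetric])
    have "m \<in> kys p" using p by (simp add: Max_in)
    thus "a + m \<in> kys (?x * p)" by (simp add: k)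
    fix y assume "y \<in> kys (?x * p)"
    then obtain b where "y = a + b" "b \<in> kys p" by (auto simp: k)
    thus "y \<le> a + m" using p by (simp add: add_left_mono)
  qed simp
  moreover have "?x * p \<in> J" using p xS by (intro graded_idealD(4)[OF J]) (auto intro: S_polys)
  moreover have "?x * p \<noteq> 0" using k p(2) by (metis image_is_empty keys_eq_empty)
  moreover have "?x * p \<in> S n (int (mon_degree a) + d)" using xS p(3) by (rule S_mult)
  ultimately show ?thesis unfolding LM_def by blast
qed

text \<open>Among the homogeneous elements of \<open>J'\<close> outside \<open>J\<close> in a
  suitable degree, take one with least leading monomial. Were this the leading monomial of an
  element of \<open>J\<close>, subtracting a multiple of that element would produce a smaller
  one.\<close>

lemma LM_strict:
  assumes J: "graded_ideal n J" "graded_ideal n J'" and sub: "J \<subset> J'"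
  shows "\<exists>m. m \<in> LM n J' \<and> m \<notin> LM n J \<and> kys m \<subseteq> {1..n}"
proof -
  obtain p0 where p0: "p0 \<in> J'" "p0 \<notin> J" using sub by blast
  then obtain d where d: "hc d p0 \<notin> J" using graded_ideal_hc_iff[OF J(1)] by blast
  define E where "E = {Max (kys p) | p. p \<in> J' \<and> p \<in> S n d \<and> p \<notin> J}"
  have nz: "p \<noteq> 0" if "p \<notin> J" for p using that graded_idealD(2)[OF J(1)] by auto
  have "E \<subseteq> {m. kys m \<subseteq> {1..n} \<and> int (mon_degree m) = d}"
  proof
    fix m assume "m \<in> E"
    then obtain p where p: "m = Max (kys p)" "p \<in> S n d" "p \<notin> J" by (auto simp: E_def)
    hence "m \<in> kys p" using nz by (simp add: Max_in)
    thus "m \<in> {m. kys m \<subseteq> {1..n} \<and> int (mon_degree m) = d}" using p(2) by (auto simp: homogeneous_part_def polys_def)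
  qed
  hence finE: "finite E" and Ed: "\<And>m. m \<in> E \<Longrightarrow> kys m \<subseteq> {1..n} \<and> int (mon_degree m) = d"
    using finite_monomials finite_subset by (blast, blast)
  have "hc d p0 \<in> J'" "hc d p0 \<in> S n d" using graded_idealD(1,6)[OF J(2) p0(1)] by auto
  hence "E \<noteq> {}" using d by (auto simp: E_def)
  define m where "m = Min E"
  have mE: "m \<in> E" using finE \<open>E \<noteq> {}\<close> by (simp add: m_def)
  then obtain p where p: "m = Max (kys p)" "p \<in> J'" "p \<in> S n d" "p \<notin> J" by (auto simp: E_def)
  have "m \<notin> LM n J"
  proof
    assume "m \<in> LM n J"
    then obtain q d' where q: "m = Max (kys q)" "q \<in> J" "q \<noteq> 0" "q \<in> S n d'" by (auto simp: LM_def)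
    have mq: "m \<in> kys q" using q by (simp add: Max_in)
    hence "d' = d" using q(4) Ed[OF mE] by (auto simp: homogeneous_part_def)
    define r where "r = p - cst (lk p m / lk q m) * q"
    have rJ: "r \<in> J'" unfolding r_def using p(2) q(2) sub
      by (intro graded_ideal_diff[OF J(2)] graded_idealD(4)[OF J(2)]) auto
    have rS: "r \<in> S n d" unfolding r_def using p(3) q(4) \<open>d' = d\<close> by (intro S_diff S_cst_mult) auto
    have rn: "r \<notin> J"
    proof
      assume "r \<in> J"
      hence "r + cst (lk p m / lk q m) * q \<in> J" using q(2) by (intro graded_idealD(3,4)[OF J(1)]) auto
      thus False using p(4) by (simp add: r_def)
    qed
    have kr: "k < m" if "k \<in> kys r" for k
    proof -
      have "k \<in> kys p \<or> k \<in> kys q" using that by (auto simp: r_def in_keys_iff lookup_minus)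
      hence "k \<le> m" using p(1) q(1) by (metis Max_ge finite_keys)
      moreover have "k \<noteq> m" using that mq by (auto simp: r_def in_keys_iff lookup_minus)
      ultimately show ?thesis by simp
    qed
    have "Max (kys r) < m" using kr nz[OF rn] by simp
    moreover have "Max (kys r) \<in> E" unfolding E_def using rJ rS rn by blast
    hence "m \<le> Max (kys r)" using finE by (simp add: m_def)
    ultimately show False by simp
  qed
  moreover have "m \<in> LM n J'" unfolding LM_def using p nz by blast
  ultimately show ?thesis using Ed[OF mE] by blast
qed

lemma LM_mono: "J \<subseteq> J' \<Longrightarrow> LM n J \<subseteq> LM n J'" by (auto simp: LM_def)

text \<open>Every step contributes a new leading monomial, but by Dickson's lemma some later one is
  a multiple of an earlier one and so was not new.\<close>

theorem graded_ideal_acc_strict: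
  assumes J: "\<And>i. graded_ideal n (J i)" and sub: "\<And>i::nat. J i \<subset> J (Suc i)"
  shows False
proof -
  have mon: "J i \<subseteq> J j" if "i \<le> j" for i j using lift_Suc_mono_le[of J i j] sub that by blast
  obtain m where m: "\<And>i. m i \<in> LM n (J (Suc i))" "\<And>i. m i \<notin> LM n (J i)" "\<And>i. kys (m i) \<subseteq> {1..n}"
    using LM_strict[OF J J sub] by metis
  obtain i j a where *: "i < j" "kys a \<subseteq> {1..n}" "m j = a + m i" using dickson[of m n] m(3) by blast
  have "m j \<in> LM n (J (Suc i))" unfolding *(3) by (rule LM_mult[OF J m(1) *(2)])
  moreover have "LM n (J (Suc i)) \<subseteq> LM n (J j)" using *(1) by (intro LM_mono mon) simp
  ultimately show False using m(2) by blast
qed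

lemma wf_graded_ideal: "wf {(J' :: 'k::field mpoly set, J). graded_ideal n J \<and> graded_ideal n J' \<and> J \<subset> J'}"
  unfolding wf_iff_no_infinite_down_chain
proof
  assume "\<exists>f. \<forall>i. (f (Suc i), f i) \<in> {(J' :: 'k mpoly set, J). graded_ideal n J \<and> graded_ideal n J' \<and> J \<subset> J'}"
  then obtain f :: "nat \<Rightarrow> 'k mpoly set"
      where "\<forall>i. (f (Suc i), f i) \<in> {(J' :: 'k mpoly set, J). graded_ideal n J \<and> graded_ideal n J' \<and> J \<subset> J'}"
          by (rule exE)
  thus False by (intro graded_ideal_acc_strict[of n f]) auto
qed

lemma graded_ideal_stabilizes:
  assumes J: "\<And>i. graded_ideal n (J i)" and sub: "\<And>i::nat. J i \<subseteq> J (Suc i)"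
  shows "\<exists>N. \<forall>i\<ge>N. J i = J N"
proof (rule ccontr)
  assume "\<not> ?thesis"
  hence "\<exists>i\<ge>N. J i \<noteq> J N" for N by blast
  then obtain g where g: "\<And>N. g N \<ge> N" "\<And>N. J (g N) \<noteq> J N" by metis
  have mon: "J i \<subseteq> J j" if "i \<le> j" for i j using lift_Suc_mono_le[of J i j] sub that by blast
  show False
  proof (rule graded_ideal_acc_strict[of n "\<lambda>k. J ((g ^^ k) 0)"])
    fix k show "J ((g ^^ k) 0) \<subset> J ((g ^^ Suc k) 0)"
      using mon[OF g(1)[of "(g ^^ k) 0"]] g(2)[of "(g ^^ k) 0"] by auto
  qed (rule J)
qed

section \<open>Graded submodules of free modules\<close>

definition free_carrier :: "nat \<Rightarrow> int list \<Rightarrow> (nat \<Rightarrow> 'k::field mpoly) set" where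
  "free_carrier n ds = {v. (\<forall>e < length ds. v e \<in> polys n) \<and> (\<forall>e \<ge> length ds. v e = 0)}"

definition free_part :: "nat \<Rightarrow> int list \<Rightarrow> int \<Rightarrow> (nat \<Rightarrow> 'k::field mpoly) set" where
  "free_part n ds d = {v \<in> free_carrier n ds. \<forall>e < length ds. v e \<in> S n (d - ds ! e)}"

definition hcv :: "int list \<Rightarrow> int \<Rightarrow> (nat \<Rightarrow> 'k::field mpoly) \<Rightarrow> nat \<Rightarrow> 'k mpoly" where
  "hcv ds d v = (\<lambda>e. hc (d - ds ! e) (v e))"

definition pv :: "'k::field mpoly \<Rightarrow> (nat \<Rightarrow> 'k mpoly) \<Rightarrow> nat \<Rightarrow> 'k mpoly" where
  "pv p v = (\<lambda>e. p * v e)"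

definition graded_submodule :: "nat \<Rightarrow> int list \<Rightarrow> (nat \<Rightarrow> 'k::field mpoly) set \<Rightarrow> bool" where
  "graded_submodule n ds K \<longleftrightarrow> K \<subseteq> free_carrier n ds \<and> 0 \<in> K \<and> (\<forall>v\<in>K. \<forall>w\<in>K. v + w \<in> K) \<and>
     (\<forall>p\<in>polys n. \<forall>v\<in>K. pv p v \<in> K) \<and> (\<forall>v\<in>K. \<forall>d. hcv ds d v \<in> K)"

lemma pv_apply [simp]: "pv p v e = p * v e" by (simp add: pv_def)
lemma hcv_apply: "hcv ds d v e = hc (d - ds ! e) (v e)" by (simp add: hcv_def)

lemma graded_submoduleD:
  assumes "graded_submodule n ds K"
  shows "v \<in> K \<Longrightarrow> v \<in> free_carrier n ds" "0 \<in> K" "v \<in> K \<Longrightarrow> w \<in> K \<Longrightarrow> v + w \<in> K"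
    "p \<in> polys n \<Longrightarrow> v \<in> K \<Longrightarrow> pv p v \<in> K" "v \<in> K \<Longrightarrow> hcv ds d v \<in> K"
  using assms by (auto simp: graded_submodule_def)

lemma graded_submodule_uminus: assumes "graded_submodule n ds K" "v \<in> K" shows "- v \<in> K"
proof -
  have "pv (- 1) v = - v" by (rule ext) simp
  thus ?thesis using graded_submoduleD(4)[OF assms(1), of "- 1" v] assms(2) polys_closed(2,4) by metis
qed

lemma graded_submodule_diff: "graded_submodule n ds K \<Longrightarrow> v \<in> K \<Longrightarrow> w \<in> K \<Longrightarrow> v - w \<in> K"
  using graded_submoduleD(3)[of n ds K v "- w"] graded_submodule_uminus[of n ds K w] by simp

lemma graded_submodule_sum: "graded_submodule n ds K \<Longrightarrow> (\<And>a. a \<in> A \<Longrightarrow> f a \<in> K) \<Longrightarrow> sum f A \<in> K"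
  by (induction A rule: infinite_finite_induct) (auto simp: graded_submoduleD(2,3))

lemma sum_apply: "(sum f A) x = (\<Sum>a\<in>A. f a x)" for f :: "'a \<Rightarrow> 'b \<Rightarrow> 'c::comm_monoid_add"
  by (induction A rule: infinite_finite_induct) auto

lemma free_carrier_iff: "v \<in> free_carrier n ds \<longleftrightarrow> (\<forall>e < length ds. v e \<in> polys n) \<and> (\<forall>e \<ge> length ds. v e = 0)"
  by (simp add: free_carrier_def)

lemma free_carrier_polys: "v \<in> free_carrier n ds \<Longrightarrow> v e \<in> polys n"
  by (cases "e < length ds") (auto simp: free_carrier_def polys_closed)

lemma hc_polys: "p \<in> polys n \<Longrightarrow> hc d p \<in> polys n"
  by (simp add: hc_def keep_polys)

lemma graded_submodule_free_carrier: "graded_submodule n ds (free_carrier n ds)"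
  unfolding graded_submodule_def by (auto simp: free_carrier_def polys_closed hcv_def hc_polys)

lemma free_part_free_carrier: "v \<in> free_part n ds d \<Longrightarrow> v \<in> free_carrier n ds" by (simp add: free_part_def)

lemma free_part_S: "v \<in> free_part n ds d \<Longrightarrow> v e \<in> S n (d - ds ! e)"
  by (cases "e < length ds") (auto simp: free_part_def free_carrier_def)

lemma hcv_free_part: "v \<in> free_carrier n ds \<Longrightarrow> hcv ds d v \<in> free_part n ds d"
  by (auto simp: free_part_def free_carrier_def hcv_def hc_polys)

lemma hcv_id: "v \<in> free_part n ds d \<Longrightarrow> hcv ds d v = v"
  by (rule ext) (simp add: hcv_def hc_id[OF free_part_S])

lemma hcv_other: "v \<in> free_part n ds d \<Longrightarrow> e \<noteq> d \<Longrightarrow> hcv ds e v = 0"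
  by (rule ext) (simp add: hcv_def hc_other[OF free_part_S])

lemma hcv_sum: "hcv ds d (sum f A) = (\<Sum>a\<in>A. hcv ds d (f a))"
  by (rule ext) (simp add: hcv_def sum_apply)

lemma hcv_decomp:
  assumes "v \<in> free_carrier n ds"
  obtains A where "finite A" "v = (\<Sum>d\<in>A. hcv ds d v)"
proof
  let ?A = "\<Union>e<length ds. (\<lambda>c. c + ds ! e) ` degs (v e)"
  show "finite ?A" by simp
  show "v = (\<Sum>d\<in>?A. hcv ds d v)"
  proof
    fix e show "v e = (\<Sum>d\<in>?A. hcv ds d v) e"
    proof (cases "e < length ds")
      case True
      have inj: "inj_on (\<lambda>d. d - ds ! e) ?A" by (auto simp: inj_on_def)
      have "(\<Sum>d\<in>?A. hcv ds d v) e = (\<Sum>c\<in>(\<lambda>d. d - ds ! e) ` ?A. hc c (v e))"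
        unfolding sum_apply hcv_apply sum.reindex[OF inj] by simp
      also have "\<dots> = v e"
      proof (rule hc_decomp_superset[symmetric])
        show "degs (v e) \<subseteq> (\<lambda>d. d - ds ! e) ` ?A"
        proof
          fix c assume "c \<in> degs (v e)"
          hence "c + ds ! e \<in> ?A" using True by blast
          thus "c \<in> (\<lambda>d. d - ds ! e) ` ?A" by (rule rev_image_eqI) simp
        qed
      qed simp
      finally show ?thesis by simp
    next
      case False
      hence "v e = 0" using assms by (simp add: free_carrier_def)
      thus ?thesis by (simp add: sum_apply hcv_apply)
    qed
  qed
qed

lemma graded_submodule_hcv_iff: "graded_submodule n ds K \<Longrightarrow> v \<in> free_carrier n ds \<Longrightarrow> v \<in> K \<longleftrightarrow> (\<forall>d. hcv ds d v \<in> K)"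
  by (metis graded_submoduleD(5) graded_submodule_sum hcv_decomp)

text \<open>Finite generation is lifted from ideals to submodules by means of the ideals of leading coordinates.\<close>

definition coord_ideal :: "(nat \<Rightarrow> 'k::field mpoly) set \<Rightarrow> nat \<Rightarrow> 'k mpoly set" where
  "coord_ideal K e = {v e | v. v \<in> K \<and> (\<forall>e'>e. v e' = 0)}"

lemma graded_ideal_coord:
  fixes K :: "(nat \<Rightarrow> 'k::field mpoly) set"
  assumes K: "graded_submodule n ds K" shows "graded_ideal n (coord_ideal K e)"
  unfolding graded_ideal_def
proof (intro conjI ballI allI)
  show "coord_ideal K e \<subseteq> polys n" unfolding coord_ideal_def using free_carrier_polys[OF graded_submoduleD(1)[OF K]]
      by blast
  show "0 \<in> coord_ideal K e" unfolding coord_ideal_def using graded_submoduleD(2)[OF K] by (auto intro!: exI[of _ 0])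
next
  fix p q assume "p \<in> coord_ideal K e" "q \<in> coord_ideal K e"
  then obtain v w where "v \<in> K" "w \<in> K" "p = v e" "q = w e" "\<forall>e'>e. v e' = 0" "\<forall>e'>e. w e' = 0"
    unfolding coord_ideal_def by blast
  thus "p + q \<in> coord_ideal K e" unfolding coord_ideal_def using graded_submoduleD(3)[OF K]
    by (auto intro!: exI[of _ "v + w"])
next
  fix p q :: "'k mpoly" assume p: "p \<in> polys n" and "q \<in> coord_ideal K e"
  then obtain w where "w \<in> K" "q = w e" "\<forall>e'>e. w e' = 0"
    unfolding coord_ideal_def by blast
  thus "p * q \<in> coord_ideal K e" unfolding coord_ideal_def using graded_submoduleD(4)[OF K p]
    by (auto intro!: exI[of _ "pv p w"])
next
  fix p and d :: int assume "p \<in> coord_ideal K e"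
  then obtain w where w: "w \<in> K" "p = w e" "\<forall>e'>e. w e' = 0"
    unfolding coord_ideal_def by blast
  have "hc d p = hcv ds (d + ds ! e) w e" by (simp add: w hcv_apply)
  moreover have "\<forall>e'>e. hcv ds (d + ds ! e) w e' = 0" using w(3) by (simp add: hcv_apply)
  ultimately show "hc d p \<in> coord_ideal K e" unfolding coord_ideal_def using graded_submoduleD(5)[OF K w(1)] by blast
qed

text \<open>Subtracting an element of \<open>K\<close> with the same leading coordinate shortens the
  vector; \<open>r\<close> bounds the number of coordinates that may still be nonzero.\<close>

lemma graded_submodule_eq_coord:
  assumes K: "graded_submodule n ds K" "graded_submodule n ds K'" and sub: "K \<subseteq> K'"
      and eq: "\<And>e. e < length ds \<Longrightarrow> coord_ideal K e = coord_ideal K' e"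
  shows "K = K'"
proof -
  have "v \<in> K" if "v \<in> K'" "\<forall>e\<ge>r. v e = 0" "r \<le> length ds" for v r
    using that
  proof (induction r arbitrary: v)
    case 0
    hence "v = 0" by auto
    show ?case unfolding \<open>v = 0\<close> by (rule graded_submoduleD(2)[OF K(1)])
  next
    case (Suc r)
    have "v r \<in> coord_ideal K' r" using Suc.prems unfolding coord_ideal_def by (auto simp: Suc_le_eq)
    hence "v r \<in> coord_ideal K r" using eq Suc.prems(3) by simp
    then obtain u where u: "u \<in> K" "v r = u r" "\<forall>e>r. u e = 0" unfolding coord_ideal_def by blast
    have "v - u \<in> K"
    proof (rule Suc.IH)
      show "v - u \<in> K'" using Suc.prems(1) u(1) sub by (intro graded_submodule_diff[OF K(2)]) auto
      show "\<forall>e\<ge>r. (v - u) e = 0"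
      proof safe
        fix e assume "r \<le> e" thus "(v - u) e = 0" using u Suc.prems(2) by (cases "e = r") auto
      qed
    qed (use Suc.prems(3) in simp)
    hence "v - u + u \<in> K" using u(1) by (rule graded_submoduleD(3)[OF K(1)])
    thus ?case by simp
  qed
  moreover have "\<forall>e\<ge>length ds. v e = 0" if "v \<in> K'" for v using graded_submoduleD(1)[OF K(2) that]
      by (simp add: free_carrier_def)
  ultimately show ?thesis using sub by blast
qed

text \<open>There are finitely many coordinates, so from some \<open>M\<close> on all their ideals
  are constant, and with them the submodules.\<close>

theorem graded_submodule_acc_strict:
  assumes K: "\<And>i. graded_submodule n ds (K i)" and sub: "\<And>i::nat. K i \<subset> K (Suc i)"
  shows False
proof -
  have mono: "coord_ideal (K i) e \<subseteq> coord_ideal (K (Suc i)) e" for i e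
    using sub[of i] by (auto simp: coord_ideal_def)
  obtain N where N: "\<And>e i. i \<ge> N e \<Longrightarrow> coord_ideal (K i) e = coord_ideal (K (N e)) e"
    using graded_ideal_stabilizes[of n "\<lambda>i. coord_ideal (K i) e" for e] graded_ideal_coord[OF K] mono by metis
  define M where "M = Max (insert 0 (N ` {..<length ds}))"
  have M: "N e \<le> M" if "e < length ds" for e using that by (simp add: M_def)
  have "K M = K (Suc M)"
  proof (rule graded_submodule_eq_coord[OF K K])
    fix e assume "e < length ds"
    hence "N e \<le> M" by (rule M)
    thus "coord_ideal (K M) e = coord_ideal (K (Suc M)) e" using N[of e M] N[of e "Suc M"] by simp
  qed (use sub in blast)
  thus False using sub[of M] by simp
qed

section \<open>Existence of minimal resolutions\<close>

text \<open>The map of free modules that sends the \<open>e\<close>-th basis vector to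
  \<open>Y e\<close>. All differentials of the constructed resolutions have this form.\<close>

definition lincomb :: "nat \<Rightarrow> (nat \<Rightarrow> 'k::field mpoly) \<Rightarrow> (nat \<Rightarrow> nat \<Rightarrow> 'k mpoly) \<Rightarrow> nat \<Rightarrow> 'k mpoly" where
  "lincomb r v Y = (\<lambda>c. \<Sum>e<r. v e * Y e c)"

definition gens :: "nat \<Rightarrow> int list \<Rightarrow> int list \<Rightarrow> (nat \<Rightarrow> nat \<Rightarrow> 'k::field mpoly) \<Rightarrow> bool" where
  "gens n ds ds' Y \<longleftrightarrow> (\<forall>e < length ds'. Y e \<in> free_part n ds (ds' ! e))"

lemma lincomb_add: "lincomb r (v + w) Y = lincomb r v Y + lincomb r w Y"
  by (simp add: lincomb_def fun_eq_iff distrib_right sum.distrib)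

lemma lincomb_pv: "lincomb r (pv p v) Y = pv p (lincomb r v Y)"
  by (simp add: lincomb_def fun_eq_iff sum_distrib_left mult.assoc)

lemma lincomb_0 [simp]: "lincomb r 0 Y = 0"
  by (simp add: lincomb_def fun_eq_iff)

lemma lincomb_free_carrier:
  assumes "gens n ds ds' Y" "v \<in> free_carrier n ds'" shows "lincomb (length ds') v Y \<in> free_carrier n ds"
proof -
  have Y: "Y e \<in> free_carrier n ds" if "e < length ds'" for e using assms(1) that by (auto simp: gens_def free_part_def)
  have "(\<Sum>e<length ds'. v e * Y e c) \<in> polys n" for c
    by (rule polys_sum) (use Y free_carrier_polys[OF assms(2)] in \<open>auto intro!: polys_closed(5) intro:
      free_carrier_polys\<close>)
  moreover have "(\<Sum>e<length ds'. v e * Y e c) = 0" if "c \<ge> length ds" for c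
    by (rule sum.neutral) (use Y that in \<open>auto simp: free_carrier_def\<close>)
  ultimately show ?thesis by (simp add: free_carrier_iff lincomb_def)
qed

lemma lincomb_free_part:
  assumes "gens n ds ds' Y" "v \<in> free_part n ds' d" shows "lincomb (length ds') v Y \<in> free_part n ds d"
proof -
  have "(\<Sum>e<length ds'. v e * Y e c) \<in> S n (d - ds ! c)" for c
  proof (rule S_sum)
    fix e assume "e \<in> {..<length ds'}"
    hence "Y e c \<in> S n (ds' ! e - ds ! c)" using assms(1) free_part_S[of "Y e" n ds "ds' ! e" c] by (simp add: gens_def)
    hence "v e * Y e c \<in> S n ((d - ds' ! e) + (ds' ! e - ds ! c))" by (intro S_mult free_part_S[OF assms(2)])
    thus "v e * Y e c \<in> S n (d - ds ! c)" by simp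
  qed
  thus ?thesis using lincomb_free_carrier[OF assms(1) free_part_free_carrier[OF assms(2)]]
      by (simp add: free_part_def lincomb_def)
qed

lemma hcv_lincomb:
  assumes "gens n ds ds' Y" "v \<in> free_carrier n ds'"
  shows "hcv ds d (lincomb (length ds') v Y) = lincomb (length ds') (hcv ds' d v) Y"
proof
  fix c
  have "hc (d - ds ! c) (v e * Y e c) = hc (d - ds' ! e) (v e) * Y e c" if "e < length ds'" for e
  proof -
    have "Y e c \<in> S n (ds' ! e - ds ! c)" using assms(1) free_part_S[of "Y e" n ds "ds' ! e" c] that
        by (simp add: gens_def)
    from hc_mult[OF this free_carrier_polys[OF assms(2)], of "d - ds ! c" e] show ?thesis by (simp add: mult.commute)
  qed
  thus "hcv ds d (lincomb (length ds') v Y) c = lincomb (length ds') (hcv ds' d v) Y c"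
    by (simp add: lincomb_def hcv_def)
qed

lemma graded_submodule_lincomb_image:
  fixes Y :: "nat \<Rightarrow> nat \<Rightarrow> 'k::field mpoly"
  assumes Y: "gens n ds ds' Y" shows "graded_submodule n ds ((\<lambda>v. lincomb (length ds') v Y) ` free_carrier n ds')"
  unfolding graded_submodule_def
proof (intro conjI ballI allI)
  note F = graded_submodule_free_carrier[of n ds']
  show "(\<lambda>v. lincomb (length ds') v Y) ` free_carrier n ds' \<subseteq> free_carrier n ds" using lincomb_free_carrier[OF Y]
      by blast
  show "0 \<in> (\<lambda>v. lincomb (length ds') v Y) ` free_carrier n ds'"
      by (rule image_eqI[of _ _ 0]) (simp_all add: graded_submoduleD(2)[OF F])
next
  fix v w assume "v \<in> (\<lambda>v. lincomb (length ds') v Y) ` free_carrier n ds'"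
      "w \<in> (\<lambda>v. lincomb (length ds') v Y) ` free_carrier n ds'"
  then obtain a b where "a \<in> free_carrier n ds'" "b \<in> free_carrier n ds'" "v = lincomb (length ds') a Y" "w =
      lincomb (length ds') b Y" by blast
  thus "v + w \<in> (\<lambda>v. lincomb (length ds') v Y) ` free_carrier n ds'"
    by (intro image_eqI[of _ _ "a + b"]) (simp_all add: lincomb_add graded_submoduleD(3)[OF
      graded_submodule_free_carrier])
next
  fix p :: "'k mpoly" and v assume "p \<in> polys n" "v \<in> (\<lambda>v. lincomb (length ds') v Y) ` free_carrier n ds'"
  then obtain a where "a \<in> free_carrier n ds'" "v = lincomb (length ds') a Y" by blast
  thus "pv p v \<in> (\<lambda>v. lincomb (length ds') v Y) ` free_carrier n ds'" using \<open>p \<in> polys n\<close>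
    by (intro image_eqI[of _ _ "pv p a"]) (simp_all add: lincomb_pv graded_submoduleD(4)[OF
      graded_submodule_free_carrier])
next
  fix v d assume "v \<in> (\<lambda>v. lincomb (length ds') v Y) ` free_carrier n ds'"
  then obtain a where a: "a \<in> free_carrier n ds'" "v = lincomb (length ds') a Y" by blast
  show "hcv ds d v \<in> (\<lambda>v. lincomb (length ds') v Y) ` free_carrier n ds'"
    unfolding a(2) hcv_lincomb[OF Y a(1)] using graded_submoduleD(5)[OF graded_submodule_free_carrier a(1)] by blast
qed

lemma graded_submodule_lincomb_kernel:
  fixes Y :: "nat \<Rightarrow> nat \<Rightarrow> 'k::field mpoly"
  assumes Y: "gens n ds ds' Y" shows "graded_submodule n ds' {v \<in> free_carrier n ds'. lincomb (length ds') v Y = 0}"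
  unfolding graded_submodule_def
proof (intro conjI ballI allI)
  note F = graded_submodule_free_carrier[of n ds']
  show "0 \<in> {v \<in> free_carrier n ds'. lincomb (length ds') v Y = 0}" by (simp add: graded_submoduleD(2)[OF F])
next
  fix v w assume "v \<in> {v \<in> free_carrier n ds'. lincomb (length ds') v Y =
      0}" "w \<in> {v \<in> free_carrier n ds'. lincomb (length ds') v Y = 0}"
  thus "v + w \<in> {v \<in> free_carrier n ds'. lincomb (length ds') v Y = 0}"
    by (simp add: lincomb_add graded_submoduleD(3)[OF graded_submodule_free_carrier])
next
  fix p :: "'k mpoly" and v assume "p \<in> polys n" "v \<in> {v \<in> free_carrier n ds'. lincomb (length ds') v Y = 0}"
  thus "pv p v \<in> {v \<in> free_carrier n ds'. lincomb (length ds') v Y = 0}"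
    by (auto simp: lincomb_pv graded_submoduleD(4)[OF graded_submodule_free_carrier] fun_eq_iff)
next
  fix v d assume v: "v \<in> {v \<in> free_carrier n ds'. lincomb (length ds') v Y = 0}"
  hence "lincomb (length ds') (hcv ds' d v) Y = hcv ds d 0" using hcv_lincomb[OF Y, of v d] by simp
  also have "\<dots> = 0" by (simp add: hcv_def fun_eq_iff)
  finally show "hcv ds' d v \<in> {v \<in> free_carrier n ds'. lincomb (length ds') v Y = 0}"
    using graded_submoduleD(5)[OF graded_submodule_free_carrier, of v n ds' d] v by simp
qed auto

text \<open>Coefficients are indexed by the generators themselves rather than by positions in a
  list, so deleting a generator needs no renumbering; \<open>gen_list\<close> translates.\<close>

definition gen :: "nat \<Rightarrow> (nat \<Rightarrow> 'k::field mpoly) set \<Rightarrow> (nat \<Rightarrow> 'k mpoly) set" where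
  "gen n G = {(\<lambda>c. \<Sum>g\<in>G. p g * g c) | p. \<forall>g. p g \<in> polys n}"

lemma gen_list:
  assumes xs: "distinct xs" "set xs = G" "length ds' = length xs"
  shows "gen n G = (\<lambda>v. lincomb (length ds') v ((!) xs)) ` free_carrier n ds'"
proof (intro equalityI subsetI)
  have bij: "bij_betw ((!) xs) {..<length xs} G" using xs by (intro bij_betw_nth) auto
  {
    fix v assume "v \<in> gen n G"
    then obtain p where p: "v = (\<lambda>c. \<Sum>g\<in>G. p g * g c)" "\<forall>g. p g \<in> polys n" unfolding gen_def by blast
    have "v = lincomb (length ds') (\<lambda>e. if e < length xs then p (xs ! e) else 0) ((!) xs)"
      unfolding p(1) lincomb_def sum.reindex_bij_betw[OF bij, symmetric] using xs(3) by (auto intro!: sum.cong)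
    moreover have "(\<lambda>e. if e < length xs then p (xs ! e) else 0) \<in> free_carrier n ds'" using p(2) xs(3)
        by (simp add: free_carrier_def)
    ultimately show "v \<in> (\<lambda>v. lincomb (length ds') v ((!) xs)) ` free_carrier n ds'" by blast
  next
    fix w assume "w \<in> (\<lambda>v. lincomb (length ds') v ((!) xs)) ` free_carrier n ds'"
    then obtain v where v: "v \<in> free_carrier n ds'" "w = lincomb (length ds') v ((!) xs)" by blast
    define i where "i = the_inv_into {..<length xs} ((!) xs)"
    have i: "i (xs ! e) = e" if "e < length xs" for e
      unfolding i_def using bij that by (intro the_inv_into_f_f) (auto simp: bij_betw_def)
    have "w = (\<lambda>c. \<Sum>g\<in>G. v (i g) * g c)"
      unfolding v(2) lincomb_def sum.reindex_bij_betw[OF bij, symmetric] using xs(3) i by (auto intro!: sum.cong)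
    thus "w \<in> gen n G" unfolding gen_def using free_carrier_polys[OF v(1)]
      by (intro CollectI exI[of _ "\<lambda>g. v (i g)"]) simp
  }
qed

definition homG :: "nat \<Rightarrow> int list \<Rightarrow> (nat \<Rightarrow> 'k::field mpoly) set \<Rightarrow> bool" where
  "homG n ds G \<longleftrightarrow> finite G \<and> (\<forall>g\<in>G. \<exists>d. g \<in> free_part n ds d)"

lemma homG_list:
  assumes "homG n ds G"
  obtains xs ds' where "distinct xs" "set xs = G" "length ds' = length xs" "gens n ds ds' ((!) xs)"
proof -
  obtain xs where xs: "set xs = G" "distinct xs" using assms finite_distinct_list unfolding homG_def by blast
  obtain D where D: "\<And>g. g \<in> G \<Longrightarrow> g \<in> free_part n ds (D g)" using assms unfolding homG_def by metis
  show ?thesis by (rule that[of xs "map D xs"]) (use xs D in \<open>auto simp: gens_def\<close>)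
qed

lemma graded_submodule_gen: assumes "homG n ds G" shows "graded_submodule n ds (gen n G)"
proof -
  obtain xs ds' where xs: "distinct xs" "set xs = G" "length ds' = length xs" "gens n ds ds' ((!) xs)"
    by (rule homG_list[OF assms])
  show ?thesis unfolding gen_list[OF xs(1,2,3)] by (rule graded_submodule_lincomb_image[OF xs(4)])
qed

lemma gen_base: assumes "finite G" "g \<in> G" shows "g \<in> gen n G"
proof -
  have "g = (\<lambda>c. \<Sum>h\<in>G. (if h = g then 1 else 0) * h c)"
  proof
    fix c
    have "(\<Sum>h\<in>G. (if h = g then 1 else 0) * h c) = (\<Sum>h\<in>G. if h = g then g c else 0)"
      by (rule sum.cong) auto
    thus "g c = (\<Sum>h\<in>G. (if h = g then 1 else 0) * h c)" using assms by simp
  qed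
  thus ?thesis unfolding gen_def by (intro CollectI exI[of _ "\<lambda>h. if h = g then 1 else 0"]) (simp add: polys_closed)
qed

lemma gen_sub:
  assumes "graded_submodule n ds K" "G \<subseteq> K" shows "gen n G \<subseteq> K"
proof
  fix v assume "v \<in> gen n G"
  then obtain p where p: "v = (\<lambda>c. \<Sum>g\<in>G. p g * g c)" "\<forall>g. p g \<in> polys n" unfolding gen_def by blast
  have "v = (\<Sum>g\<in>G. pv (p g) g)" by (simp add: p(1) fun_eq_iff sum_apply)
  also have "\<dots> \<in> K" using assms(2) p(2)
      by (intro graded_submodule_sum[OF assms(1)] graded_submoduleD(4)[OF assms(1)]) auto
  finally show "v \<in> K" .
qed

text \<open>Otherwise homogeneous elements of \<open>K\<close> could be added forever, each
  enlarging the submodule generated so far.\<close>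

lemma graded_submodule_fg:
  assumes K: "graded_submodule n ds K"
  shows "\<exists>G. homG n ds G \<and> G \<subseteq> K \<and> gen n G = K"
proof (rule ccontr)
  assume neg: "\<not> ?thesis"
  have step: "\<exists>G'. (homG n ds G' \<and> G' \<subseteq> K) \<and> gen n G \<subset> gen n G'" if G: "homG n ds G \<and> G \<subseteq> K" for G
  proof -
    have "gen n G \<subseteq> K" using gen_sub[OF K] G by blast
    moreover have "gen n G \<noteq> K" using neg G by blast
    ultimately obtain v where v: "v \<in> K" "v \<notin> gen n G" by blast
    obtain d where d: "hcv ds d v \<notin> gen n G"
      using graded_submodule_hcv_iff[OF graded_submodule_gen[of n ds G] graded_submoduleD(1)[OF K v(1)]] G v(2) by blast
    let ?G = "insert (hcv ds d v) G"
    have hG: "homG n ds ?G" using G hcv_free_part[OF graded_submoduleD(1)[OF K v(1)]] unfolding homG_def by blast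
    have fin: "finite ?G" using hG by (simp add: homG_def)
    have "gen n G \<subseteq> gen n ?G" using gen_base[OF fin] by (intro gen_sub[OF graded_submodule_gen[OF hG]]) blast
    moreover have "hcv ds d v \<in> gen n ?G" using gen_base[OF fin] by blast
    moreover have "?G \<subseteq> K" using G graded_submoduleD(5)[OF K v(1)] by blast
    ultimately show ?thesis using hG d by blast
  qed
  have "homG n ds {} \<and> {} \<subseteq> K" by (simp add: homG_def)
  from dependent_nat_choice[of "\<lambda>_ G. homG n ds G \<and> G \<subseteq> K" "\<lambda>_ G G'. gen n G \<subset> gen n G'", OF exI[of _ "{}"], OF this]
  obtain f where "\<forall>i. (homG n ds (f i) \<and> f i \<subseteq> K) \<and> gen n (f i) \<subset> gen n (f (Suc i))" using step by blast
  thus False by (intro graded_submodule_acc_strict[of n ds "\<lambda>i. gen n (f i)"]) (auto intro: graded_submodule_gen)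
qed

text \<open>\<open>Y\<close> is a minimal system of homogeneous generators of \<open>K\<close>, of degrees \<open>ds'\<close>.\<close>

definition minimal_cover :: "nat \<Rightarrow> int list \<Rightarrow> (nat \<Rightarrow> 'k::field mpoly) set \<Rightarrow> int list \<Rightarrow> (nat \<Rightarrow> nat \<Rightarrow> 'k mpoly) \<Rightarrow> bool"
    where
  "minimal_cover n ds K ds' Y \<longleftrightarrow> gens n ds ds' Y \<and> (\<lambda>v. lincomb (length ds') v Y) ` free_carrier n ds' = K \<and>
     (\<forall>v\<in>free_carrier n ds'. lincomb (length ds') v Y = 0 \<longrightarrow> (\<forall>e<length ds'. v e \<in> irrelevant_ideal n))"

text \<open>A generating set of least cardinality is minimal. Given a relation whose coefficient at
  \<open>e0\<close> has a constant term, its component of degree \<open>ds' ! e0\<close> is a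
  relation in which this coefficient is a nonzero constant, so the generator is a combination of the
  others.\<close>

theorem exists_minimal_cover:
  fixes K :: "(nat \<Rightarrow> 'k::field mpoly) set"
  assumes K: "graded_submodule n ds K"
  shows "\<exists>ds' Y. minimal_cover n ds K ds' Y"
proof -
  define P where "P = (\<lambda>G. homG n ds G \<and> G \<subseteq> K \<and> gen n G = K)"
  define G where "G = arg_min card P"
  have "\<exists>G. P G" unfolding P_def by (rule graded_submodule_fg[OF K])
  hence G: "P G" "\<And>G'. P G' \<Longrightarrow> card G \<le> card G'"
    unfolding G_def by (auto intro: arg_min_natI arg_min_nat_le)
  have hG: "homG n ds G" and GK: "G \<subseteq> K" and gG: "gen n G = K" using G(1) by (simp_all add: P_def)
  have fin: "finite G" using hG by (simp add: homG_def)
  obtain xs ds' where xs: "distinct xs" "set xs = G" "length ds' = length xs" "gens n ds ds' ((!) xs)"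
    by (rule homG_list[OF hG])
  have "v e0 \<in> irrelevant_ideal n" if v: "v \<in> free_carrier n ds'" "lincomb (length ds') v ((!) xs) = 0"
      and e0: "e0 < length ds'" for v e0
  proof (rule ccontr)
    assume "v e0 \<notin> irrelevant_ideal n"
    define c where "c = lk (v e0) 0"
    have c: "c \<noteq> 0" using \<open>v e0 \<notin> irrelevant_ideal n\<close> free_carrier_polys[OF v(1)]
        by (auto simp: irrelevant_ideal_def c_def)
    define w where "w = hcv ds' (ds' ! e0) v"
    have wP: "w \<in> free_carrier n ds'" unfolding w_def by (rule free_part_free_carrier[OF hcv_free_part[OF v(1)]])
    have w0: "w e0 = cst c" by (simp add: w_def hcv_apply hc_0_cst c_def)
    have "lincomb (length ds') w ((!) xs) = hcv ds (ds' ! e0) 0"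
      unfolding w_def using hcv_lincomb[OF xs(4) v(1)] v(2) by simp
    hence w_rel: "(\<Sum>e<length ds'. w e * (xs ! e) x) = 0" for x
      by (simp add: lincomb_def hcv_def fun_eq_iff)
    have bij: "bij_betw ((!) xs) {..<length ds'} G" using xs by (intro bij_betw_nth) auto
    define i where "i = the_inv_into {..<length ds'} ((!) xs)"
    have i: "i (xs ! e) = e" if "e < length ds'" for e
      unfolding i_def using bij that by (intro the_inv_into_f_f) (auto simp: bij_betw_def)
    define g0 where "g0 = xs ! e0"
    have g0G: "g0 \<in> G" using e0 xs by (auto simp: g0_def)
    have rel: "(\<Sum>g\<in>G. w (i g) * g x) = 0" for x
    proof -
      have "(\<Sum>g\<in>G. w (i g) * g x) = (\<Sum>e<length ds'. w e * (xs ! e) x)"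
        unfolding sum.reindex_bij_betw[OF bij, symmetric] using i by (auto intro!: sum.cong)
      thus ?thesis using w_rel by simp
    qed
    have wg0: "w (i g0) = cst c" using w0 i[OF e0] by (simp add: g0_def)
    have g0: "g0 x = (\<Sum>g\<in>G - {g0}. (cst (- inverse c) * w (i g)) * g x)" for x
    proof -
      have "cst c * g0 x = - (\<Sum>g\<in>G - {g0}. w (i g) * g x)"
        using rel[of x] wg0 sum.remove[OF fin g0G, of "\<lambda>g. w (i g) * g x"] by (simp add: eq_neg_iff_add_eq_0)
      hence "cst (inverse c) * (cst c * g0 x) = - (cst (inverse c) * (\<Sum>g\<in>G - {g0}. w (i g) * g x))" by simp
      moreover have "cst (inverse c) * (cst c * g0 x) = g0 x"
        using c cst_simps(4)[of "inverse c" c] by (simp flip: mult.assoc)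
      ultimately have "g0 x = cst (- inverse c) * (\<Sum>g\<in>G - {g0}. w (i g) * g x)" by simp
      thus ?thesis unfolding sum_distrib_left mult.assoc .
    qed
    have "K \<subseteq> gen n (G - {g0})"
    proof
      fix u assume "u \<in> K"
      then obtain p where p: "u = (\<lambda>x. \<Sum>g\<in>G. p g * g x)" "\<forall>g. p g \<in> polys n" unfolding gG[symmetric] gen_def by blast
      define q where "q = (\<lambda>g. p g + p g0 * (cst (- inverse c) * w (i g)))"
      have "u x = (\<Sum>g\<in>G - {g0}. q g * g x)" for x
      proof -
        have "u x = p g0 * g0 x + (\<Sum>g\<in>G - {g0}. p g * g x)"
          unfolding p(1) by (rule sum.remove[OF fin g0G])
        also have "p g0 * g0 x = (\<Sum>g\<in>G - {g0}. (p g0 * (cst (- inverse c) * w (i g))) * g x)"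
          unfolding g0[of x] sum_distrib_left mult.assoc ..
        finally show ?thesis unfolding q_def distrib_right sum.distrib by (simp only: add.commute)
      qed
      hence "u = (\<lambda>x. \<Sum>g\<in>G - {g0}. q g * g x)" by blast
      moreover have "\<forall>g. q g \<in> polys n" unfolding q_def using p(2) free_carrier_polys[OF wP]
        by (intro allI polys_closed(1,5)) (simp_all del: cst_simps)
      ultimately show "u \<in> gen n (G - {g0})" unfolding gen_def by blast
    qed
    moreover have "gen n (G - {g0}) \<subseteq> K" using GK by (intro gen_sub[OF K]) blast
    moreover have "homG n ds (G - {g0})" using hG by (auto simp: homG_def)
    ultimately have "P (G - {g0})" unfolding P_def using GK by blast
    hence "card G \<le> card (G - {g0})" by (rule G(2))
    thus False using g0G fin by (metis card_Diff1_less not_le)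
  qed
  hence "minimal_cover n ds K ds' ((!) xs)"
    unfolding minimal_cover_def using xs gG gen_list[OF xs(1,2,3), of n] by blast
  thus ?thesis by blast
qed

definition relations :: "nat \<Rightarrow> int list \<Rightarrow> (nat \<Rightarrow> nat \<Rightarrow> 'k::field mpoly) \<Rightarrow> (nat \<Rightarrow> 'k mpoly) set" where
  "relations n ds Y = {v \<in> free_carrier n ds. lincomb (length ds) v Y = 0}"

theorem exists_minimal_sequence:
  fixes K :: "(nat \<Rightarrow> 'k::field mpoly) set"
  assumes K: "graded_submodule n d0 K"
  shows "\<exists>D Y. minimal_cover n d0 K (D 0) (Y 0) \<and>
    (\<forall>i. minimal_cover n (D i) (relations n (D i) (Y i)) (D (Suc i)) (Y (Suc i)))"
proof -
  \<comment> \<open>A state consists of degrees and generators. That it covers some submodule makes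
    its relations graded, and the last clause pins down the starting point.\<close>
  let ?P = "\<lambda>i x. \<exists>ds K'. graded_submodule n ds K' \<and> minimal_cover n ds K' (fst x) (snd x) \<and> (i = (0::nat) \<longrightarrow> ds = d0 \<and>
      K' = K)"
  let ?numerator = "\<lambda>i x y. minimal_cover n (fst x) (relations n (fst x) (snd x)) (fst y) (snd y)"
  have "\<exists>f. \<forall>i. ?P i (f i) \<and> ?numerator i (f i) (f (Suc i))"
  proof (rule dependent_nat_choice)
    obtain ds' Y where "minimal_cover n d0 K ds' Y" using exists_minimal_cover[OF K] by blast
    thus "\<exists>x. ?P 0 x" using K by (intro exI[of _ "(ds', Y)"]) auto
  next
    fix x i assume "?P i x"
    then obtain ds K' where "graded_submodule n ds K'" "minimal_cover n ds K' (fst x) (snd x)" by blast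
    hence g: "graded_submodule n (fst x) (relations n (fst x) (snd x))" unfolding relations_def minimal_cover_def
        by (blast intro: graded_submodule_lincomb_kernel)
    obtain ds' Y where "minimal_cover n (fst x) (relations n (fst x) (snd x)) ds' Y" using exists_minimal_cover[OF g]
        by blast
    thus "\<exists>y. ?P (Suc i) y \<and> ?numerator i x y" using g by (intro exI[of _ "(ds', Y)"]) auto
  qed
  then obtain f where f0: "\<forall>i. ?P i (f i) \<and> ?numerator i (f i) (f (Suc i))" by (rule exE)
  hence f: "\<forall>i. ?P i (f i)" "\<forall>i. ?numerator i (f i) (f (Suc i))" by simp_all
  have "minimal_cover n d0 K (fst (f 0)) (snd (f 0))" using f(1)[rule_format, of 0] by auto
  thus ?thesis using f(2) by (intro exI[of _ "\<lambda>i. fst (f i)"] exI[of _ "\<lambda>i. snd (f i)"]) simp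
qed

section \<open>Uniqueness of the multiplicities\<close>

definition vscale :: "'k::field \<Rightarrow> (nat \<Rightarrow> 'k mpoly) \<Rightarrow> nat \<Rightarrow> 'k mpoly" where "vscale c v = pv (cst c) v"

lemma vscale_apply: "vscale c v e = cst c * v e" by (simp add: vscale_def)

interpretation fv: vector_space "vscale :: 'k::field \<Rightarrow> _"
  by unfold_locales (simp_all add: fun_eq_iff vscale_apply algebra_simps)

interpretation fvm: vector_space_pair "vscale :: 'k::field \<Rightarrow> _" "pscale :: 'k::field \<Rightarrow> _"
  by unfold_locales

interpretation fvv: vector_space_pair "vscale :: 'k::field \<Rightarrow> _" "vscale :: 'k::field \<Rightarrow> _"
  by unfold_locales

lemma free_part_0: "0 \<in> free_part n ds d" by (simp add: free_part_def free_carrier_def polys_closed)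

lemma free_part_add: "v \<in> free_part n ds d \<Longrightarrow> w \<in> free_part n ds d \<Longrightarrow> v + w \<in> free_part n ds d"
  by (simp add: free_part_def free_carrier_def polys_closed S_add)

lemma free_part_diff: "v \<in> free_part n ds d \<Longrightarrow> w \<in> free_part n ds d \<Longrightarrow> v - w \<in> free_part n ds d"
  by (simp add: free_part_def free_carrier_def polys_diff S_diff)

lemma free_part_pv: "p \<in> S n c \<Longrightarrow> v \<in> free_part n ds d \<Longrightarrow> pv p v \<in> free_part n ds (c + d)"
  unfolding free_part_def using S_mult[of p n c]
      by (auto simp: free_carrier_def S_polys polys_closed add_diff_eq[symmetric])

lemma free_part_vscale: "v \<in> free_part n ds d \<Longrightarrow> vscale c v \<in> free_part n ds d"
  using free_part_pv[OF cst_S, of v n ds d c] by (simp add: vscale_def)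

lemma subspace_free_part: "fv.subspace (free_part n ds d)"
  by (simp add: fv.subspace_def free_part_0 free_part_add free_part_vscale)

definition bas :: "nat \<Rightarrow> nat \<Rightarrow> 'k::field mpoly" where "bas e = (\<lambda>c. if c = e then 1 else 0)"

lemma bas_free_part: "e < length ds \<Longrightarrow> bas e \<in> free_part n ds (ds ! e)"
  using cst_S[of 1 n] by (auto simp: free_part_def free_carrier_def bas_def polys_closed)

lemma bas_expand:
  assumes "v \<in> free_carrier n ds" shows "v = (\<Sum>e<length ds. pv (v e) (bas e))"
proof
  fix c
  have "(\<Sum>e<length ds. pv (v e) (bas e)) c = (\<Sum>e<length ds. if e = c then v c else 0)"
    unfolding sum_apply bas_def by (rule sum.cong) auto
  thus "v c = (\<Sum>e<length ds. pv (v e) (bas e)) c" using assms by (auto simp: free_carrier_def)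
qed

text \<open>Splitting off the last summand leaves the positions of the others unchanged; this is the
  induction step for finite dimension and for the dimension formula.\<close>

lemma free_part_snoc:
  fixes a :: int
  shows "v \<in> free_part n (ds @ [a]) d \<Longrightarrow> v (length ds) = 0 \<Longrightarrow> v \<in> free_part n ds d"
    and "v \<in> free_part n ds d \<Longrightarrow> v \<in> free_part n (ds @ [a]) d \<and> v (length ds) = 0"
    and "v \<in> free_part n (ds @ [a]) d \<Longrightarrow> v (length ds) \<in> S n (d - a)"
    and "p \<in> S n (d - a) \<Longrightarrow> (\<lambda>e. if e = length ds then p else 0) \<in> free_part n (ds @ [a]) d"
proof -
  assume v: "v \<in> free_part n (ds @ [a]) d" "v (length ds) = 0"
  have "v e \<in> polys n \<and> v e \<in> S n (d - ds ! e)" if "e < length ds" for e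
    using v(1) that by (auto simp: free_part_def free_carrier_def nth_append less_Suc_eq)
  moreover have "v e = 0" if "e \<ge> length ds" for e
    using v that by (cases "e = length ds") (auto simp: free_part_def free_carrier_def)
  ultimately show "v \<in> free_part n ds d" by (simp add: free_part_def free_carrier_def)
next
  assume "v \<in> free_part n ds d" thus "v \<in> free_part n (ds @ [a]) d \<and> v (length ds) = 0"
    by (auto simp: free_part_def free_carrier_def nth_append polys_closed less_Suc_eq)
next
  assume "v \<in> free_part n (ds @ [a]) d" thus "v (length ds) \<in> S n (d - a)" by (auto simp: free_part_def)
next
  assume "p \<in> S n (d - a)" thus "(\<lambda>e. if e = length ds then p else 0) \<in> free_part n (ds @ [a]) d"
    by (auto simp: free_part_def free_carrier_def polys_closed S_polys nth_append)
qed

lemma free_part_finite_span: "\<exists>W. finite W \<and> free_part n ds d \<subseteq> fv.span (W :: (nat \<Rightarrow> 'k::field mpoly) set)"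
proof (induction ds rule: rev_induct)
  case Nil
  have "free_part n [] d \<subseteq> fv.span ({} :: (nat \<Rightarrow> 'k mpoly) set)"
      by (auto simp: free_part_def free_carrier_def fun_eq_iff)
  thus ?case by blast
next
  case (snoc a ds)
  then obtain W where W: "finite W" "free_part n ds d \<subseteq> fv.span (W :: (nat \<Rightarrow> 'k mpoly) set)" by blast
  obtain U where U: "finite U" "S n (d - a) \<subseteq> mv.span (U :: 'k mpoly set)" by (rule S_finite_span)
  define j where "j = (\<lambda>p::'k mpoly. \<lambda>e. if e = length ds then p else 0)"
  have jspan: "j p \<in> fv.span (W \<union> j ` U)" if "p \<in> mv.span U" for p
    using that
  proof (induction rule: mv.span_induct_alt)
    case base
    have "j 0 = 0" by (auto simp: j_def)
    show ?case unfolding \<open>j 0 = 0\<close> by (rule fv.span_zero)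
  next
    case (step c x y)
    have eq: "j (pscale c x + y) = vscale c (j x) + j y" by (auto simp: j_def vscale_apply pscale_def)
    have "j x \<in> fv.span (W \<union> j ` U)" by (rule fv.span_base) (rule UnI2[OF imageI[OF step(1)]])
    hence "vscale c (j x) \<in> fv.span (W \<union> j ` U)" by (rule fv.span_scale)
    hence "vscale c (j x) + j y \<in> fv.span (W \<union> j ` U)" using step(2) by (rule fv.span_add)
    thus ?case unfolding eq .
  qed
  have "free_part n (ds @ [a]) d \<subseteq> fv.span (W \<union> j ` U)"
  proof
    fix v :: "nat \<Rightarrow> 'k mpoly" assume v: "v \<in> free_part n (ds @ [a]) d"
    let ?p = "v (length ds)"
    have p: "?p \<in> S n (d - a)" by (rule free_part_snoc(3)[OF v])
    have "v - j ?p \<in> free_part n (ds @ [a]) d" unfolding j_def by (rule free_part_diff[OF v free_part_snoc(4)[OF p]])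
    hence "v - j ?p \<in> free_part n ds d" by (rule free_part_snoc(1)) (simp add: j_def)
    hence "v - j ?p \<in> fv.span (W \<union> j ` U)" using W(2) fv.span_mono[of W "W \<union> j ` U"] by blast
    moreover have "j ?p \<in> fv.span (W \<union> j ` U)" using jspan p U(2) by blast
    ultimately have "v - j ?p + j ?p \<in> fv.span (W \<union> j ` U)" by (rule fv.span_add)
    thus "v \<in> fv.span (W \<union> j ` U)" by simp
  qed
  moreover have "finite (W \<union> j ` U)" using W(1) U(1) by simp
  ultimately show ?case by (intro exI[of _ "W \<union> j ` U"] conjI)
qed

definition sdim :: "'k::field itself \<Rightarrow> nat \<Rightarrow> int \<Rightarrow> nat" where
  "sdim _ n d = mv.dim (S n d :: 'k mpoly set)"

lemma dim_free_part: "fv.dim (free_part n ds d :: (nat \<Rightarrow> 'k::field mpoly) set) =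
    sum_list (map (\<lambda>x. sdim TYPE('k) n (d - x)) ds)"
proof (induction ds rule: rev_induct)
  case Nil
  have "free_part n [] d \<subseteq> fv.span ({} :: (nat \<Rightarrow> 'k mpoly) set)"
      by (auto simp: free_part_def free_carrier_def fun_eq_iff)
  hence "fv.dim (free_part n [] d :: (nat \<Rightarrow> 'k mpoly) set) \<le> card ({} :: (nat \<Rightarrow> 'k mpoly) set)"
      by (rule fv.dim_le_card) simp
  thus ?case by simp
next
  case (snoc a ds)
  obtain W where W: "finite W" "free_part n (ds @ [a]) d \<subseteq> fv.span (W :: (nat \<Rightarrow> 'k mpoly) set)"
      using free_part_finite_span by blast
  have "fv.dim (free_part n (ds @ [a]) d :: (nat \<Rightarrow> 'k mpoly) set) =
      fv.dim {v \<in> free_part n (ds @ [a]) d. v (length ds) =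
          (0 :: 'k mpoly)} + mv.dim ((\<lambda>v. v (length ds)) ` free_part n (ds @ [a]) d :: 'k mpoly set)"
    by (rule fvm.rank_nullity[OF subspace_free_part W]) (simp_all add: vscale_apply pscale_def)
  also have "{v \<in> free_part n (ds @ [a]) d. v (length ds) = (0 :: 'k mpoly)} = free_part n ds d"
    using free_part_snoc(1,2)[of _ n ds] by blast
  also have "(\<lambda>v. v (length ds)) ` free_part n (ds @ [a]) d = (S n (d - a) :: 'k mpoly set)"
  proof (intro equalityI subsetI)
    fix p :: "'k mpoly" assume "p \<in> S n (d - a)"
    from free_part_snoc(4)[OF this] show "p \<in> (\<lambda>v. v (length ds)) ` free_part n (ds @ [a]) d"
        by (rule rev_image_eqI) simp
  qed (auto intro: free_part_snoc(3))
  finally show ?case using snoc by (simp add: sdim_def)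
qed

lemma sdim_neg: "d < 0 \<Longrightarrow> sdim TYPE('k::field) n d = 0"
proof -
  assume "d < 0"
  hence "S n d \<subseteq> mv.span ({} :: 'k mpoly set)" using S_neg[of d n] by auto
  hence "mv.dim (S n d :: 'k mpoly set) \<le> card ({}::'k mpoly set)" by (rule mv.dim_le_card) simp
  thus ?thesis by (simp add: sdim_def)
qed

lemma sdim_0: "sdim TYPE('k::field) n 0 = 1"
  unfolding sdim_def
proof (rule mv.dim_unique[of "{1}"])
  show "S n 0 \<subseteq> mv.span {1 :: 'k mpoly}"
  proof
    fix p :: "'k mpoly" assume "p \<in> S n 0"
    then obtain c where "p = pscale c 1" using S_0 by (auto simp: pscale_def)
    thus "p \<in> mv.span {1}" by (simp add: mv.span_scale mv.span_base)
  qed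
qed (use cst_S[of 1 n] in auto)

text \<open>The shifts \<open>s (d - x)\<close> are triangular in \<open>x\<close>. At the least
  degree \<open>m\<close> where the counts differ, all other contributions to the equation for
  \<open>d = m\<close> agree.\<close>

lemma count_determined:
  fixes s :: "int \<Rightarrow> nat"
  assumes s: "s 0 = 1" "\<And>d. d < 0 \<Longrightarrow> s d = 0"
    and eq: "\<And>d. sum_list (map (\<lambda>x. s (d - x)) ds) = sum_list (map (\<lambda>x. s (d - x)) ds')"
  shows "count_list ds j = count_list ds' j"
proof (rule ccontr)
  assume neq: "count_list ds j \<noteq> count_list ds' j"
  define A where "A = set ds \<union> set ds'"
  have sl: "sum_list (map g xs) = (\<Sum>x\<in>A. count_list xs x * g x)" if "set xs \<subseteq> A" for g :: "int \<Rightarrow> nat" and xs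
    using sum_list_map_eq_sum_count2[OF that, of g] by (simp add: A_def)
  define B where "B = {x\<in>A. count_list ds x \<noteq> count_list ds' x}"
  have "j \<in> B"
  proof (rule ccontr)
    assume "j \<notin> B"
    hence "j \<notin> A" using neq by (simp add: B_def)
    thus False using neq by (simp add: A_def count_list_0_iff)
  qed
  moreover have fB: "finite B" by (simp add: B_def A_def)
  ultimately have m: "Min B \<in> B" by (intro Min_in) auto
  define m where "m = Min B"
  have mB: "m \<in> B" using m by (simp add: m_def)
  have less: "count_list ds x = count_list ds' x" if "x \<in> A" "x < m" for x
  proof (rule ccontr)
    assume "count_list ds x \<noteq> count_list ds' x"
    hence "x \<in> B" using that by (simp add: B_def)
    hence "m \<le> x" using fB by (simp add: m_def)
    thus False using that by simp
  qed
  have split: "(\<Sum>x\<in>A. count_list xs x * s (m - x)) =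
      count_list xs m + (\<Sum>x\<in>A - {m}. if x < m then count_list xs x * s (m - x) else 0)" for xs
  proof -
    have "(\<Sum>x\<in>A. count_list xs x * s (m - x)) = count_list xs m * s 0 + (\<Sum>x\<in>A - {m}. count_list xs x * s (m - x))"
      using sum.remove[of A m "\<lambda>x. count_list xs x * s (m - x)"] mB by (simp add: B_def A_def)
    also have "(\<Sum>x\<in>A - {m}. count_list xs x * s (m - x)) =
        (\<Sum>x\<in>A - {m}. if x < m then count_list xs x * s (m - x) else 0)"
      by (rule sum.cong) (auto simp: s(2))
    finally show ?thesis by (simp add: s(1))
  qed
  have "(\<Sum>x\<in>A - {m}. if x < m then count_list ds x * s (m - x) else 0) =
      (\<Sum>x\<in>A - {m}. if x < m then count_list ds' x * s (m - x) else 0)"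
    by (rule sum.cong) (auto simp: less)
  moreover have "(\<Sum>x\<in>A. count_list ds x * s (m - x)) = (\<Sum>x\<in>A. count_list ds' x * s (m - x))"
    using eq[of m] sl[of ds] sl[of ds'] by (simp add: A_def)
  ultimately have "count_list ds m = count_list ds' m" using split[of ds] split[of ds'] by simp
  thus False using mB by (simp add: B_def)
qed

text \<open>A projective cover in the graded sense. The components \<open>Mc\<close> are a separate
  parameter, so that a kernel in a resolution can be covered while the operations are those of the
  ambient free module.\<close>

definition graded_cover :: "nat \<Rightarrow> ('k::field mpoly, 'b,
    'm) module_scheme \<Rightarrow> (int \<Rightarrow> 'b set) \<Rightarrow> int list \<Rightarrow> ((nat \<Rightarrow> 'k mpoly) \<Rightarrow> 'b) \<Rightarrow> bool" where
  "graded_cover n M Mc ds \<epsilon> \<longleftrightarrow> (\<forall>v\<in>free_carrier n ds. \<epsilon> v \<in> carrier M) \<and>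
     (\<forall>v\<in>free_carrier n ds. \<forall>w\<in>free_carrier n ds. \<epsilon> (v + w) = \<epsilon> v \<oplus>\<^bsub>M\<^esub> \<epsilon> w) \<and>
     (\<forall>p\<in>polys n. \<forall>v\<in>free_carrier n ds. \<epsilon> (pv p v) = p \<odot>\<^bsub>M\<^esub> \<epsilon> v) \<and>
     (\<forall>d. \<epsilon> ` free_part n ds d = Mc d) \<and>
     (\<forall>v\<in>free_carrier n ds. \<epsilon> v = \<zero>\<^bsub>M\<^esub> \<longrightarrow> (\<forall>e<length ds. v e \<in> irrelevant_ideal n))"

lemma graded_coverD:
  assumes "graded_cover n M Mc ds \<epsilon>"
  shows "v \<in> free_carrier n ds \<Longrightarrow> \<epsilon> v \<in> carrier M"
    "v \<in> free_carrier n ds \<Longrightarrow> w \<in> free_carrier n ds \<Longrightarrow> \<epsilon> (v + w) = \<epsilon> v \<oplus>\<^bsub>M\<^esub> \<epsilon> w"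
    "p \<in> polys n \<Longrightarrow> v \<in> free_carrier n ds \<Longrightarrow> \<epsilon> (pv p v) = p \<odot>\<^bsub>M\<^esub> \<epsilon> v"
    "\<epsilon> ` free_part n ds d = Mc d"
    "v \<in> free_carrier n ds \<Longrightarrow> \<epsilon> v = \<zero>\<^bsub>M\<^esub> \<Longrightarrow> e < length ds \<Longrightarrow> v e \<in> irrelevant_ideal n"
  using assms unfolding graded_cover_def by blast+

locale two_covers =
  fixes n :: nat and M :: "('k::field mpoly, 'b, 'm) module_scheme" and Mc :: "int \<Rightarrow> 'b set"
  assumes mod: "abelian_group M"
begin

lemma graded_cover_0: "graded_cover n M Mc ds \<epsilon> \<Longrightarrow> \<epsilon> 0 = \<zero>\<^bsub>M\<^esub>"
proof -
  assume c: "graded_cover n M Mc ds \<epsilon>"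
  interpret abelian_group M by (rule mod)
  have z: "0 \<in> free_carrier n ds" by (rule graded_submoduleD(2)[OF graded_submodule_free_carrier])
  hence "\<epsilon> 0 \<oplus>\<^bsub>M\<^esub> \<epsilon> 0 = \<epsilon> 0" using graded_coverD(2)[OF c z z] by simp
  thus ?thesis using graded_coverD(1)[OF c z] by (metis add.l_cancel_one' )
qed

lemma graded_cover_eq_iff:
  assumes c: "graded_cover n M Mc ds \<epsilon>" and v: "v \<in> free_carrier n ds" "w \<in> free_carrier n ds"
  shows "\<epsilon> v = \<epsilon> w \<longleftrightarrow> \<epsilon> (v - w) = \<zero>\<^bsub>M\<^esub>"
proof -
  interpret abelian_group M by (rule mod)
  have d: "v - w \<in> free_carrier n ds" by (rule graded_submodule_diff[OF graded_submodule_free_carrier v])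
  have "\<epsilon> v = \<epsilon> (v - w) \<oplus>\<^bsub>M\<^esub> \<epsilon> w" using graded_coverD(2)[OF c d v(2)] by simp
  thus ?thesis using graded_coverD(1)[OF c d] graded_coverD(1)[OF c v(2)] graded_coverD(1)[OF c v(1)]
      by (metis add.r_cancel_one' l_zero)
qed

text \<open>Free modules are projective: \<open>Y e\<close> is a preimage under \<epsilon>', in the
  right degree, of the image of the \<open>e\<close>-th basis vector.\<close>

lemma exists_lift:
  assumes c: "graded_cover n M Mc ds \<epsilon>" and c': "graded_cover n M Mc ds' \<epsilon>'"
  shows "\<exists>Y. gens n ds' ds Y \<and> (\<forall>v\<in>free_carrier n ds. \<epsilon>' (lincomb (length ds) v Y) = \<epsilon> v)"
proof -
  have "\<exists>y. y \<in> free_part n ds' (ds ! e) \<and> \<epsilon>' y = \<epsilon> (bas e)" if "e < length ds" for e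
  proof -
    have "\<epsilon> (bas e) \<in> \<epsilon>' ` free_part n ds' (ds ! e)" unfolding graded_coverD(4)[OF c'] graded_coverD(4)[OF c, symmetric]
      using bas_free_part[OF that] by blast
    thus ?thesis by auto
  qed
  then obtain Y where Y: "\<And>e. e < length ds \<Longrightarrow> Y e \<in> free_part n ds' (ds ! e)" "\<And>e. e < length ds \<Longrightarrow>
      \<epsilon>' (Y e) = \<epsilon> (bas e)" by metis
  have "\<epsilon>' (lincomb (length ds) v Y) = \<epsilon> v" if v: "v \<in> free_carrier n ds" for v
  proof -
    have "(\<Sum>e<r. pv (v e) (Y e)) \<in> free_carrier n ds' \<and> (\<Sum>e<r. pv (v e) (bas e)) \<in> free_carrier n ds \<and>
        \<epsilon>' (\<Sum>e<r. pv (v e) (Y e)) = \<epsilon> (\<Sum>e<r. pv (v e) (bas e))" if "r \<le> length ds" for r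
      using that
    proof (induction r)
      case 0
      show ?case unfolding lessThan_0 sum.empty graded_cover_0[OF c] graded_cover_0[OF c']
        using graded_submoduleD(2)[OF graded_submodule_free_carrier] by blast
    next
      case (Suc r)
      have r: "r < length ds" using Suc.prems by simp
      have vr: "v r \<in> polys n" by (rule free_carrier_polys[OF v])
      have Yr: "Y r \<in> free_carrier n ds'" by (rule free_part_free_carrier[OF Y(1)[OF r]])
      have br: "bas r \<in> free_carrier n ds" by (rule free_part_free_carrier[OF bas_free_part[OF r]])
      note pY = graded_submoduleD(4)[OF graded_submodule_free_carrier vr Yr]
          and pb = graded_submoduleD(4)[OF graded_submodule_free_carrier vr br]
      have IH: "(\<Sum>e<r. pv (v e) (Y e)) \<in> free_carrier n ds'" "(\<Sum>e<r. pv (v e) (bas e)) \<in> free_carrier n ds"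
        "\<epsilon>' (\<Sum>e<r. pv (v e) (Y e)) = \<epsilon> (\<Sum>e<r. pv (v e) (bas e))" using Suc.IH[OF less_imp_le[OF r]] by blast+
      show ?case unfolding sum.lessThan_Suc
      proof (intro conjI)
        show "\<epsilon>' ((\<Sum>e<r. pv (v e) (Y e)) + pv (v r) (Y r)) = \<epsilon> ((\<Sum>e<r. pv (v e) (bas e)) + pv (v r) (bas r))"
          unfolding graded_coverD(2)[OF c' IH(1) pY] graded_coverD(2)[OF c IH(2) pb] graded_coverD(3)[OF c' vr Yr]
              graded_coverD(3)[OF c vr br] IH(3) Y(2)[OF r] ..
      qed (rule graded_submoduleD(3)[OF graded_submodule_free_carrier IH(1) pY],
          rule graded_submoduleD(3)[OF graded_submodule_free_carrier IH(2) pb])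
    qed
    from this[of "length ds"] have "\<epsilon>' (\<Sum>e<length ds. pv (v e) (Y e)) = \<epsilon> v"
      using bas_expand[OF v] by simp
    moreover have "lincomb (length ds) v Y = (\<Sum>e<length ds. pv (v e) (Y e))"
      by (simp add: fun_eq_iff lincomb_def sum_apply)
    ultimately show ?thesis by simp
  qed
  thus ?thesis using Y(1) by (auto simp: gens_def)
qed

text \<open>A graded form of Nakayama's lemma. Every \<open>w\<close> of degree \<open>d\<close>
  differs from an element of the image by some \<open>u\<close> in the kernel of \<epsilon>'. By
  minimality the coefficients of \<open>u\<close> have no constant term, so \<open>u\<close>
  involves only basis vectors of degree less than \<open>d\<close>, which an induction over the
  degrees has already reached.\<close>

lemma lift_surj:
  assumes c: "graded_cover n M Mc ds \<epsilon>" and c': "graded_cover n M Mc ds' \<epsilon>'" and Y: "gens n ds' ds Y"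
    and lift: "\<And>v. v \<in> free_carrier n ds \<Longrightarrow> \<epsilon>' (lincomb (length ds) v Y) = \<epsilon> v"
  shows "free_part n ds' d \<subseteq> (\<lambda>v. lincomb (length ds) v Y) ` free_part n ds d"
proof -
  let ?f = "\<lambda>v. lincomb (length ds) v Y"
  have step: "w \<in> ?f ` free_part n ds d"
    if w: "w \<in> free_part n ds' d" and low: "\<And>e. e < length ds' \<Longrightarrow> ds' ! e < d \<Longrightarrow> bas e \<in> ?f ` free_part n ds (ds' ! e)"
        for w d
  proof -
    have "\<epsilon>' w \<in> \<epsilon> ` free_part n ds d" unfolding graded_coverD(4)[OF c] graded_coverD(4)[OF c', symmetric] using w
        by (rule imageI)
    then obtain v where v: "v \<in> free_part n ds d" "\<epsilon>' w = \<epsilon> v" by blast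
    have vf: "v \<in> free_carrier n ds" by (rule free_part_free_carrier[OF v(1)])
    define u where "u = w - ?f v"
    have u: "u \<in> free_part n ds' d" unfolding u_def by (rule free_part_diff[OF w lincomb_free_part[OF Y v(1)]])
    have "\<epsilon>' u = \<zero>\<^bsub>M\<^esub>" unfolding u_def
      using graded_cover_eq_iff[OF c' free_part_free_carrier[OF w] lincomb_free_carrier[OF Y vf]] v(2) lift[OF vf]
          by simp
    hence irr: "u e \<in> irrelevant_ideal n" if "e < length ds'" for e
      using graded_coverD(5)[OF c' free_part_free_carrier[OF u]] that by blast
    have "\<exists>b. b \<in> free_part n ds d \<and> ?f b = pv (u e) (bas e)" if e: "e < length ds'" for e
    proof (cases "ds' ! e < d")
      case True
      from low[OF e this] obtain b where b: "?f b = bas e" "b \<in> free_part n ds (ds' ! e)" by (metis imageE)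
      have "pv (u e) b \<in> free_part n ds ((d - ds' ! e) + ds' ! e)" by (rule free_part_pv[OF free_part_S[OF u] b(2)])
      thus ?thesis using b(1) by (intro exI[of _ "pv (u e) b"]) (simp add: lincomb_pv)
    next
      case False
      \<comment> \<open>The coefficient has degree \<open>d - ds' ! e\<close>, which is at most 0,
        and it has no constant term.\<close>
      have "u e = 0"
      proof (cases "d = ds' ! e")
        case True
        hence "u e \<in> S n 0" using free_part_S[OF u, of e] by simp
        hence "u e = cst (lk (u e) 0)" by (rule S_0_cst)
        thus ?thesis using irr[OF e] by (simp add: irrelevant_ideal_def)
      next
        case f: False
        thus ?thesis using free_part_S[OF u, of e] False S_neg[of "d - ds' ! e" n] by auto
      qed
      thus ?thesis by (intro exI[of _ 0]) (simp add: free_part_0 fun_eq_iff)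
    qed
    then obtain b where b: "\<And>e. e < length ds' \<Longrightarrow> b e \<in> free_part n ds d" "\<And>e. e < length ds' \<Longrightarrow>
        ?f (b e) = pv (u e) (bas e)" by metis
    have "(\<Sum>e<r. b e) \<in> free_part n ds d \<and> ?f (\<Sum>e<r. b e) = (\<Sum>e<r. pv (u e) (bas e))" if "r \<le> length ds'" for r
      using that by (induction r) (simp_all add: free_part_0 free_part_add lincomb_add b)
    from this[of "length ds'"] have bs: "(\<Sum>e<length ds'. b e) \<in> free_part n ds d" "?f (\<Sum>e<length ds'. b e) = u"
      using bas_expand[OF free_part_free_carrier[OF u]] by simp_all
    have "?f (v + (\<Sum>e<length ds'. b e)) = w" using bs(2) by (simp add: lincomb_add u_def)
    thus ?thesis using free_part_add[OF v(1) bs(1)] by (intro image_eqI[of _ _ "v + (\<Sum>e<length ds'. b e)"]) simp_all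
  qed
  have basis: "bas e \<in> ?f ` free_part n ds (ds' ! e)" if "e < length ds'" for e
    using that
  \<comment> \<open>Degrees are integers without a common lower bound; the number of distinct
    smaller degrees in the list serves as the measure.\<close>
  proof (induction "card {x\<in>set ds'. x < ds' ! e}" arbitrary: e rule: less_induct)
    case less
    show ?case
    proof (rule step[OF bas_free_part[OF less.prems]])
      fix e' assume e': "e' < length ds'" "ds' ! e' < ds' ! e"
      have "{x\<in>set ds'. x < ds' ! e'} \<subset> {x\<in>set ds'. x < ds' ! e}"
      proof
        show "{x\<in>set ds'. x < ds' ! e'} \<subseteq> {x\<in>set ds'. x < ds' ! e}" using e'(2) by auto
        have "ds' ! e' \<in> {x\<in>set ds'. x < ds' ! e}" using e' by simp
        thus "{x\<in>set ds'. x < ds' ! e'} \<noteq> {x\<in>set ds'. x < ds' ! e}" by blast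
      qed
      hence "card {x\<in>set ds'. x < ds' ! e'} < card {x\<in>set ds'. x < ds' ! e}" by (intro psubset_card_mono) auto
      thus "bas e' \<in> ?f ` free_part n ds (ds' ! e')" by (rule less.hyps) (rule e'(1))
    qed
  qed
  show ?thesis
  proof
    fix w :: "nat \<Rightarrow> 'k mpoly" assume "w \<in> free_part n ds' d"
    thus "w \<in> ?f ` free_part n ds d" by (rule step) (rule basis)
  qed
qed

lemma dim_free_part_le:
  assumes Y: "gens n ds' ds (Y :: nat \<Rightarrow> nat \<Rightarrow> 'k mpoly)"
      and s: "free_part n ds' d \<subseteq> (\<lambda>v. lincomb (length ds) v Y) ` free_part n ds d"
  shows "fv.dim (free_part n ds d :: (nat \<Rightarrow> 'k mpoly) set) = fv.dim {v \<in> free_part n ds d. lincomb (length ds) v Y =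
      0} + fv.dim (free_part n ds' d :: (nat \<Rightarrow> 'k mpoly) set)"
proof -
  obtain W where W: "finite W" "free_part n ds d \<subseteq> fv.span (W :: (nat \<Rightarrow> 'k mpoly) set)" using free_part_finite_span
      by blast
  have "(\<lambda>v. lincomb (length ds) v Y) ` free_part n ds d = free_part n ds' d" using s lincomb_free_part[OF Y] by blast
  moreover have "fv.dim (free_part n ds d :: (nat \<Rightarrow> 'k mpoly) set) =
      fv.dim {v \<in> free_part n ds d. lincomb (length ds) v Y =
          0} + fv.dim ((\<lambda>v. lincomb (length ds) v Y) ` free_part n ds d)"
    by (rule fvv.rank_nullity[OF subspace_free_part W]) (simp_all add: lincomb_add vscale_def lincomb_pv)
  ultimately show ?thesis by simp
qed

text \<open>Lifts in both directions are surjective, so the dimensions agree in every degree and the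
  lifts have no kernel. The dimensions determine the degrees by \<open>count_determined\<close>. The
  isomorphism is part of the conclusion because the next stage of a resolution needs it.\<close>

theorem cover_unique:
  assumes c: "graded_cover n M Mc ds \<epsilon>" and c': "graded_cover n M Mc ds' \<epsilon>'"
  shows "(\<forall>j. count_list ds j = count_list ds' j) \<and>
    (\<exists>Y. gens n ds' ds Y \<and> (\<forall>v\<in>free_carrier n ds. \<epsilon>' (lincomb (length ds) v Y) = \<epsilon> v) \<and>
      (\<forall>d. (\<lambda>v. lincomb (length ds) v Y) ` free_part n ds d = free_part n ds' d) \<and>
          (\<forall>v\<in>free_carrier n ds. lincomb (length ds) v Y = 0 \<longrightarrow> v = 0))"
proof -
  obtain Y where Y: "gens n ds' ds Y" "\<And>v. v \<in> free_carrier n ds \<Longrightarrow> \<epsilon>' (lincomb (length ds) v Y) = \<epsilon> v"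
      using exists_lift[OF c c'] by blast
  obtain Z where Z: "gens n ds ds' Z" "\<And>v. v \<in> free_carrier n ds' \<Longrightarrow> \<epsilon> (lincomb (length ds') v Z) = \<epsilon>' v"
      using exists_lift[OF c' c] by blast
  note sY = lift_surj[OF c c' Y] and sZ = lift_surj[OF c' c Z]
  have deq: "fv.dim (free_part n ds d :: (nat \<Rightarrow> 'k mpoly) set) = fv.dim (free_part n ds' d :: (nat \<Rightarrow> 'k mpoly) set)"
    and k0: "fv.dim {v \<in> free_part n ds d. lincomb (length ds) v Y = 0} = 0" for d
    using dim_free_part_le[OF Y(1) sY, of d] dim_free_part_le[OF Z(1) sZ, of d] by simp_all
  have inj: "v = 0" if v: "v \<in> free_part n ds d" "lincomb (length ds) v Y = 0" for v d
  proof -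
    let ?U = "{v \<in> free_part n ds d. lincomb (length ds) v Y = 0}"
    obtain W where W: "finite W" "free_part n ds d \<subseteq> fv.span (W :: (nat \<Rightarrow> 'k mpoly) set)" using free_part_finite_span
        by blast
    have "{0} = ?U"
    proof (rule fv.fd_dim_eq[OF W(1)])
      show "?U \<subseteq> fv.span W" using W(2) by blast
      have "fv.dim {0 :: nat \<Rightarrow> 'k mpoly} \<le> card ({} :: (nat \<Rightarrow> 'k mpoly) set)"
          by (rule fv.dim_le_card) (auto simp: fv.span_zero)
      hence "fv.dim {0 :: nat \<Rightarrow> 'k mpoly} = 0" unfolding card.empty by (rule le_zero_eq[THEN iffD1])
      thus "fv.dim {0 :: nat \<Rightarrow> 'k mpoly} = fv.dim ?U" unfolding k0 .
    qed (auto simp: free_part_0 fv.subspace_def)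
    thus ?thesis using v by blast
  qed
  have "v = 0" if v: "v \<in> free_carrier n ds" "lincomb (length ds) v Y = 0" for v
  proof -
    have "hcv ds d v = 0" for d
    proof (rule inj[OF hcv_free_part[OF v(1)]])
      show "lincomb (length ds) (hcv ds d v) Y = 0" using hcv_lincomb[OF Y(1) v(1), of d] v(2)
          by (simp add: hcv_def fun_eq_iff)
    qed
    moreover obtain A where "v = (\<Sum>d\<in>A. hcv ds d v)" by (rule hcv_decomp[OF v(1)])
    ultimately show ?thesis by simp
  qed
  moreover have "(\<lambda>v. lincomb (length ds) v Y) ` free_part n ds d = free_part n ds' d" for d
      using sY lincomb_free_part[OF Y(1)] by blast
  moreover have "count_list ds j = count_list ds' j" for j
    by (rule count_determined[of "sdim TYPE('k) n"]) (use deq in \<open>simp_all add: sdim_0 sdim_neg dim_free_part\<close>)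
  ultimately show ?thesis using Y by blast
qed

end

section \<open>From single covers to whole resolutions\<close>

lemma free_simps:
  "carrier (free_graded_module n ds :: ('k::field mpoly, _) graded_module) = free_carrier n ds"
  "\<zero>\<^bsub>free_graded_module n ds :: ('k mpoly, _) graded_module\<^esub> = 0"
  "v \<oplus>\<^bsub>free_graded_module n ds :: ('k mpoly, _) graded_module\<^esub> w = v + w"
  "p \<odot>\<^bsub>free_graded_module n ds :: ('k mpoly, _) graded_module\<^esub> v = pv p v"
  "component (free_graded_module n ds :: ('k mpoly, _) graded_module) d = free_part n ds d"
  by (auto simp: free_graded_module_def Let_def free_carrier_def free_part_def pv_def plus_fun_def zero_fun_def)

lemma poly_ring_simps: "carrier (poly_ring n) = polys n" "p \<otimes>\<^bsub>poly_ring n\<^esub> q = p * q" "p \<oplus>\<^bsub>poly_ring n\<^esub> q = p + q"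
    "\<zero>\<^bsub>poly_ring n\<^esub> = 0" "\<one>\<^bsub>poly_ring n\<^esub> = 1"
  by (simp_all add: poly_ring_def)

lemma abelian_free: "abelian_group (free_graded_module n ds :: ('k::field mpoly, _) graded_module)"
  using module_free_graded_module by (rule Module.module.axioms(2))

abbreviation fgm :: "nat \<Rightarrow> int list \<Rightarrow> ('k::field mpoly, nat \<Rightarrow> 'k mpoly) graded_module" where
  "fgm \<equiv> free_graded_module"

text \<open>A minimal resolution of the submodule \<open>K\<close>, read as successive covers of
  kernels. Dropping the first term leaves a chain of the same shape, on which the induction over
  homological degrees relies.\<close>

definition cover_chain :: "nat \<Rightarrow> int list \<Rightarrow> (nat \<Rightarrow> 'k::field mpoly) set \<Rightarrow> (nat \<Rightarrow> int list) \<Rightarrow>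
    (nat \<Rightarrow> (nat \<Rightarrow> 'k mpoly) \<Rightarrow> (nat \<Rightarrow> 'k mpoly)) \<Rightarrow> bool" where
  "cover_chain n ds0 K D \<Phi> \<longleftrightarrow> graded_cover n (fgm n ds0) (\<lambda>d. K \<inter> free_part n ds0 d) (D 0) (\<Phi> 0) \<and>
     (\<forall>i. graded_cover n (fgm n (D i)) (\<lambda>d. {v \<in> free_carrier n (D i). \<Phi> i v =
         0} \<inter> free_part n (D i) d) (D (Suc i)) (\<Phi> (Suc i)))"

lemma cover_chain_shift:
  "cover_chain n ds0 K D \<Phi> \<Longrightarrow> cover_chain n (D 0) {v \<in> free_carrier n (D 0). \<Phi> 0 v = 0} (\<lambda>i. D (Suc i)) (\<lambda>i. \<Phi> (Suc i))"
  by (simp add: cover_chain_def)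

text \<open>\<open>Y\<close> identifies \<open>K\<close> with \<open>K'\<close>, so composing with
  it turns a cover of \<open>K\<close> into one of \<open>K'\<close>, and
  \<open>cover_unique\<close> applies to two covers of the same module. The new identification
  \<open>Z\<close> lives one term further left.\<close>

lemma cover_chain_step:
  fixes K K' :: "(nat \<Rightarrow> 'k::field mpoly) set"
  assumes s: "cover_chain n ds0 K D \<Phi>" "cover_chain n ds0' K' D' \<Phi>'" and Y: "gens n ds0' ds0 Y"
    and inj: "\<And>v. v \<in> free_carrier n ds0 \<Longrightarrow> lincomb (length ds0) v Y = 0 \<Longrightarrow> v = 0"
    and im: "\<And>d. (\<lambda>v. lincomb (length ds0) v Y) ` (K \<inter> free_part n ds0 d) = K' \<inter> free_part n ds0' d"
  shows "(\<forall>j. count_list (D 0) j = count_list (D' 0) j) \<and>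
    (\<exists>Z. gens n (D' 0) (D 0) Z \<and> (\<forall>v\<in>free_carrier n (D 0). \<Phi>' 0 (lincomb (length (D 0)) v Z) =
        lincomb (length ds0) (\<Phi> 0 v) Y) \<and>
      (\<forall>d. (\<lambda>v. lincomb (length (D 0)) v Z) ` free_part n (D 0) d = free_part n (D' 0) d) \<and>
          (\<forall>v\<in>free_carrier n (D 0). lincomb (length (D 0)) v Z = 0 \<longrightarrow> v = 0))"
proof -
  let ?f = "\<lambda>v. lincomb (length ds0) v Y"
  have c: "graded_cover n (fgm n ds0) (\<lambda>d. K \<inter> free_part n ds0 d) (D 0) (\<Phi> 0)" using s(1) by (simp add: cover_chain_def)
  have c': "graded_cover n (fgm n ds0') (\<lambda>d. K' \<inter> free_part n ds0' d) (D' 0) (\<Phi>' 0)" using s(2)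
      by (simp add: cover_chain_def)
  have im: "(\<lambda>v. ?f (\<Phi> 0 v)) ` free_part n (D 0) d = K' \<inter> free_part n ds0' d" for d
    unfolding im[symmetric] graded_coverD(4)[OF c, symmetric] image_image ..
  have c2: "graded_cover n (fgm n ds0') (\<lambda>d. K' \<inter> free_part n ds0' d) (D 0) (\<lambda>v. ?f (\<Phi> 0 v))"
    unfolding graded_cover_def free_simps
  proof (intro conjI ballI allI impI)
    fix v :: "nat \<Rightarrow> 'k mpoly" assume v: "v \<in> free_carrier n (D 0)"
    show "?f (\<Phi> 0 v) \<in> free_carrier n ds0'" using graded_coverD(1)[OF c v]
        by (intro lincomb_free_carrier[OF Y]) (simp add: free_simps)
    show "?f (\<Phi> 0 (v + w)) = ?f (\<Phi> 0 v) + ?f (\<Phi> 0 w)" if w: "w \<in> free_carrier n (D 0)" for w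
      unfolding graded_coverD(2)[OF c v w] free_simps lincomb_add ..
    show "v e \<in> irrelevant_ideal n" if "?f (\<Phi> 0 v) = 0" "e < length (D 0)" for e
    proof (rule graded_coverD(5)[OF c v _ that(2)])
      show "\<Phi> 0 v = \<zero>\<^bsub>fgm n ds0\<^esub>" unfolding free_simps
        by (rule inj[OF _ that(1)]) (use graded_coverD(1)[OF c v] in \<open>simp add: free_simps\<close>)
    qed
  next
    fix p :: "'k mpoly" and v :: "nat \<Rightarrow> 'k mpoly" assume p: "p \<in> polys n" and v: "v \<in> free_carrier n (D 0)"
    show "?f (\<Phi> 0 (pv p v)) = pv p (?f (\<Phi> 0 v))"
      unfolding graded_coverD(3)[OF c p v] free_simps lincomb_pv ..
  qed (rule im)
  interpret two_covers n "fgm n ds0' :: ('k mpoly, _) graded_module" "\<lambda>d. K' \<inter> free_part n ds0' d"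
    by (rule two_covers.intro) (rule abelian_free)
  show ?thesis by (rule cover_unique[OF c2 c'])
qed

text \<open>Because \<open>Z\<close> commutes with the covers and \<open>Y\<close> is injective,
  \<open>Z\<close> maps kernel onto kernel. These are the modules that the shifted chains
  resolve.\<close>

theorem cover_chain_unique:
  fixes K K' :: "(nat \<Rightarrow> 'k::field mpoly) set"
  assumes "cover_chain n ds0 K D \<Phi>" "cover_chain n ds0' K' D' \<Phi>'" "gens n ds0' ds0 Y"
    "\<And>v. v \<in> free_carrier n ds0 \<Longrightarrow> lincomb (length ds0) v Y = 0 \<Longrightarrow> v = 0"
    "\<And>d. (\<lambda>v. lincomb (length ds0) v Y) ` (K \<inter> free_part n ds0 d) = K' \<inter> free_part n ds0' d"
  shows "count_list (D i) j = count_list (D' i) j"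
  using assms
proof (induction i arbitrary: ds0 K D \<Phi> ds0' K' D' \<Phi>' Y)
  case (0 ds0 K D \<Phi> ds0' K' D' \<Phi>' Y)
  show ?case by (rule spec[OF conjunct1[OF cover_chain_step[OF 0]]])
next
  case (Suc i ds0 K D \<Phi> ds0' K' D' \<Phi>' Y)
  from conjunct2[OF cover_chain_step[OF Suc.prems]] obtain Z where Z0: "gens n (D' 0) (D 0) Z \<and>
      (\<forall>v\<in>free_carrier n (D 0). \<Phi>' 0 (lincomb (length (D 0)) v Z) = lincomb (length ds0) (\<Phi> 0 v) Y) \<and>
      (\<forall>d. (\<lambda>v. lincomb (length (D 0)) v Z) ` free_part n (D 0) d = free_part n (D' 0) d) \<and>
          (\<forall>v\<in>free_carrier n (D 0). lincomb (length (D 0)) v Z = 0 \<longrightarrow> v = 0)"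
    by (rule exE)
  note Z = conjunct1[OF Z0] bspec[OF conjunct1[OF conjunct2[OF Z0]]] spec[OF conjunct1[OF conjunct2[OF conjunct2[OF
      Z0]]]]
    bspec[OF conjunct2[OF conjunct2[OF conjunct2[OF Z0]]], THEN mp]
  have c: "graded_cover n (fgm n ds0) (\<lambda>d. K \<inter> free_part n ds0 d) (D 0) (\<Phi> 0)" using Suc.prems(1)
      by (simp add: cover_chain_def)
  show ?case
  proof (rule Suc.IH[OF cover_chain_shift[OF Suc.prems(1)] cover_chain_shift[OF Suc.prems(2)] Z(1) Z(4)])
    fix d
    have z: "\<Phi>' 0 (lincomb (length (D 0)) v Z) = 0 \<longleftrightarrow> \<Phi> 0 v = 0" if v: "v \<in> free_carrier n (D 0)" for v
    proof -
      have "\<Phi> 0 v \<in> free_carrier n ds0" using graded_coverD(1)[OF c v] by (simp add: free_simps)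
      hence "lincomb (length ds0) (\<Phi> 0 v) Y = 0 \<longleftrightarrow> \<Phi> 0 v = 0" using Suc.prems(4) lincomb_0 by metis
      thus ?thesis unfolding Z(2)[OF v] .
    qed
    show "(\<lambda>v. lincomb (length (D 0)) v Z) ` ({v \<in> free_carrier n (D 0). \<Phi> 0 v = 0} \<inter> free_part n (D 0) d) =
       {v \<in> free_carrier n (D' 0). \<Phi>' 0 v = 0} \<inter> free_part n (D' 0) d"
    proof (intro equalityI subsetI)
      fix w assume "w \<in> (\<lambda>v. lincomb (length (D 0)) v Z) ` ({v \<in> free_carrier n (D 0). \<Phi> 0 v =
          0} \<inter> free_part n (D 0) d)"
      then obtain v where v: "v \<in> free_carrier n (D 0)" "\<Phi> 0 v = 0" "v \<in> free_part n (D 0) d" "w =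
          lincomb (length (D 0)) v Z" by blast
      have "w \<in> free_part n (D' 0) d" unfolding v(4) by (rule lincomb_free_part[OF Z(1) v(3)])
      thus "w \<in> {v \<in> free_carrier n (D' 0). \<Phi>' 0 v = 0} \<inter> free_part n (D' 0) d"
          using z[OF v(1)] v(2,4) free_part_free_carrier by blast
    next
      fix w assume "w \<in> {v \<in> free_carrier n (D' 0). \<Phi>' 0 v = 0} \<inter> free_part n (D' 0) d"
      hence w: "\<Phi>' 0 w = 0" "w \<in> free_part n (D' 0) d" by auto
      then obtain v where v: "v \<in> free_part n (D 0) d" "w = lincomb (length (D 0)) v Z" unfolding Z(3)[symmetric]
          by blast
      have "\<Phi> 0 v = 0" using z[OF free_part_free_carrier[OF v(1)]] w(1) v(2) by simp
      thus "w \<in> (\<lambda>v. lincomb (length (D 0)) v Z) ` ({v \<in> free_carrier n (D 0). \<Phi> 0 v = 0} \<inter> free_part n (D 0) d)"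
        using v free_part_free_carrier[OF v(1)] by (intro image_eqI[of _ _ v]) simp_all
    qed
  qed
qed

text \<open>A \<open>graded_module\<close> need not be the direct sum of its components. This property is all that the
  uniqueness of the Betti numbers needs, and it holds for ideals and their quotients.\<close>

definition gsurj :: "nat \<Rightarrow> ('k::field mpoly, 'b) graded_module \<Rightarrow> bool" where
  "gsurj n M \<longleftrightarrow> (\<forall>ds \<epsilon>. \<epsilon> \<in> graded_hom n (fgm n ds) M \<and> \<epsilon> ` free_carrier n ds = carrier M \<longrightarrow>
     (\<forall>d. component M d \<subseteq> \<epsilon> ` free_part n ds d))"

lemma graded_homD:
  assumes "\<epsilon> \<in> graded_hom n (fgm n ds) M"
  shows "v \<in> free_carrier n ds \<Longrightarrow> \<epsilon> v \<in> carrier M"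
    "v \<in> free_carrier n ds \<Longrightarrow> w \<in> free_carrier n ds \<Longrightarrow> \<epsilon> (v + w) = \<epsilon> v \<oplus>\<^bsub>M\<^esub> \<epsilon> w"
    "p \<in> polys n \<Longrightarrow> v \<in> free_carrier n ds \<Longrightarrow> \<epsilon> (pv p v) = p \<odot>\<^bsub>M\<^esub> \<epsilon> v"
    "v \<in> free_part n ds d \<Longrightarrow> \<epsilon> v \<in> component M d"
  using assms unfolding graded_hom_def free_simps poly_ring_simps by blast+

lemma hom_sum:
  assumes e: "\<epsilon> \<in> graded_hom n (fgm n ds) (fgm n ds')" and fin: "finite A" and f: "\<And>a. a \<in> A \<Longrightarrow> f a \<in> free_carrier n ds"
  shows "\<epsilon> (\<Sum>a\<in>A. f a) = (\<Sum>a\<in>A. \<epsilon> (f a))"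
  using fin f
proof induction
  case empty
  have z: "0 \<in> free_carrier n ds" by (rule graded_submoduleD(2)[OF graded_submodule_free_carrier])
  have "\<epsilon> 0 + \<epsilon> 0 = \<epsilon> 0" using graded_homD(2)[OF e z z] by (simp add: free_simps)
  hence "\<epsilon> 0 = 0" by (rule add_cancel_left_left[THEN iffD1])
  thus ?case unfolding sum.empty .
next
  case (insert a A)
  have "(\<Sum>a\<in>A. f a) \<in> free_carrier n ds" using insert.prems
      by (intro graded_submodule_sum[OF graded_submodule_free_carrier]) auto
  hence "\<epsilon> (f a + (\<Sum>a\<in>A. f a)) = \<epsilon> (f a) + \<epsilon> (\<Sum>a\<in>A. f a)"
    using graded_homD(2)[OF e] insert.prems by (simp add: free_simps)
  moreover have "\<epsilon> (\<Sum>a\<in>A. f a) = (\<Sum>a\<in>A. \<epsilon> (f a))" using insert by simp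
  ultimately show ?case by (simp only: sum.insert[OF insert.hyps])
qed

lemma hom_hcv:
  assumes e: "\<epsilon> \<in> graded_hom n (fgm n ds) (fgm n ds')" and v: "v \<in> free_carrier n ds"
  shows "hcv ds' d (\<epsilon> v) = \<epsilon> (hcv ds d v)"
proof -
  obtain A where A: "finite A" "v = (\<Sum>c\<in>A. hcv ds c v)" by (rule hcv_decomp[OF v])
  have f: "hcv ds c v \<in> free_carrier n ds" for c by (rule free_part_free_carrier[OF hcv_free_part[OF v]])
  have h: "hcv ds' d (\<epsilon> (hcv ds c v)) = (if c = d then \<epsilon> (hcv ds d v) else 0)" for c
  proof -
    have "\<epsilon> (hcv ds c v) \<in> free_part n ds' c" using graded_homD(4)[OF e hcv_free_part[OF v]] by (simp add: free_simps)
    thus ?thesis using hcv_id hcv_other by metis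
  qed
  have d0: "\<epsilon> (hcv ds d v) = 0" if "d \<notin> A"
  proof -
    have "hcv ds d v = (\<Sum>c\<in>A. hcv ds d (hcv ds c v))" by (subst (1) A(2)) (rule hcv_sum)
    also have "\<dots> = 0" by (rule sum.neutral) (use that hcv_other[OF hcv_free_part[OF v]] in metis)
    finally have "hcv ds d v = 0" .
    thus ?thesis using hom_sum[OF e, of "{}"] by simp
  qed
  have "\<epsilon> v = (\<Sum>c\<in>A. \<epsilon> (hcv ds c v))" by (subst (1) A(2)) (rule hom_sum[OF e A(1) f])
  hence "hcv ds' d (\<epsilon> v) = (\<Sum>c\<in>A. if c = d then \<epsilon> (hcv ds d v) else 0)"
    by (simp only: hcv_sum h)
  also have "\<dots> = \<epsilon> (hcv ds d v)" using A(1) d0 by (simp only: sum.delta' sum.delta) (metis (full_types))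
  finally show ?thesis .
qed

text \<open>A resolution demands surjectivity and exactness for whole modules, a cover demands them
  degree by degree. For the augmentation \<open>gsurj\<close> bridges the gap, for the differentials
  \<open>hom_hcv\<close> does. Minimality of each cover is that of the following differential, whose
  image is the kernel.\<close>

lemma resolution_cover_chain:
  fixes M :: "('k::field mpoly, 'b) graded_module"
  assumes r: "minimal_graded_free_resolution n M ds \<phi> \<epsilon>" and M: "gsurj n M"
  shows "graded_cover n M (component M) (ds 0) \<epsilon> \<and>
    cover_chain n (ds 0) {v \<in> free_carrier n (ds 0). \<epsilon> v = \<zero>\<^bsub>M\<^esub>} (\<lambda>i. ds (Suc i)) \<phi>"
proof -
  note r = r[unfolded minimal_graded_free_resolution_def Let_def free_simps One_nat_def]
  note r2 = conjunct2[OF r] note r3 = conjunct2[OF r2] note r4 = conjunct2[OF r3]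
  note r5 = conjunct2[OF r4] note r6 = conjunct2[OF r5]
  have e: "\<epsilon> \<in> graded_hom n (fgm n (ds 0)) M" by (rule conjunct1[OF r])
  have p: "\<phi> i \<in> graded_hom n (fgm n (ds (Suc i))) (fgm n (ds i))" for i by (rule spec[OF conjunct1[OF r2]])
  have eim: "\<epsilon> ` free_carrier n (ds 0) = carrier M" by (rule conjunct1[OF r3])
  have k0: "\<phi> 0 ` free_carrier n (ds (Suc 0)) = {v \<in> free_carrier n (ds 0). \<epsilon> v = \<zero>\<^bsub>M\<^esub>}" by (rule conjunct1[OF r4])
  have k: "\<phi> (Suc i) ` free_carrier n (ds (Suc (Suc i))) = {v \<in> free_carrier n (ds (Suc i)). \<phi> i v = 0}" for i
    by (rule spec[OF conjunct1[OF r5]])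
  have m: "\<phi> i v e \<in> irrelevant_ideal n" if "v \<in> free_carrier n (ds (Suc i))" "e < length (ds i)" for i v e
    using r6 that by simp
  have 1: "graded_cover n M (component M) (ds 0) \<epsilon>"
    unfolding graded_cover_def
  proof (intro conjI ballI allI impI)
    show "\<epsilon> ` free_part n (ds 0) d = component M d" for d
    proof (intro equalityI image_subsetI)
      show "component M d \<subseteq> \<epsilon> ` free_part n (ds 0) d"
        using M[unfolded gsurj_def, rule_format, of \<epsilon> "ds 0" d] e eim by simp
    qed (rule graded_homD(4)[OF e])
    fix v e assume v: "v \<in> free_carrier n (ds 0)" and z: "\<epsilon> v = \<zero>\<^bsub>M\<^esub>" and l: "e < length (ds 0)"
    have "v \<in> \<phi> 0 ` free_carrier n (ds (Suc 0))" unfolding k0 using v z by simp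
    thus "v e \<in> irrelevant_ideal n" using m[OF _ l] by auto
  qed (use graded_homD[OF e] in auto)
  have gen: "graded_cover n (fgm n (ds i)) (\<lambda>d. K \<inter> free_part n (ds i) d) (ds (Suc i)) (\<phi> i)"
    if K: "\<phi> i ` free_carrier n (ds (Suc i)) = K" for i K
    unfolding graded_cover_def free_simps
  proof (intro conjI ballI allI impI)
    show "\<phi> i ` free_part n (ds (Suc i)) d = K \<inter> free_part n (ds i) d" for d
    proof (intro equalityI subsetI)
      fix w assume "w \<in> \<phi> i ` free_part n (ds (Suc i)) d"
      then obtain v where v: "v \<in> free_part n (ds (Suc i)) d" "w = \<phi> i v" by (metis imageE)
      have "w \<in> free_part n (ds i) d" using graded_homD(4)[OF p v(1)] v(2) by (simp add: free_simps)
      moreover have "w \<in> K" unfolding v(2) K[symmetric] by (rule imageI[OF free_part_free_carrier[OF v(1)]])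
      ultimately show "w \<in> K \<inter> free_part n (ds i) d" by simp
    next
      fix w assume w: "w \<in> K \<inter> free_part n (ds i) d"
      hence "w \<in> \<phi> i ` free_carrier n (ds (Suc i))" using K by simp
      then obtain v where v: "w = \<phi> i v" "v \<in> free_carrier n (ds (Suc i))" by (rule imageE)
      have "w = hcv (ds i) d w" using w hcv_id by (metis IntD2)
      also have "\<dots> = \<phi> i (hcv (ds (Suc i)) d v)" unfolding v(1) by (rule hom_hcv[OF p v(2)])
      finally show "w \<in> \<phi> i ` free_part n (ds (Suc i)) d" using hcv_free_part[OF v(2)] by (rule image_eqI)
    qed
    fix v e assume v: "v \<in> free_carrier n (ds (Suc i))" and z: "\<phi> i v = 0" and l: "e < length (ds (Suc i))"
    have "v \<in> \<phi> (Suc i) ` free_carrier n (ds (Suc (Suc i)))" unfolding k using v z by simp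
    thus "v e \<in> irrelevant_ideal n" using m[OF _ l] by auto
  qed (use graded_homD[OF p] in \<open>auto simp: free_simps\<close>)
  have "cover_chain n (ds 0) {v \<in> free_carrier n (ds 0). \<epsilon> v = \<zero>\<^bsub>M\<^esub>} (\<lambda>i. ds (Suc i)) \<phi>"
    unfolding cover_chain_def using gen[OF k0] gen[OF k] by simp
  thus ?thesis using 1 by blast
qed

theorem resolution_unique:
  fixes M :: "('k::field mpoly, 'b) graded_module"
  assumes r: "minimal_graded_free_resolution n M ds \<phi> \<epsilon>" "minimal_graded_free_resolution n M ds' \<phi>' \<epsilon>'"
    and M: "gsurj n M" "Module.module (poly_ring n) M"
  shows "count_list (ds i) j = count_list (ds' i) j"
proof -
  note c = resolution_cover_chain[OF r(1) M(1)] and c' = resolution_cover_chain[OF r(2) M(1)]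
  interpret two_covers n M "component M"
    by (rule two_covers.intro) (rule Module.module.axioms(2)[OF M(2)])
  note cu = cover_unique[OF conjunct1[OF c] conjunct1[OF c']]
  note cnt = spec[OF conjunct1[OF cu]]
  from conjunct2[OF cu] obtain Z where Z0: "gens n (ds' 0) (ds 0) Z \<and>
      (\<forall>v\<in>free_carrier n (ds 0). \<epsilon>' (lincomb (length (ds 0)) v Z) = \<epsilon> v) \<and>
      (\<forall>d. (\<lambda>v. lincomb (length (ds 0)) v Z) ` free_part n (ds 0) d = free_part n (ds' 0) d) \<and>
          (\<forall>v\<in>free_carrier n (ds 0). lincomb (length (ds 0)) v Z = 0 \<longrightarrow> v = 0)"
    by (rule exE)
  note Z = conjunct1[OF Z0] bspec[OF conjunct1[OF conjunct2[OF Z0]]] spec[OF conjunct1[OF conjunct2[OF conjunct2[OF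
      Z0]]]]
    bspec[OF conjunct2[OF conjunct2[OF conjunct2[OF Z0]]], THEN mp]
  show ?thesis
  proof (cases i)
    case 0
    thus ?thesis using cnt by simp
  next
    case (Suc i')
    have "count_list (ds (Suc i')) j = count_list (ds' (Suc i')) j"
    proof (rule cover_chain_unique[OF conjunct2[OF c] conjunct2[OF c'] Z(1) Z(4)])
      fix d
      show "(\<lambda>v. lincomb (length (ds 0)) v Z) ` ({v \<in> free_carrier n (ds 0). \<epsilon> v = \<zero>\<^bsub>M\<^esub>} \<inter> free_part n (ds 0) d) =
          {v \<in> free_carrier n (ds' 0). \<epsilon>' v = \<zero>\<^bsub>M\<^esub>} \<inter> free_part n (ds' 0) d"
      proof (intro equalityI subsetI)
        fix w assume "w \<in> (\<lambda>v. lincomb (length (ds 0)) v Z) ` ({v \<in> free_carrier n (ds 0). \<epsilon> v =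
            \<zero>\<^bsub>M\<^esub>} \<inter> free_part n (ds 0) d)"
        then obtain v where v: "v \<in> free_carrier n (ds 0)" "\<epsilon> v = \<zero>\<^bsub>M\<^esub>" "v \<in> free_part n (ds 0) d" "w =
            lincomb (length (ds 0)) v Z" by blast
        have "w \<in> free_part n (ds' 0) d" unfolding v(4) by (rule lincomb_free_part[OF Z(1) v(3)])
        thus "w \<in> {v \<in> free_carrier n (ds' 0). \<epsilon>' v = \<zero>\<^bsub>M\<^esub>} \<inter> free_part n (ds' 0) d"
            using Z(2)[OF v(1)] v(2,4) free_part_free_carrier by auto
      next
        fix w assume "w \<in> {v \<in> free_carrier n (ds' 0). \<epsilon>' v = \<zero>\<^bsub>M\<^esub>} \<inter> free_part n (ds' 0) d"
        hence w: "\<epsilon>' w = \<zero>\<^bsub>M\<^esub>" "w \<in> free_part n (ds' 0) d" by auto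
        then obtain v where v: "v \<in> free_part n (ds 0) d" "w = lincomb (length (ds 0)) v Z" unfolding Z(3)[symmetric]
            by blast
        have "\<epsilon> v = \<zero>\<^bsub>M\<^esub>" using Z(2)[OF free_part_free_carrier[OF v(1)]] w(1) v(2) by simp
        thus "w \<in> (\<lambda>v. lincomb (length (ds 0)) v Z) ` ({v \<in> free_carrier n (ds 0). \<epsilon> v = \<zero>\<^bsub>M\<^esub>} \<inter> free_part n (ds 0) d)"
          using v free_part_free_carrier[OF v(1)] by (intro image_eqI[of _ _ v]) simp_all
      qed
    qed
    thus ?thesis using Suc by simp
  qed
qed

theorem betti_eq_count:
  fixes M :: "('k::field mpoly, 'b) graded_module"
  assumes "minimal_graded_free_resolution n M ds \<phi> \<epsilon>" "gsurj n M" "Module.module (poly_ring n) M"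
  shows "betti n M i j = count_list (ds i) j"
  unfolding betti_def
proof (rule the_equality)
  show "\<exists>ds' \<phi> \<epsilon>. minimal_graded_free_resolution n M ds' \<phi> \<epsilon> \<and> count_list (ds i) j = count_list (ds' i) j"
    using assms(1) by blast
  fix b assume "\<exists>ds' \<phi> \<epsilon>. minimal_graded_free_resolution n M ds' \<phi> \<epsilon> \<and> b = count_list (ds' i) j"
  thus "b = count_list (ds i) j" using resolution_unique[OF _ assms] by blast
qed

section \<open>Resolutions of ideals and of their quotients\<close>

text \<open>An ideal as a submodule of the free module of rank one generated in degree 0, so that
  the results on submodules apply.\<close>

definition emb :: "'k::field mpoly set \<Rightarrow> (nat \<Rightarrow> 'k mpoly) set" where
  "emb I = {v. v 0 \<in> I \<and> (\<forall>e>0. v e = 0)}"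

definition inj0 :: "'k::field mpoly \<Rightarrow> nat \<Rightarrow> 'k mpoly" where
  "inj0 p = (\<lambda>e. if e = 0 then p else 0)"

lemma inj0_emb: "inj0 p \<in> emb I \<longleftrightarrow> p \<in> I" "inj0 p 0 = p"
  by (simp_all add: inj0_def emb_def)

lemma emb_eq: "v \<in> emb I \<Longrightarrow> v = inj0 (v 0)"
  by (auto simp: emb_def inj0_def fun_eq_iff)

lemma graded_submodule_emb:
  fixes I :: "'k::field mpoly set"
  assumes I: "graded_ideal n I" shows "graded_submodule n [0] (emb I)"
  unfolding graded_submodule_def
proof (intro conjI ballI allI)
  show "emb I \<subseteq> free_carrier n [0]" using graded_idealD(1)[OF I] by (auto simp: emb_def free_carrier_def)
qed (auto simp: emb_def graded_idealD[OF I] hcv_def)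

text \<open>\<open>D l\<close> lists the degrees in the \<open>l\<close>-th term of the resolution
  of \<open>I\<close>, which is the term \<open>l + 1\<close> for the quotient by
  \<open>I\<close>.\<close>

definition minimal_chain :: "nat \<Rightarrow> 'k::field mpoly set \<Rightarrow> (nat \<Rightarrow> int list) \<Rightarrow> (nat \<Rightarrow> nat \<Rightarrow> nat \<Rightarrow> 'k mpoly) \<Rightarrow> bool" where
  "minimal_chain n I D Y \<longleftrightarrow> minimal_cover n [0] (emb I) (D 0) (Y 0) \<and>
     (\<forall>i. minimal_cover n (D i) (relations n (D i) (Y i)) (D (Suc i)) (Y (Suc i)))"

lemma exists_minimal_chain: "graded_ideal n I \<Longrightarrow> \<exists>D Y. minimal_chain n I D Y"
  unfolding minimal_chain_def by (rule exists_minimal_sequence[OF graded_submodule_emb])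

lemma minimal_coverD:
  assumes "minimal_cover n ds K ds' Y"
  shows "gens n ds ds' Y" "(\<lambda>v. lincomb (length ds') v Y) ` free_carrier n ds' = K"
    "v \<in> relations n ds' Y \<Longrightarrow> e < length ds' \<Longrightarrow> v e \<in> irrelevant_ideal n"
  using assms unfolding minimal_cover_def relations_def by blast+

lemma msqD:
  assumes "minimal_chain n I D Y"
  shows "minimal_cover n [0] (emb I) (D 0) (Y 0)"
      "minimal_cover n (D i) (relations n (D i) (Y i)) (D (Suc i)) (Y (Suc i))"
  using assms by (simp_all add: minimal_chain_def)

lemma lincomb_graded_hom:
  assumes "gens n ds ds' Y"
  shows "(\<lambda>v. lincomb (length ds') v Y) \<in> graded_hom n (fgm n ds') (fgm n ds)"
  unfolding graded_hom_def free_simps poly_ring_simps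
  using lincomb_free_carrier[OF assms] lincomb_free_part[OF assms]
      by (auto simp: lincomb_add lincomb_pv image_subset_iff)

lemma ideal_module_simps:
  "carrier (ideal_module n I) = I" "x \<oplus>\<^bsub>ideal_module n I\<^esub> y = x + y" "p \<odot>\<^bsub>ideal_module n I\<^esub> x = p * x"
  "\<zero>\<^bsub>ideal_module n I\<^esub> = 0" "component (ideal_module n I) d = graded_part n I d"
  by (simp_all add: ideal_module_def graded_part_def)

lemma graded_ideal_ideal: fixes I :: "'k::field mpoly set" assumes I: "graded_ideal n I" shows "ideal I (poly_ring n)"
proof (rule idealI)
  show "ring (poly_ring n :: 'k mpoly ring)" using cring_poly_ring by (rule cring.axioms(1))
  show "subgroup I (add_monoid (poly_ring n))"
  proof (rule group.subgroupI)
    show "group (add_monoid (poly_ring n :: 'k mpoly ring))"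
      by (rule abelian_group.a_group[OF ring.is_abelian_group[OF cring.axioms(1)[OF cring_poly_ring]]])
    show "I \<subseteq> carrier (add_monoid (poly_ring n))" using graded_idealD(1)[OF I] by (auto simp: poly_ring_def)
    show "I \<noteq> {}" using graded_idealD(2)[OF I] by auto
    fix a b assume "a \<in> I" "b \<in> I"
    thus "a \<otimes>\<^bsub>add_monoid (poly_ring n)\<^esub> b \<in> I" using graded_idealD(3)[OF I] by (simp add: poly_ring_def)
  next
    fix a assume a: "a \<in> I"
    interpret R: cring "poly_ring n :: 'k mpoly ring" by (rule cring_poly_ring)
    have aP: "a \<in> carrier (poly_ring n)" using graded_idealD(1)[OF I a] by (simp add: poly_ring_simps)
    have "\<ominus>\<^bsub>poly_ring n\<^esub> a = - a"
      by (rule R.minus_equality) (use aP in \<open>simp_all add: poly_ring_simps polys_closed\<close>)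
    thus "inv\<^bsub>add_monoid (poly_ring n)\<^esub> a \<in> I" using graded_ideal_uminus[OF I a] by (simp add: a_inv_def)
  qed
qed (use graded_idealD(4,5)[OF I] in \<open>auto simp: poly_ring_simps\<close>)

lemma ideal_resolution:
  fixes I :: "'k::field mpoly set"
  assumes I: "graded_ideal n I" and s: "minimal_chain n I D Y"
  shows "minimal_graded_free_resolution n (ideal_module n I) D
    (\<lambda>i v. lincomb (length (D (Suc i))) v (Y (Suc i))) (\<lambda>v. lincomb (length (D 0)) v (Y 0) 0)"
  unfolding minimal_graded_free_resolution_def Let_def free_simps ideal_module_simps One_nat_def
proof (intro conjI allI ballI impI)
  note c0 = msqD(1)[OF s] and c = msqD(2)[OF s]
  have emb: "lincomb (length (D 0)) v (Y 0) \<in> emb I" if "v \<in> free_carrier n (D 0)" for v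
    using minimal_coverD(2)[OF c0] that by blast
  show "(\<lambda>v. lincomb (length (D 0)) v (Y 0) 0) \<in> graded_hom n (fgm n (D 0)) (ideal_module n I)"
    unfolding graded_hom_def free_simps poly_ring_simps ideal_module_simps
  proof (intro CollectI conjI ballI allI funcsetI image_subsetI)
    fix v :: "nat \<Rightarrow> 'k mpoly" assume "v \<in> free_carrier n (D 0)"
    thus "lincomb (length (D 0)) v (Y 0) 0 \<in> I" using emb by (simp add: emb_def)
  next
    fix d and v :: "nat \<Rightarrow> 'k mpoly" assume v: "v \<in> free_part n (D 0) d"
    have "lincomb (length (D 0)) v (Y 0) \<in> free_part n [0] d" by (rule lincomb_free_part[OF minimal_coverD(1)[OF c0] v])
    thus "lincomb (length (D 0)) v (Y 0) 0 \<in> graded_part n I d"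
      using emb[OF free_part_free_carrier[OF v]] by (simp add: graded_part_def emb_def free_part_def)
  qed (simp_all add: lincomb_add lincomb_pv)
  show "(\<lambda>v. lincomb (length (D (Suc i))) v (Y (Suc i))) \<in> graded_hom n (fgm n (D (Suc i))) (fgm n (D i))" for i
    by (rule lincomb_graded_hom[OF minimal_coverD(1)[OF c]])
  show "(\<lambda>v. lincomb (length (D 0)) v (Y 0) 0) ` free_carrier n (D 0) = I"
  proof (intro equalityI subsetI)
    fix p assume "p \<in> I"
    hence "inj0 p \<in> (\<lambda>v. lincomb (length (D 0)) v (Y 0)) ` free_carrier n (D 0)" unfolding minimal_coverD(2)[OF c0]
        by (simp add: inj0_emb)
    then obtain v where "inj0 p = lincomb (length (D 0)) v (Y 0)" "v \<in> free_carrier n (D 0)" by (rule imageE)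
    thus "p \<in> (\<lambda>v. lincomb (length (D 0)) v (Y 0) 0) ` free_carrier n (D 0)" using inj0_emb(2)[of p]
        by (intro image_eqI[of _ _ v]) simp_all
  qed (use emb in \<open>auto simp: emb_def\<close>)
  have ker0: "relations n (D 0) (Y 0) = {v \<in> free_carrier n (D 0). lincomb (length (D 0)) v (Y 0) 0 = 0}"
    unfolding relations_def
  proof (intro Collect_cong conj_cong refl)
    fix v :: "nat \<Rightarrow> 'k mpoly" assume "v \<in> free_carrier n (D 0)"
    from emb_eq[OF emb[OF this]] show "(lincomb (length (D 0)) v (Y 0) = 0) = (lincomb (length (D 0)) v (Y 0) 0 = 0)"
      by (metis inj0_def zero_fun_apply ext)
  qed
  show "(\<lambda>v. lincomb (length (D (Suc 0))) v (Y (Suc 0))) ` free_carrier n (D (Suc 0)) =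
      {v \<in> free_carrier n (D 0). lincomb (length (D 0)) v (Y 0) 0 = 0}"
    unfolding ker0[symmetric] by (rule minimal_coverD(2)[OF c])
  show "(\<lambda>v. lincomb (length (D (Suc (Suc i)))) v (Y (Suc (Suc i)))) ` free_carrier n (D (Suc (Suc i))) =
      {v \<in> free_carrier n (D (Suc i)). lincomb (length (D (Suc i))) v (Y (Suc i)) = 0}" for i
    unfolding relations_def[symmetric] by (rule minimal_coverD(2)[OF c])
  fix i e and v :: "nat \<Rightarrow> 'k mpoly" assume v: "v \<in> free_carrier n (D (Suc i))" and e: "e < length (D i)"
  have "lincomb (length (D (Suc i))) v (Y (Suc i)) \<in> relations n (D i) (Y i)"
    unfolding minimal_coverD(2)[OF c, symmetric] using v by (rule imageI)
  thus "lincomb (length (D (Suc i))) v (Y (Suc i)) e \<in> irrelevant_ideal n"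
    using minimal_coverD(3)[OF c0, of _ e] minimal_coverD(3)[OF c, of _ "i - 1" e] e by (cases i) auto
qed

text \<open>The ideal sits in a free module of rank one, and graded maps between free modules
  commute with taking components.\<close>

lemma gsurj_ideal: fixes I :: "'k::field mpoly set" assumes I: "graded_ideal n I" shows "gsurj n (ideal_module n I)"
  unfolding gsurj_def ideal_module_simps
proof (intro allI impI subsetI, elim conjE)
  fix ds \<epsilon> d p assume e: "\<epsilon> \<in> graded_hom n (fgm n ds) (ideal_module n I)" and im: "\<epsilon> ` free_carrier n ds = I"
      and p: "p \<in> graded_part n I d"
  have h: "(\<lambda>v. inj0 (\<epsilon> v)) \<in> graded_hom n (fgm n ds) (fgm n [0])"
    unfolding graded_hom_def free_simps poly_ring_simps
  proof (intro CollectI conjI ballI allI funcsetI image_subsetI)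
    fix v :: "nat \<Rightarrow> 'k mpoly" assume v: "v \<in> free_carrier n ds"
    have "\<epsilon> v \<in> I" using graded_homD(1)[OF e v] by (simp add: ideal_module_simps)
    thus "inj0 (\<epsilon> v) \<in> free_carrier n [0]" using graded_idealD(1)[OF I] by (simp add: free_carrier_def inj0_def)
    show "inj0 (\<epsilon> (v + w)) = inj0 (\<epsilon> v) + inj0 (\<epsilon> w)" if "w \<in> free_carrier n ds" for w
      using graded_homD(2)[OF e v that] by (simp add: ideal_module_simps inj0_def fun_eq_iff)
  next
    fix p :: "'k mpoly" and v :: "nat \<Rightarrow> 'k mpoly" assume "p \<in> polys n" "v \<in> free_carrier n ds"
    thus "inj0 (\<epsilon> (pv p v)) = pv p (inj0 (\<epsilon> v))"
      using graded_homD(3)[OF e] by (simp add: ideal_module_simps inj0_def fun_eq_iff)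
  next
    fix d and v :: "nat \<Rightarrow> 'k mpoly" assume "v \<in> free_part n ds d"
    hence "\<epsilon> v \<in> graded_part n I d" using graded_homD(4)[OF e] by (simp add: ideal_module_simps)
    thus "inj0 (\<epsilon> v) \<in> free_part n [0] d" using S_polys
        by (auto simp: free_part_def free_carrier_def inj0_def graded_part_def)
  qed
  have "p \<in> \<epsilon> ` free_carrier n ds" using p im by (simp add: graded_part_def)
  then obtain v where v: "p = \<epsilon> v" "v \<in> free_carrier n ds" by (rule imageE)
  have "hcv [0] d (inj0 (\<epsilon> v)) 0 = inj0 (\<epsilon> (hcv ds d v)) 0" using hom_hcv[OF h v(2), of d] by simp
  hence "hc d p = \<epsilon> (hcv ds d v)" by (simp add: hcv_apply inj0_emb v(1))
  moreover have "hc d p = p" using p hc_id[of p n d] by (simp add: graded_part_def)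
  ultimately show "p \<in> \<epsilon> ` free_part n ds d" using hcv_free_part[OF v(2), of d]
      by (intro image_eqI[of _ _ "hcv ds d v"]) simp_all
qed

lemma betti_ideal:
  assumes I: "graded_ideal n I" and s: "minimal_chain n I D Y"
  shows "betti n (ideal_module n I) i j = count_list (D i) j"
  by (rule betti_eq_count[OF ideal_resolution[OF I s] gsurj_ideal[OF I] module_ideal_module[OF graded_ideal_ideal[OF
    I]]])

section \<open>The quotient by a graded ideal\<close>

definition coset_of :: "nat \<Rightarrow> 'k::field mpoly set \<Rightarrow> 'k mpoly \<Rightarrow> 'k mpoly set" where
  "coset_of n I p = I +>\<^bsub>poly_ring n\<^esub> p"

context
  fixes n and I :: "'k::field mpoly set"
  assumes I: "graded_ideal n I"
begin

lemma coset_of_eq_iff: "coset_of n I p = coset_of n I q \<longleftrightarrow> p - q \<in> I"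
proof -
  have c: "coset_of n I p = {h + p | h. h \<in> I}" for p by (auto simp: coset_of_def a_r_coset_def' poly_ring_simps)
  show ?thesis
  proof
    assume "coset_of n I p = coset_of n I q"
    moreover have "p \<in> coset_of n I p" unfolding c using graded_idealD(2)[OF I] by (auto intro!: exI[of _ 0])
    ultimately obtain h where "p = h + q" "h \<in> I" unfolding c by blast
    thus "p - q \<in> I" by simp
  next
    have sub: "coset_of n I p \<subseteq> coset_of n I q" if "p - q \<in> I" for p q
    proof
      fix x assume "x \<in> coset_of n I p"
      then obtain h where h: "x = h + p" "h \<in> I" unfolding c by blast
      have "x = (h + (p - q)) + q" by (simp add: h)
      thus "x \<in> coset_of n I q" unfolding c using graded_idealD(3)[OF I h(2) that] by blast
    qed
    assume pq: "p - q \<in> I"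
    hence "q - p \<in> I" using graded_ideal_uminus[OF I pq] by simp
    thus "coset_of n I p = coset_of n I q" using sub pq by blast
  qed
qed

lemma quotient_simps:
  "carrier (quotient_module n I) = coset_of n I ` polys n"
  "p \<in> polys n \<Longrightarrow> q \<in> polys n \<Longrightarrow> coset_of n I p \<oplus>\<^bsub>quotient_module n I\<^esub> coset_of n I q = coset_of n I (p + q)"
  "p \<in> polys n \<Longrightarrow> q \<in> polys n \<Longrightarrow> p \<odot>\<^bsub>quotient_module n I\<^esub> coset_of n I q = coset_of n I (p * q)"
  "\<zero>\<^bsub>quotient_module n I\<^esub> = coset_of n I 0"
  "component (quotient_module n I) d = coset_of n I ` S n d"
proof -
  interpret ideal I "poly_ring n" by (rule graded_ideal_ideal[OF I])
  have h: "coset_of n I \<in> ring_hom (poly_ring n) (poly_ring n Quot I)"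
    using rcos_ring_hom by (simp add: coset_of_def[abs_def])
  show "carrier (quotient_module n I) = coset_of n I ` polys n"
    by (auto simp: quotient_module_def Let_def FactRing_def A_RCOSETS_def' coset_of_def poly_ring_simps)
  show "p \<in> polys n \<Longrightarrow> q \<in> polys n \<Longrightarrow> coset_of n I p \<oplus>\<^bsub>quotient_module n I\<^esub> coset_of n I q = coset_of n I (p + q)"
    using ring_hom_add[OF h, of p q] by (simp add: quotient_module_def Let_def poly_ring_simps)
  show "p \<in> polys n \<Longrightarrow> q \<in> polys n \<Longrightarrow> p \<odot>\<^bsub>quotient_module n I\<^esub> coset_of n I q = coset_of n I (p * q)"
    using ring_hom_mult[OF h, of p q] by (simp add: quotient_module_def Let_def poly_ring_simps flip: coset_of_def)
  have "coset_of n I 0 = I" by (auto simp: coset_of_def a_r_coset_def' poly_ring_simps)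
  thus "\<zero>\<^bsub>quotient_module n I\<^esub> = coset_of n I 0" by (simp add: quotient_module_def Let_def FactRing_def)
  show "component (quotient_module n I) d = coset_of n I ` S n d"
    by (simp add: quotient_module_def Let_def coset_of_def)
qed

text \<open>The target is not free, so the images of the basis vectors are first lifted to
  homogeneous polynomials \<open>q c\<close>. The map is then a combination of the
  \<open>q c\<close> followed by passage to cosets, and components can be taken in the polynomial
  ring.\<close>

lemma gsurj_quotient: "gsurj n (quotient_module n I)"
  unfolding gsurj_def quotient_simps
proof (intro allI impI subsetI, elim conjE)
  let ?numerator = "quotient_module n I"
  fix ds \<epsilon> d x assume e: "\<epsilon> \<in> graded_hom n (fgm n ds) ?numerator"
      and im: "\<epsilon> ` free_carrier n ds = coset_of n I ` polys n"
    and x: "x \<in> coset_of n I ` S n d"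
  have "\<exists>q. q \<in> S n (ds ! c) \<and> \<epsilon> (bas c) = coset_of n I q" if "c < length ds" for c
    using graded_homD(4)[OF e bas_free_part[OF that]] by (auto simp: quotient_simps)
  then obtain q where q: "\<And>c. c < length ds \<Longrightarrow> q c \<in> S n (ds ! c)" "\<And>c. c < length ds \<Longrightarrow> \<epsilon> (bas c) = coset_of n I (q c)"
      by metis
  have ev: "\<epsilon> v = coset_of n I (\<Sum>c<length ds. v c * q c)" if v: "v \<in> free_carrier n ds" for v
  proof -
    have "(\<Sum>c<r. pv (v c) (bas c)) \<in> free_carrier n ds \<and> (\<Sum>c<r. v c * q c) \<in> polys n \<and>
      \<epsilon> (\<Sum>c<r. pv (v c) (bas c)) = coset_of n I (\<Sum>c<r. v c * q c)" if "r \<le> length ds" for r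
      using that
    proof (induction r)
      case 0
      have z: "0 \<in> free_carrier n ds" by (rule graded_submoduleD(2)[OF graded_submodule_free_carrier])
      have "\<epsilon> (pv 0 0) = 0 \<odot>\<^bsub>?numerator\<^esub> \<epsilon> 0" using graded_homD(3)[OF e _ z] polys_closed(3) by blast
      moreover obtain p where "p \<in> polys n" "\<epsilon> 0 = coset_of n I p" using graded_homD(1)[OF e z]
          by (auto simp: quotient_simps)
      moreover have "pv 0 0 = (0 :: nat \<Rightarrow> 'k mpoly)" by (rule ext) simp
      ultimately have "\<epsilon> 0 = coset_of n I 0" using quotient_simps(3)[OF polys_closed(3), of p] by simp
      thus ?case using z polys_closed(3) unfolding lessThan_0 sum.empty by blast
    next
      case (Suc r)
      have r: "r < length ds" using Suc.prems by simp
      have vr: "v r \<in> polys n" by (rule free_carrier_polys[OF v])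
      have br: "bas r \<in> free_carrier n ds" by (rule free_part_free_carrier[OF bas_free_part[OF r]])
      note pb = graded_submoduleD(4)[OF graded_submodule_free_carrier vr br]
      have qr: "q r \<in> polys n" by (rule S_polys[OF q(1)[OF r]])
      have IH: "(\<Sum>c<r. pv (v c) (bas c)) \<in> free_carrier n ds" "(\<Sum>c<r. v c * q c) \<in> polys n"
        "\<epsilon> (\<Sum>c<r. pv (v c) (bas c)) = coset_of n I (\<Sum>c<r. v c * q c)" using Suc.IH[OF less_imp_le[OF r]] by blast+
      have "\<epsilon> ((\<Sum>c<r. pv (v c) (bas c)) + pv (v r) (bas r)) = coset_of n I ((\<Sum>c<r. v c * q c) + v r * q r)"
        unfolding graded_homD(2)[OF e IH(1) pb] graded_homD(3)[OF e vr br] IH(3) q(2)[OF r]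
          quotient_simps(3)[OF vr qr] quotient_simps(2)[OF IH(2) polys_closed(5)[OF vr qr]] ..
      thus ?case unfolding sum.lessThan_Suc
        using graded_submoduleD(3)[OF graded_submodule_free_carrier IH(1) pb] polys_closed(1)[OF IH(2)
            polys_closed(5)[OF vr qr]] by blast
    qed
    from this[of "length ds"] show ?thesis using bas_expand[OF v] by simp
  qed
  obtain p where p: "p \<in> S n d" "x = coset_of n I p" using x by blast
  have "x \<in> \<epsilon> ` free_carrier n ds" unfolding im p(2) by (rule imageI[OF S_polys[OF p(1)]])
  then obtain v where v: "x = \<epsilon> v" "v \<in> free_carrier n ds" by (rule imageE)
  have "p - (\<Sum>c<length ds. v c * q c) \<in> I" using ev[OF v(2)] v(1) p(2) coset_of_eq_iff by metis
  hence "hc d (p - (\<Sum>c<length ds. v c * q c)) \<in> I" by (rule graded_idealD(6)[OF I])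
  also have "hc d (p - (\<Sum>c<length ds. v c * q c)) = p - (\<Sum>c<length ds. hcv ds d v c * q c)"
  proof -
    have "hc d (v c * q c) = hcv ds d v c * q c" if "c < length ds" for c
      using hc_mult[OF q(1)[OF that] free_carrier_polys[OF v(2)], of d c] by (simp add: hcv_apply mult.commute)
    thus ?thesis using p(1) by (simp add: hc_id)
  qed
  finally have "x = \<epsilon> (hcv ds d v)"
      unfolding p(2) ev[OF free_part_free_carrier[OF hcv_free_part[OF v(2)]]] coset_of_eq_iff .
  thus "x \<in> \<epsilon> ` free_part n ds d" using hcv_free_part[OF v(2)] by (rule image_eqI)
qed

text \<open>The resolution of \<open>I\<close> is prolonged by the polynomial ring itself. The
  prolonged complex is minimal because a proper graded ideal lies in the irrelevant ideal: the
  constant term of an element is its component of degree 0, and a nonzero one would be a unit in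
  \<open>I\<close>.\<close>

lemma quotient_resolution:
  assumes p: "1 \<notin> I" and s: "minimal_chain n I D Y"
  shows "minimal_graded_free_resolution n (quotient_module n I) (\<lambda>i. case i of 0 \<Rightarrow> [0] | Suc i \<Rightarrow> D i)
    (\<lambda>i v. lincomb (length (D i)) v (Y i)) (\<lambda>v. coset_of n I (v 0))"
  unfolding minimal_graded_free_resolution_def Let_def free_simps One_nat_def nat.case quotient_simps
proof (intro conjI allI ballI impI)
  let ?d = "\<lambda>i. case i of 0 \<Rightarrow> [0] | Suc i \<Rightarrow> D i"
  note c0 = msqD(1)[OF s] and c = msqD(2)[OF s]
  show "(\<lambda>v. coset_of n I (v 0)) \<in> graded_hom n (fgm n [0]) (quotient_module n I)"
    unfolding graded_hom_def free_simps poly_ring_simps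
    by (auto simp: quotient_simps free_carrier_polys free_part_def)
  have k0: "emb I = {v \<in> free_carrier n [0]. coset_of n I (v 0) = coset_of n I 0}"
    using graded_idealD(1)[OF I] by (auto simp: coset_of_eq_iff emb_def free_carrier_def)
  have img: "(\<lambda>v. lincomb (length (D i)) v (Y i)) ` free_carrier n (D i) =
      (case i of 0 \<Rightarrow> emb I | Suc i \<Rightarrow> relations n (D i) (Y i))" for i
    by (cases i) (simp_all add: minimal_coverD(2)[OF c0] minimal_coverD(2)[OF c])
  show "(\<lambda>v. lincomb (length (D i)) v (Y i)) \<in> graded_hom n (fgm n (D i)) (fgm n (?d i))" for i
    by (cases i) (simp_all add: lincomb_graded_hom[OF minimal_coverD(1)[OF c0]] lincomb_graded_hom[OF
      minimal_coverD(1)[OF c]])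
  show "(\<lambda>v. coset_of n I (v 0)) ` free_carrier n [0] = coset_of n I ` polys n"
  proof (intro equalityI subsetI)
    fix x assume "x \<in> coset_of n I ` polys n"
    then obtain q where "q \<in> polys n" "x = coset_of n I q" by blast
    thus "x \<in> (\<lambda>v. coset_of n I (v 0)) ` free_carrier n [0]"
        by (intro image_eqI[of _ _ "inj0 q"]) (auto simp: inj0_def free_carrier_def)
  qed (auto simp: free_carrier_polys)
  show "(\<lambda>v. lincomb (length (D 0)) v (Y 0)) ` free_carrier n (D 0) = {v \<in> free_carrier n [0]. coset_of n I (v 0) =
      coset_of n I 0}"
    unfolding k0[symmetric] img by simp
  show "(\<lambda>v. lincomb (length (D (Suc i))) v (Y (Suc i))) ` free_carrier n (D (Suc i)) =
      {v \<in> free_carrier n (D i). lincomb (length (D i)) v (Y i) = 0}" for i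
    unfolding relations_def[symmetric] img by simp
  fix i e and v :: "nat \<Rightarrow> 'k mpoly" assume v: "v \<in> free_carrier n (D i)" and e: "e < length (?d i)"
  have w: "lincomb (length (D i)) v (Y i) \<in> (case i of 0 \<Rightarrow> emb I | Suc i \<Rightarrow> relations n (D i) (Y i))"
    unfolding img[symmetric] using v by (rule imageI)
  show "lincomb (length (D i)) v (Y i) e \<in> irrelevant_ideal n"
  proof (cases i)
    case 0
    hence "e = 0" "lincomb (length (D i)) v (Y i) 0 \<in> I" using e w by (simp_all add: emb_def)
    moreover have "q \<in> irrelevant_ideal n" if q: "q \<in> I" for q
    proof (rule ccontr)
      assume "q \<notin> irrelevant_ideal n"
      hence "lk q 0 \<noteq> 0" using graded_idealD(1)[OF I q] by (simp add: irrelevant_ideal_def)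
      moreover have "cst (inverse (lk q 0)) * hc 0 q \<in> I"
          by (intro graded_idealD(4)[OF I] graded_idealD(6)[OF I q]) simp
      ultimately show False using p cst_simps(4)[of "inverse (lk q 0)" "lk q 0"] by (simp add: hc_0_cst)
    qed
    ultimately show ?thesis by simp
  next
    case (Suc i')
    show ?thesis
    proof (cases i')
      case 0
      thus ?thesis using minimal_coverD(3)[OF c0] w e Suc by simp
    next
      case (Suc i'')
      thus ?thesis using minimal_coverD(3)[OF c] w e \<open>i = Suc i'\<close> by simp
    qed
  qed
qed

lemma betti_quotient:
  assumes p: "1 \<notin> I" and s: "minimal_chain n I D Y"
  shows "betti n (quotient_module n I) i j = count_list (case i of 0 \<Rightarrow> [0] | Suc i \<Rightarrow> D i) j"
  by (rule betti_eq_count[OF quotient_resolution[OF p s] gsurj_quotient module_quotient_module[OF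
    graded_ideal_ideal[OF I]]])

end

section \<open>Linear resolutions and Koszul homology\<close>

interpretation kv: koszul "\<lambda>i (v :: nat \<Rightarrow> 'k::field mpoly). pv (var i) v"
  by unfold_locales (simp_all add: fun_eq_iff algebra_simps)

lemma gm_free_part: "kv.gm n (free_part n ds)"
  unfolding kv.gm_def
proof safe
  fix d i and x :: "nat \<Rightarrow> 'a mpoly" assume i: "i \<in> {1..n}" and x: "x \<in> free_part n ds d"
  show "pv (var i) x \<in> free_part n ds (d + 1)" using free_part_pv[OF var_S[OF i] x] by (simp add: add.commute)
qed (simp_all add: free_part_0 free_part_diff)

lemma sg_apply: "sg j A v e = sg j A (v e)"
  by (simp add: sg_def)

lemma kv_koszul_diff_apply: "kv.koszul_diff n u A e = kp.koszul_diff n (\<lambda>A. u A e) A"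
  by (simp add: kv.koszul_diff_def kp.koszul_diff_def sum_apply sg_apply)

lemma koszul_exact_free_part:
  fixes ds :: "int list"
  assumes "\<And>x. x \<in> set ds \<Longrightarrow> j - x > int i"
  shows "kv.koszul_exact n i j (free_part n ds) (\<lambda>_. {0 :: nat \<Rightarrow> 'k::field mpoly})"
  unfolding kv.koszul_exact_def
proof safe
  fix u :: "nat set \<Rightarrow> nat \<Rightarrow> 'k mpoly" assume u: "chain n i j (free_part n ds) u" "\<forall>A. kv.koszul_diff n u A \<in> {0}"
  have "\<exists>w. chain n (Suc i) (j - ds ! e) (S n) w \<and> (\<forall>A. u A e - kp.koszul_diff n w A \<in> {0})" if e: "e < length ds" for e
  proof -
    have z: "kp.koszul_exact n i (j - ds ! e) (S n) (\<lambda>_. {0 :: 'k mpoly})"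
        by (rule koszul_exact_S) (use assms e in simp)
    have c: "chain n i (j - ds ! e) (S n) (\<lambda>A. u A e)"
    proof (rule chainI)
      fix A assume "A \<subseteq> {1..n}" "card A = i"
      thus "u A e \<in> S n (j - ds ! e - int i)" using free_part_S[OF chain_val[OF u(1)], of A e]
          by (simp add: algebra_simps)
    qed (simp add: chain_0[OF u(1)])
    have k: "kp.koszul_diff n (\<lambda>A. u A e) A \<in> {0}" for A using u(2) kv_koszul_diff_apply[of n u A e] by simp
    show ?thesis by (rule kp.koszul_exactE[OF z c k]) blast
  qed
  then obtain w where w: "\<And>e. e < length ds \<Longrightarrow> chain n (Suc i) (j - ds ! e) (S n) (w e)"
    "\<And>e A. e < length ds \<Longrightarrow> u A e - kp.koszul_diff n (w e) A \<in> {0}" by metis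
  define W where "W = (\<lambda>A e. if e < length ds then w e A else 0)"
  have "chain n (Suc i) j (free_part n ds) W"
  proof (rule chainI)
    fix A assume A: "A \<subseteq> {1..n}" "card A = Suc i"
    have "w e A \<in> S n (j - int (Suc i) - ds ! e)" if "e < length ds" for e
      using chain_val[OF w(1)[OF that] A] by (simp add: algebra_simps)
    thus "W A \<in> free_part n ds (j - int (Suc i))" by (auto simp: free_part_def free_carrier_def W_def intro: S_polys)
  next
    fix A assume "\<not> (A \<subseteq> {1..n} \<and> card A = Suc i)"
    hence "w e A = 0" if "e < length ds" for e by (rule chain_0[OF w(1)[OF that]])
    thus "W A = 0" by (intro ext) (simp add: W_def)
  qed
  moreover have "u A - kv.koszul_diff n W A \<in> {0}" for A
  proof -
    have "u A e = kv.koszul_diff n W A e" for e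
    proof (cases "e < length ds")
      case True
      have "(\<lambda>A. W A e) = w e" using True by (simp add: W_def)
      thus ?thesis using w(2)[OF True, of A] by (simp add: kv_koszul_diff_apply)
    next
      case False
      hence "(\<lambda>A. W A e) = (\<lambda>A. 0)" by (simp add: W_def)
      hence "kv.koszul_diff n W A e = 0" by (simp add: kv_koszul_diff_apply kp.koszul_diff_def)
      moreover have "u A e = 0" using kv.chain_in[OF u(1) gm_free_part, of A] False
          by (simp add: free_part_def free_carrier_def)
      ultimately show ?thesis by simp
    qed
    thus ?thesis by (simp add: fun_eq_iff)
  qed
  ultimately show "\<exists>w. chain n (Suc i) j (free_part n ds) w \<and> (\<forall>A. u A - kv.koszul_diff n w A \<in> {0})" by blast
qed

lemma (in koszul) koszul_exact_0_dest:
  assumes gm: "gm n M" and z: "koszul_exact n 0 j M (\<lambda>_. {0})" and p: "p \<in> M j"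
  shows "\<exists>w. (\<forall>k. w k \<in> M (j - 1)) \<and> p = (\<Sum>k\<in>{1..n}. act k (w k))"
proof -
  define u where "u = (\<lambda>A::nat set. if A = {} then p else 0)"
  have c: "chain n 0 j M u"
  proof (rule chainI)
    fix A assume A: "A \<subseteq> {1..n}" "card A = 0"
    have "finite A" by (rule finite_subset[OF A(1)]) simp
    thus "u A \<in> M (j - int 0)" using A(2) p by (simp add: u_def)
  qed (auto simp: u_def)
  have k: "koszul_diff n u A \<in> {0}" for A using koszul_diff_chain_0[OF c] by simp
  obtain w where w: "chain n (Suc 0) j M w" "\<And>A. u A - koszul_diff n w A \<in> {0}" by (rule koszul_exactE[OF z c k]) blast
  have "p = koszul_diff n w {}" using w(2)[of "{}"] by (simp add: u_def)
  also have "\<dots> = (\<Sum>k\<in>{1..n}. act k (w {k}))" unfolding koszul_diff_def by (rule sum.cong) (simp_all add: sg_def)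
  finally have "p = (\<Sum>k\<in>{1..n}. act k (w {k}))" .
  moreover have "w {k} \<in> M (j - 1)" for k using chain_in[OF w(1) gm, of "{k}"] by simp
  ultimately show ?thesis by (intro exI[of _ "\<lambda>k. w {k}"] conjI allI)
qed

text \<open>A basis vector of degree below \<open>t\<close> is mapped to 0. One of degree above
  \<open>t\<close> has, by vanishing of \<open>H_0\<close>, the same image as a combination of
  multiples of the variables. Either way the kernel contains a vector with a coefficient outside the
  irrelevant ideal, against minimality.\<close>

lemma gen_degrees:
  fixes h :: "(nat \<Rightarrow> 'k::field mpoly) \<Rightarrow> 'w::ab_group_add"
  assumes hom: "koszul_hom (\<lambda>i v. pv (var i) v) act2 n (free_part n ds) h"
    and min: "\<And>v d e. v \<in> free_part n ds d \<Longrightarrow> h v = 0 \<Longrightarrow> e < length ds \<Longrightarrow> v e \<in> irrelevant_ideal n"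
    and up: "\<And>j. j > t \<Longrightarrow> koszul.koszul_exact act2 n 0 j (\<lambda>d. h ` free_part n ds d) (\<lambda>_. {0})"
    and low: "\<And>d. d < t \<Longrightarrow> h ` free_part n ds d \<subseteq> {0}"
  shows "\<forall>x\<in>set ds. x = t"
proof
  interpret koszul_hom "\<lambda>i v. pv (var i) v" act2 n "free_part n ds" h by (rule hom)
  fix x assume "x \<in> set ds"
  then obtain e where e: "e < length ds" "ds ! e = x" by (auto simp: in_set_conv_nth)
  have b: "bas e \<in> free_part n ds x" using bas_free_part[OF e(1)] e(2) by simp
  have b1: "bas e e = (1 :: 'k mpoly)" by (simp add: bas_def)
  have irr1: "(1 :: 'k mpoly) \<notin> irrelevant_ideal n" by (simp add: irrelevant_ideal_def)
  have "\<not> x < t"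
  proof
    assume "x < t"
    hence "h (bas e) = 0" using low b by blast
    thus False using min[OF b _ e(1)] b1 irr1 by simp
  qed
  moreover have "\<not> x > t"
  proof
    assume "x > t"
    have gmi: "b.gm n (\<lambda>d. h ` free_part n ds d)"
      unfolding b.gm_def
    proof safe
      fix d show "0 \<in> h ` free_part n ds d" using free_part_0[of n ds d]
          by (intro image_eqI[of _ _ 0]) (simp_all add: h_0)
    next
      fix d and x y :: "nat \<Rightarrow> 'k mpoly" assume xy: "x \<in> free_part n ds d" "y \<in> free_part n ds d"
      show "h x - h y \<in> h ` free_part n ds d" unfolding h_diff[OF xy, symmetric]
          by (rule imageI[OF free_part_diff[OF xy]])
    next
      fix d i and x :: "nat \<Rightarrow> 'k mpoly" assume ix: "i \<in> {1..n}" "x \<in> free_part n ds d"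
      show "act2 i (h x) \<in> h ` free_part n ds (d + 1)" unfolding h_act[OF ix, symmetric]
        by (rule imageI[OF kv.gm_act[OF gm ix]])
    qed
    obtain w where w: "\<forall>k. w k \<in> h ` free_part n ds (x - 1)" "h (bas e) = (\<Sum>k\<in>{1..n}. act2 k (w k))"
      using b.koszul_exact_0_dest[OF gmi up[OF \<open>x > t\<close>] imageI[OF b]] by blast
    hence "\<exists>v. v \<in> free_part n ds (x - 1) \<and> w k = h v" for k by auto
    then obtain v where v: "\<And>k. v k \<in> free_part n ds (x - 1)" "\<And>k. w k = h (v k)" by metis
    \<comment> \<open>\<open>bas e - s\<close> will lie in the kernel, although its
      \<open>e\<close>-th coordinate has constant term 1.\<close>
    define s where "s = (\<Sum>k\<in>{1..n}. pv (var k) (v k))"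
    have pvF: "pv (var k) (v k) \<in> free_part n ds x" if "k \<in> {1..n}" for k
      using free_part_pv[OF var_S[OF that] v(1)[of k]] by simp
    have sF: "s \<in> free_part n ds x" unfolding s_def by (rule kv.gm_sum[OF gm pvF])
    have "h s = (\<Sum>k\<in>{1..n}. h (pv (var k) (v k)))" unfolding s_def by (rule h_sum[OF pvF])
    also have "\<dots> = (\<Sum>k\<in>{1..n}. act2 k (w k))" by (rule sum.cong) (simp_all only: h_act[OF _ v(1)] v(2))
    finally have "h (bas e - s) = 0" using h_diff[OF b sF] w(2) by simp
    hence "(bas e - s) e \<in> irrelevant_ideal n" by (rule min[OF free_part_diff[OF b sF] _ e(1)])
    moreover have "s e = (\<Sum>k\<in>{1..n}. var k * v k e)" by (simp add: s_def sum_apply)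
    hence "lk (s e) 0 = 0" by (simp add: lookup_sum lookup_var_mult_0)
    ultimately show False by (simp add: irrelevant_ideal_def b1 lookup_minus)
  qed
  ultimately show "x = t" by simp
qed

section \<open>Koszul homology of the syzygies of a minimal resolution\<close>

definition syzygies :: "nat \<Rightarrow> (nat \<Rightarrow> int list) \<Rightarrow> (nat \<Rightarrow> nat \<Rightarrow> nat \<Rightarrow> 'k::field mpoly) \<Rightarrow> nat \<Rightarrow> int \<Rightarrow> (nat \<Rightarrow> 'k mpoly)
    set" where
  "syzygies n D Y l d = {v \<in> free_part n (D l) d. lincomb (length (D l)) v (Y l) = 0}"

context
  fixes n :: nat and I :: "'k::field mpoly set" and D and Y
  assumes I: "graded_ideal n I" and s: "minimal_chain n I D Y"
begin

lemma gens0: "gens n [0] (D 0) (Y 0)" by (rule minimal_coverD(1)[OF msqD(1)[OF s]])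
lemma gensS: "gens n (D l) (D (Suc l)) (Y (Suc l))" by (rule minimal_coverD(1)[OF msqD(2)[OF s]])

lemma hom0: "koszul_hom (\<lambda>i v. pv (var i) v) (\<lambda>i p. var i * p) n (free_part n (D 0)) (\<lambda>v. lincomb (length (D 0)) v (Y
    0) 0)"
proof unfold_locales
  fix x y :: "nat \<Rightarrow> 'k mpoly" and d assume "x \<in> free_part n (D 0) d" "y \<in> free_part n (D 0) d"
  have "lincomb (length (D 0)) (x - y) (Y 0) + lincomb (length (D 0)) y (Y 0) = lincomb (length (D 0)) x (Y 0)"
    unfolding lincomb_add[symmetric] diff_add_cancel ..
  from fun_cong[OF this, of 0]
  show "lincomb (length (D 0)) (x - y) (Y 0) 0 = lincomb (length (D 0)) x (Y 0) 0 - lincomb (length (D 0)) y (Y 0) 0"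
    unfolding plus_fun_apply eq_diff_eq .
qed (simp_all add: gm_free_part lincomb_pv)

lemma homS: "koszul_hom (\<lambda>i v. pv (var i) v) (\<lambda>i v. pv (var i) v) n (free_part n (D (Suc l))) (\<lambda>v. lincomb (length (D
    (Suc l))) v (Y (Suc l)))"
proof unfold_locales
  fix x y :: "nat \<Rightarrow> 'k mpoly" and d assume "x \<in> free_part n (D (Suc l)) d" "y \<in> free_part n (D (Suc l)) d"
  have "lincomb (length (D (Suc l))) (x - y) (Y (Suc l)) + lincomb (length (D (Suc l))) y (Y (Suc l)) =
      lincomb (length (D (Suc l))) x (Y (Suc l))"
    unfolding lincomb_add[symmetric] diff_add_cancel ..
  thus "lincomb (length (D (Suc l))) (x - y) (Y (Suc l)) =
      lincomb (length (D (Suc l))) x (Y (Suc l)) - lincomb (length (D (Suc l))) y (Y (Suc l))"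
    unfolding eq_diff_eq .
qed (simp_all add: gm_free_part lincomb_pv)

lemma image0: "(\<lambda>v. lincomb (length (D 0)) v (Y 0) 0) ` free_part n (D 0) d = graded_part n I d"
proof (intro equalityI subsetI)
  fix p assume "p \<in> (\<lambda>v. lincomb (length (D 0)) v (Y 0) 0) ` free_part n (D 0) d"
  then obtain v where v: "v \<in> free_part n (D 0) d" "p = lincomb (length (D 0)) v (Y 0) 0" by blast
  have "lincomb (length (D 0)) v (Y 0) \<in> emb I"
      using minimal_coverD(2)[OF msqD(1)[OF s]] free_part_free_carrier[OF v(1)] by blast
  thus "p \<in> graded_part n I d" using lincomb_free_part[OF gens0 v(1)] v(2)
      by (simp add: graded_part_def emb_def free_part_def)
next
  fix p assume p: "p \<in> graded_part n I d"
  hence "inj0 p \<in> (\<lambda>v. lincomb (length (D 0)) v (Y 0)) ` free_carrier n (D 0)"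
    unfolding minimal_coverD(2)[OF msqD(1)[OF s]] by (simp add: inj0_emb graded_part_def)
  then obtain v where v: "inj0 p = lincomb (length (D 0)) v (Y 0)" "v \<in> free_carrier n (D 0)" by (rule imageE)
  have "lincomb (length (D 0)) (hcv (D 0) d v) (Y 0) 0 = hc d p"
    unfolding hcv_lincomb[OF gens0 v(2), symmetric] v(1)[symmetric] by (simp add: hcv_apply inj0_emb)
  also have "\<dots> = p" using p hc_id[of p n d] by (simp add: graded_part_def)
  finally show "p \<in> (\<lambda>v. lincomb (length (D 0)) v (Y 0) 0) ` free_part n (D 0) d"
    using hcv_free_part[OF v(2)] by (intro image_eqI[of _ _ "hcv (D 0) d v"]) simp_all
qed

lemma imageS: "(\<lambda>v. lincomb (length (D (Suc l))) v (Y (Suc l))) ` free_part n (D (Suc l)) d = syzygies n D Y l d"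
proof (intro equalityI subsetI)
  fix w assume "w \<in> (\<lambda>v. lincomb (length (D (Suc l))) v (Y (Suc l))) ` free_part n (D (Suc l)) d"
  then obtain v where v: "v \<in> free_part n (D (Suc l)) d" "w = lincomb (length (D (Suc l))) v (Y (Suc l))" by blast
  have "w \<in> relations n (D l) (Y l)" using minimal_coverD(2)[OF msqD(2)[OF s]] free_part_free_carrier[OF v(1)] v(2)
      by blast
  thus "w \<in> syzygies n D Y l d" using lincomb_free_part[OF gensS v(1)] v(2) by (simp add: syzygies_def relations_def)
next
  fix w assume w: "w \<in> syzygies n D Y l d"
  hence "w \<in> (\<lambda>v. lincomb (length (D (Suc l))) v (Y (Suc l))) ` free_carrier n (D (Suc l))"
    unfolding minimal_coverD(2)[OF msqD(2)[OF s]]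
        by (auto simp: syzygies_def relations_def dest: free_part_free_carrier)
  then obtain v where v: "w = lincomb (length (D (Suc l))) v (Y (Suc l))" "v \<in> free_carrier n (D (Suc l))"
      by (rule imageE)
  have "lincomb (length (D (Suc l))) (hcv (D (Suc l)) d v) (Y (Suc l)) = hcv (D l) d w"
    unfolding hcv_lincomb[OF gensS v(2), symmetric] v(1) ..
  also have "\<dots> = w" using w by (intro hcv_id[of _ n]) (simp add: syzygies_def)
  finally show "w \<in> (\<lambda>v. lincomb (length (D (Suc l))) v (Y (Suc l))) ` free_part n (D (Suc l)) d"
    using hcv_free_part[OF v(2)] by (intro image_eqI[of _ _ "hcv (D (Suc l)) d v"]) simp_all
qed

lemma lc0_iff: "v \<in> free_part n (D 0) d \<Longrightarrow> lincomb (length (D 0)) v (Y 0) 0 = 0 \<longleftrightarrow> lincomb (length (D 0)) v (Y 0) = 0"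
proof -
  assume v: "v \<in> free_part n (D 0) d"
  have "lincomb (length (D 0)) v (Y 0) \<in> emb I" using minimal_coverD(2)[OF msqD(1)[OF s]] free_part_free_carrier[OF v]
      by blast
  from emb_eq[OF this] show ?thesis by (metis inj0_def zero_fun_apply ext)
qed

lemma kernel0: "koszul_hom.K (free_part n (D 0)) (\<lambda>v. lincomb (length (D 0)) v (Y 0) 0) = syzygies n D Y 0"
proof (rule ext)
  fix d show "koszul_hom.K (free_part n (D 0)) (\<lambda>v. lincomb (length (D 0)) v (Y 0) 0) d = syzygies n D Y 0 d"
    unfolding koszul_hom.K_def[OF hom0] syzygies_def by (intro Collect_cong conj_cong refl lc0_iff)
qed

lemma kernelS: "koszul_hom.K (free_part n (D (Suc l))) (\<lambda>v. lincomb (length (D (Suc l))) v (Y (Suc l))) =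
    syzygies n D Y (Suc l)"
  by (rule ext) (simp only: koszul_hom.K_def[OF homS] syzygies_def)

lemma syzygies_irr: "v \<in> syzygies n D Y l d \<Longrightarrow> e < length (D l) \<Longrightarrow> v e \<in> irrelevant_ideal n"
proof -
  assume v: "v \<in> syzygies n D Y l d" and e: "e < length (D l)"
  have "v \<in> relations n (D l) (Y l)" using v free_part_free_carrier by (auto simp: syzygies_def relations_def)
  thus ?thesis using minimal_coverD(3)[OF msqD(1)[OF s]] minimal_coverD(3)[OF msqD(2)[OF s]] e by (cases l) auto
qed

text \<open>Dimension shifting: \<open>H_(m+1)\<close> of a syzygy module lies between
  \<open>H_(m+1)\<close> of the free module covering it and \<open>H_m\<close> of the next syzygies.
  The free module over the \<open>l\<close>-th syzygies is generated in degree \<open>l + 3\<close>,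
  whence the bound.\<close>

lemma linear_koszul_exact_syzygies:
  assumes lin: "\<And>l. \<forall>x\<in>set (D l). x = int l + 2"
  shows "j > int m + int l + 3 \<Longrightarrow> kv.koszul_exact n m j (syzygies n D Y l) (\<lambda>_. {0})"
proof (induction m arbitrary: l)
  case (0 l)
  have "kv.koszul_exact n 0 j (free_part n (D (Suc l))) (\<lambda>_. {0 :: nat \<Rightarrow> 'k mpoly})"
    by (rule koszul_exact_free_part) (use lin[of "Suc l"] 0 in auto)
  from koszul_hom.koszul_exact_image_0[OF homS this] show ?case unfolding imageS .
next
  case (Suc m l)
  have F: "kv.koszul_exact n (Suc m) j (free_part n (D (Suc l))) (\<lambda>_. {0 :: nat \<Rightarrow> 'k mpoly})"
    by (rule koszul_exact_free_part) (use lin[of "Suc l"] Suc.prems in auto)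
  have K: "kv.koszul_exact n m j (syzygies n D Y (Suc l)) (\<lambda>_. {0})" by (rule Suc.IH) (use Suc.prems in simp)
  show ?case using koszul_hom.koszul_exact_image[OF homS F, unfolded kernelS imageS, OF K] .
qed

lemma linear_koszul_exact_ideal:
  assumes lin: "\<And>l. \<forall>x\<in>set (D l). x = int l + 2" and j: "j > int i + 2"
  shows "kp.koszul_exact n i j (graded_part n I) (\<lambda>_. {0})"
proof (cases i)
  case 0
  have "kv.koszul_exact n 0 j (free_part n (D 0)) (\<lambda>_. {0 :: nat \<Rightarrow> 'k mpoly})"
    by (rule koszul_exact_free_part) (use lin[of 0] 0 j in auto)
  from koszul_hom.koszul_exact_image_0[OF hom0 this] show ?thesis unfolding image0 0 .
next
  case (Suc m)
  have F: "kv.koszul_exact n (Suc m) j (free_part n (D 0)) (\<lambda>_. {0 :: nat \<Rightarrow> 'k mpoly})"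
    by (rule koszul_exact_free_part) (use lin[of 0] Suc j in auto)
  have K: "kv.koszul_exact n m j (syzygies n D Y 0) (\<lambda>_. {0})"
      by (rule linear_koszul_exact_syzygies[OF lin]) (use Suc j in simp)
  show ?thesis using koszul_hom.koszul_exact_image[OF hom0 F, unfolded kernel0 image0, OF K] unfolding Suc .
qed

text \<open>The sequence \<open>0 -> I -> S -> S/I -> 0\<close> relates \<open>H_(i+1)(S/I)\<close>
  to \<open>H_i(I)\<close>, so the bound \<open>i + 2\<close> for the ideal turns into regularity 1
  for the quotient.\<close>

theorem linear_regularity_le:
  assumes lin: "\<And>l. \<forall>x\<in>set (D l). x = int l + 2"
  shows "regularity_le n 1 I"
  unfolding regularity_le_def
proof (intro allI impI)
  fix i j assume j: "j > int i + 1"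
  have Z: "kp.koszul_exact n i j (S n) (\<lambda>_. {0 :: 'k mpoly})" by (rule koszul_exact_S) (use j in simp)
  have sub: "{0} \<subseteq> graded_part n I d" for d using graded_idealD(2)[OF I] by (simp add: graded_part_def)
  show "kp.koszul_exact n i j (S n) (graded_part n I)"
  proof (cases i)
    case 0
    show ?thesis unfolding 0 by (rule kp.koszul_exact_coker_0[OF kp.gm_zero sub]) (use Z 0 in simp)
  next
    case (Suc m)
    have P: "kp.koszul_exact n m j (graded_part n I) (\<lambda>_. {0})"
        by (rule linear_koszul_exact_ideal[OF lin]) (use j Suc in simp)
    show ?thesis unfolding Suc
      by (rule kp.koszul_exact_coker[OF gm_S[OF order_refl] gm_graded_part[OF I] kp.gm_zero sub graded_part_S P]) (use
        Z Suc in simp)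
  qed
qed

text \<open>By minimality the coefficients of a syzygy have no constant term, so its degree exceeds
  the common degree \<open>l + 2\<close> of the basis vectors.\<close>

lemma syzygies_low:
  assumes Dl: "\<forall>x\<in>set (D l). x = int l + 2" and d: "d < int l + 3"
  shows "syzygies n D Y l d \<subseteq> {0}"
proof
  fix v assume v: "v \<in> syzygies n D Y l d"
  have vF: "v \<in> free_part n (D l) d" using v by (simp add: syzygies_def)
  have "v e = 0" for e
  proof (cases "e < length (D l)")
    case True
    have "D l ! e = int l + 2" using Dl nth_mem[OF True] by blast
    hence vS: "v e \<in> S n (d - (int l + 2))" using free_part_S[OF vF, of e] by simp
    show ?thesis
    proof (cases "d = int l + 2")
      case t: True
      hence "v e = cst (lk (v e) 0)" using vS by (intro S_0_cst[of _ n]) simp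
      thus ?thesis using syzygies_irr[OF v True] by (simp add: irrelevant_ideal_def)
    next
      case False
      hence "d - (int l + 2) < 0" using d by simp
      from S_neg[OF this] show ?thesis using vS by blast
    qed
  next
    case False
    thus ?thesis using vF by (simp add: free_part_def free_carrier_def)
  qed
  thus "v \<in> {0}" by (simp add: fun_eq_iff)
qed

text \<open>Dimension shifting in the opposite direction: vanishing of \<open>H_(m+1)\<close> of one
  syzygy module passes to \<open>H_m\<close> of the next. The degrees are part of the same
  induction, because exactness over the next free module can be used only once
  \<open>gen_degrees\<close> has shown it to be linear.\<close>

theorem regularity_le_linear:
  assumes r: "regularity_le n 1 I" and low: "\<And>d. d \<le> 1 \<Longrightarrow> graded_part n I d \<subseteq> {0}"
  shows "\<forall>x\<in>set (D l). x = int l + 2"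
proof -
  have sub: "{0} \<subseteq> graded_part n I d" for d using graded_idealD(2)[OF I] by (simp add: graded_part_def)
  have zI: "kp.koszul_exact n m j (graded_part n I) (\<lambda>_. {0})" if "j > int m + 2" for m j
    by (rule kp.koszul_exact_sub[OF gm_S[OF order_refl] gm_graded_part[OF I] kp.gm_zero sub graded_part_S
      koszul_exact_S])
      (use r that in \<open>simp_all add: regularity_le_def\<close>)
  have D0: "\<forall>x\<in>set (D 0). x = 2"
  proof (rule gen_degrees[OF hom0])
    fix v d e assume v: "v \<in> free_part n (D 0) d" "lincomb (length (D 0)) v (Y 0) 0 = 0" "e < length (D 0)"
    have "v \<in> syzygies n D Y 0 d" using v lc0_iff[OF v(1)] by (simp add: syzygies_def)
    thus "v e \<in> irrelevant_ideal n" using v(3) by (rule syzygies_irr)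
  next
    fix j :: int assume "j > 2"
    thus "kp.koszul_exact n 0 j (\<lambda>d. (\<lambda>v. lincomb (length (D 0)) v (Y 0) 0) ` free_part n (D 0) d) (\<lambda>_. {0})"
      unfolding image0 by (intro zI) simp
  next
    fix d :: int assume "d < 2"
    thus "(\<lambda>v. lincomb (length (D 0)) v (Y 0) 0) ` free_part n (D 0) d \<subseteq> {0}" unfolding image0 by (intro low) simp
  qed
  have "(\<forall>x\<in>set (D l). x = int l + 2) \<and> (\<forall>m j. j > int m + int l + 3 \<longrightarrow>
      kv.koszul_exact n m j (syzygies n D Y l) (\<lambda>_. {0}))" for l
  proof (induction l)
    case 0
    have "kv.koszul_exact n m j (syzygies n D Y 0) (\<lambda>_. {0})" if j: "j > int m + int 0 + 3" for m j
    proof -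
      have F: "kv.koszul_exact n m j (free_part n (D 0)) (\<lambda>_. {0 :: nat \<Rightarrow> 'k mpoly})"
        by (rule koszul_exact_free_part) (use D0 j in auto)
      have "kp.koszul_exact n (Suc m) j (graded_part n I) (\<lambda>_. {0})" by (rule zI) (use j in simp)
      thus ?thesis using koszul_hom.koszul_exact_kernel[OF hom0 F, unfolded kernel0 image0] by blast
    qed
    hence "\<forall>m j. j > int m + int 0 + 3 \<longrightarrow> kv.koszul_exact n m j (syzygies n D Y 0) (\<lambda>_. {0})" by blast
    moreover have "\<forall>x\<in>set (D 0). x = int 0 + 2" using D0 by simp
    ultimately show ?case by (intro conjI)
  next
    case (Suc l)
    note Dl = conjunct1[OF Suc.IH]
    have zl: "kv.koszul_exact n m j (syzygies n D Y l) (\<lambda>_. {0})" if "j > int m + int l + 3" for m j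
      using conjunct2[OF Suc.IH] that by blast
    have DS: "\<forall>x\<in>set (D (Suc l)). x = int l + 3"
    proof (rule gen_degrees[OF homS])
      fix v d e assume v: "v \<in> free_part n (D (Suc l)) d" "lincomb (length (D (Suc l))) v (Y (Suc l)) =
          0" "e < length (D (Suc l))"
      have "v \<in> syzygies n D Y (Suc l) d" using v by (simp add: syzygies_def)
      thus "v e \<in> irrelevant_ideal n" using v(3) by (rule syzygies_irr)
    next
      fix j assume "j > int l + 3"
      thus "kv.koszul_exact n 0 j (\<lambda>d. (\<lambda>v. lincomb (length (D (Suc l))) v (Y (Suc l))) ` free_part n (D (Suc l)) d)
          (\<lambda>_. {0})"
        unfolding imageS by (intro zl) simp
    next
      fix d assume d: "d < int l + 3"
      show "(\<lambda>v. lincomb (length (D (Suc l))) v (Y (Suc l))) ` free_part n (D (Suc l)) d \<subseteq> {0}"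
        unfolding imageS by (rule syzygies_low[OF Dl d])
    qed
    have "kv.koszul_exact n m j (syzygies n D Y (Suc l)) (\<lambda>_. {0})" if j: "j > int m + int (Suc l) + 3" for m j
    proof -
      have F: "kv.koszul_exact n m j (free_part n (D (Suc l))) (\<lambda>_. {0 :: nat \<Rightarrow> 'k mpoly})"
        by (rule koszul_exact_free_part) (use DS j in auto)
      have "kv.koszul_exact n (Suc m) j (syzygies n D Y l) (\<lambda>_. {0})" by (rule zl) (use j in simp)
      thus ?thesis using koszul_hom.koszul_exact_kernel[OF homS F, unfolded kernelS imageS] by blast
    qed
    hence "\<forall>m j. j > int m + int (Suc l) + 3 \<longrightarrow> kv.koszul_exact n m j (syzygies n D Y (Suc l)) (\<lambda>_. {0})" by blast
    moreover have "\<forall>x\<in>set (D (Suc l)). x = int (Suc l) + 2" using DS by auto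
    ultimately show ?case by (intro conjI)
  qed
  thus ?thesis by blast
qed

end

section \<open>Monomial ideals\<close>

text \<open>The span of a set of monomials. In this form taking the colon by a variable and
  adjoining a variable become operations on sets of monomials.\<close>

definition mon_ideal :: "nat \<Rightarrow> (nat \<Rightarrow>\<^sub>0 nat) set \<Rightarrow> 'k::field mpoly set" where
  "mon_ideal n D = {p \<in> polys n. kys p \<subseteq> D}"

definition upset :: "(nat \<Rightarrow>\<^sub>0 nat) set \<Rightarrow> bool" where
  "upset D \<longleftrightarrow> (\<forall>a\<in>D. \<forall>b. b + a \<in> D)"

lemma graded_ideal_mon:
  fixes D :: "(nat \<Rightarrow>\<^sub>0 nat) set"
  assumes D: "upset D" shows "graded_ideal n (mon_ideal n D :: 'k::field mpoly set)"
  unfolding graded_ideal_def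
proof (intro conjI ballI allI)
  fix p q :: "'k mpoly" assume "p \<in> mon_ideal n D" "q \<in> mon_ideal n D"
  thus "p + q \<in> mon_ideal n D" using Poly_Mapping.keys_add[of p q] by (auto simp: mon_ideal_def polys_closed)
next
  fix p q :: "'k mpoly" assume p: "p \<in> polys n" and q: "q \<in> mon_ideal n D"
  have "kys (p * q) \<subseteq> D"
  proof
    fix m assume "m \<in> kys (p * q)"
    then obtain a b where "m = a + b" "b \<in> kys q" using keys_mult[of p q] by blast
    thus "m \<in> D" using D q by (auto simp: upset_def mon_ideal_def)
  qed
  thus "p * q \<in> mon_ideal n D" using p q by (simp add: mon_ideal_def polys_closed)
next
  fix p :: "'k mpoly" and d assume "p \<in> mon_ideal n D"
  thus "hc d p \<in> mon_ideal n D" by (auto simp: mon_ideal_def hc_polys in_keys_iff lookup_hc split: if_splits)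
qed (auto simp: mon_ideal_def polys_closed)

lemma colon_mon:
  assumes "v \<in> {1..n}"
  shows "colon n (mon_ideal n D) (var v :: 'k::field mpoly) = mon_ideal n {m. xm v + m \<in> D}"
proof -
  have "var v * p \<in> polys n" if "p \<in> polys n" for p :: "'k mpoly"
    using polys_closed(5)[OF var_in_polys[OF assms] that] .
  thus ?thesis by (auto simp: colon_def mon_ideal_def mult.commute[of _ "var v"] keys_var_mult)
qed

lemma adjoin_mon:
  assumes v: "v \<in> {1..n}"
  shows "adjoin n (mon_ideal n D) (var v :: 'k::field mpoly) = mon_ideal n (D \<union> {m. v \<in> kys m})"
proof (intro equalityI subsetI)
  fix p :: "'k mpoly" assume "p \<in> adjoin n (mon_ideal n D) (var v)"
  then obtain a b where *: "p = a + b * var v" "a \<in> mon_ideal n D" "b \<in> polys n" unfolding adjoin_def by blast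
  have "kys (b * var v) \<subseteq> {m. v \<in> kys m}" by (auto simp: mult.commute[of b] keys_var_mult keys_nat_add)
  hence "kys p \<subseteq> D \<union> {m. v \<in> kys m}" using Poly_Mapping.keys_add[of a "b * var v"] * by (auto simp: mon_ideal_def)
  moreover have "p \<in> polys n" using * v by (simp add: mon_ideal_def polys_closed)
  ultimately show "p \<in> mon_ideal n (D \<union> {m. v \<in> kys m})" by (simp add: mon_ideal_def)
next
  fix p :: "'k mpoly" assume p: "p \<in> mon_ideal n (D \<union> {m. v \<in> kys m})"
  let ?a = "keep (\<lambda>m. v \<notin> kys m) p"
  have "p = ?a + divvar v p * var v" unfolding mult.commute[of _ "var v"] var_divvar
    by (rule poly_mapping_eqI) (simp add: lookup_add)
  moreover have "?a \<in> mon_ideal n D"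
  proof -
    have "kys ?a \<subseteq> D"
    proof
      fix x assume "x \<in> kys ?a"
      hence "x \<in> kys p" "v \<notin> kys x" by (auto simp: in_keys_iff split: if_splits)
      thus "x \<in> D" using p by (auto simp: mon_ideal_def)
    qed
    thus ?thesis using p by (simp add: mon_ideal_def keep_polys)
  qed
  moreover have "divvar v p \<in> polys n"
    unfolding polys_iff
  proof (intro allI impI)
    fix m assume "lk (divvar v p) m \<noteq> 0"
    hence "kys (xm v + m) \<subseteq> {1..n}" using p by (simp add: mon_ideal_def polys_iff)
    thus "kys m \<subseteq> {1..n}" by (simp add: keys_nat_add)
  qed
  ultimately show "p \<in> adjoin n (mon_ideal n D) (var v)" unfolding adjoin_def by blast
qed

definition varD :: "nat set \<Rightarrow> (nat \<Rightarrow>\<^sub>0 nat) set" where "varD A = {m. kys m \<inter> A \<noteq> {}}"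

lemma upset_varD: "upset (varD A)"
  by (auto simp: upset_def varD_def keys_nat_add)

lemma mon_ideal_empty: "mon_ideal n {} = {0 :: 'k::field mpoly}"
  by (auto simp: mon_ideal_def polys_closed)

lemma varD_step:
  assumes "v \<notin> A" "v \<in> {1..n}"
  shows "colon n (mon_ideal n (varD A)) (var v) = (mon_ideal n (varD A) :: 'k::field mpoly set)"
    "adjoin n (mon_ideal n (varD A)) (var v) = (mon_ideal n (varD (insert v A)) :: 'k::field mpoly set)"
proof -
  have "{m. xm v + m \<in> varD A} = varD A" using assms(1) by (auto simp: varD_def keys_nat_add)
  thus "colon n (mon_ideal n (varD A)) (var v) = (mon_ideal n (varD A) :: 'k mpoly set)"
    unfolding colon_mon[OF assms(2)] by simp
  have "varD A \<union> {m. v \<in> kys m} = varD (insert v A)" by (auto simp: varD_def)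
  thus "adjoin n (mon_ideal n (varD A)) (var v) = (mon_ideal n (varD (insert v A)) :: 'k mpoly set)"
    unfolding adjoin_mon[OF assms(2)] by simp
qed

text \<open>The variables of \<open>A\<close> are adjoined one at a time, each being a
  nonzerodivisor modulo the previous ones.\<close>

lemma varD_ideal:
  assumes "finite A" "A \<subseteq> {1..n}"
  shows "regularity_le n 0 (mon_ideal n (varD A) :: 'k::field mpoly set) \<and>
    hilbert_series n (mon_ideal n (varD A) :: 'k mpoly set) =
        (1 - fps_X) ^ card A * hilbert_series n ({0} :: 'k mpoly set)"
  using assms
proof (induction A rule: finite_induct)
  case empty
  have "varD {} = {}" by (simp add: varD_def)
  thus ?case by (simp add: mon_ideal_empty regularity_le_zero)
next
  case (insert v A)
  have v: "v \<in> {1..n}" using insert.prems by simp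
  note st = varD_step[OF insert.hyps(2) v, where ?'k = 'k]
      and g = graded_ideal_mon[OF upset_varD, of n A, where ?'k = 'k]
  have "regularity_le n 0 (mon_ideal n (varD (insert v A)) :: 'k mpoly set)"
    unfolding st(2)[symmetric] using insert by (intro regularity_le_nonzerodivisor[OF g var_S[OF v] st(1)]) simp
  moreover have "hilbert_series n (mon_ideal n (varD (insert v A)) :: 'k mpoly set) =
      (1 - fps_X) * hilbert_series n (mon_ideal n (varD A) :: 'k mpoly set)"
    unfolding st(2)[symmetric] by (rule hilbert_series_nonzerodivisor[OF g var_S[OF v] st(1)])
  ultimately show ?case using insert by (simp add: mult.assoc)
qed

text \<open>Adjoining all variables to the zero ideal leaves the field with series 1. The series of
  the polynomial ring thus comes out without counting monomials.\<close>

lemma hilbert_series_zero: "(1 - fps_X) ^ n * hilbert_series n ({0} :: 'k::field mpoly set) = 1"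
proof -
  have v: "\<forall>k\<in>{1..n}. var k \<in> (mon_ideal n (varD {1..n}) :: 'k mpoly set)"
  proof
    fix k assume k: "k \<in> {1..n}"
    have "kys (var k :: 'k mpoly) = {xm k}" by (simp add: var_xm)
    thus "var k \<in> (mon_ideal n (varD {1..n}) :: 'k mpoly set)" using var_in_polys[OF k] k
        by (simp add: mon_ideal_def varD_def)
  qed
  have one: "1 \<notin> (mon_ideal n (varD {1..n}) :: 'k mpoly set)" by (simp add: mon_ideal_def varD_def)
  have "hilbert_series n (mon_ideal n (varD {1..n}) :: 'k mpoly set) = 1"
    by (rule hilbert_series_irrelevant[OF graded_ideal_mon[OF upset_varD] v one])
  thus ?thesis using varD_ideal[of "{1..n}" n, where ?'k = 'k] by simp
qed

section \<open>Betti numbers of linear ideals from the Hilbert series\<close>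

lemma dim_zero: "mv.dim {0 :: 'k::field mpoly} = 0" "fv.dim {0 :: nat \<Rightarrow> 'k mpoly} = 0"
proof -
  have "mv.dim {0 :: 'k mpoly} \<le> card ({} :: 'k mpoly set)" by (rule mv.dim_le_card) (auto simp: mv.span_zero)
  thus "mv.dim {0 :: 'k mpoly} = 0" by simp
  have "fv.dim {0 :: nat \<Rightarrow> 'k mpoly} \<le> card ({} :: (nat \<Rightarrow> 'k mpoly) set)"
      by (rule fv.dim_le_card) (auto simp: fv.span_zero)
  thus "fv.dim {0 :: nat \<Rightarrow> 'k mpoly} = 0" unfolding card.empty le_zero_eq .
qed

lemma hilbert_fun_zero: "hilbert_fun n ({0} :: 'k::field mpoly set) d = int (sdim TYPE('k) n d)"
  by (simp add: hilbert_fun_def sdim_def graded_part_zero dim_zero)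

context
  fixes n :: nat and I :: "'k::field mpoly set" and D and Y
  assumes I: "graded_ideal n I" and s: "minimal_chain n I D Y" and lin: "\<And>l. \<forall>x\<in>set (D l). x = int l + 2"
begin

text \<open>\<open>Zs l\<close> is the Hilbert series of the \<open>l\<close>-th syzygy module. Its
  product \<open>Rs l\<close> with \<open>(1 - t)^n\<close> is the convenient quantity, since a
  linear free module then contributes a single monomial.\<close>

definition Zs :: "nat \<Rightarrow> int fps" where "Zs l = Abs_fps (\<lambda>d. int (fv.dim (syzygies n D Y l (int d))))"
definition Rs :: "nat \<Rightarrow> int fps" where "Rs l = (1 - fps_X) ^ n * Zs l"

lemma dim_free_part_linear: "fv.dim (free_part n (D l) d :: (nat \<Rightarrow> 'k mpoly) set) =
    length (D l) * sdim TYPE('k) n (d - int l - 2)"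
proof -
  have "map (\<lambda>x. sdim TYPE('k) n (d - x)) (D l) = map (\<lambda>x. sdim TYPE('k) n (d - int l - 2)) (D l)"
    by (rule map_cong) (use lin[of l] in \<open>auto simp: algebra_simps\<close>)
  thus ?thesis unfolding dim_free_part by (simp only: sum_list_triv) simp
qed

lemma fps_shift_nth: "fps_nth (fps_X ^ k * hilbert_series n ({0} :: 'k mpoly set)) d =
    int (sdim TYPE('k) n (int d - int k))"
proof (cases "d < k")
  case True
  hence "sdim TYPE('k) n (int d - int k) = 0" by (intro sdim_neg) simp
  thus ?thesis using True by (simp add: fps_X_power_mult_nth)
next
  case False
  thus ?thesis by (simp add: fps_X_power_mult_nth hilbert_series_nth hilbert_fun_zero of_nat_diff)
qed

lemma rank0: "fv.dim (free_part n (D 0) d :: (nat \<Rightarrow> 'k mpoly) set) =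
    fv.dim (syzygies n D Y 0 d) + mv.dim (graded_part n I d)"
proof -
  obtain W where W: "finite W" "free_part n (D 0) d \<subseteq> fv.span (W :: (nat \<Rightarrow> 'k mpoly) set)" using free_part_finite_span
      by blast
  have "fv.dim (free_part n (D 0) d :: (nat \<Rightarrow> 'k mpoly) set) =
      fv.dim {v \<in> free_part n (D 0) d. lincomb (length (D 0)) v (Y 0) 0 =
          0} + mv.dim ((\<lambda>v. lincomb (length (D 0)) v (Y 0) 0) ` free_part n (D 0) d)"
    by (rule fvm.rank_nullity[OF subspace_free_part W]) (simp_all add: lincomb_add vscale_def lincomb_pv pscale_def)
  moreover have "{v \<in> free_part n (D 0) d. lincomb (length (D 0)) v (Y 0) 0 = 0} = syzygies n D Y 0 d"
    unfolding syzygies_def by (intro Collect_cong conj_cong refl lc0_iff[OF I s])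
  ultimately show ?thesis unfolding image0[OF I s] by simp
qed

lemma rankS: "fv.dim (free_part n (D (Suc l)) d :: (nat \<Rightarrow> 'k mpoly) set) =
    fv.dim (syzygies n D Y (Suc l) d) + fv.dim (syzygies n D Y l d)"
proof -
  obtain W where W: "finite W" "free_part n (D (Suc l)) d \<subseteq> fv.span (W :: (nat \<Rightarrow> 'k mpoly) set)"
      using free_part_finite_span by blast
  have "fv.dim (free_part n (D (Suc l)) d :: (nat \<Rightarrow> 'k mpoly) set) =
      fv.dim {v \<in> free_part n (D (Suc l)) d. lincomb (length (D (Suc l))) v (Y (Suc l)) =
          0} + fv.dim ((\<lambda>v. lincomb (length (D (Suc l))) v (Y (Suc l))) ` free_part n (D (Suc l)) d)"
    by (rule fvv.rank_nullity[OF subspace_free_part W]) (simp_all only: lincomb_add vscale_def lincomb_pv)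
  thus ?thesis unfolding imageS[OF I s] syzygies_def[of n D Y "Suc l" d] .
qed

text \<open>Rank-nullity for the cover of the \<open>l\<close>-th syzygies by the free module
  generated in degree \<open>l + 3\<close>.\<close>

lemma Rs_step: "Rs l = of_nat (length (D (Suc l))) * fps_X ^ (l + 3) - Rs (Suc l)"
proof -
  have "Zs l = of_nat (length (D (Suc l))) * (fps_X ^ (l + 3) * hilbert_series n ({0} :: 'k mpoly set)) - Zs (Suc l)"
  proof (rule fps_ext)
    fix d
    have e: "int d - int (Suc l) - 2 = int d - int (l + 3)" by simp
    have "fv.dim (syzygies n D Y (Suc l) (int d)) + fv.dim (syzygies n D Y l (int d)) =
        length (D (Suc l)) * sdim TYPE('k) n (int d - int (l + 3))"
      unfolding rankS[of l "int d", symmetric] dim_free_part_linear[of "Suc l" "int d", unfolded e] ..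
    hence "int (fv.dim (syzygies n D Y (Suc l) (int d))) + int (fv.dim (syzygies n D Y l (int d))) =
        int (length (D (Suc l))) * int (sdim TYPE('k) n (int d - int (l + 3)))"
      by (metis of_nat_add of_nat_mult)
    thus "fps_nth (Zs l) d = fps_nth (of_nat (length (D (Suc l))) * (fps_X ^ (l + 3) * hilbert_series n ({0} :: 'k
        mpoly set)) - Zs (Suc l)) d"
      unfolding fps_sub_nth fps_mult_of_nat_nth fps_shift_nth by (simp add: Zs_def)
  qed
  hence "Rs l = of_nat (length (D (Suc l))) * fps_X ^ (l + 3) * ((1 - fps_X) ^ n * hilbert_series n ({0} :: 'k mpoly
      set)) - Rs (Suc l)"
  proof -
    have "c * (b * (x * h) - z) = b * x * (c * h) - c * z" for b c x h z :: "int fps" by (simp add: algebra_simps)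
    thus ?thesis unfolding Rs_def \<open>Zs l = _\<close> .
  qed
  thus ?thesis unfolding hilbert_series_zero by simp
qed

lemma P_eq: "(1 - fps_X) ^ n * hilbert_series n I = 1 - of_nat (length (D 0)) * fps_X ^ 2 + Rs 0"
proof -
  have "hilbert_series n I = hilbert_series n ({0} :: 'k mpoly set) - of_nat (length (D 0)) * (fps_X ^ 2 *
      hilbert_series n ({0} :: 'k mpoly set)) + Zs 0"
  proof (rule fps_ext)
    fix d
    have "int (fv.dim (syzygies n D Y 0 (int d))) + int (mv.dim (graded_part n I (int d))) =
        int (length (D 0)) * int (sdim TYPE('k) n (int d - int 2))"
      using rank0[of "int d"] dim_free_part_linear[of 0 "int d"] by (simp flip: of_nat_add of_nat_mult)
    moreover have "hilbert_fun n I (int d) =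
        hilbert_fun n ({0} :: 'k mpoly set) (int d) - int (mv.dim (graded_part n I (int d)))"
      unfolding hilbert_fun_zero by (simp add: hilbert_fun_def sdim_def)
    ultimately show "fps_nth (hilbert_series n I) d =
        fps_nth (hilbert_series n ({0} :: 'k mpoly set) - of_nat (length (D 0)) * (fps_X ^ 2 * hilbert_series n ({0}
            :: 'k mpoly set)) + Zs 0) d"
      unfolding fps_sub_nth fps_add_nth fps_mult_of_nat_nth fps_shift_nth by (simp add: Zs_def hilbert_series_nth)
  qed
  hence "(1 - fps_X) ^ n * hilbert_series n I =
      ((1 - fps_X) ^ n * hilbert_series n ({0} :: 'k mpoly set)) - of_nat (length (D 0)) * fps_X ^ 2 * ((1 - fps_X) ^
          n * hilbert_series n ({0} :: 'k mpoly set)) + Rs 0"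
  proof -
    have "c * (h - b * (x * h) + z) = c * h - b * x * (c * h) + c * z" for b c x h z :: "int fps"
        by (simp add: algebra_simps)
    thus ?thesis unfolding Rs_def \<open>hilbert_series n I = _\<close> .
  qed
  thus ?thesis unfolding hilbert_series_zero by simp
qed

lemma Rs_low: "k < l + 3 \<Longrightarrow> fps_nth (Rs l) k = 0"
proof -
  assume k: "k < l + 3"
  have "fps_nth (Zs l) i = 0" if "i \<le> k" for i
  proof -
    have "syzygies n D Y l (int i) \<subseteq> {0}" by (rule syzygies_low[OF I s lin]) (use k that in simp)
    hence "syzygies n D Y l (int i) = {0}" by (auto simp: syzygies_def free_part_0)
    thus ?thesis by (simp add: Zs_def dim_zero del: One_nat_def)
  qed
  thus ?thesis by (simp add: Rs_def fps_mult_nth)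
qed

text \<open>Iterating \<open>Rs_step\<close> moves the coefficient to \<open>Rs (l + m)\<close>, at
  the cost of a sign, where it is the lowest one and hence unaffected by the remaining
  syzygies.\<close>

lemma Rs_nth: "fps_nth (Rs l) (l + m + 3) = (-1) ^ m * int (length (D (l + m + 1)))"
proof (induction m arbitrary: l)
  case 0
  have "fps_nth (Rs l) (l + 3) = int (length (D (Suc l))) - fps_nth (Rs (Suc l)) (l + 3)"
    by (subst Rs_step) (simp add: fps_mult_of_nat_nth)
  thus ?case using Rs_low[of "l + 3" "Suc l"] by simp
next
  case (Suc m)
  have "fps_nth (Rs l) (l + Suc m + 3) = - fps_nth (Rs (Suc l)) (Suc l + m + 3)"
    by (subst Rs_step) (simp add: fps_mult_of_nat_nth)
  thus ?case using Suc[of "Suc l"] by simp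
qed

text \<open>In a linear resolution the terms of the alternating sum occupy distinct degrees. Nothing
  cancels, so the numerator of the Hilbert series displays all Betti numbers.\<close>

theorem hilbert_betti:
  "fps_nth ((1 - fps_X) ^ n * hilbert_series n I) 0 = 1" "fps_nth ((1 - fps_X) ^ n * hilbert_series n I) 1 = 0"
  "fps_nth ((1 - fps_X) ^ n * hilbert_series n I) (i + 2) = (-1) ^ (i + 1) * int (length (D i))"
proof -
  show "fps_nth ((1 - fps_X) ^ n * hilbert_series n I) 0 = 1" "fps_nth ((1 - fps_X) ^ n * hilbert_series n I) 1 = 0"
    unfolding P_eq by (simp_all add: fps_mult_of_nat_nth Rs_low)
  show "fps_nth ((1 - fps_X) ^ n * hilbert_series n I) (i + 2) = (-1) ^ (i + 1) * int (length (D i))"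
  proof (cases i)
    case 0
    thus ?thesis unfolding P_eq by (simp add: fps_mult_of_nat_nth Rs_low)
  next
    case (Suc m)
    hence "fps_nth ((1 - fps_X) ^ n * hilbert_series n I) (i + 2) = fps_nth (Rs 0) (0 + m + 3)"
      unfolding P_eq by (simp add: fps_mult_of_nat_nth eval_nat_numeral)
    thus ?thesis unfolding Rs_nth using Suc by simp
  qed
qed

end

section \<open>Linear nonzerodivisors over an infinite field\<close>

text \<open>The points of the moment curve are in general position: only finitely many of these forms lie in a
  proper subspace.\<close>

definition moment_form :: "nat \<Rightarrow> 'k::field \<Rightarrow> 'k mpoly" where
  "moment_form n a = (\<Sum>i\<in>{1..n}. cst (a ^ i) * var i)"

lemma moment_form_S: "moment_form n a \<in> S n 1"
  unfolding moment_form_def by (rule S_sum) (rule S_cst_mult, simp)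

text \<open>A coefficient of \<open>g\<close> is a linear functional that vanishes on
  \<open>J\<close>; choose one that does not vanish on \<open>x_i\<close>. Along the curve it is a
  nonzero polynomial in the parameter, which has finitely many roots.\<close>

lemma finite_moment_form_in:
  fixes J :: "'k::field mpoly set"
  assumes J: "graded_ideal n J" and i: "i \<in> {1..n}" "var i \<notin> J"
  shows "finite {a. moment_form n a \<in> J}"
proof -
  have "mv.subspace J" using graded_idealD[OF J] by (auto simp: mv.subspace_def pscale_def)
  then obtain g where g: "\<And>x y. g (x + y) = g x + g y" "\<And>c x. g (pscale c x) = pscale c (g x)" "\<And>x. g x = 0 \<longleftrightarrow> x \<in> J"
    using mv.exists_projection_kernel[of J] by blast
  have "g (var i) \<noteq> 0" using g(3) i(2) by blast
  then obtain m where m: "lk (g (var i)) m \<noteq> 0" by (metis poly_mapping_eqI lookup_zero)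
  define p where "p = (\<Sum>k\<in>{1..n}. monom (lk (g (var k)) m) k)"
  have g0: "g 0 = 0" using g(3) graded_idealD(2)[OF J] by blast
  have gs: "g (sum f A) = (\<Sum>a\<in>A. g (f a))" for f and A :: "nat set"
    by (induction A rule: infinite_finite_induct) (simp_all add: g0 g(1))
  have "poly p a = lk (g (moment_form n a)) m" for a
  proof -
    have "g (moment_form n a) = (\<Sum>k\<in>{1..n}. pscale (a ^ k) (g (var k)))"
      unfolding moment_form_def gs by (rule sum.cong) (simp_all add: pscale_def g(2)[unfolded pscale_def])
    thus ?thesis unfolding p_def poly_sum poly_monom
      by (simp only: lookup_sum pscale_def lookup_cst_mult) (rule sum.cong[OF refl mult.commute])
  qed
  moreover have "g (moment_form n a) = 0" if "moment_form n a \<in> J" for a using g(3) that by blast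
  ultimately have "{a. moment_form n a \<in> J} \<subseteq> {a. poly p a = 0}" by auto
  moreover have "p \<noteq> 0"
  proof
    assume "p = 0"
    have "coeff p i = (\<Sum>k\<in>{1..n}. if k = i then lk (g (var k)) m else 0)" unfolding p_def coeff_sum coeff_monom ..
    also have "\<dots> = lk (g (var i)) m" using i(1) by simp
    finally show False using m \<open>p = 0\<close> by simp
  qed
  ultimately show ?thesis using poly_roots_finite finite_subset by blast
qed

text \<open>The submodule of \<open>S/J\<close> generated by \<open>f\<close> contains a nonzero
  socle element.\<close>

definition has_socle_multiple :: "nat \<Rightarrow> 'k::field mpoly set \<Rightarrow> 'k mpoly \<Rightarrow> bool" where
  "has_socle_multiple n J f \<longleftrightarrow> (\<exists>h\<in>polys n. h * f \<notin> J \<and> (\<forall>k\<in>{1..n}. var k * (h * f) \<in> J))"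

text \<open>If \<open>S/J\<close> has zero socle, these are the parameters at which the form is a
  zero divisor. Tolerating elements with socle multiples lets the notion pass through the induction,
  since the larger ideals that occur in it may acquire a socle.\<close>

definition badset :: "nat \<Rightarrow> 'k::field mpoly set \<Rightarrow> 'k set" where
  "badset n J = {a. \<exists>f\<in>polys n. moment_form n a * f \<in> J \<and> f \<notin> J \<and> \<not> has_socle_multiple n J f}"

lemma has_socle_multiple_mult: "has_socle_multiple n J (h * f) \<Longrightarrow> h \<in> polys n \<Longrightarrow> has_socle_multiple n J f"
proof -
  assume "has_socle_multiple n J (h * f)" and h: "h \<in> polys n"
  then obtain g where g: "g \<in> polys n" "g * (h * f) \<notin> J" "\<forall>k\<in>{1..n}. var k * (g * (h * f)) \<in> J"
    by (auto simp: has_socle_multiple_def)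
  have "g * (h * f) = (g * h) * f" by (simp only: mult.assoc)
  thus ?thesis unfolding has_socle_multiple_def using g polys_closed(5)[OF g(1) h] by metis
qed

text \<open>\<open>(J+g)/J\<close> is a copy of \<open>S/(J:g)\<close>. A witness \<open>f\<close>
  that a parameter is bad for \<open>J\<close> either lies in this copy or is nonzero modulo
  \<open>J + g\<close>. In the second case take a socle multiple modulo \<open>J + g\<close>: it
  belongs to the socle of \<open>S/J\<close>, or some variable moves it to a nonzero element of the
  copy, which settles the matter as in the first case.\<close>

lemma badset_step:
  fixes J :: "'k::field mpoly set"
  assumes J: "graded_ideal n J" and g: "g \<in> S n d"
  shows "badset n J \<subseteq> badset n (adjoin n J g) \<union> badset n (colon n J g)"
proof
  fix a assume "a \<in> badset n J"
  then obtain f where f: "f \<in> polys n" "moment_form n a * f \<in> J" "f \<notin> J" "\<not> has_socle_multiple n J f"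
      by (auto simp: badset_def)
  note gP = S_polys[OF g] and lP = S_polys[OF moment_form_S[of n a]]
  show "a \<in> badset n (adjoin n J g) \<union> badset n (colon n J g)"
  proof (rule ccontr)
    assume neg: "a \<notin> badset n (adjoin n J g) \<union> badset n (colon n J g)"
    \<comment> \<open>The case of elements of \<open>(J+g)/J\<close>: write \<open>u\<close> as
      \<open>c + b * g\<close> and transfer the socle multiple of \<open>b\<close> modulo
      \<open>J : g\<close>.\<close>
    have key: "has_socle_multiple n J u" if u: "u \<in> polys n" "u \<in> adjoin n J g" "moment_form n a * u \<in> J" "u \<notin> J" for u
    proof -
      obtain c b where cb: "u = c + b * g" "c \<in> J" "b \<in> polys n" using u(2) unfolding adjoin_def by blast
      have "b * g \<notin> J" using u(4) cb graded_idealD(3)[OF J cb(2)] by auto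
      hence bn: "b \<notin> colon n J g" using cb(3) by (simp add: colon_def)
      have "moment_form n a * u - moment_form n a * c \<in> J"
          by (rule graded_ideal_diff[OF J u(3) graded_idealD(4)[OF J lP cb(2)]])
      hence "moment_form n a * b * g \<in> J" by (simp add: cb(1) algebra_simps)
      hence "moment_form n a * b \<in> colon n J g" using cb(3) lP by (simp add: colon_def polys_closed)
      hence "has_socle_multiple n (colon n J g) b" using neg cb(3) bn by (auto simp: badset_def)
      then obtain h where h: "h \<in> polys n" "h * b \<notin> colon n J g" "\<forall>k\<in>{1..n}. var k * (h * b) \<in> colon n J g"
        by (auto simp: has_socle_multiple_def)
      have hu: "h * u = h * c + h * b * g" by (simp add: cb(1) algebra_simps)
      have hc: "h * c \<in> J" using h(1) cb(2) by (rule graded_idealD(4)[OF J])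
      have "h * u \<notin> J"
      proof
        assume "h * u \<in> J"
        from graded_ideal_diff[OF J this hc] have "h * b * g \<in> J" by (simp add: hu)
        thus False using h(1,2) cb(3) by (simp add: colon_def polys_closed)
      qed
      moreover have "var k * (h * u) \<in> J" if k: "k \<in> {1..n}" for k
      proof -
        have "var k * (h * b) * g \<in> J" using h(3) k by (simp add: colon_def)
        moreover have "var k * (h * c) \<in> J" by (rule graded_idealD(4)[OF J var_in_polys[OF k] hc])
        ultimately have "var k * (h * c) + var k * (h * b) * g \<in> J" by (intro graded_idealD(3)[OF J])
        thus ?thesis by (simp add: hu algebra_simps)
      qed
      ultimately show ?thesis using h(1) by (auto simp: has_socle_multiple_def)
    qed
    have fn: "f \<notin> adjoin n J g" using key[OF f(1) _ f(2,3)] f(4) by blast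
    have "moment_form n a * f \<in> adjoin n J g" using f(2) adjoin_sup(1) by blast
    hence "has_socle_multiple n (adjoin n J g) f" using neg f(1) fn by (auto simp: badset_def)
    then obtain h where h: "h \<in> polys n" "h * f \<notin> adjoin n J g" "\<forall>k\<in>{1..n}. var k * (h * f) \<in> adjoin n J g"
      by (auto simp: has_socle_multiple_def)
    have hfn: "h * f \<notin> J" using h(2) adjoin_sup(1) by blast
    have lh: "moment_form n a * (h * f) \<in> J" using graded_idealD(4)[OF J h(1) f(2)] by (simp add: mult.left_commute)
    show False
    proof (cases "\<forall>k\<in>{1..n}. var k * (h * f) \<in> J")
      case True
      thus ?thesis using f(4) h(1) hfn by (auto simp: has_socle_multiple_def)
    next
      case False
      then obtain k where k: "k \<in> {1..n}" "var k * (h * f) \<notin> J" by blast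
      have "moment_form n a * (var k * (h * f)) \<in> J"
        using graded_idealD(4)[OF J var_in_polys[OF k(1)] lh] by (simp add: mult.left_commute)
      moreover have "var k * (h * f) \<in> polys n" using k h f by (simp add: polys_closed)
      ultimately have "has_socle_multiple n J (var k * (h * f))" using h(3) k by (intro key) auto
      hence "has_socle_multiple n J ((var k * h) * f)" by (simp add: mult.assoc)
      hence "has_socle_multiple n J f" by (rule has_socle_multiple_mult) (use k h in \<open>simp add: polys_closed\<close>)
      thus ?thesis using f(4) by simp
    qed
  qed
qed

text \<open>Noetherian induction. If some homogeneous \<open>g\<close> outside \<open>J\<close> is a
  zero divisor modulo \<open>J\<close>, then \<open>J + g\<close> and \<open>J : g\<close> are both
  strictly larger. Otherwise a form at a bad parameter must lie in \<open>J\<close>, which happens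
  finitely often unless \<open>J\<close> contains all variables; in that case every element outside
  \<open>J\<close> is itself in the socle.\<close>

theorem finite_badset:
  fixes J :: "'k::field mpoly set"
  shows "graded_ideal n J \<Longrightarrow> finite (badset n J)"
proof (induction J rule: wf_induct_rule[OF wf_graded_ideal[of n]])
  case (1 J)
  note J = 1(2)
  have IH: "finite (badset n J')" if "graded_ideal n J'" "J \<subset> J'" for J' using 1(1)[of J'] that J by blast
  show ?case
  proof (cases "\<exists>d g. g \<in> S n d \<and> g \<notin> J \<and> colon n J g \<noteq> J")
    case True
    then obtain d g where g: "g \<in> S n d" "g \<notin> J" "colon n J g \<noteq> J" by blast
    have "J \<subset> adjoin n J g" using adjoin_sup(1)[of J n g] adjoin_sup(2)[OF J, of g] g(2) by blast
    moreover have "J \<subset> colon n J g" using colon_sup[OF J S_polys[OF g(1)]] g(3) by blast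
    ultimately have "finite (badset n (adjoin n J g) \<union> badset n (colon n J g))"
      using IH graded_ideal_adjoin[OF J g(1)] graded_ideal_colon[OF J g(1)] by blast
    thus ?thesis using badset_step[OF J g(1)] by (rule rev_finite_subset)
  next
    case False
    show ?thesis
    proof (cases "\<forall>k\<in>{1..n}. var k \<in> J")
      case True
      have "has_socle_multiple n J f" if "f \<in> polys n" "f \<notin> J" for f
        unfolding has_socle_multiple_def using that True graded_idealD(5)[OF J]
            by (intro bexI[of _ 1]) (simp_all add: polys_closed)
      hence "badset n J = {}" by (auto simp: badset_def)
      thus ?thesis by simp
    next
      case f: False
      then obtain i where i: "i \<in> {1..n}" "var i \<notin> J" by blast
      have "badset n J \<subseteq> {a. moment_form n a \<in> J}"
      proof
        fix a assume "a \<in> badset n J"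
        then obtain f where f: "f \<in> polys n" "moment_form n a * f \<in> J" "f \<notin> J" by (auto simp: badset_def)
        hence "f \<in> colon n J (moment_form n a)" by (simp add: colon_def mult.commute)
        hence "colon n J (moment_form n a) \<noteq> J" using f(3) by auto
        thus "a \<in> {a. moment_form n a \<in> J}" using False moment_form_S by blast
      qed
      thus ?thesis using finite_moment_form_in[OF J i] by (rule finite_subset)
    qed
  qed
qed

text \<open>Components of socle elements are socle elements, so nothing has a socle multiple, and
  every parameter outside the finite set \<open>badset n J\<close> will do.\<close>

lemma exists_nonzerodivisor:
  fixes J :: "'k::field mpoly set"
  assumes inf: "infinite (UNIV :: 'k set)" and J: "graded_ideal n J"
    and soc: "\<And>d f. f \<in> S n d \<Longrightarrow> \<forall>k\<in>{1..n}. var k * f \<in> J \<Longrightarrow> f \<in> J"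
  shows "\<exists>f. f \<in> S n 1 \<and> colon n J f = J"
proof -
  have ns: "\<not> has_socle_multiple n J f" if "f \<in> polys n" for f
  proof
    assume "has_socle_multiple n J f"
    then obtain h where h: "h \<in> polys n" "h * f \<notin> J" "\<forall>k\<in>{1..n}. var k * (h * f) \<in> J"
        by (auto simp: has_socle_multiple_def)
    have hilbert_fun: "h * f \<in> polys n" using h(1) that by (rule polys_closed(5))
    have "hc d (h * f) \<in> J" for d
    proof (rule soc[OF hc_S[OF hilbert_fun]], rule ballI)
      fix k assume k: "k \<in> {1..n}"
      have "hc (d + 1) (var k * (h * f)) = var k * hc d (h * f)" using hc_mult[OF var_S[OF k] hilbert_fun, of "d + 1"]
          by simp
      thus "var k * hc d (h * f) \<in> J" using graded_idealD(6)[OF J h(3)[rule_format, OF k], of "d + 1"] by simp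
    qed
    thus False using h(2) graded_ideal_hc_iff[OF J] by blast
  qed
  obtain a where a: "a \<notin> badset n J" using finite_badset[OF J] inf by (metis UNIV_I finite_subset subsetI)
  have "colon n J (moment_form n a) = J"
  proof (intro equalityI subsetI)
    fix f assume "f \<in> colon n J (moment_form n a)"
    hence f: "f \<in> polys n" "moment_form n a * f \<in> J" by (simp_all add: colon_def mult.commute)
    show "f \<in> J"
    proof (rule ccontr)
      assume "f \<notin> J"
      hence "a \<in> badset n J" unfolding badset_def using f ns[OF f(1)] by blast
      thus False using a by simp
    qed
  qed (use colon_sup[OF J S_polys[OF moment_form_S]] in blast)
  thus ?thesis using moment_form_S by blast
qed

section \<open>Hilbert series of 1-regular quotients\<close>

text \<open>\<open>W w\<close> is the Hilbert series, divided by that of a polynomial ring in one variable, of the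
  threshold graph built by \<open>w\<close>: \<open>True\<close> adds a dominating and \<open>False\<close> an isolated vertex,
  the head of the list coming last.\<close>

fun W :: "bool list \<Rightarrow> int fps" where
  "W [] = 1"
| "W (b # w) = (if b then Abs_fps (\<lambda>_. 1) * W w else W w + fps_X)"

lemma geom_inverse: "(1 - fps_X) * Abs_fps (\<lambda>_. 1) = (1 :: int fps)"
proof (rule fps_ext)
  fix d show "fps_nth ((1 - fps_X) * Abs_fps (\<lambda>_. 1)) d = fps_nth (1 :: int fps) d"
    by (cases d) (simp_all add: left_diff_distrib)
qed

text \<open>For \<open>q = 0\<close> every variable lies in \<open>J\<close> and the quotient is the
  field. Otherwise the form \<open>f\<close> of either case is linear and outside \<open>J\<close>,
  and \<open>q\<close> drops by one. Forms removed first correspond to vertices added last.\<close>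

theorem regular_hilbert_series:
  fixes J :: "'k::field mpoly set"
  assumes inf: "infinite (UNIV :: 'k set)"
  shows "graded_ideal n J \<Longrightarrow> 1 \<notin> J \<Longrightarrow> regularity_le n 1 J \<Longrightarrow> hilbert_fun n J 1 = int q \<Longrightarrow> \<exists>w. length w = q \<and>
      hilbert_series n J = W w"
proof (induction q arbitrary: J)
  case (0 J)
  have "var k \<in> J" if k: "k \<in> {1..n}" for k
  proof -
    obtain B where B: "finite B" "S n 1 \<subseteq> mv.span (B :: 'k mpoly set)" by (rule S_finite_span)
    have "graded_part n J 1 = S n 1"
      by (rule mv.fd_dim_eq[OF B graded_part_S subspace_graded_part[OF 0(1)]]) (use 0(4) in \<open>simp add: hilbert_fun_def\<close>)
    thus ?thesis using var_S[OF k] by (auto simp: graded_part_def)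
  qed
  hence "hilbert_series n J = 1" using hilbert_series_irrelevant[OF 0(1) _ 0(2)] by blast
  thus ?case by (intro exI[of _ "[]"]) simp
next
  case (Suc q J)
  note J = Suc.prems(1)
  \<comment> \<open>For reasons of degree \<open>1\<close> cannot lie in \<open>J + f\<close>. The
    contradiction is phrased as membership of \<open>f\<close> in \<open>J\<close>, which both cases
    refute.\<close>
  have one_in: "f \<in> J" if f: "1 \<in> adjoin n J f" "f \<in> S n 1" for f
  proof -
    have "1 \<in> graded_part n (adjoin n J f) 0" using f(1) cst_S[of 1 n] by (simp add: graded_part_def)
    then obtain a b where ab: "a \<in> graded_part n J 0" "b \<in> S n (0 - 1)" "1 = a + b * f"
        unfolding graded_part_adjoin_iff[OF J f(2)] by blast
    have "b = 0" using ab(2) S_neg[of "0 - 1" n] by auto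
    hence "1 \<in> J" using ab by (simp add: graded_part_def)
    thus ?thesis using Suc.prems(2) by simp
  qed
  show ?case
  proof (cases "\<exists>f. f \<in> S n 1 \<and> f \<notin> J \<and> (\<forall>k\<in>{1..n}. var k * f \<in> J)")
    case True
    then obtain f where f: "f \<in> S n 1" "f \<notin> J" "\<forall>k\<in>{1..n}. var k * f \<in> J" by blast
    have cv: "\<forall>k\<in>{1..n}. var k \<in> colon n J f" using f(3) by (simp add: colon_def)
    have c1: "1 \<notin> colon n J f" using f(2) by (simp add: colon_def)
    have Hc: "hilbert_series n (colon n J f) = 1"
        by (rule hilbert_series_irrelevant[OF graded_ideal_colon[OF J f(1)] cv c1])
    have H: "hilbert_series n J = hilbert_series n (adjoin n J f) + fps_X" using hilbert_series_exact[OF J f(1)] Hc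
        by simp
    have "hilbert_fun n (adjoin n J f) 1 = int q"
      using arg_cong[OF H, of "\<lambda>p. fps_nth p 1"] Suc.prems(4) by (simp add: hilbert_series_nth)
    then obtain w where w: "length w = q" "hilbert_series n (adjoin n J f) = W w"
      using Suc.IH[OF graded_ideal_adjoin[OF J f(1)] _ regularity_le_socle[OF J f(1,3) Suc.prems(3)]] one_in f(1,2)
          by auto
    show ?thesis using w H by (intro exI[of _ "False # w"]) simp
  next
    case False
    \<comment> \<open>Degrees from 2 on are excluded by regularity and degree 1 by the case
      assumption. A nonzero constant in the socle would put all variables into \<open>J\<close>,
      contrary to the positive dimension of the linear part.\<close>
    have soc: "f \<in> J" if f: "f \<in> S n d" "\<forall>k\<in>{1..n}. var k * f \<in> J" for d f
    proof (cases "d \<ge> 2")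
      case True
      show ?thesis by (rule regularity_le_no_socle[OF J Suc.prems(3) f(1) True f(2)])
    next
      case d: False
      show ?thesis
      proof (cases "d = 1")
        case True
        thus ?thesis using False f by blast
      next
        case d1: False
        show ?thesis
        proof (cases "d = 0")
          case True
          then obtain c where c: "f = cst c" using f(1) S_0 by blast
          have "c = 0"
          proof (rule ccontr)
            assume "c \<noteq> 0"
            have "var k \<in> J" if k: "k \<in> {1..n}" for k
            proof -
              have "cst (inverse c) * (var k * f) \<in> J"
                  by (rule graded_idealD(4)[OF J cst_in_polys f(2)[rule_format, OF k]])
              also have "cst (inverse c) * (var k * f) = cst (inverse c * c) * var k" by (simp add: c)
              finally show ?thesis using \<open>c \<noteq> 0\<close> by (simp del: cst_simps(4))
            qed
            hence "S n 1 \<subseteq> J" by (intro S_pos_in_ideal[OF J]) auto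
            hence "graded_part n J 1 = S n 1" by (auto simp: graded_part_def)
            thus False using Suc.prems(4) by (simp add: hilbert_fun_def)
          qed
          thus ?thesis using c graded_idealD(2)[OF J] by simp
        next
          case False
          hence "d < 0" using d d1 by simp
          have "f \<in> {0}" using f(1) unfolding S_neg[OF \<open>d < 0\<close>] .
          thus ?thesis using graded_idealD(2)[OF J] by simp
        qed
      qed
    qed
    have "\<exists>f. f \<in> S n 1 \<and> colon n J f = J" by (rule exists_nonzerodivisor[OF inf J]) (rule soc)
    then obtain f where f: "f \<in> S n 1" "colon n J f = J" by blast
    have fn: "f \<notin> J"
    proof
      assume "f \<in> J"
      hence "1 \<in> colon n J f" by (simp add: colon_def polys_closed)
      thus False using f(2) Suc.prems(2) by simp
    qed
    have H: "hilbert_series n J = hilbert_series n (adjoin n J f) + fps_X * hilbert_series n J"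
        using hilbert_series_exact[OF J f(1)] f(2) by simp
    have "hilbert_fun n J 0 = 1"
    proof -
      have "graded_part n J 0 \<subseteq> {0}"
      proof
        fix p assume p: "p \<in> graded_part n J 0"
        then obtain c where c: "p = cst c" using S_0 by (auto simp: graded_part_def)
        have "c = 0"
        proof (rule ccontr)
          assume "c \<noteq> 0"
          have "cst (inverse c) * p \<in> J" using p by (intro graded_idealD(4)[OF J]) (auto simp: graded_part_def)
          thus False using \<open>c \<noteq> 0\<close> cst_simps(4)[of "inverse c" c] Suc.prems(2) by (simp add: c)
        qed
        thus "p \<in> {0}" using c by simp
      qed
      hence "graded_part n J 0 = {0}" using graded_idealD(2)[OF J] by (auto simp: graded_part_def)
      thus ?thesis using sdim_0[where ?'k = 'k, of n] by (simp add: hilbert_fun_def dim_zero sdim_def)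
    qed
    hence "hilbert_fun n (adjoin n J f) 1 = int q"
      using arg_cong[OF H, of "\<lambda>p. fps_nth p 1"] Suc.prems(4) by (simp add: hilbert_series_nth)
    then obtain w where w: "length w = q" "hilbert_series n (adjoin n J f) = W w"
      using Suc.IH[OF graded_ideal_adjoin[OF J f(1)] _ regularity_le_nonzerodivisor[OF J f Suc.prems(3)]] one_in f(1)
          fn by auto
    have "(1 - fps_X) * hilbert_series n J = W w"
      unfolding left_diff_distrib mult_1 diff_eq_eq w(2)[symmetric] by (rule H)
    moreover have "hilbert_series n J = ((1 - fps_X) * Abs_fps (\<lambda>_. 1)) * hilbert_series n J" unfolding geom_inverse
        by simp
    hence "hilbert_series n J = Abs_fps (\<lambda>_. 1) * ((1 - fps_X) * hilbert_series n J)" by (simp only: mult_ac)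
    ultimately have "hilbert_series n J = W (True # w)" by simp
    thus ?thesis using w(1) by (intro exI[of _ "True # w"]) simp
  qed
qed

section \<open>Extension of the base field\<close>

locale field_extension =
  fixes \<iota> :: "'k::field \<Rightarrow> 'K::field"
  assumes iota: "\<iota> 0 = 0" "\<iota> 1 = 1" "\<iota> (a + b) = \<iota> a + \<iota> b" "\<iota> (a * b) = \<iota> a * \<iota> b"
begin

sublocale K: vector_space "\<lambda>c x. \<iota> c * x"
  by unfold_locales (simp_all add: iota algebra_simps)

definition Bs :: "'K set" where "Bs = K.extend_basis {}"

lemma Bs: "K.independent Bs" "K.span Bs = UNIV"
  by (simp_all add: Bs_def K.independent_extend_basis K.span_extend_basis K.independent_empty)

definition \<pi> :: "'K \<Rightarrow> 'K \<Rightarrow> 'k" where "\<pi> b x = K.representation Bs x b"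

lemma pi_add: "\<pi> b (x + y) = \<pi> b x + \<pi> b y"
  unfolding \<pi>_def using K.representation_add[OF Bs(1)] Bs(2) by simp

lemma pi_0: "\<pi> b 0 = 0"
  unfolding \<pi>_def by (simp add: K.representation_zero)

lemma pi_scale: "\<pi> b (\<iota> c * x) = c * \<pi> b x"
  unfolding \<pi>_def using K.representation_scale[OF Bs(1), of x c] Bs(2) by simp

lemma pi_outside: "b \<notin> Bs \<Longrightarrow> \<pi> b x = 0"
  unfolding \<pi>_def using K.representation_ne_zero by metis

lemma pi_basis: "b \<in> Bs \<Longrightarrow> \<pi> c b = (if c = b then 1 else 0)"
  unfolding \<pi>_def using K.representation_basis[OF Bs(1), of b] by simp

lemma pi_finite: "finite {b. \<pi> b x \<noteq> 0}"
  unfolding \<pi>_def by (rule K.finite_representation)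

lemma pi_sum: "x = (\<Sum>b | \<pi> b x \<noteq> 0. \<iota> (\<pi> b x) * b)"
  unfolding \<pi>_def using K.sum_nonzero_representation_eq[OF Bs(1), of x] Bs(2) by simp

lemma pi_sum_superset: "finite A \<Longrightarrow> {b. \<pi> b x \<noteq> 0} \<subseteq> A \<Longrightarrow> x = (\<Sum>b\<in>A. \<iota> (\<pi> b x) * b)"
  by (subst (1) pi_sum) (rule sum.mono_neutral_left, auto simp: iota)

text \<open>The polynomial over \<open>k\<close> formed by the \<open>b\<close>-th coordinates of
  the coefficients. A polynomial over \<open>K\<close> is recovered from finitely many of these,
  those with \<open>b\<close> in \<open>supp\<close>.\<close>

definition pm :: "'K \<Rightarrow> 'K mpoly \<Rightarrow> 'k mpoly" where "pm b p = Poly_Mapping.map (\<pi> b) p"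
definition im :: "'k mpoly \<Rightarrow> 'K mpoly" where "im p = Poly_Mapping.map \<iota> p"

lemma lookup_pm [simp]: "lk (pm b p) m = \<pi> b (lk p m)"
  unfolding pm_def by (auto simp: Poly_Mapping.map.rep_eq when_def pi_0)

lemma lookup_im [simp]: "lk (im p) m = \<iota> (lk p m)"
  unfolding im_def by (auto simp: Poly_Mapping.map.rep_eq when_def iota)

lemma pm_add: "pm b (p + q) = pm b p + pm b q" by (rule poly_mapping_eqI) (simp add: lookup_add pi_add)
lemma pm_0 [simp]: "pm b 0 = 0" by (rule poly_mapping_eqI) (simp add: pi_0)
lemma pm_uminus: "pm b (- p) = - pm b p"
  using pm_add[of b p "- p"] by (simp add: eq_neg_iff_add_eq_0 add.commute)
lemma pm_diff: "pm b (p - q) = pm b p - pm b q"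
  using pm_add[of b p "- q"] by (simp add: pm_uminus)
lemma pm_sum: "pm b (sum f A) = (\<Sum>a\<in>A. pm b (f a))"
  by (induction A rule: infinite_finite_induct) (simp_all add: pm_add)

lemma pm_polys: "p \<in> polys n \<Longrightarrow> pm b p \<in> polys n"
  unfolding polys_iff lookup_pm by (metis pi_0)

lemma pm_S: "p \<in> S n d \<Longrightarrow> pm b p \<in> S n d"
  unfolding S_iff lookup_pm using pm_polys by (metis pi_0)

lemma im_S: "p \<in> S n d \<Longrightarrow> im p \<in> S n d"
  unfolding S_iff polys_iff lookup_im by (metis iota(1))

lemma pm_hc: "pm b (hc d p) = hc d (pm b p)"
  by (rule poly_mapping_eqI) (simp add: lookup_hc pi_0)

lemma pm_var: "pm b (var i * p) = var i * pm b p"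
  by (rule poly_mapping_eqI) (simp add: lookup_var_mult_if pi_0)

definition supp :: "'K mpoly \<Rightarrow> 'K set" where "supp p = (\<Union>m\<in>kys p. {b. \<pi> b (lk p m) \<noteq> 0})"

lemma finite_supp: "finite (supp p)" by (simp add: supp_def pi_finite)

lemma in_supp: "\<pi> b (lk p m) \<noteq> 0 \<Longrightarrow> b \<in> supp p"
  unfolding supp_def by (rule UN_I[of m]) (auto simp: in_keys_iff pi_0)

lemma pm_notin_supp: "b \<notin> supp p \<Longrightarrow> pm b p = 0"
  by (rule poly_mapping_eqI) (auto simp: supp_def in_keys_iff pi_0)

lemma pm_expand:
  assumes "finite A" "supp p \<subseteq> A" shows "p = (\<Sum>b\<in>A. cst b * im (pm b p))"
proof (rule poly_mapping_eqI)
  fix m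
  have "{b. \<pi> b (lk p m) \<noteq> 0} \<subseteq> A" using assms(2) in_supp by blast
  from pi_sum_superset[OF assms(1) this] show "lk p m = lk (\<Sum>b\<in>A. cst b * im (pm b p)) m"
    by (simp add: lookup_sum mult.commute)
qed

lemma pm_cst_im: "b \<in> Bs \<Longrightarrow> pm c (cst b * im p) = (if c = b then p else 0)"
proof (rule poly_mapping_eqI)
  fix m assume b: "b \<in> Bs"
  have "\<pi> c (b * \<iota> (lk p m)) = lk p m * \<pi> c b" using pi_scale[of c "lk p m" b] by (simp add: mult.commute)
  thus "lk (pm c (cst b * im p)) m = lk (if c = b then p else 0) m" using pi_basis[OF b, of c] by simp
qed

lemma supp_Bs: "supp p \<subseteq> Bs" using pi_outside by (auto simp: supp_def)

text \<open>The extension of \<open>J\<close> to a bigger field consists of the polynomials whose coordinates with respect to a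
  basis of the field extension all lie in \<open>J\<close>.\<close>

definition ext :: "nat \<Rightarrow> 'k mpoly set \<Rightarrow> 'K mpoly set" where
  "ext n J = {p \<in> polys n. \<forall>b. pm b p \<in> J}"

lemma lookup_single_mult_if:
  fixes r :: "'a::field mpoly"
  shows "lk (Poly_Mapping.single m a * r) k = (if \<exists>l. k = m + l then a * lk r (k - m) else 0)"
proof (cases "\<exists>l. k = m + l")
  case True
  then obtain l where "k = m + l" by blast
  thus ?thesis using lookup_single_mult[of m a r l] by auto
next
  case False
  thus ?thesis using lookup_single_mult_0[of k m a r] by auto
qed

text \<open>Every coordinate of \<open>p * q\<close> is a combination of coordinates of
  \<open>q\<close> with coefficients over \<open>k\<close>, even though \<open>p\<close> has
  coefficients in \<open>K\<close>. Hence \<open>ext\<close> is closed under multiplication by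
  polynomials over \<open>K\<close>.\<close>

lemma pm_mult_expand:
  assumes "finite A" "supp q \<subseteq> A"
  shows "pm b (p * q) = (\<Sum>c\<in>A. \<Sum>m\<in>kys p. cst (\<pi> b (lk p m * c)) * Poly_Mapping.single m 1 * pm c q)"
proof (rule poly_mapping_eqI)
  fix k
  have "p * q = (\<Sum>m\<in>kys p. Poly_Mapping.single m (lk p m) * q)"
    by (subst (1) poly_sum_monomials[of p]) (simp add: sum_distrib_right)
  hence "lk (pm b (p * q)) k = (\<Sum>m\<in>kys p. \<pi> b (lk (Poly_Mapping.single m (lk p m) * q) k))"
    by (simp only: pm_sum lookup_sum lookup_pm)
  also have "\<dots> = (\<Sum>m\<in>kys p. \<Sum>c\<in>A. lk (cst (\<pi> b (lk p m * c)) * Poly_Mapping.single m 1 * pm c q) k)"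
  proof (rule sum.cong[OF refl])
    fix m
    show "\<pi> b (lk (Poly_Mapping.single m (lk p m) * q) k) =
        (\<Sum>c\<in>A. lk (cst (\<pi> b (lk p m * c)) * Poly_Mapping.single m 1 * pm c q) k)"
    proof (cases "\<exists>l. k = m + l")
      case True
      have ps: "\<pi> b (sum f A) = (\<Sum>a\<in>A. \<pi> b (f a))" for f
        by (induction A rule: infinite_finite_induct) (simp_all add: pi_0 pi_add)
      have sub: "{c. \<pi> c (lk q (k - m)) \<noteq> 0} \<subseteq> A" using assms(2) in_supp by blast
      have "lk p m * lk q (k - m) = (\<Sum>c\<in>A. \<iota> (\<pi> c (lk q (k - m))) * (lk p m * c))"
        by (subst pi_sum_superset[OF assms(1) sub]) (simp add: sum_distrib_left mult.left_commute)
      hence "\<pi> b (lk p m * lk q (k - m)) = (\<Sum>c\<in>A. \<pi> c (lk q (k - m)) * \<pi> b (lk p m * c))"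
        by (simp only: ps pi_scale)
      thus ?thesis using True
        by (simp add: lookup_single_mult_if mult.assoc) (rule sum.cong[OF refl mult.commute])
    next
      case False
      thus ?thesis by (simp add: lookup_single_mult_if mult.assoc pi_0)
    qed
  qed
  also have "\<dots> = (\<Sum>c\<in>A. \<Sum>m\<in>kys p. lk (cst (\<pi> b (lk p m * c)) * Poly_Mapping.single m 1 * pm c q) k)"
    by (rule sum.swap)
  finally show "lk (pm b (p * q)) k = lk (\<Sum>c\<in>A. \<Sum>m\<in>kys p. cst (\<pi> b (lk p m * c)) * Poly_Mapping.single m 1 * pm c q) k"
    by (simp only: lookup_sum)
qed

lemma graded_ideal_ext:
  assumes J: "graded_ideal n J" shows "graded_ideal n (ext n J)"
  unfolding graded_ideal_def
proof (intro conjI ballI allI)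
  fix p q :: "'K mpoly" assume p: "p \<in> polys n" and q: "q \<in> ext n J"
  have "pm b (p * q) \<in> J" for b
    unfolding pm_mult_expand[OF finite_supp order_refl]
  proof (rule graded_ideal_sum[OF J], rule graded_ideal_sum[OF J], rule graded_idealD(4)[OF J])
    fix c m assume "m \<in> kys p"
    hence "kys m \<subseteq> {1..n}" by (rule polysD[OF p])
    hence "Poly_Mapping.single m 1 \<in> polys n" by (simp add: polys_def)
    thus "cst (\<pi> b (lk p m * c)) * Poly_Mapping.single m 1 \<in> polys n" by (intro polys_closed(5)) simp_all
  qed (use q in \<open>simp add: ext_def\<close>)
  thus "p * q \<in> ext n J" using p q by (simp add: ext_def polys_closed)
qed (auto simp: ext_def polys_closed pm_add pm_hc hc_polys graded_idealD[OF J])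

lemma ext_one: "graded_ideal n J \<Longrightarrow> 1 \<in> ext n J \<Longrightarrow> 1 \<in> J"
proof -
  assume J: "graded_ideal n J" and e: "1 \<in> ext n J"
  \<comment> \<open>The basis need not contain \<open>1\<close>, so some basis element with a
    nonzero coordinate of \<open>1\<close> is chosen.\<close>
  obtain b where b: "\<pi> b (1::'K) \<noteq> 0"
  proof (rule ccontr)
    assume "\<not> thesis"
    hence "\<pi> b (1::'K) = 0" for b using that by blast
    hence "(1::'K) = 0" using pi_sum[of 1] by simp
    thus False by simp
  qed
  have "pm b 1 = cst (\<pi> b 1)" by (rule poly_mapping_eqI) (simp add: lookup_one when_def lookup_cst pi_0)
  hence "cst (\<pi> b 1) \<in> J" using e by (simp add: ext_def) metis
  hence "cst (inverse (\<pi> b 1)) * cst (\<pi> b 1) \<in> J" by (intro graded_idealD(4)[OF J]) simp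
  thus "1 \<in> J" using b cst_simps(4)[of "inverse (\<pi> b 1)" "\<pi> b 1"] by simp
qed

lemma pm_koszul_diff: "pm b (kp.koszul_diff n u A) = kp.koszul_diff n (\<lambda>A. pm b (u A)) A"
  unfolding kp.koszul_diff_def pm_sum by (rule sum.cong) (simp_all add: sg_def pm_uminus pm_var)

lemma pm_chain: "chain n i j (S n) u \<Longrightarrow> chain n i j (S n) (\<lambda>A. pm b (u A))"
  by (rule chainI) (simp_all add: pm_S chain_val chain_0 del: atLeastAtMost_iff)

text \<open>The Koszul differential only multiplies by variables and so acts on each coordinate
  separately. The equations are solved over \<open>k\<close> for the finitely many coordinates in
  \<open>F\<close> that the chain involves, and the solutions are reassembled in
  \<open>v\<close>.\<close>

lemma regularity_le_ext_field:
  assumes r: "regularity_le n r J" and J: "graded_ideal n J" shows "regularity_le n r (ext n J)"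
  unfolding regularity_le_def
proof (intro allI impI)
  fix i j assume j: "j > int i + r"
  show "kp.koszul_exact n i j (S n) (graded_part n (ext n J))"
    unfolding kp.koszul_exact_def
  proof safe
    fix u :: "nat set \<Rightarrow> 'K mpoly" assume u: "chain n i j (S n) u"
        "\<forall>A. kp.koszul_diff n u A \<in> graded_part n (ext n J) (j - int i + 1)"
    define F where "F = (\<Union>A\<in>Pow {1..n}. supp (u A))"
    have fF: "finite F" unfolding F_def by (intro finite_UN_I finite_supp) simp
    have FB: "F \<subseteq> Bs" using supp_Bs by (auto simp: F_def)
    have z: "kp.koszul_exact n i j (S n) (graded_part n J)" using r j by (simp add: regularity_le_def)
    have "\<exists>w. chain n (Suc i) j (S n) w \<and> (\<forall>A. pm b (u A) - kp.koszul_diff n w A \<in> graded_part n J (j - int i))" for b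
    proof -
      have k: "kp.koszul_diff n (\<lambda>A. pm b (u A)) A \<in> graded_part n J (j - int i + 1)" for A
        using u(2) pm_S unfolding pm_koszul_diff[symmetric] by (auto simp: graded_part_def ext_def)
      show ?thesis by (rule kp.koszul_exactE[OF z pm_chain[OF u(1), of b] k]) blast
    qed
    then obtain w where w: "\<And>b. chain n (Suc i) j (S n) (w b)"
        "\<And>b A. pm b (u A) - kp.koszul_diff n (w b) A \<in> graded_part n J (j - int i)" by metis
    define v where "v = (\<lambda>A. \<Sum>b\<in>F. cst b * im (w b A))"
    have im0: "im 0 = 0" by (rule poly_mapping_eqI) (simp add: iota)
    have cv: "chain n (Suc i) j (S n) v"
    proof (rule chainI)
      fix A assume "A \<subseteq> {1..n}" "card A = Suc i"
      thus "v A \<in> S n (j - int (Suc i))" unfolding v_def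
        by (intro S_sum S_cst_mult im_S) (rule chain_val[OF w(1)])
    next
      fix A assume "\<not> (A \<subseteq> {1..n} \<and> card A = Suc i)"
      hence "w b A = 0" for b by (rule chain_0[OF w(1)])
      thus "v A = 0" by (simp add: v_def im0)
    qed
    have pmv: "pm c (v A) = (if c \<in> F then w c A else 0)" for c A
    proof -
      have "pm c (v A) = (\<Sum>b\<in>F. if c = b then w b A else 0)"
        unfolding v_def pm_sum by (rule sum.cong[OF refl]) (use FB pm_cst_im in auto)
      thus ?thesis using fF by simp
    qed
    have "u A - kp.koszul_diff n v A \<in> graded_part n (ext n J) (j - int i)" for A
    proof -
      have S: "u A - kp.koszul_diff n v A \<in> S n (j - int i)"
        using kp.chain_in[OF kp.koszul_diff_chain[OF gm_S cv] gm_S] kp.chain_in[OF u(1) gm_S] by (simp add: S_diff)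
      have "pm c (u A - kp.koszul_diff n v A) \<in> J" for c
      proof (cases "c \<in> F")
        case True
        have "(\<lambda>A. pm c (v A)) = w c" using True by (simp add: pmv)
        hence "pm c (u A - kp.koszul_diff n v A) = pm c (u A) - kp.koszul_diff n (w c) A"
            by (simp add: pm_diff pm_koszul_diff)
        thus ?thesis using w(2)[of c A] by (simp add: graded_part_def)
      next
        case False
        have "(\<lambda>A. pm c (v A)) = (\<lambda>A. 0)" using False by (simp add: pmv)
        hence "pm c (kp.koszul_diff n v A) = kp.koszul_diff n (\<lambda>A. 0) A" by (simp only: pm_koszul_diff)
        hence "pm c (kp.koszul_diff n v A) = 0" by (simp add: kp.koszul_diff_def[of n "\<lambda>A. 0"])
        moreover have "pm c (u A) = 0"
        proof (cases "A \<subseteq> {1..n}")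
          case True
          hence "c \<notin> supp (u A)" using False by (auto simp: F_def)
          thus ?thesis by (rule pm_notin_supp)
        next
          case f: False
          thus ?thesis using chain_0[OF u(1), of A] by simp
        qed
        ultimately show ?thesis using graded_idealD(2)[OF J] by (simp add: pm_diff)
      qed
      thus ?thesis using S S_polys by (auto simp: graded_part_def ext_def)
    qed
    thus "\<exists>w. chain n (Suc i) j (S n) w \<and> (\<forall>A. u A - kp.koszul_diff n w A \<in> graded_part n (ext n J) (j - int i))"
        using cv by blast
  qed
qed

text \<open>A basis of \<open>J_d\<close> over \<open>k\<close> remains a basis over
  \<open>K\<close>: expansion by coordinates shows that it spans, and a linear relation over
  \<open>K\<close> gives one over \<open>k\<close> in every coordinate.\<close>

lemma dim_ext:
  assumes J: "graded_ideal n J"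
  shows "mv.dim (graded_part n (ext n J) d) = mv.dim (graded_part n J d)"
proof -
  obtain B where B: "B \<subseteq> graded_part n J d" "mv.independent B" "graded_part n J d \<subseteq> mv.span B" "card B =
      mv.dim (graded_part n J d)" by (rule mv.basis_exists)
  obtain W where W: "finite W" "S n d \<subseteq> mv.span (W :: 'k mpoly set)" by (rule S_finite_span)
  have finB: "finite B" using mv.independent_span_bound[OF W(1) B(2)] B(1) W(2) graded_part_S by blast
  have inj: "inj im"
  proof (rule injI)
    fix p q assume pq: "im p = im q"
    have "Bs \<noteq> {}"
    proof
      assume "Bs = {}"
      hence "(1::'K) \<in> K.span {}" using Bs(2) by simp
      thus False by simp
    qed
    then obtain b where "b \<in> Bs" by blast
    from pm_cst_im[OF this, of b] show "p = q" using pq by metis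
  qed
  have sp: "graded_part n (ext n J) d \<subseteq> mv.span (im ` B)"
  proof
    fix p assume p: "p \<in> graded_part n (ext n J) d"
    have "cst b * im (pm b p) \<in> mv.span (im ` B)" for b
    proof -
      have "pm b p \<in> mv.span B" using p pm_S B(3) by (auto simp: graded_part_def ext_def)
      hence "im (pm b p) \<in> mv.span (im ` B)"
      proof (induction rule: mv.span_induct_alt)
        case base
        have "im 0 = 0" by (rule poly_mapping_eqI) (simp add: iota)
        thus ?case by (simp add: mv.span_zero)
      next
        case (step c x y)
        have "im (pscale c x + y) = pscale (\<iota> c) (im x) + im y"
          by (rule poly_mapping_eqI) (simp add: lookup_add iota pscale_def)
        moreover have "pscale (\<iota> c) (im x) \<in> mv.span (im ` B)" using step(1) by (intro mv.span_scale mv.span_base) simp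
        ultimately show ?case using step(2) by (simp add: mv.span_add)
      qed
      from mv.span_scale[OF this, of b] show ?thesis by (simp add: pscale_def)
    qed
    hence "(\<Sum>b\<in>supp p. cst b * im (pm b p)) \<in> mv.span (im ` B)" by (intro mv.span_sum)
    thus "p \<in> mv.span (im ` B)" using pm_expand[OF finite_supp order_refl, of p] by simp
  qed
  have sub: "im ` B \<subseteq> graded_part n (ext n J) d"
  proof
    fix x assume "x \<in> im ` B"
    then obtain p where p: "x = im p" "p \<in> B" by blast
    have pJ: "p \<in> J" "p \<in> S n d" using p(2) B(1) by (auto simp: graded_part_def)
    have "pm b (im p) = cst (\<pi> b 1) * p" for b
    proof (rule poly_mapping_eqI)
      fix m show "lk (pm b (im p)) m = lk (cst (\<pi> b 1) * p) m"
        unfolding lookup_pm lookup_im lookup_cst_mult using pi_scale[of b "lk p m" 1] by (simp add: mult.commute)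
    qed
    hence "im p \<in> ext n J" using pJ im_S[OF pJ(2)] graded_idealD(4)[OF J cst_in_polys pJ(1)] S_polys
        by (auto simp: ext_def)
    thus "x \<in> graded_part n (ext n J) d" using p(1) im_S[OF pJ(2)] by (simp add: graded_part_def)
  qed
  have ind: "mv.independent (im ` B)"
  proof (rule mv.independent_if_scalars_zero)
    show "finite (im ` B)" using finB by simp
    fix f x assume eq: "(\<Sum>x\<in>im ` B. pscale (f x) x) = 0" and x: "x \<in> im ` B"
    have eq': "(\<Sum>p\<in>B. pscale (f (im p)) (im p)) = 0"
      using eq by (subst (asm) sum.reindex[OF inj_on_subset[OF inj subset_UNIV]]) simp
    have "\<pi> c (f (im p)) = 0" if p: "p \<in> B" for c p
    proof -
      have "pm c (pscale a (im q)) = pscale (\<pi> c a) q" for a q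
      proof (rule poly_mapping_eqI)
        fix m show "lk (pm c (pscale a (im q))) m = lk (pscale (\<pi> c a) q) m"
          unfolding pscale_def lookup_pm lookup_im lookup_cst_mult using pi_scale[of c "lk q m" a]
              by (simp add: mult.commute)
      qed
      hence "(\<Sum>p\<in>B. pscale (\<pi> c (f (im p))) p) = pm c (\<Sum>p\<in>B. pscale (f (im p)) (im p))" by (simp add: pm_sum)
      hence "(\<Sum>p\<in>B. pscale (\<pi> c (f (im p))) p) = 0" by (simp add: eq')
      thus ?thesis by (rule mv.independentD[OF B(2) finB order_refl _ p])
    qed
    hence "f (im p) = 0" if "p \<in> B" for p using that pi_sum[of "f (im p)"] by simp
    thus "f x = 0" using x by blast
  qed
  have "mv.dim (graded_part n (ext n J) d) = card (im ` B)" by (rule mv.dim_unique[OF sub sp ind refl])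
  also have "\<dots> = card B" by (rule card_image[OF inj_on_subset[OF inj subset_UNIV]])
  finally show ?thesis using B(4) by simp
qed

lemma ext_polys: "ext n (polys n) = polys n"
  by (auto simp: ext_def pm_polys)

lemma hilbert_series_ext:
  assumes J: "graded_ideal n J" shows "hilbert_series n (ext n J) = hilbert_series n J"
proof -
  have "mv.dim (S n d :: 'K mpoly set) = mv.dim (S n d :: 'k mpoly set)" for d
    using dim_ext[OF graded_ideal_polys, of n d] by (simp add: ext_polys graded_part_polys)
  hence "hilbert_fun n (ext n J) d = hilbert_fun n J d" for d by (simp add: hilbert_fun_def dim_ext[OF J])
  thus ?thesis by (simp add: hilbert_series_def)
qed

end

lemma field_extension_fract: "field_extension (\<lambda>c :: 'k::field. Fract [:c:] (1 :: 'k poly))"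
proof unfold_locales
  fix a b :: 'k
  show "Fract [:a * b:] (1 :: 'k poly) = Fract [:a:] 1 * Fract [:b:] 1" by (simp add: mult.commute)
qed (simp_all add: Zero_fract_def One_fract_def one_pCons)

lemma infinite_fract_poly: "infinite (UNIV :: 'k::field poly fract set)"
proof
  assume "finite (UNIV :: 'k poly fract set)"
  moreover have "inj (\<lambda>n. Fract (monom (1::'k) n) (1 :: 'k poly))"
    by (rule injI) (simp add: eq_fract monom_eq_iff')
  ultimately have "finite (UNIV :: nat set)" by (metis finite_imageD finite_subset subset_UNIV)
  thus False by simp
qed

text \<open>Over an arbitrary field one passes to the infinite field of rational functions.\<close>

theorem regular_hilbert_series_any:
  fixes J :: "'k::field mpoly set"
  assumes J: "graded_ideal n J" "1 \<notin> J" "regularity_le n 1 J" "hilbert_fun n J 1 = int q"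
  shows "\<exists>w. length w = q \<and> hilbert_series n J = W w"
proof -
  interpret field_extension "\<lambda>c :: 'k. Fract [:c:] (1 :: 'k poly)" by (rule field_extension_fract)
  have "hilbert_fun n (ext n J) 1 = int q"
    using arg_cong[OF hilbert_series_ext[OF J(1)], of "\<lambda>p. fps_nth p 1"] J(4) by (simp add: hilbert_series_nth)
  from regular_hilbert_series[OF infinite_fract_poly graded_ideal_ext[OF J(1)] _ regularity_le_ext_field[OF J(3,1)]
      this]
  show ?thesis using ext_one[OF J(1)] J(2) hilbert_series_ext[OF J(1)] by auto
qed

section \<open>Generated ideals\<close>

lemma ideal_closed:
  assumes "ideal I (poly_ring n :: 'k::field mpoly ring)"
  shows "p \<in> I \<Longrightarrow> p \<in> polys n" "0 \<in> I" "p \<in> I \<Longrightarrow> q \<in> I \<Longrightarrow> p + q \<in> I" "r \<in> polys n \<Longrightarrow> p \<in> I \<Longrightarrow> r * p \<in> I"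
proof -
  interpret ideal I "poly_ring n :: 'k mpoly ring" by fact
  show "p \<in> I \<Longrightarrow> p \<in> polys n" using Icarr[of p] by (simp add: poly_ring_simps)
  show "0 \<in> I" using additive_subgroup.zero_closed[OF additive_subgroup_axioms] by (simp add: poly_ring_simps)
  show "p \<in> I \<Longrightarrow> q \<in> I \<Longrightarrow> p + q \<in> I"
    using additive_subgroup.a_closed[OF additive_subgroup_axioms] by (simp add: poly_ring_simps)
  show "r \<in> polys n \<Longrightarrow> p \<in> I \<Longrightarrow> r * p \<in> I" using I_l_closed[of p r] by (simp add: poly_ring_simps)
qed

lemma ideal_closed_sum:
  assumes "ideal I (poly_ring n :: 'k::field mpoly ring)"
  shows "(\<And>a. a \<in> A \<Longrightarrow> f a \<in> I) \<Longrightarrow> sum f A \<in> I"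
  by (induction A rule: infinite_finite_induct) (simp_all add: ideal_closed(2,3)[OF assms])

lemma genideal_props:
  assumes "H \<subseteq> polys n"
  shows "ideal (genideal (poly_ring n) H) (poly_ring n :: 'k::field mpoly ring)" "H \<subseteq> genideal (poly_ring n) H"
    "ideal I (poly_ring n) \<Longrightarrow> H \<subseteq> I \<Longrightarrow> genideal (poly_ring n) H \<subseteq> I"
proof -
  interpret R: cring "poly_ring n :: 'k mpoly ring" by (rule cring_poly_ring)
  have H: "H \<subseteq> carrier (poly_ring n)" using assms by (simp add: poly_ring_simps)
  show "ideal (genideal (poly_ring n) H) (poly_ring n :: 'k mpoly ring)" by (rule R.genideal_ideal[OF H])
  show "H \<subseteq> genideal (poly_ring n) H" by (rule R.genideal_self[OF H])
  show "ideal I (poly_ring n) \<Longrightarrow> H \<subseteq> I \<Longrightarrow> genideal (poly_ring n) H \<subseteq> I" by (rule R.genideal_minimal)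
qed

text \<open>The elements of \<open>I\<close> all of whose components lie in \<open>I\<close> form an
  ideal that contains the generators, hence all of \<open>I\<close>.\<close>

lemma homogeneous_ideal_graded_ideal:
  fixes I :: "'k::field mpoly set"
  assumes "homogeneous_ideal n I" shows "graded_ideal n I"
proof -
  obtain H where H: "H \<subseteq> (\<Union>d. S n d)" "I = genideal (poly_ring n) H"
    using assms unfolding homogeneous_ideal_def by blast
  have HP: "H \<subseteq> polys n" using H(1) S_polys by blast
  note g = genideal_props[OF HP]
  have I: "ideal I (poly_ring n)" unfolding H(2) by (rule g(1))
  note c = ideal_closed[OF I]
  define I' where "I' = {p \<in> I. \<forall>d. hc d p \<in> I}"
  have G: "graded_ideal n I'"
    unfolding graded_ideal_def
  proof (intro conjI ballI allI)
    fix p q :: "'k mpoly" assume p: "p \<in> polys n" and q: "q \<in> I'"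
    have "hc d (p * q) \<in> I" for d
    proof -
      have "p * q = (\<Sum>e\<in>degs p. hc e p * q)" by (subst (1) hc_decomp[of p]) (simp add: sum_distrib_right)
      hence "hc d (p * q) = (\<Sum>e\<in>degs p. hc d (hc e p * q))" by (simp only: hc_sum)
      also have "\<dots> = (\<Sum>e\<in>degs p. hc e p * hc (d - e) q)"
        using q c(1) by (intro sum.cong refl hc_mult[OF hc_S[OF p]]) (simp add: I'_def)
      also have "\<dots> \<in> I" using q by (intro ideal_closed_sum[OF I] c(4) hc_polys[OF p]) (simp add: I'_def)
      finally show ?thesis .
    qed
    thus "p * q \<in> I'" using c(4)[OF p] q by (simp add: I'_def)
  next
    fix p :: "'k mpoly" and d assume p: "p \<in> I'"
    hence "hc e (hc d p) \<in> I" for e using hc_hc[OF c(1), of p e d] c(2) by (simp add: I'_def)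
    thus "hc d p \<in> I'" using p by (simp add: I'_def)
  qed (auto simp: I'_def c(1,2,3))
  have "H \<subseteq> I'"
  proof
    fix p assume p: "p \<in> H"
    then obtain d where d: "p \<in> S n d" using H(1) by blast
    have "p \<in> I" using g(2) p H(2) by blast
    moreover have "hc e p \<in> I" for e using \<open>p \<in> I\<close> hc_id[OF d] hc_other[OF d, of e] c(2) by (cases "e = d") simp_all
    ultimately show "p \<in> I'" by (simp add: I'_def)
  qed
  hence "I \<subseteq> I'" unfolding H(2) by (rule g(3)[OF graded_ideal_ideal[OF G]])
  hence "I' = I" by (auto simp: I'_def)
  thus ?thesis using G by simp
qed

definition nonedge_monomials :: "nat sgraph \<Rightarrow> (nat \<Rightarrow>\<^sub>0 nat) set" where
  "nonedge_monomials G = {m. \<exists>i\<in>verts G. \<exists>j\<in>verts G. i \<noteq> j \<and> {i, j} \<notin> edges G \<and> i \<in> kys m \<and> j \<in> kys m}"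

lemma upset_nonedge_monomials: "upset (nonedge_monomials G)"
  unfolding upset_def
proof (intro allI ballI)
  fix m m' assume "m \<in> nonedge_monomials G"
  then obtain i j where "i \<in> verts G" "j \<in> verts G" "i \<noteq> j" "{i, j} \<notin> edges G" "i \<in> kys m" "j \<in> kys m"
    unfolding nonedge_monomials_def by blast
  thus "m' + m \<in> nonedge_monomials G" unfolding nonedge_monomials_def keys_nat_add mem_Collect_eq
      by (intro bexI[of _ i] bexI[of _ j]) simp_all
qed

lemma nonedge_ideal_mon:
  assumes V: "verts G = {1..N}"
  shows "nonedge_ideal N G = (mon_ideal N (nonedge_monomials G) :: 'k::field mpoly set)"
proof -
  let ?H = "{var i * var j | i j. i \<in> {1..N} \<and> j \<in> {1..N} \<and> i \<noteq> j \<and> {i, j} \<notin> edges G} :: 'k mpoly set"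
  have HP: "?H \<subseteq> polys N" using polys_closed(5)[OF var_in_polys var_in_polys] by blast
  note g = genideal_props[OF HP]
  show ?thesis unfolding nonedge_ideal_def
  proof (intro equalityI)
    have "?H \<subseteq> mon_ideal N (nonedge_monomials G)"
    proof
      fix p :: "'k mpoly" assume p: "p \<in> ?H"
      then obtain i j where ij: "p = var i * var j" "i \<in> {1..N}" "j \<in> {1..N}" "i \<noteq> j" "{i, j} \<notin> edges G" by blast
      have "kys p = {xm i + xm j}" unfolding ij(1) keys_var_mult by (simp add: var_xm)
      moreover have "xm i + xm j \<in> nonedge_monomials G"
        unfolding nonedge_monomials_def mem_Collect_eq keys_nat_add V using ij
            by (intro bexI[of _ i] bexI[of _ j]) simp_all
      ultimately show "p \<in> mon_ideal N (nonedge_monomials G)" using HP p by (auto simp: mon_ideal_def)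
    qed
    thus "genideal (poly_ring N) ?H \<subseteq> mon_ideal N (nonedge_monomials G)"
      by (rule g(3)[OF graded_ideal_ideal[OF graded_ideal_mon[OF upset_nonedge_monomials]]])
  next
    show "mon_ideal N (nonedge_monomials G) \<subseteq> genideal (poly_ring N) ?H"
    proof
      fix p :: "'k mpoly" assume p: "p \<in> mon_ideal N (nonedge_monomials G)"
      have "(\<Sum>m\<in>kys p. Poly_Mapping.single m (lk p m)) \<in> genideal (poly_ring N) ?H"
      proof (rule ideal_closed_sum[OF g(1)])
        fix m assume m: "m \<in> kys p"
        then obtain i j where ij: "i \<in> {1..N}" "j \<in> {1..N}" "i \<noteq> j" "{i, j} \<notin> edges G" "i \<in> kys m" "j \<in> kys m"
          using p V unfolding mon_ideal_def nonedge_monomials_def by blast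
        define m1 where "m1 = m - xm i"
        have m1: "m = xm i + m1" unfolding m1_def by (rule mono_add_decomp[OF ij(5)])
        have "j \<in> kys m1" using ij(3,6) unfolding m1 keys_nat_add by auto
        hence m2: "m1 = xm j + (m1 - xm j)" by (rule mono_add_decomp)
        have km: "kys m \<subseteq> {1..N}" using p m by (auto simp: mon_ideal_def polys_def)
        have "kys (m1 - xm j) \<subseteq> {1..N}" using km unfolding m1 by (subst (asm) m2) (simp add: keys_nat_add)
        hence sP: "Poly_Mapping.single (m1 - xm j) (lk p m) \<in> polys N" by (auto simp: polys_iff lookup_single when_def)
        have "Poly_Mapping.single m (lk p m) =
            Poly_Mapping.single (xm i) 1 * (Poly_Mapping.single (xm j) 1 * Poly_Mapping.single (m1 - xm j) (lk p m))"
          unfolding mult_single m2[symmetric] m1[symmetric] by simp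
        also have "\<dots> = Poly_Mapping.single (m1 - xm j) (lk p m) * (var i * var j)"
          unfolding var_xm by (simp only: mult_ac)
        also have "\<dots> \<in> genideal (poly_ring N) ?H"
          by (rule ideal_closed(4)[OF g(1) sP]) (use g(2) ij in blast)
        finally show "Poly_Mapping.single m (lk p m) \<in> genideal (poly_ring N) ?H" .
      qed
      thus "p \<in> genideal (poly_ring N) ?H" by (simp flip: poly_sum_monomials)
    qed
  qed
qed

section \<open>Threshold graphs\<close>

text \<open>A canonical labelling: vertices are numbered in the order of their addition, the head of
  the list being the last operation.\<close>

fun threshold_graph :: "bool list \<Rightarrow> nat sgraph" where
  "threshold_graph [] = \<lparr>verts = {1}, edges = {}\<rparr>"
| "threshold_graph (b # w) = (if b then add_dominating else add_isolated) (length w + 2) (threshold_graph w)"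

lemma threshold_graph_verts: "verts (threshold_graph w) = {1..length w + 1}"
proof (induction w)
  case (Cons b w)
  have "verts (threshold_graph (b # w)) = insert (length w + 2) (verts (threshold_graph w))"
    by (cases b) (simp_all add: add_dominating_def add_isolated_def)
  also have "\<dots> = insert (Suc (length w + 1)) {1..length w + 1}" unfolding Cons
      by (simp only: add_2_eq_Suc' Suc_eq_plus1)
  also have "\<dots> = {1..Suc (length w + 1)}" by (rule atLeastAtMostSuc_conv[symmetric]) linarith
  finally show ?case by simp
qed simp

lemma threshold_graph_threshold: "threshold (threshold_graph w)"
proof (induction w)
  case (Cons b w)
  have "length w + 2 \<notin> verts (threshold_graph w)" by (simp add: threshold_graph_verts)
  thus ?case using threshold.isolated[OF Cons] threshold.dominating[OF Cons] by simp
qed (simp add: threshold.single)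

lemma iso_extend:
  assumes "graph_iso H G" "simple_graph H" "simple_graph G" "u \<notin> verts H" "v \<notin> verts G"
  shows "graph_iso (add_isolated u H) (add_isolated v G)" "graph_iso (add_dominating u H) (add_dominating v G)"
proof -
  obtain f where f: "bij_betw f (verts H) (verts G)" "(\<lambda>e. f ` e) ` edges H = edges G"
    using assms(1) unfolding graph_iso_def by blast
  let ?f = "f(u := v)"
  have same: "?f x = f x" if "x \<in> verts H" for x using that assms(4) by auto
  have b: "bij_betw ?f (insert u (verts H)) (insert v (verts G))"
  proof -
    have "bij_betw ?f (verts H) (verts G)" using bij_betw_cong[of "verts H" ?f f] same f(1) by blast
    from notIn_Un_bij_betw[OF assms(4) _ this] show ?thesis using assms(5) by (simp add: Un_insert_right)
  qed
  have sub: "e \<subseteq> verts H" if "e \<in> edges H" for e using assms(2) that by (auto simp: simple_graph_def)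
  have e: "(\<lambda>e. ?f ` e) ` edges H = edges G"
    unfolding f(2)[symmetric] by (intro image_cong refl) (use sub same in blast)
  show "graph_iso (add_isolated u H) (add_isolated v G)"
    unfolding graph_iso_def add_isolated_def using b e by (intro exI[of _ ?f]) simp
  have "(\<lambda>e. ?f ` e) ` {{x, u} | x. x \<in> verts H} = {{x, v} | x. x \<in> verts G}"
  proof -
    have "{{x, u} | x. x \<in> verts H} = (\<lambda>x. {x, u}) ` verts H" by auto
    hence "(\<lambda>e. ?f ` e) ` {{x, u} | x. x \<in> verts H} = (\<lambda>x. {f x, v}) ` verts H"
      using same by (simp only: image_image image_insert image_empty) (intro image_cong refl, simp)
    also have "\<dots> = (\<lambda>x. {x, v}) ` (f ` verts H)" by (simp only: image_image)
    also have "f ` verts H = verts G" using f(1) by (simp add: bij_betw_def)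
    finally show ?thesis by auto
  qed
  thus "graph_iso (add_dominating u H) (add_dominating v G)"
    unfolding graph_iso_def add_dominating_def using b e by (intro exI[of _ ?f]) (simp add: image_Un)
qed

text \<open>The number \<open>N\<close> of variables is free because a graph on
  \<open>{1..n+1}\<close> arises from smaller graphs whose labels need not form an initial segment.
  The exponent accounts for the \<open>N - length w - 1\<close> variables outside \<open>G\<close>
  and for the one that \<open>W\<close> divides out.\<close>

definition built_by :: "'k::field itself \<Rightarrow> bool list \<Rightarrow> nat sgraph \<Rightarrow> bool" where
  "built_by _ w G \<longleftrightarrow> threshold G \<and> length w + 1 = card (verts G) \<and> graph_iso (threshold_graph w) G \<and>
     (\<forall>N. verts G \<subseteq> {1..N} \<longrightarrow> regularity_le N 1 (mon_ideal N (nonedge_monomials G) :: 'k mpoly set) \<and>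
        (1 - fps_X) ^ (N - length w) * hilbert_series N (mon_ideal N (nonedge_monomials G) :: 'k mpoly set) = W w)"

lemma regularity_le_mono: "regularity_le n r J \<Longrightarrow> r \<le> r' \<Longrightarrow> regularity_le n r' J"
  by (simp add: regularity_le_def)

lemma built_by_single: "built_by TYPE('k::field) [] \<lparr>verts = {v}, edges = {}\<rparr>"
proof -
  have "nonedge_monomials \<lparr>verts = {v}, edges = {}\<rparr> = {}" by (auto simp: nonedge_monomials_def)
  moreover have "graph_iso (threshold_graph []) \<lparr>verts = {v}, edges = {}\<rparr>"
    unfolding graph_iso_def by (intro exI[of _ "\<lambda>_. v"]) (auto simp: bij_betw_def)
  moreover have "regularity_le N 1 ({0} :: 'k mpoly set)" for N by (rule regularity_le_mono[OF regularity_le_zero]) simp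
  ultimately show ?thesis unfolding built_by_def by (simp add: threshold.single mon_ideal_empty hilbert_series_zero)
qed

text \<open>With \<open>f = x_v\<close> the colon ideal is generated by the variables of
  \<open>G\<close> and is 0-regular. Modulo \<open>x_v\<close> the ideals before and after adding
  \<open>v\<close> coincide, and \<open>x_v\<close> is a nonzerodivisor modulo the former; so
  \<open>regularity_le_ext\<close> and the exact sequence for Hilbert series apply.\<close>

lemma built_by_isolated:
  assumes g: "built_by TYPE('k::field) w G" and v: "v \<notin> verts G"
  shows "built_by TYPE('k) (False # w) (add_isolated v G)"
proof -
  have t: "threshold G" and l: "length w + 1 = card (verts G)" and iso: "graph_iso (threshold_graph w) G"
    and H: "\<And>N. verts G \<subseteq> {1..N} \<Longrightarrow> regularity_le N 1 (mon_ideal N (nonedge_monomials G) :: 'k mpoly set) \<and>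
        (1 - fps_X) ^ (N - length w) * hilbert_series N (mon_ideal N (nonedge_monomials G) :: 'k mpoly set) = W w"
    using g unfolding built_by_def by blast+
  note sg = threshold_simple_graph[OF t]
  have fin: "finite (verts G)" using sg by (simp add: simple_graph_def)
  have sub: "e \<subseteq> verts G" if "e \<in> edges G" for e using sg that by (auto simp: simple_graph_def)
  let ?G = "add_isolated v G"
  have gD': "nonedge_monomials ?G = nonedge_monomials G \<union> {m. v \<in> kys m \<and> kys m \<inter> verts G \<noteq> {}}"
  proof (intro equalityI subsetI)
    fix m assume "m \<in> nonedge_monomials ?G"
    then obtain i j where ij: "i \<in> insert v (verts G)" "j \<in> insert v (verts G)" "i \<noteq> j" "{i,
        j} \<notin> edges G" "i \<in> kys m" "j \<in> kys m"
      unfolding nonedge_monomials_def add_isolated_def by auto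
    show "m \<in> nonedge_monomials G \<union> {m. v \<in> kys m \<and> kys m \<inter> verts G \<noteq> {}}"
    proof (cases "i = v \<or> j = v")
      case True thus ?thesis using ij by auto
    next
      case False
      hence "m \<in> nonedge_monomials G" unfolding nonedge_monomials_def using ij by blast
      thus ?thesis by blast
    qed
  next
    fix m assume "m \<in> nonedge_monomials G \<union> {m. v \<in> kys m \<and> kys m \<inter> verts G \<noteq> {}}"
    thus "m \<in> nonedge_monomials ?G"
    proof
      assume "m \<in> nonedge_monomials G"
      thus ?thesis unfolding nonedge_monomials_def add_isolated_def by auto
    next
      assume "m \<in> {m. v \<in> kys m \<and> kys m \<inter> verts G \<noteq> {}}"
      then obtain i where i: "v \<in> kys m" "i \<in> kys m" "i \<in> verts G" by blast
      have "v \<noteq> i" "{v, i} \<notin> edges G" using i(3) v sub by auto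
      thus ?thesis using i unfolding nonedge_monomials_def add_isolated_def by auto
    qed
  qed
  have main: "regularity_le N 1 (mon_ideal N (nonedge_monomials ?G) :: 'k mpoly set) \<and>
      (1 - fps_X) ^ (N - length (False # w)) * hilbert_series N (mon_ideal N (nonedge_monomials ?G) :: 'k mpoly set) =
          W (False # w)"
    if N: "verts ?G \<subseteq> {1..N}" for N
  proof -
    have vN: "v \<in> {1..N}" and GN: "verts G \<subseteq> {1..N}" using N by (auto simp: add_isolated_def)
    have "card (insert v (verts G)) \<le> N" using card_mono[OF _ N] by (simp add: add_isolated_def)
    hence lN: "length w + 2 \<le> N" using l v fin by simp
    let ?J = "mon_ideal N (nonedge_monomials G) :: 'k mpoly set"
        and ?J' = "mon_ideal N (nonedge_monomials ?G) :: 'k mpoly set"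
    note gJ = graded_ideal_mon[OF upset_nonedge_monomials[of G], of N, where ?'k = 'k]
        and gJ' = graded_ideal_mon[OF upset_nonedge_monomials[of ?G], of N, where ?'k = 'k]
    have c: "colon N ?J' (var v) = mon_ideal N (varD (verts G))"
    proof -
      have "{m. xm v + m \<in> nonedge_monomials ?G} = varD (verts G)"
        using v unfolding gD' by (auto simp: nonedge_monomials_def varD_def keys_nat_add)
      thus ?thesis unfolding colon_mon[OF vN] by simp
    qed
    have a: "adjoin N ?J' (var v) = adjoin N ?J (var v)"
    proof -
      have "nonedge_monomials ?G \<union> {m. v \<in> kys m} = nonedge_monomials G \<union> {m. v \<in> kys m}" unfolding gD' by auto
      thus ?thesis unfolding adjoin_mon[OF vN] by simp
    qed
    have cJ: "colon N ?J (var v) = ?J"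
    proof -
      have "{m. xm v + m \<in> nonedge_monomials G} = nonedge_monomials G" using v
          by (auto simp: nonedge_monomials_def keys_nat_add)
      thus ?thesis unfolding colon_mon[OF vN] by simp
    qed
    have vD: "regularity_le N 0 (mon_ideal N (varD (verts G)) :: 'k mpoly set)"
      "hilbert_series N (mon_ideal N (varD (verts G)) :: 'k mpoly set) =
          (1 - fps_X) ^ card (verts G) * hilbert_series N ({0} :: 'k mpoly set)"
      using varD_ideal[OF fin GN, where ?'k = 'k] by simp_all
    have vS: "var v \<in> (S N 1 :: 'k mpoly set)" by (rule var_S[OF vN])
    have "regularity_le N 1 (adjoin N ?J' (var v))" unfolding a
      using H[OF GN] by (intro regularity_le_nonzerodivisor[OF gJ vS cJ]) simp
    moreover have "regularity_le N 0 (colon N ?J' (var v))" unfolding c by (rule vD(1))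
    ultimately have r: "regularity_le N 1 ?J'" by (intro regularity_le_ext[OF gJ' vS])
    have HJ: "hilbert_series N ?J' =
        (1 - fps_X) * hilbert_series N ?J + fps_X * ((1 - fps_X) ^ card (verts G) * hilbert_series N ({0} :: 'k mpoly
            set))"
      using hilbert_series_exact[OF gJ' vS] hilbert_series_nonzerodivisor[OF gJ vS cJ] unfolding a c vD(2) by simp
    \<comment> \<open>\<open>card (verts G) = length w + 1\<close> completes the exponent of the
      second summand to \<open>N\<close>, which leaves exactly \<open>t\<close>.\<close>
    define e where "e = N - length (False # w)"
    have e1: "N - length w = Suc e" and e2: "e + card (verts G) = N" using lN l by (simp_all add: e_def)
    have "(1 - fps_X) ^ e * hilbert_series N ?J' =
        (1 - fps_X) ^ Suc e * hilbert_series N ?J + fps_X * ((1 - fps_X) ^ (e + card (verts G)) * hilbert_series N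
            ({0} :: 'k mpoly set))"
      unfolding HJ power_add power_Suc by (simp only: distrib_left mult_ac)
    also have "\<dots> = W w + fps_X" unfolding e2 hilbert_series_zero using H[OF GN] e1 by simp
    finally show ?thesis using r by (simp add: e_def)
  qed
  have "graph_iso (threshold_graph (False # w)) ?G"
    using iso_extend(1)[OF iso threshold_simple_graph[OF threshold_graph_threshold] sg _ v, of "length w + 2"]
    by (simp add: threshold_graph_verts)
  moreover have "threshold ?G" by (rule threshold.isolated[OF t v])
  moreover have "length (False # w) + 1 = card (verts ?G)" using l fin v by (simp add: add_isolated_def)
  ultimately show ?thesis unfolding built_by_def using main by blast
qed

text \<open>A dominating vertex creates no nonedge, so the ideal stays the same. Only the number of
  vertices changes, and with it the exponent of \<open>1 - t\<close>.\<close>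

lemma built_by_dominating:
  assumes g: "built_by TYPE('k::field) w G" and v: "v \<notin> verts G"
  shows "built_by TYPE('k) (True # w) (add_dominating v G)"
proof -
  have t: "threshold G" and l: "length w + 1 = card (verts G)" and iso: "graph_iso (threshold_graph w) G"
    and H: "\<And>N. verts G \<subseteq> {1..N} \<Longrightarrow> regularity_le N 1 (mon_ideal N (nonedge_monomials G) :: 'k mpoly set) \<and>
        (1 - fps_X) ^ (N - length w) * hilbert_series N (mon_ideal N (nonedge_monomials G) :: 'k mpoly set) = W w"
    using g unfolding built_by_def by blast+
  note sg = threshold_simple_graph[OF t]
  have fin: "finite (verts G)" using sg by (simp add: simple_graph_def)
  let ?G = "add_dominating v G"
  have ne: "{i, j} \<in> edges ?G \<longleftrightarrow> {i, j} \<in> edges G" if "i \<in> verts G" "j \<in> verts G" for i j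
    using v that by (auto simp: add_dominating_def doubleton_eq_iff)
  have vu: "{v, u} \<in> edges ?G" "{u, v} \<in> edges ?G" if "u \<in> verts G" for u
    using that by (auto simp: add_dominating_def insert_commute)
  have vG: "verts ?G = insert v (verts G)" by (simp add: add_dominating_def)
  have gD': "nonedge_monomials ?G = nonedge_monomials G"
  proof (intro equalityI subsetI)
    fix m assume "m \<in> nonedge_monomials ?G"
    then obtain i j where ij: "i \<in> verts ?G" "j \<in> verts ?G" "i \<noteq> j" "{i, j} \<notin> edges ?G" "i \<in> kys m" "j \<in> kys m"
      unfolding nonedge_monomials_def by blast
    have "i \<in> verts G" "j \<in> verts G" using ij(1-4) vu unfolding vG by auto
    thus "m \<in> nonedge_monomials G" using ij ne unfolding nonedge_monomials_def by blast
  next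
    fix m assume "m \<in> nonedge_monomials G"
    then obtain i j where ij: "i \<in> verts G" "j \<in> verts G" "i \<noteq> j" "{i, j} \<notin> edges G" "i \<in> kys m" "j \<in> kys m"
      unfolding nonedge_monomials_def by blast
    thus "m \<in> nonedge_monomials ?G" using ne unfolding nonedge_monomials_def vG by blast
  qed
  have main: "regularity_le N 1 (mon_ideal N (nonedge_monomials ?G) :: 'k mpoly set) \<and>
      (1 - fps_X) ^ (N - length (True # w)) * hilbert_series N (mon_ideal N (nonedge_monomials ?G) :: 'k mpoly set) =
          W (True # w)"
    if N: "verts ?G \<subseteq> {1..N}" for N
  proof -
    have GN: "verts G \<subseteq> {1..N}" using N by (auto simp: vG)
    have "card (insert v (verts G)) \<le> N" using card_mono[OF _ N] by (simp add: vG)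
    hence lN: "length w + 2 \<le> N" using l v fin by simp
    let ?J = "mon_ideal N (nonedge_monomials G) :: 'k mpoly set"
    define e where "e = N - length (True # w)"
    have e1: "N - length w = Suc e" using lN by (simp add: e_def)
    have "(1 - fps_X) ^ e * hilbert_series N ?J =
        ((1 - fps_X) * Abs_fps (\<lambda>_. 1)) * ((1 - fps_X) ^ e * hilbert_series N ?J)"
      unfolding geom_inverse by simp
    also have "\<dots> = Abs_fps (\<lambda>_. 1) * ((1 - fps_X) ^ Suc e * hilbert_series N ?J)" unfolding power_Suc
        by (simp only: mult_ac)
    also have "(1 - fps_X) ^ Suc e * hilbert_series N ?J = W w" using H[OF GN] e1 by simp
    finally show ?thesis using H[OF GN] by (simp add: e_def gD')
  qed
  have "graph_iso (threshold_graph (True # w)) ?G"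
    using iso_extend(2)[OF iso threshold_simple_graph[OF threshold_graph_threshold] sg _ v, of "length w + 2"]
    by (simp add: threshold_graph_verts)
  moreover have "threshold ?G" by (rule threshold.dominating[OF t v])
  moreover have "length (True # w) + 1 = card (verts ?G)" using l fin v by (simp add: vG)
  ultimately show ?thesis unfolding built_by_def using main by blast
qed

lemma threshold_built_by: "threshold G \<Longrightarrow> \<exists>w. built_by TYPE('k::field) w G"
proof (induction rule: threshold.induct)
  case (single v)
  show ?case by (rule exI, rule built_by_single)
next
  case (isolated G v)
  from isolated(3) obtain w where w: "built_by TYPE('k) w G" by (rule exE)
  show ?case by (rule exI, rule built_by_isolated[OF w isolated(2)])
next
  case (dominating G v)
  from dominating(3) obtain w where w: "built_by TYPE('k) w G" by (rule exE)
  show ?case by (rule exI, rule built_by_dominating[OF w dominating(2)])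
qed

lemma threshold_graph_built_by: "built_by TYPE('k::field) w (threshold_graph w)"
proof (induction w)
  case Nil
  show ?case using built_by_single by simp
next
  case (Cons b w)
  have "length w + 2 \<notin> verts (threshold_graph w)" by (simp add: threshold_graph_verts)
  thus ?case using built_by_isolated[OF Cons] built_by_dominating[OF Cons] by (cases b) simp_all
qed

section \<open>Recovering the operations from the Hilbert series\<close>

lemma one_minus_X_nth: "fps_nth ((1 - fps_X) * p) k = fps_nth p k - (if k = 0 then 0 else fps_nth p (k - 1))"
    for p :: "int fps"
  by (simp add: left_diff_distrib)

lemma one_minus_X_power: "fps_nth ((1 - fps_X) ^ m :: int fps) m = (-1) ^ m \<and>
    (\<forall>k>m. fps_nth ((1 - fps_X) ^ m :: int fps) k = 0)"
  by (induction m) (simp_all add: one_minus_X_nth)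

text \<open>\<open>W w\<close> with its denominator cleared: every \<open>True\<close> introduces
  one factor \<open>1/(1 - t)\<close>, and there are at most \<open>length w\<close> of
  them.\<close>

definition numerator :: "bool list \<Rightarrow> int fps" where "numerator w = (1 - fps_X) ^ length w * W w"

lemma numerator_Cons: "numerator (True # w) = numerator w" "numerator (False # w) =
    (1 - fps_X) * numerator w + (1 - fps_X) ^ Suc (length w) * fps_X"
proof -
  have "numerator (True # w) = ((1 - fps_X) * Abs_fps (\<lambda>_. 1)) * ((1 - fps_X) ^ length w * W w)"
    unfolding numerator_def W.simps list.size power_Suc by (simp add: mult_ac)
  thus "numerator (True # w) = numerator w" unfolding geom_inverse by (simp add: numerator_def)
  show "numerator (False # w) = (1 - fps_X) * numerator w + (1 - fps_X) ^ Suc (length w) * fps_X"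
    by (simp add: numerator_def algebra_simps)
qed

text \<open>Up to sign, the coefficient of degree \<open>length w + 1\<close> in \<open>numerator w\<close> counts the isolated vertices added
  after the last dominating one, so it reveals the kind of the last operation.\<close>

lemma numerator_top: "(\<forall>k > length w + 1. fps_nth (numerator w) k = 0) \<and>
    (-1) ^ length w * fps_nth (numerator w) (length w + 1) \<ge> 0"
proof (induction w)
  case Nil
  show ?case by (simp add: numerator_def)
next
  case (Cons b w)
  show ?case
  proof (cases b)
    case True
    thus ?thesis using Cons by (simp add: numerator_Cons)
  next
    case False
    have "fps_nth (numerator (False # w)) k =
        fps_nth (numerator w) k - fps_nth (numerator w) (k - 1) + fps_nth ((1 - fps_X) ^ Suc (length w)) (k - 1)"
      if "k > 0" for k using that unfolding numerator_Cons by (simp add: one_minus_X_nth del: power_Suc)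
    moreover have "(-1) ^ length w * (-1) ^ length w = (1::int)" by (simp flip: power_mult_distrib)
    ultimately show ?thesis using Cons False one_minus_X_power[of "Suc (length w)"]
      by (simp del: power_Suc) (simp add: right_diff_distrib)
  qed
qed

text \<open>Up to the common sign \<open>(-1)^(length w + 1)\<close> the coefficient is a
  nonnegative number plus 1.\<close>

lemma numerator_False_top: "fps_nth (numerator (False # w)) (length w + 2) \<noteq> 0"
proof -
  have "fps_nth (numerator (False # w)) (length w + 2) = - fps_nth (numerator w) (length w + 1) + (-1) ^ Suc (length w)"
    unfolding numerator_Cons using numerator_top[of w] one_minus_X_power[of "Suc (length w)"]
        by (simp add: one_minus_X_nth del: power_Suc)
  hence "(-1) ^ length w * fps_nth (numerator (False # w)) (length w + 2) =
      (-1) ^ length w * (- fps_nth (numerator w) (length w + 1) + (-1) ^ Suc (length w))"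
    by (rule arg_cong)
  also have "\<dots> = - ((-1) ^ length w * fps_nth (numerator w) (length w + 1)) - ((-1) ^ length w * (-1) ^ length w)"
    by (simp add: right_diff_distrib)
  also have "(-1) ^ length w * (-1) ^ length w = (1::int)" by (simp flip: power_mult_distrib)
  finally show ?thesis using numerator_top[of w] by auto
qed

text \<open>After \<open>True\<close> the coefficient in degree \<open>length w + 2\<close> of the
  tail \<open>w\<close> vanishes, after \<open>False\<close> it does not, so the heads agree.
  Cancelling the factor \<open>1 - t\<close> then recovers the numerator of the tail.\<close>

lemma numerator_inj: "length w = length w' \<Longrightarrow> numerator w = numerator w' \<Longrightarrow> w = w'"
proof (induction w arbitrary: w')
  case (Cons b w w')
  then obtain b' u where w': "w' = b' # u" "length u = length w" by (cases w') auto
  have T: "fps_nth (numerator (True # x)) (length x + 2) = 0" for x using numerator_top[of x]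
      by (simp add: numerator_Cons)
  have "b = b'"
  proof (rule ccontr)
    assume "b \<noteq> b'"
    thus False using Cons.prems(2) numerator_False_top[of w] numerator_False_top[of u] T[of w] T[of u] w'
        by (cases b) auto
  qed
  have "(1 - fps_X :: int fps) \<noteq> 0"
  proof
    assume "(1 - fps_X :: int fps) = 0"
    from arg_cong[OF this, of "\<lambda>p. fps_nth p 0"] show False by simp
  qed
  hence "numerator w = numerator u" using Cons.prems(2) \<open>b = b'\<close> w' by (cases b) (auto simp: numerator_Cons)
  thus ?case using Cons.IH[of u] w' \<open>b = b'\<close> by simp
qed simp

section \<open>The main theorem\<close>

lemma count_list_linear:
  assumes "\<forall>x\<in>set xs. x = c" shows "count_list xs j = (if j = c then length xs else 0)"
  using assms by (induction xs) auto

lemma linear_low: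
  assumes I: "graded_ideal n I" and s: "minimal_chain n I D Y" and lin: "\<forall>x\<in>set (D 0). x = 2" and d: "d \<le> 1"
  shows "graded_part n I d \<subseteq> {0}"
proof
  fix p assume "p \<in> graded_part n I d"
  then obtain v where v: "v \<in> free_part n (D 0) d" "p = lincomb (length (D 0)) v (Y 0) 0"
      unfolding image0[OF I s, symmetric] by blast
  have "v e = 0" if "e < length (D 0)" for e
  proof -
    have "D 0 ! e = 2" using lin nth_mem[OF that] by blast
    hence "v e \<in> S n (d - 2)" using free_part_S[OF v(1), of e] by simp
    moreover have "d - 2 < 0" using d by simp
    ultimately show ?thesis using S_neg by blast
  qed
  thus "p \<in> {0}" unfolding v(2) lincomb_def by simp
qed

lemma hilbert_series_zero_nth_1: "hilbert_fun n ({0} :: 'k::field mpoly set) 1 = int n"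
proof -
  have p: "fps_nth ((1 - fps_X) ^ n :: int fps) 0 = 1 \<and> fps_nth ((1 - fps_X) ^ n :: int fps) 1 = - int n" for n
    by (induction n) (simp_all add: one_minus_X_nth)
  have 0: "hilbert_fun n ({0} :: 'k mpoly set) 0 = 1" by (simp add: hilbert_fun_zero sdim_0)
  have "fps_nth ((1 - fps_X) ^ n * hilbert_series n ({0} :: 'k mpoly set)) 1 = 0" unfolding hilbert_series_zero by simp
  moreover have "fps_nth ((1 - fps_X) ^ n * hilbert_series n ({0} :: 'k mpoly set)) 1 =
      fps_nth ((1 - fps_X) ^ n) 0 * hilbert_fun n ({0} :: 'k mpoly set) 1 + fps_nth ((1 - fps_X) ^ n) 1 * hilbert_fun
          n ({0} :: 'k mpoly set) 0"
    by (simp add: fps_mult_nth hilbert_series_nth)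
  ultimately show ?thesis using p[of n] 0 by simp
qed

lemma low_not_one:
  fixes I :: "'k::field mpoly set"
  assumes "\<And>d. d \<le> 1 \<Longrightarrow> graded_part n I d \<subseteq> {0}" shows "1 \<notin> I"
proof
  assume "1 \<in> I"
  hence "1 \<in> graded_part n I 0" using cst_S[of 1 n] by (simp add: graded_part_def)
  hence "(1 :: 'k mpoly) = 0" using assms[of 0] by auto
  thus False by simp
qed

text \<open>Linearity leaves one possible degree in each homological degree, so the tables are the
  lengths of the \<open>D l\<close>, and these are coefficients of the numerators. Coefficients 0
  and 1 agree in any case. The numbers of variables may differ, as they do in the
  application.\<close>

lemma betti_linear_cong:
  fixes I :: "'k::field mpoly set" and J :: "'k mpoly set"
  assumes I: "graded_ideal n I" and sI: "minimal_chain n I D Y" and lI: "\<And>l. \<forall>x\<in>set (D l). x = int l + 2"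
      and oI: "1 \<notin> I"
    and J: "graded_ideal m J" and sJ: "minimal_chain m J D' Y'" and lJ: "\<And>l. \<forall>x\<in>set (D' l). x = int l + 2"
        and oJ: "1 \<notin> J"
  shows "(\<forall>i j. betti n (quotient_module n I) i j = betti m (quotient_module m J) i j) \<longleftrightarrow>
     (1 - fps_X) ^ n * hilbert_series n I = (1 - fps_X) ^ m * hilbert_series m J"
proof -
  let ?P = "(1 - fps_X) ^ n * hilbert_series n I" and ?R = "(1 - fps_X) ^ m * hilbert_series m J"
  note hI = hilbert_betti[OF I sI lI] and hJ = hilbert_betti[OF J sJ lJ]
  have len: "length (D i) = length (D' i) \<longleftrightarrow> fps_nth ?P (i + 2) = fps_nth ?R (i + 2)" for i
    unfolding hI(3) hJ(3) by simp
  have b: "betti n (quotient_module n I) i j = betti m (quotient_module m J) i j \<longleftrightarrow>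
      (case i of 0 \<Rightarrow> True | Suc l \<Rightarrow> j = int l + 2 \<longrightarrow> length (D l) = length (D' l))" for i j
    unfolding betti_quotient[OF I oI sI] betti_quotient[OF J oJ sJ]
    by (cases i) (simp_all add: count_list_linear[OF lI] count_list_linear[OF lJ])
  have "(\<forall>i j. betti n (quotient_module n I) i j = betti m (quotient_module m J) i j) \<longleftrightarrow>
      (\<forall>l. length (D l) = length (D' l))"
  proof (intro iffI allI)
    fix l assume "\<forall>i j. betti n (quotient_module n I) i j = betti m (quotient_module m J) i j"
    from this[rule_format, of "Suc l" "int l + 2"] show "length (D l) = length (D' l)" unfolding b by simp
  next
    fix i j assume "\<forall>l. length (D l) = length (D' l)"
    thus "betti n (quotient_module n I) i j = betti m (quotient_module m J) i j" unfolding b by (cases i) simp_all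
  qed
  also have "\<dots> \<longleftrightarrow> ?P = ?R"
  proof
    assume "\<forall>l. length (D l) = length (D' l)"
    hence *: "fps_nth ?P (i + 2) = fps_nth ?R (i + 2)" for i by (intro iffD1[OF len]) (rule spec)
    show "?P = ?R"
    proof (rule fps_ext)
      fix k :: nat
      have "k = 0 \<or> k = 1 \<or> (\<exists>i. k = i + 2)" by presburger
      then consider "k = 0" | "k = 1" | i where "k = i + 2" by (elim disjE exE)
      thus "fps_nth ?P k = fps_nth ?R k"
      proof cases
        case 3
        show ?thesis unfolding 3 by (rule *)
      qed (simp_all only: hI(1,2) hJ(1,2))
    qed
  next
    assume "?P = ?R"
    thus "\<forall>l. length (D l) = length (D' l)" by (intro allI iffD2[OF len]) (rule arg_cong)
  qed
  finally show ?thesis .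
qed

lemma nonedge_monomials_low:
  assumes "d \<le> 1" shows "graded_part N (mon_ideal N (nonedge_monomials G) :: 'k::field mpoly set) d \<subseteq> {0}"
proof
  fix p :: "'k mpoly" assume p: "p \<in> graded_part N (mon_ideal N (nonedge_monomials G)) d"
  have "kys p = {}"
  proof (rule ccontr)
    assume "kys p \<noteq> {}"
    then obtain m where m: "m \<in> kys p" by blast
    then obtain i j where ij: "i \<noteq> j" "i \<in> kys m" "j \<in> kys m" using p
        by (auto simp: graded_part_def mon_ideal_def nonedge_monomials_def)
    define m1 where "m1 = m - xm i"
    have m1: "m = xm i + m1" unfolding m1_def by (rule mono_add_decomp[OF ij(2)])
    have "j \<in> kys m1" using ij unfolding m1 keys_nat_add by auto
    hence "m1 \<noteq> 0" by auto
    hence "mon_degree m1 \<noteq> 0" using mon_degree_eq_0[of m1] by blast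
    hence "mon_degree m \<ge> 2" unfolding m1 mon_degree_add mon_degree_simps by linarith
    moreover have "int (mon_degree m) = d" using p m by (auto simp: graded_part_def homogeneous_part_def)
    ultimately show False using assms by simp
  qed
  thus "p \<in> {0}" by simp
qed

text \<open>The equivalence gives existence, with the canonical graph of \<open>w\<close>, and
  uniqueness, since any other graph with the same table is built by the same word.\<close>

lemma betti_threshold_iff:
  fixes I :: "'k::field mpoly set"
  assumes I: "graded_ideal n I" and sI: "minimal_chain n I D Y" and lI: "\<And>l. \<forall>x\<in>set (D l). x = int l + 2"
      and oI: "1 \<notin> I"
    and H: "hilbert_series n I = W w" and w: "length w = n" and g: "built_by TYPE('k) w' T" and V: "verts T = {1..n+1}"
  shows "(\<forall>i j. betti n (quotient_module n I) i j
      = betti (n+1) (graph_module (n+1) T :: ('k mpoly, 'k mpoly set) graded_module) i j) \<longleftrightarrow> w = w'"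
proof -
  let ?J = "mon_ideal (n+1) (nonedge_monomials T) :: 'k mpoly set"
  have lw: "length w' = n" and r: "regularity_le (n+1) 1 ?J"
      and HJ: "(1 - fps_X) ^ (n + 1 - length w') * hilbert_series (n+1) ?J = W w'"
    using g V unfolding built_by_def by auto
  note J = graded_ideal_mon[OF upset_nonedge_monomials[of T], of "n+1", where ?'k = 'k]
  have low: "graded_part (n+1) ?J d \<subseteq> {0}" if "d \<le> 1" for d by (rule nonedge_monomials_low[OF that])
  obtain D' Y' where s: "minimal_chain (n+1) ?J D' Y'" using exists_minimal_chain[OF J] by blast
  note lJ = regularity_le_linear[OF J s r low] and oJ = low_not_one[OF low]
  have "(1 - fps_X) ^ (n+1) * hilbert_series (n+1) ?J = numerator w'"
    using HJ lw by (simp add: numerator_def mult_ac)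
  moreover have "(1 - fps_X) ^ n * hilbert_series n I = numerator w" using H w by (simp add: numerator_def)
  ultimately have "(\<forall>i j. betti n (quotient_module n I) i j = betti (n+1) (quotient_module (n+1) ?J) i j) \<longleftrightarrow>
      numerator w = numerator w'"
    using betti_linear_cong[OF I sI lI oI J s lJ oJ] by simp
  also have "\<dots> \<longleftrightarrow> w = w'" using numerator_inj[of w w'] w lw by auto
  finally show ?thesis unfolding graph_module_def nonedge_ideal_mon[OF V] .
qed

theorem mainTheorem1:
  fixes n :: nat and I :: "'k::field mpoly set"
  assumes "homogeneous_ideal n I"
    and "two_linear n I"
  shows "\<exists>T :: nat sgraph.
      (threshold T \<and> verts T = {1..n+1} \<and>
        (\<forall>i j. betti n (quotient_module n I) i j
              = betti (n+1) (graph_module (n+1) T :: ('k mpoly, 'k mpoly set) graded_module) i j)) \<and>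
      (\<forall>T' :: nat sgraph.
        (threshold T' \<and> verts T' = {1..n+1} \<and>
          (\<forall>i j. betti n (quotient_module n I) i j
                = betti (n+1) (graph_module (n+1) T' :: ('k mpoly, 'k mpoly set) graded_module) i j))
        \<longrightarrow> graph_iso T T')"
proof -
  have I: "graded_ideal n I" by (rule homogeneous_ideal_graded_ideal[OF assms(1)])
  obtain D Y where s: "minimal_chain n I D Y" using exists_minimal_chain[OF I] by blast
  have lin: "\<forall>x\<in>set (D l). x = int l + 2" for l
  proof (rule ballI, rule ccontr)
    fix x assume x: "x \<in> set (D l)" "x \<noteq> int l + 2"
    hence "betti n (ideal_module n I) l x = 0" using assms(2) by (simp add: two_linear_def)
    thus False using x(1) unfolding betti_ideal[OF I s] by (simp add: count_list_0_iff)
  qed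
  have low: "graded_part n I d \<subseteq> {0}" if "d \<le> 1" for d
    by (rule linear_low[OF I s _ that]) (use lin[of 0] in simp)
  have one: "1 \<notin> I" by (rule low_not_one) (rule low)
  \<comment> \<open>No nonzero linear form lies in \<open>I\<close>, so the linear part of the
    quotient has dimension \<open>n\<close>. This is the length of the word, which fixes the vertex
    set \<open>{1..n+1}\<close>.\<close>
  have "graded_part n I 1 = graded_part n ({0} :: 'k mpoly set) 1" using low[of 1] graded_idealD(2)[OF I]
      by (auto simp: graded_part_def)
  hence "hilbert_fun n I 1 = int n" using hilbert_series_zero_nth_1[of n, where ?'k = 'k] by (simp add: hilbert_fun_def)
  then obtain w where w: "length w = n" "hilbert_series n I = W w"
    using regular_hilbert_series_any[OF I one linear_regularity_le[OF I s lin]] by blast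
  note iff = betti_threshold_iff[OF I s lin one w(2,1)]
  have V: "verts (threshold_graph w) = {1..n+1}" unfolding threshold_graph_verts w(1) ..
  show ?thesis
  proof (intro exI[of _ "threshold_graph w"] conjI allI impI)
    show "betti n (quotient_module n I) i j = betti (n+1) (graph_module (n+1) (threshold_graph w) :: ('k mpoly,
        'k mpoly set) graded_module) i j" for i j
      using iff[OF threshold_graph_built_by V] by blast
    fix T' assume T': "threshold T' \<and> verts T' = {1..n+1} \<and>
        (\<forall>i j. betti n (quotient_module n I) i j = betti (n+1) (graph_module (n+1) T' :: ('k mpoly,
            'k mpoly set) graded_module) i j)"
    then obtain w' where w': "built_by TYPE('k) w' T'" using threshold_built_by by blast
    have "w = w'" using iff[OF w'] T' by blast
    thus "graph_iso (threshold_graph w) T'" using w' by (simp add: built_by_def)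
  qed (rule threshold_graph_threshold, rule V)
qed

end
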